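(* Let $(M,\pi)$ be a connected Poisson manifold, let $\mathfrak{g}$ be an abelian Lie algebra, let $\rho\colon\mathfrak{g}\to C^\infty(M)$, $u\mapsto H_u$, be a complete weakly Hamiltonian action, and let $c$ be its associated cocycle. Let $F\to M$ be a vector sub-bundle of $\mathfrak{g}\times M$ over the leaf space which is symplectic relative to $c$, of rank $2d$. Then a framing of $F$ over the leaf space compatible with the fiberwise symplectic structure, with corresponding constant symplectic form $\omega$ on $\mathbb{R}^{2d}$, determines a splitting of $M$ into a symplectic vector space and a Poisson manifold: there exist a Poisson-Dirac submanifold $N\subset (M,\pi)$, with induced Poisson structure $\pi|_N$, and a Poisson diffeomorphism $$\Phi\colon (M,\pi)\to(\mathbb{R}^{2d}\times N,\ \omega^{-1}\oplus\pi|_N).$$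
   Context: Lie algebras are real and finite-dimensional. For $f\in C^\infty(M)$ the Hamiltonian vector field $X_f$ satisfies $dg(X_f)=\{g,f\}$ for all $g$. $\mathrm{Cas}(M)$ is the space of Casimirs (functions Poisson-commuting with all functions). The symplectic leaves of $(M,\pi)$ are the leaves of the (singular) foliation tangent to all Hamiltonian vector fields. For a symplectic form $\omega$, $\omega^{-1}$ denotes the corresponding Poisson bivector, with the convention $\omega(X_f,X_g)=\{f,g\}$. Weakly Hamiltonian action: an action $u\mapsto X_u$ of $\mathfrak{g}$ by Poisson vector fields on $M$ all of whose fundamental vector fields $X_u$ are Hamiltonian. It is given through a chosen linear lift $\rho\colon\mathfrak{g}\to C^\infty(M)$, $u\mapsto H_u$, where $X_u$ is the Hamiltonian vector field of $H_u$. It is complete if all $X_u$ are complete. Its associated cocycle is the bilinear map $c\colon\mathfrak{g}\times\mathfrak{g}\to\mathrm{Cas}(M)$, $c_{u,v}=\{H_u,H_v\}-H_{[u,v]}$ (so $c_{u,v}=\{H_u,H_v\}$ when $\mathfrak{g}$ is abelian). For $x\in M$, $c(x)$ is the skew bilinear form $(u,v)\mapsto c_{u,v}(x)$ on $\mathfrak{g}$. Sub-bundle over the leaf space: a smooth vector sub-bundle $F\to M$ of the trivial bundle $\mathfrak{g}\times M\to M$ such that $F_x=F_y$ (as subspaces of $\mathfrak{g}$) whenever $x,y$ lie in the same symplectic leaf. It is symplectic relative to $c$ if for every $x\in M$ the restriction of $c(x)$ to $F_x$ is a (linear) symplectic form. A framing over the leaf space of such $F$ is a global trivialization $\mathfrak{b}\colon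 F\to\mathbb{R}^{2d}$ (a smooth map restricting to a linear isomorphism $\mathfrak{b}_x\colon F_x\to\mathbb{R}^{2d}$ on each fiber) that is constant over symplectic leaves: $\mathfrak{b}_x=\mathfrak{b}_y$ whenever $x,y$ lie in the same leaf. It is compatible with the fiberwise symplectic structure if it also trivializes the fiberwise symplectic forms, i.e. there is one constant linear symplectic form $\omega$ on $\mathbb{R}^{2d}$ such that $(\mathfrak{b}_x)_*(c(x)|_{F_x})=\omega$ for all $x\in M$. Poisson-Dirac submanifold: a submanifold $N\subset(M,\pi)$ such that $T_xN\cap\pi^\#(T_xN^0)=\{0\}$ for all $x\in N$, where $T_xN^0\subset T_x^*M$ is the annihilator of $T_xN$, and such that the induced bivector $\pi|_N$ is smooth; here $(\pi|_N)^\#(\xi)=\pi^\#(\tilde\xi)$ for any extension $\tilde\xi\in T_x^*M$ of $\xi\in T_x^*N$ with $\pi^\#(\tilde\xi)\in T_xN$. The induced bivector is then a Poisson structure on $N$. *)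

theory Defs
  imports "HOL-Analysis.Analysis"
begin

text \<open>
  Throughout, a finite-dimensional real vector space is represented by a linear subspace of a
  type of class \<open>euclidean_space\<close>. In contrast to the types themselves this includes
  dimension zero, and it allows the dimension of an existentially quantified manifold to vary.
  In particular \<open>\<real>\<^bsup>2d\<^esup>\<close> is represented by a subspace \<open>E\<close> with \<open>dim E = 2 * d\<close>; for \<open>d > 0\<close> this
  includes the choice \<open>E = UNIV :: (real^'n) set\<close> with \<open>CARD('n) = 2 * d\<close>.
\<close>


section \<open>Smooth maps between subsets of Euclidean spaces\<close>

primrec C_k_on :: "nat \<Rightarrow> 'e::euclidean_space set \<Rightarrow> ('e \<Rightarrow> 'f::euclidean_space) \<Rightarrow> bool" where
  "C_k_on 0 S f \<longleftrightarrow> continuous_on S f"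
| "C_k_on (Suc k) S f \<longleftrightarrow> (\<forall>x\<in>S. f differentiable (at x)) \<and>
     (\<forall>v. C_k_on k S (\<lambda>x. frechet_derivative f (at x) v))"

text \<open>
  \<open>C_k_on\<close> is only meaningful on open sets. On an arbitrary set \<open>S\<close> a map is smooth if it extends
  to a smooth map near every point of \<open>S\<close>. For a relatively open subset of a linear subspace
  this is the usual notion.
\<close>

definition smooth_on :: "'e::euclidean_space set \<Rightarrow> ('e \<Rightarrow> 'f::euclidean_space) \<Rightarrow> bool" where
  "smooth_on S f \<longleftrightarrow> (\<forall>x\<in>S. \<exists>T g. open T \<and> x \<in> T \<and> (\<forall>k. C_k_on k T g) \<and>
     (\<forall>y\<in>S \<inter> T. g y = f y))"


section \<open>Smooth manifolds\<close>

text \<open>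
  Charts take values in the linear subspace \<open>model M\<close>, so \<open>M\<close> has dimension \<open>dim (model M)\<close>.
  The atlas need not be maximal.
\<close>

record ('a, 'e) manifold =
  mtop :: "'a topology"
  model :: "'e set"
  atlas :: "('a set \<times> ('a \<Rightarrow> 'e)) set"

abbreviation points :: "('a, 'e) manifold \<Rightarrow> 'a set" where
  "points M \<equiv> topspace (mtop M)"

definition smooth_manifold :: "('a, 'e::euclidean_space) manifold \<Rightarrow> bool" where
  "smooth_manifold M \<longleftrightarrow>
     Hausdorff_space (mtop M) \<and> second_countable (mtop M) \<and> subspace (model M) \<and>
     \<Union> (fst ` atlas M) = points M \<and>
     (\<forall>(U, \<phi>)\<in>atlas M. openin (mtop M) U \<and> openin (top_of_set (model M)) (\<phi> ` U) \<and>
        homeomorphic_map (subtopology (mtop M) U) (top_of_set (\<phi> ` U)) \<phi>) \<and>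
     (\<forall>(U, \<phi>)\<in>atlas M. \<forall>(V, \<psi>)\<in>atlas M. smooth_on (\<phi> ` (U \<inter> V)) (\<psi> \<circ> inv_into U \<phi>))"

text \<open>Smoothness on an arbitrary subset \<open>S\<close>, in the sense of local smooth extensions.\<close>

definition smooth_fun_on ::
    "('a, 'e::euclidean_space) manifold \<Rightarrow> 'a set \<Rightarrow> ('a \<Rightarrow> 'f::euclidean_space) \<Rightarrow> bool" where
  "smooth_fun_on M S f \<longleftrightarrow> (\<forall>(U, \<phi>)\<in>atlas M. smooth_on (\<phi> ` (U \<inter> S)) (f \<circ> inv_into U \<phi>))"

text \<open>Functions are total; their values outside \<open>points M\<close> play no role.\<close>

definition smooth_functions :: "('a, 'e::euclidean_space) manifold \<Rightarrow> ('a \<Rightarrow> real) set" where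
  "smooth_functions M = {f. smooth_fun_on M (points M) f}"

definition smooth_map ::
    "('a, 'e::euclidean_space) manifold \<Rightarrow> ('b, 'f::euclidean_space) manifold \<Rightarrow> ('a \<Rightarrow> 'b) \<Rightarrow> bool" where
  "smooth_map M N F \<longleftrightarrow> continuous_map (mtop M) (mtop N) F \<and>
     (\<forall>(U, \<phi>)\<in>atlas M. \<forall>(V, \<psi>)\<in>atlas N.
        smooth_on (\<phi> ` (U \<inter> F -` V)) (\<psi> \<circ> F \<circ> inv_into U \<phi>))"

definition diffeomorphism ::
    "('a, 'e::euclidean_space) manifold \<Rightarrow> ('b, 'f::euclidean_space) manifold \<Rightarrow> ('a \<Rightarrow> 'b) \<Rightarrow> bool" where
  "diffeomorphism M N F \<longleftrightarrow> smooth_map M N F \<and> bij_betw F (points M) (points N) \<and>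
     smooth_map N M (inv_into (points M) F)"

definition vec_manifold :: "'e::euclidean_space set \<Rightarrow> ('e, 'e) manifold" where
  "vec_manifold V = \<lparr>mtop = top_of_set V, model = V, atlas = {(V, id)}\<rparr>"

definition prod_manifold ::
    "('a, 'e::euclidean_space) manifold \<Rightarrow> ('b, 'f::euclidean_space) manifold \<Rightarrow>
     ('a \<times> 'b, 'e \<times> 'f) manifold" where
  "prod_manifold M N = \<lparr>mtop = prod_topology (mtop M) (mtop N), model = model M \<times> model N,
     atlas = {(U \<times> V, map_prod \<phi> \<psi>) | U \<phi> V \<psi>. (U, \<phi>) \<in> atlas M \<and> (V, \<psi>) \<in> atlas N}\<rparr>"


section \<open>Tangent and cotangent spaces\<close>

text \<open>
  Tangent vectors are derivations at a point. Being zero off \<open>smooth_functions M\<close>, and for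
  covectors off the tangent space, makes equality of functions the intended equality.
\<close>

definition tangent_space ::
    "('a, 'e::euclidean_space) manifold \<Rightarrow> 'a \<Rightarrow> (('a \<Rightarrow> real) \<Rightarrow> real) set" where
  "tangent_space M x = {v.
     (\<forall>f\<in>smooth_functions M. \<forall>g\<in>smooth_functions M. \<forall>a b.
        v (\<lambda>y. a * f y + b * g y) = a * v f + b * v g) \<and>
     (\<forall>f\<in>smooth_functions M. \<forall>g\<in>smooth_functions M.
        v (\<lambda>y. f y * g y) = f x * v g + g x * v f) \<and>
     (\<forall>f. f \<notin> smooth_functions M \<longrightarrow> v f = 0)}"

type_synonym 'a covector = "(('a \<Rightarrow> real) \<Rightarrow> real) \<Rightarrow> real"

definition cotangent_space ::
    "('a, 'e::euclidean_space) manifold \<Rightarrow> 'a \<Rightarrow> 'a covector set" where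
  "cotangent_space M x = {\<alpha>.
     (\<forall>v\<in>tangent_space M x. \<forall>w\<in>tangent_space M x. \<forall>a b.
        \<alpha> (\<lambda>f. a * v f + b * w f) = a * \<alpha> v + b * \<alpha> w) \<and>
     (\<forall>v. v \<notin> tangent_space M x \<longrightarrow> \<alpha> v = 0)}"

definition differential ::
    "('a, 'e::euclidean_space) manifold \<Rightarrow> ('a \<Rightarrow> real) \<Rightarrow> 'a \<Rightarrow> 'a covector" where
  "differential M f x = (\<lambda>v. if v \<in> tangent_space M x then v f else 0)"

definition push_vector ::
    "('b, 'f::euclidean_space) manifold \<Rightarrow> ('a \<Rightarrow> 'b) \<Rightarrow>
     (('a \<Rightarrow> real) \<Rightarrow> real) \<Rightarrow> (('b \<Rightarrow> real) \<Rightarrow> real)" where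
  "push_vector N F v = (\<lambda>g. if g \<in> smooth_functions N then v (g \<circ> F) else 0)"

definition pull_covector ::
    "('a, 'e::euclidean_space) manifold \<Rightarrow> ('b, 'f::euclidean_space) manifold \<Rightarrow>
     ('a \<Rightarrow> 'b) \<Rightarrow> 'a \<Rightarrow> 'b covector \<Rightarrow> 'a covector" where
  "pull_covector M N F x \<alpha> = (\<lambda>v. if v \<in> tangent_space M x then \<alpha> (push_vector N F v) else 0)"

definition embedded_submanifold ::
    "('a, 'f::euclidean_space) manifold \<Rightarrow> ('a, 'e::euclidean_space) manifold \<Rightarrow> bool" where
  "embedded_submanifold N M \<longleftrightarrow> smooth_manifold N \<and> points N \<subseteq> points M \<and>
     mtop N = subtopology (mtop M) (points N) \<and> smooth_map N M id \<and>
     (\<forall>x\<in>points N. inj_on (push_vector M id) (tangent_space N x))"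


section \<open>Poisson manifolds\<close>

type_synonym 'a bivector = "'a \<Rightarrow> 'a covector \<Rightarrow> 'a covector \<Rightarrow> real"

definition bivector_field :: "('a, 'e::euclidean_space) manifold \<Rightarrow> 'a bivector \<Rightarrow> bool" where
  "bivector_field M \<pi> \<longleftrightarrow> (\<forall>x\<in>points M.
     \<forall>\<alpha>\<in>cotangent_space M x. \<forall>\<beta>\<in>cotangent_space M x.
       \<pi> x \<alpha> \<beta> = - \<pi> x \<beta> \<alpha> \<and>
       (\<forall>\<gamma>\<in>cotangent_space M x. \<forall>a b.
          \<pi> x (\<lambda>v. a * \<alpha> v + b * \<beta> v) \<gamma> = a * \<pi> x \<alpha> \<gamma> + b * \<pi> x \<beta> \<gamma>))"

definition bracket ::
    "('a, 'e::euclidean_space) manifold \<Rightarrow> 'a bivector \<Rightarrow>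
     ('a \<Rightarrow> real) \<Rightarrow> ('a \<Rightarrow> real) \<Rightarrow> ('a \<Rightarrow> real)" where
  "bracket M \<pi> f g = (\<lambda>x. \<pi> x (differential M f x) (differential M g x))"

text \<open>A bivector field is smooth iff it has smooth values on differentials of smooth functions.\<close>

definition smooth_bivector_field :: "('a, 'e::euclidean_space) manifold \<Rightarrow> 'a bivector \<Rightarrow> bool" where
  "smooth_bivector_field M \<pi> \<longleftrightarrow> bivector_field M \<pi> \<and>
     (\<forall>f\<in>smooth_functions M. \<forall>g\<in>smooth_functions M. bracket M \<pi> f g \<in> smooth_functions M)"

definition poisson_structure :: "('a, 'e::euclidean_space) manifold \<Rightarrow> 'a bivector \<Rightarrow> bool" where
  "poisson_structure M \<pi> \<longleftrightarrow> smooth_bivector_field M \<pi> \<and>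
     (\<forall>f\<in>smooth_functions M. \<forall>g\<in>smooth_functions M. \<forall>h\<in>smooth_functions M. \<forall>x\<in>points M.
        bracket M \<pi> f (bracket M \<pi> g h) x + bracket M \<pi> g (bracket M \<pi> h f) x +
        bracket M \<pi> h (bracket M \<pi> f g) x = 0)"

definition poisson_manifold :: "('a, 'e::euclidean_space) manifold \<Rightarrow> 'a bivector \<Rightarrow> bool" where
  "poisson_manifold M \<pi> \<longleftrightarrow> smooth_manifold M \<and> poisson_structure M \<pi>"

text \<open>The sign convention is \<open>dg(X\<^sub>f) = {g, f}\<close>.\<close>

definition hamiltonian_vf ::
    "('a, 'e::euclidean_space) manifold \<Rightarrow> 'a bivector \<Rightarrow>
     ('a \<Rightarrow> real) \<Rightarrow> 'a \<Rightarrow> (('a \<Rightarrow> real) \<Rightarrow> real)" where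
  "hamiltonian_vf M \<pi> f x = (\<lambda>g. if g \<in> smooth_functions M then bracket M \<pi> g f x else 0)"

definition integral_curve ::
    "('a, 'e::euclidean_space) manifold \<Rightarrow> ('a \<Rightarrow> (('a \<Rightarrow> real) \<Rightarrow> real)) \<Rightarrow>
     real set \<Rightarrow> (real \<Rightarrow> 'a) \<Rightarrow> bool" where
  "integral_curve M X J \<gamma> \<longleftrightarrow> continuous_map (top_of_set J) (mtop M) \<gamma> \<and>
     (\<forall>t\<in>J. \<forall>g\<in>smooth_functions M.
        ((\<lambda>s. g (\<gamma> s)) has_real_derivative X (\<gamma> t) g) (at t within J))"

definition complete_vf ::
    "('a, 'e::euclidean_space) manifold \<Rightarrow> ('a \<Rightarrow> (('a \<Rightarrow> real) \<Rightarrow> real)) \<Rightarrow> bool" where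
  "complete_vf M X \<longleftrightarrow> (\<forall>x\<in>points M. \<exists>\<gamma>. \<gamma> 0 = x \<and> integral_curve M X UNIV \<gamma>)"

text \<open>
  By the Stefan-Sussmann theorem the leaves of the foliation tangent to the Hamiltonian vector
  fields are the orbits of these vector fields: two points lie in the same leaf iff they can be
  joined by finitely many integral curves of (globally defined) Hamiltonian functions. Rescaling
  the Hamiltonian reduces to the time interval \<open>[0, 1]\<close>, and negating it gives symmetry.
\<close>

definition hamiltonian_step ::
    "('a, 'e::euclidean_space) manifold \<Rightarrow> 'a bivector \<Rightarrow> 'a \<Rightarrow> 'a \<Rightarrow> bool" where
  "hamiltonian_step M \<pi> x y \<longleftrightarrow> (\<exists>f\<in>smooth_functions M. \<exists>\<gamma>.
     integral_curve M (hamiltonian_vf M \<pi> f) {0..1} \<gamma> \<and> \<gamma> 0 = x \<and> \<gamma> 1 = y)"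

definition same_leaf ::
    "('a, 'e::euclidean_space) manifold \<Rightarrow> 'a bivector \<Rightarrow> 'a \<Rightarrow> 'a \<Rightarrow> bool" where
  "same_leaf M \<pi> x y \<longleftrightarrow> x \<in> points M \<and> y \<in> points M \<and> (hamiltonian_step M \<pi>)\<^sup>*\<^sup>* x y"

text \<open>\<open>\<beta> (sharp M \<pi> x \<alpha>) = \<pi> x \<alpha> \<beta>\<close>, written out for \<open>\<beta> = dg\<close>.\<close>

definition sharp ::
    "('a, 'e::euclidean_space) manifold \<Rightarrow> 'a bivector \<Rightarrow> 'a \<Rightarrow>
     'a covector \<Rightarrow> (('a \<Rightarrow> real) \<Rightarrow> real)" where
  "sharp M \<pi> x \<alpha> = (\<lambda>g. if g \<in> smooth_functions M then \<pi> x \<alpha> (differential M g x) else 0)"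

definition poisson_diffeomorphism ::
    "('a, 'e::euclidean_space) manifold \<Rightarrow> 'a bivector \<Rightarrow>
     ('b, 'f::euclidean_space) manifold \<Rightarrow> 'b bivector \<Rightarrow> ('a \<Rightarrow> 'b) \<Rightarrow> bool" where
  "poisson_diffeomorphism M \<pi> P \<sigma> \<Phi> \<longleftrightarrow> diffeomorphism M P \<Phi> \<and>
     (\<forall>f\<in>smooth_functions P. \<forall>g\<in>smooth_functions P. \<forall>x\<in>points M.
        bracket M \<pi> (f \<circ> \<Phi>) (g \<circ> \<Phi>) x = bracket P \<sigma> f g (\<Phi> x))"

definition sum_bivector ::
    "('a, 'e::euclidean_space) manifold \<Rightarrow> 'a bivector \<Rightarrow>
     ('b, 'f::euclidean_space) manifold \<Rightarrow> 'b bivector \<Rightarrow> ('a \<times> 'b) bivector" where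
  "sum_bivector M \<pi> N \<sigma> = (\<lambda>(x, y) \<alpha> \<beta>.
     \<pi> x (pull_covector M (prod_manifold M N) (\<lambda>x'. (x', y)) x \<alpha>)
         (pull_covector M (prod_manifold M N) (\<lambda>x'. (x', y)) x \<beta>) +
     \<sigma> y (pull_covector N (prod_manifold M N) (\<lambda>y'. (x, y')) y \<alpha>)
         (pull_covector N (prod_manifold M N) (\<lambda>y'. (x, y')) y \<beta>))"


section \<open>Poisson-Dirac submanifolds\<close>

definition tangent_in ::
    "('a, 'f::euclidean_space) manifold \<Rightarrow> ('a, 'e::euclidean_space) manifold \<Rightarrow> 'a \<Rightarrow>
     (('a \<Rightarrow> real) \<Rightarrow> real) set" where
  "tangent_in N M x = push_vector M id ` tangent_space N x"

definition conormal_space ::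
    "('a, 'f::euclidean_space) manifold \<Rightarrow> ('a, 'e::euclidean_space) manifold \<Rightarrow> 'a \<Rightarrow>
     'a covector set" where
  "conormal_space N M x = {\<alpha>\<in>cotangent_space M x. \<forall>v\<in>tangent_in N M x. \<alpha> v = 0}"

definition induced_bivector ::
    "('a, 'f::euclidean_space) manifold \<Rightarrow> ('a, 'e::euclidean_space) manifold \<Rightarrow>
     'a bivector \<Rightarrow> 'a bivector" where
  "induced_bivector N M \<pi> x \<xi> \<eta> =
     \<eta> (THE v. v \<in> tangent_space N x \<and> (\<exists>\<alpha>\<in>cotangent_space M x.
          pull_covector N M id x \<alpha> = \<xi> \<and> push_vector M id v = sharp M \<pi> x \<alpha>))"

definition poisson_dirac_submanifold ::
    "('a, 'f::euclidean_space) manifold \<Rightarrow> ('a, 'e::euclidean_space) manifold \<Rightarrow>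
     'a bivector \<Rightarrow> bool" where
  "poisson_dirac_submanifold N M \<pi> \<longleftrightarrow> embedded_submanifold N M \<and>
     (\<forall>x\<in>points N. tangent_in N M x \<inter> sharp M \<pi> x ` conormal_space N M x = {\<lambda>_. 0}) \<and>
     smooth_bivector_field N (induced_bivector N M \<pi>)"


section \<open>Symplectic vector spaces\<close>

definition symplectic_form_on :: "'v::real_vector set \<Rightarrow> ('v \<Rightarrow> 'v \<Rightarrow> real) \<Rightarrow> bool" where
  "symplectic_form_on V \<omega> \<longleftrightarrow>
     (\<forall>u\<in>V. \<forall>v\<in>V. \<omega> u v = - \<omega> v u) \<and>
     (\<forall>u\<in>V. \<forall>v\<in>V. \<forall>w\<in>V. \<forall>a b. \<omega> (a *\<^sub>R u + b *\<^sub>R v) w = a * \<omega> u w + b * \<omega> v w) \<and>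
     (\<forall>u\<in>V. (\<forall>v\<in>V. \<omega> u v = 0) \<longrightarrow> u = 0)"

definition direction_vector ::
    "'b::euclidean_space set \<Rightarrow> 'b \<Rightarrow> 'b \<Rightarrow> (('b \<Rightarrow> real) \<Rightarrow> real)" where
  "direction_vector E p w =
     (\<lambda>f. if f \<in> smooth_functions (vec_manifold E) then deriv (\<lambda>t. f (p + t *\<^sub>R w)) 0 else 0)"

text \<open>
  With \<open>dg(X\<^sub>f) = {g, f}\<close>, the convention \<open>\<omega>(X\<^sub>f, X\<^sub>g) = {f, g}\<close> amounts to
  \<open>\<omega>(X\<^sub>f, w) = df(w)\<close> for all \<open>w\<close>.
\<close>

definition symplectic_sharp ::
    "'b::euclidean_space set \<Rightarrow> ('b \<Rightarrow> 'b \<Rightarrow> real) \<Rightarrow> 'b \<Rightarrow> 'b covector \<Rightarrow> 'b" where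
  "symplectic_sharp E \<omega> p \<alpha> = (THE v. v \<in> E \<and> (\<forall>w\<in>E. \<omega> v w = \<alpha> (direction_vector E p w)))"

definition inverse_bivector :: "'b::euclidean_space set \<Rightarrow> ('b \<Rightarrow> 'b \<Rightarrow> real) \<Rightarrow> 'b bivector" where
  "inverse_bivector E \<omega> p \<alpha> \<beta> = \<omega> (symplectic_sharp E \<omega> p \<alpha>) (symplectic_sharp E \<omega> p \<beta>)"


section \<open>Lie algebras and weakly Hamiltonian actions\<close>

definition lie_algebra :: "'g::euclidean_space set \<Rightarrow> ('g \<Rightarrow> 'g \<Rightarrow> 'g) \<Rightarrow> bool" where
  "lie_algebra G lie \<longleftrightarrow> subspace G \<and>
     (\<forall>u\<in>G. \<forall>v\<in>G. lie u v \<in> G) \<and>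
     (\<forall>u\<in>G. \<forall>v\<in>G. \<forall>w\<in>G. \<forall>a b. lie (a *\<^sub>R u + b *\<^sub>R v) w = a *\<^sub>R lie u w + b *\<^sub>R lie v w) \<and>
     (\<forall>u\<in>G. \<forall>v\<in>G. lie u v = - lie v u) \<and>
     (\<forall>u\<in>G. \<forall>v\<in>G. \<forall>w\<in>G. lie u (lie v w) + lie v (lie w u) + lie w (lie u v) = 0)"

definition abelian_lie_algebra :: "'g::euclidean_space set \<Rightarrow> ('g \<Rightarrow> 'g \<Rightarrow> 'g) \<Rightarrow> bool" where
  "abelian_lie_algebra G lie \<longleftrightarrow> lie_algebra G lie \<and> (\<forall>u\<in>G. \<forall>v\<in>G. lie u v = 0)"

text \<open>
  The fundamental vector field \<open>X\<^sub>u\<close> acts on functions as \<open>{_, H u}\<close>. The last conjunct is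
  \<open>X\<^bsub>[u,v]\<^esub> = - [X\<^sub>u, X\<^sub>v]\<close>; in view of \<open>[X\<^sub>f, X\<^sub>g] = - X\<^bsub>{f,g}\<^esub>\<close> this is the sign for which
  the functions \<open>{H u, H v} - H [u,v]\<close> are Casimirs.
\<close>

definition weakly_hamiltonian_action ::
    "('a, 'e::euclidean_space) manifold \<Rightarrow> 'a bivector \<Rightarrow> 'g::euclidean_space set \<Rightarrow>
     ('g \<Rightarrow> 'g \<Rightarrow> 'g) \<Rightarrow> ('g \<Rightarrow> 'a \<Rightarrow> real) \<Rightarrow> bool" where
  "weakly_hamiltonian_action M \<pi> G lie H \<longleftrightarrow>
     (\<forall>u\<in>G. H u \<in> smooth_functions M) \<and>
     (\<forall>u\<in>G. \<forall>v\<in>G. \<forall>a b. \<forall>x\<in>points M. H (a *\<^sub>R u + b *\<^sub>R v) x = a * H u x + b * H v x) \<and>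
     (\<forall>u\<in>G. \<forall>v\<in>G. \<forall>g\<in>smooth_functions M. \<forall>x\<in>points M.
        bracket M \<pi> g (H (lie u v)) x =
        - (bracket M \<pi> (bracket M \<pi> g (H v)) (H u) x - bracket M \<pi> (bracket M \<pi> g (H u)) (H v) x))"

definition complete_action ::
    "('a, 'e::euclidean_space) manifold \<Rightarrow> 'a bivector \<Rightarrow> 'g::euclidean_space set \<Rightarrow>
     ('g \<Rightarrow> 'a \<Rightarrow> real) \<Rightarrow> bool" where
  "complete_action M \<pi> G H \<longleftrightarrow> (\<forall>u\<in>G. complete_vf M (hamiltonian_vf M \<pi> (H u)))"

definition cocycle ::
    "('a, 'e::euclidean_space) manifold \<Rightarrow> 'a bivector \<Rightarrow> ('g \<Rightarrow> 'g \<Rightarrow> 'g) \<Rightarrow>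
     ('g \<Rightarrow> 'a \<Rightarrow> real) \<Rightarrow> 'g \<Rightarrow> 'g \<Rightarrow> 'a \<Rightarrow> real" where
  "cocycle M \<pi> lie H u v x = bracket M \<pi> (H u) (H v) x - H (lie u v) x"


section \<open>Sub-bundles over the leaf space\<close>

definition smooth_subbundle ::
    "('a, 'e::euclidean_space) manifold \<Rightarrow> 'g::euclidean_space set \<Rightarrow> nat \<Rightarrow> ('a \<Rightarrow> 'g set) \<Rightarrow> bool" where
  "smooth_subbundle M G k F \<longleftrightarrow>
     (\<forall>x\<in>points M. subspace (F x) \<and> F x \<subseteq> G \<and> dim (F x) = k) \<and>
     (\<forall>x\<in>points M. \<exists>U s. openin (mtop M) U \<and> x \<in> U \<and>
        (\<forall>i<k. smooth_fun_on M U (s i :: 'a \<Rightarrow> 'g)) \<and>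
        (\<forall>y\<in>U. F y = span ((\<lambda>i. s i y) ` {..<k})))"

definition subbundle_over_leaf_space ::
    "('a, 'e::euclidean_space) manifold \<Rightarrow> 'a bivector \<Rightarrow> 'g::euclidean_space set \<Rightarrow>
     nat \<Rightarrow> ('a \<Rightarrow> 'g set) \<Rightarrow> bool" where
  "subbundle_over_leaf_space M \<pi> G k F \<longleftrightarrow> smooth_subbundle M G k F \<and>
     (\<forall>x y. same_leaf M \<pi> x y \<longrightarrow> F x = F y)"

definition symplectic_relative_to ::
    "('a, 'e::euclidean_space) manifold \<Rightarrow> ('g::euclidean_space \<Rightarrow> 'g \<Rightarrow> 'a \<Rightarrow> real) \<Rightarrow>
     ('a \<Rightarrow> 'g set) \<Rightarrow> bool" where
  "symplectic_relative_to M c F \<longleftrightarrow> (\<forall>x\<in>points M. symplectic_form_on (F x) (\<lambda>u v. c u v x))"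

definition framing_over_leaf_space ::
    "('a, 'e::euclidean_space) manifold \<Rightarrow> 'a bivector \<Rightarrow> 'g::euclidean_space set \<Rightarrow>
     ('a \<Rightarrow> 'g set) \<Rightarrow> 'b::euclidean_space set \<Rightarrow> ('a \<Rightarrow> 'g \<Rightarrow> 'b) \<Rightarrow> bool" where
  "framing_over_leaf_space M \<pi> G F E b \<longleftrightarrow>
     smooth_fun_on (prod_manifold (vec_manifold G) M) {(u, x). x \<in> points M \<and> u \<in> F x}
       (\<lambda>(u, x). b x u) \<and>
     (\<forall>x\<in>points M. bij_betw (b x) (F x) E \<and>
        (\<forall>u\<in>F x. \<forall>v\<in>F x. \<forall>r s. b x (r *\<^sub>R u + s *\<^sub>R v) = r *\<^sub>R b x u + s *\<^sub>R b x v)) \<and>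
     (\<forall>x y. same_leaf M \<pi> x y \<longrightarrow> (\<forall>u\<in>F x. b x u = b y u))"

definition compatible_framing ::
    "('a, 'e::euclidean_space) manifold \<Rightarrow> ('g::euclidean_space \<Rightarrow> 'g \<Rightarrow> 'a \<Rightarrow> real) \<Rightarrow>
     ('a \<Rightarrow> 'g set) \<Rightarrow> 'b::euclidean_space set \<Rightarrow> ('a \<Rightarrow> 'g \<Rightarrow> 'b) \<Rightarrow>
     ('b \<Rightarrow> 'b \<Rightarrow> real) \<Rightarrow> bool" where
  "compatible_framing M c F E b \<omega> \<longleftrightarrow> symplectic_form_on E \<omega> \<and>
     (\<forall>x\<in>points M. \<forall>u\<in>F x. \<forall>v\<in>F x. \<omega> (b x u) (b x v) = c u v x)"

end

theory Submission imports Defs begin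

text \<open>Let \<beta>_x : E -> F_x be the inverse of the framing b_x, and put J_w(x) = H_u(x) with
  u = \<beta>_x w. The components of \<beta> are constant on symplectic leaves, hence Casimirs
  (\<open>bracket_leaf_invariant\<close>), so at each point x the function J_w has the same
  Hamiltonian vector as H_u with u frozen at its value at x. This has two consequences. First, {J_v,
  J_w} is the cocycle evaluated on \<beta>_x v and \<beta>_x w, which is the constant \<omega>(v, w)
  by compatibility. Secondly, the vector field of J_w is complete: an integral curve of H_u stays in
  one leaf, where u does not change. As \<omega> is nondegenerate, the functions J_w are the
  components \<omega>(w, j) of a single map j : M -> E (\<open>symplectic_splitting_exists\<close>).

  Constant brackets and Jacobi's identity make the vector fields commute, and with them the flows
  (\<open>brackets_with_h_commute\<close>, \<open>flow_invariance\<close>, \<open>flow_add\<close>).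
  The time-one maps \<phi>_w thus form an action of the vector group E on M, and j(\<phi>_w x) =
  j(x) + w (\<open>flow_j\<close>). Every orbit therefore meets N = {j = 0} exactly once, namely in
  r(x) = \<phi>_w x with w = - j(x). The differential of j is onto, so N is a submanifold
  (\<open>flattening\<close>), and x \<mapsto> (j x, r x) is a diffeomorphism from M to E \<times> N
  with inverse (w, n) \<mapsto> \<phi>_w n (\<open>diffeomorphism_jr\<close>).

  For the brackets, functions of r are invariant under the flows. Hence they commute with all J_w,
  and by Jacobi's identity their mutual brackets are invariant too
  (\<open>bracket_r_invariant\<close>). On N the Hamiltonian vector of such a function is tangent to
  N. This yields the Poisson-Dirac condition (\<open>sharp_in_tangent_eq_0\<close>) and identifies
  the induced bracket of u and l as that of u \<circ> r and l \<circ> r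
  (\<open>induced_bracket\<close>). The map j is Poisson for the bivector inverse to \<omega>
  (\<open>bracket_comp_j\<close>). Splitting a function of (j, r) by the chain rule
  (\<open>tangent_split\<close>) leaves the sum of the two brackets without cross terms
  (\<open>poisson_diffeomorphism_jr\<close>).

  The analysis behind this is developed along the way: smooth dependence of solutions of
  differential equations on parameters (\<open>linear_ode_C_k\<close>, \<open>local_flow\<close>,
  \<open>flow_smooth\<close>), smooth local inverses (\<open>smooth_inverse_function\<close>), and
  bump functions with Hadamard's lemma, which let derivations be computed in charts
  (\<open>tangent_chain\<close>, \<open>cotangent_is_differential\<close>).\<close>

section \<open>Calculus of smooth maps\<close>

abbreviation "fderiv f x \<equiv> frechet_derivative f (at x)"

text \<open>The derivative at a point depends only on the germ there, and on an open set equality on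
  the set is equality of germs.\<close>

lemma C_k_on_cong:
  assumes "open S" "\<And>x. x \<in> S \<Longrightarrow> f x = g x"
  shows "C_k_on k S f \<longleftrightarrow> C_k_on k S g"
proof -
  have "C_k_on k S g" if "C_k_on k S f" "\<And>x. x \<in> S \<Longrightarrow> f x = g x" for f g :: "'a \<Rightarrow> 'b" using that
  proof (induction k arbitrary: f g)
    case 0
    then show ?case by (simp cong: continuous_on_cong)
  next
    case (Suc k)
    have d: "(g has_derivative fderiv f x) (at x)" if "x \<in> S" for x
    proof -
      have "(f has_derivative fderiv f x) (at x)" using Suc.prems(1) that frechet_derivative_works by auto
      then show ?thesis by (rule has_derivative_transform_within_open[OF _ assms(1) that]) (use Suc.prems in auto)
    qed
    have eq: "fderiv g x = fderiv f x" if "x \<in> S" for x using frechet_derivative_at[OF d[OF that]] by simp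
    have "C_k_on k S (\<lambda>x. fderiv g x v)" for v by (rule Suc.IH[of "\<lambda>x. fderiv f x v"]) (use Suc.prems eq in auto)
    then show ?case using d by (auto simp: differentiable_def)
  qed
  from this[of f g] this[of g f] assms(2) show ?thesis by metis
qed

text \<open>Lets an explicit derivative stand in for the chosen \<open>frechet_derivative\<close>;
  most induction steps below go through it.\<close>

lemma C_k_on_SucI:
  assumes "open S" "\<And>x. x \<in> S \<Longrightarrow> (f has_derivative f' x) (at x)"
    and "\<And>v. C_k_on k S (\<lambda>x. f' x v)"
  shows "C_k_on (Suc k) S f"
proof -
  have "fderiv f x = f' x" if "x \<in> S" for x using frechet_derivative_at[OF assms(2)[OF that]] by simp
  then have "C_k_on k S (\<lambda>x. fderiv f x v)" for v using C_k_on_cong[OF assms(1), of "\<lambda>x. fderiv f x v" "\<lambda>x. f' x v" k]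
      assms(3) by simp
  then show ?thesis using assms(2) by (auto simp: differentiable_def)
qed

lemma C_k_on_has_derivative:
  assumes "C_k_on (Suc k) S f" "x \<in> S"
  shows "(f has_derivative fderiv f x) (at x)" using assms frechet_derivative_works by auto

lemma C_k_on_subset: "C_k_on k S f \<Longrightarrow> T \<subseteq> S \<Longrightarrow> C_k_on k T f" by (induction k arbitrary: f) (auto intro: continuous_on_subset)

lemma C_k_on_Suc_imp:
  assumes "C_k_on (Suc k) S f" shows "C_k_on k S f" using assms
proof (induction k arbitrary: f)
  case 0
  then show ?case by (auto intro!: continuous_at_imp_continuous_on differentiable_imp_continuous_within)
next
  case (Suc k)
  then show ?case by auto
qed

lemma C_k_on_le: "C_k_on k S f \<Longrightarrow> j \<le> k \<Longrightarrow> C_k_on j S f" by (induction k) (auto simp: le_Suc_eq simp del: C_k_on.simps(2) dest: C_k_on_Suc_imp)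

lemma C_k_on_imp_continuous_on: "C_k_on k S f \<Longrightarrow> continuous_on S f" using C_k_on_le[of k S f 0] by simp

lemma C_k_on_local:
  assumes "\<And>x. x \<in> S \<Longrightarrow> \<exists>T. open T \<and> x \<in> T \<and> C_k_on k T f"
  shows "C_k_on k S f" using assms
proof (induction k arbitrary: f)
  case 0
  then show ?case by (intro continuous_at_imp_continuous_on ballI iffD2[OF C_k_on.simps(1)]) (use continuous_on_eq_continuous_at in fastforce)
next
  case (Suc k)
  have "f differentiable at x" if "x \<in> S" for x using Suc.prems[OF that] by auto
  moreover have "C_k_on k S (\<lambda>x. fderiv f x v)" for v by (rule Suc.IH) (use Suc.prems in fastforce)
  ultimately show ?case by auto
qed

lemma C_k_on_const: "open S \<Longrightarrow> C_k_on k S (\<lambda>x. c)"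
proof (induction k arbitrary: c)
  case (Suc k)
  then show ?case by (auto intro!: C_k_on_SucI[where f' = "\<lambda>_ _. 0"])
qed auto

lemma C_k_on_bounded_linear:
  assumes "open S" "bounded_linear L" shows "C_k_on k S L"
proof (cases k)
  case 0
  then show ?thesis using assms by (simp add: linear_continuous_on)
next
  case (Suc j)
  show ?thesis unfolding Suc by (rule C_k_on_SucI[where f' = "\<lambda>_. L"]) (use assms in \<open>auto intro: C_k_on_const bounded_linear_imp_has_derivative\<close>)
qed

lemma C_k_on_linear_comp:
  assumes "open S" "bounded_linear L" "C_k_on k S f" shows "C_k_on k S (\<lambda>x. L (f x))" using assms(3)
proof (induction k arbitrary: f)
  case 0
  then show ?case using assms(2) by (simp add: bounded_linear.continuous_on)
next
  case (Suc k)
  show ?case by (rule C_k_on_SucI[where f' = "\<lambda>x v. L (fderiv f x v)"])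
      (use Suc assms in \<open>auto intro!: bounded_linear.has_derivative[OF assms(2)] C_k_on_has_derivative\<close>)
qed

lemma C_k_on_add:
  assumes "open S" "C_k_on k S f" "C_k_on k S g" shows "C_k_on k S (\<lambda>x. f x + g x)" using assms(2,3)
proof (induction k arbitrary: f g)
  case 0
  then show ?case by (simp add: continuous_on_add)
next
  case (Suc k)
  show ?case by (rule C_k_on_SucI[where f' = "\<lambda>x v. fderiv f x v + fderiv g x v"])
      (use Suc assms(1) in \<open>auto intro!: has_derivative_add C_k_on_has_derivative\<close>)
qed

lemma C_k_on_sum:
  assumes "open S" "\<And>i. i \<in> I \<Longrightarrow> C_k_on k S (f i)" shows "C_k_on k S (\<lambda>x. \<Sum>i\<in>I. f i x)" using assms(2)
  by (induction I rule: infinite_finite_induct) (auto intro!: C_k_on_const C_k_on_add assms(1))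

lemma C_k_on_bilinear:
  assumes "open S" "bounded_bilinear B" "C_k_on k S f" "C_k_on k S g"
  shows "C_k_on k S (\<lambda>x. B (f x) (g x))" using assms(3,4)
proof (induction k arbitrary: f g)
  case 0
  then show ?case using assms(2) by (simp add: bounded_bilinear.continuous_on)
next
  case (Suc k)
  have "C_k_on k S f" "C_k_on k S g" using Suc.prems C_k_on_Suc_imp by blast+
  then show ?case by (intro C_k_on_SucI[where f' = "\<lambda>x v. B (f x) (fderiv g x v) + B (fderiv f x v) (g x)"])
      (use Suc assms(1) in \<open>auto intro!: bounded_bilinear.FDERIV[OF assms(2)] C_k_on_add C_k_on_has_derivative\<close>)
qed

lemma C_k_on_Pair:
  assumes "open S" "C_k_on k S f" "C_k_on k S g" shows "C_k_on k S (\<lambda>x. (f x, g x))"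
proof -
  have "C_k_on k S (\<lambda>x. (f x, 0) + (0, g x))" by (intro C_k_on_add assms(1) C_k_on_linear_comp[OF assms(1) _ assms(2), of "\<lambda>y. (y, 0)"]
        C_k_on_linear_comp[OF assms(1) _ assms(3), of "\<lambda>y. (0, y)"])
      (auto intro: bounded_linear_Pair bounded_linear_zero bounded_linear_ident)
  then show ?thesis by simp
qed

text \<open>Expanding \<open>u x\<close> in the standard basis turns the evaluation of a varying
  linear map into a finite sum of products. It is made for expressions such as
  \<open>fderiv g (f x) (fderiv f x v)\<close>, where map and argument both vary.\<close>

lemma C_k_on_linear_family:
  assumes "open S" "\<And>x. x \<in> S \<Longrightarrow> linear (A x)" "\<And>b. b \<in> Basis \<Longrightarrow> C_k_on k S (\<lambda>x. A x b)" "C_k_on k S u"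
  shows "C_k_on k S (\<lambda>x. A x (u x))"
proof -
  have "C_k_on k S (\<lambda>x. \<Sum>b\<in>Basis. (u x \<bullet> b) *\<^sub>R A x b)" by (intro C_k_on_sum C_k_on_bilinear[OF _ bounded_bilinear_scaleR] assms
        C_k_on_linear_comp[OF assms(1) bounded_linear_inner_left])
  moreover have "(\<Sum>b\<in>Basis. (u x \<bullet> b) *\<^sub>R A x b) = A x (u x)" if "x \<in> S" for x using assms(2)[OF that]
    by (subst (2) euclidean_representation[symmetric, of "u x"]) (simp only: linear_sum linear_cmul)
  ultimately show ?thesis using C_k_on_cong[OF assms(1)] by (metis (mono_tags, lifting))
qed

text \<open>Induction on \<open>k\<close> for all \<open>g\<close> at once: the derivative is a
  linear family whose columns are compositions of \<open>f\<close> with derivatives of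
  \<open>g\<close>, to which the induction hypothesis applies.\<close>

lemma C_k_on_compose:
  assumes "open S" "open T" "C_k_on k S f" "C_k_on k T g" "f ` S \<subseteq> T"
  shows "C_k_on k S (\<lambda>x. g (f x))" using assms(3,4)
proof (induction k arbitrary: g)
  case 0
  then show ?case using continuous_on_compose2[of T g S f] assms(5) by simp
next
  case (Suc k)
  have g': "(g has_derivative fderiv g (f x)) (at (f x))" if "x \<in> S" for x using that assms(5) by (intro C_k_on_has_derivative[OF Suc.prems(2)]) auto
  have f': "(f has_derivative fderiv f x) (at x)" if "x \<in> S" for x using C_k_on_has_derivative[OF Suc.prems(1) that] .
  have f_k: "C_k_on k S f" using Suc.prems(1) by (rule C_k_on_Suc_imp)
  have g_k: "C_k_on k S (\<lambda>x. fderiv g (f x) v)" for v by (rule Suc.IH[OF f_k]) (use Suc.prems(2) in simp)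
  have fk': "C_k_on k S (\<lambda>x. fderiv f x v)" for v using Suc.prems(1) by simp
  have "C_k_on k S (\<lambda>x. fderiv g (f x) (fderiv f x v))" for v by (rule C_k_on_linear_family[OF assms(1) has_derivative_linear[OF g'] g_k fk'])
  then show ?case using diff_chain_at[OF f' g', unfolded comp_def] by (intro C_k_on_SucI[OF assms(1), where f' = "\<lambda>x v. fderiv g (f x) (fderiv f x v)"])
qed

lemma has_vector_derivative_compose_has_derivative:
  assumes "(c has_vector_derivative c') (at t within J)" "(f has_derivative f') (at (c t))"
  shows "((\<lambda>t. f (c t)) has_vector_derivative f' c') (at t within J)" using has_derivative_compose[OF assms(1)[unfolded has_vector_derivative_def] assms(2)]
    linear_cmul[OF has_derivative_linear[OF assms(2)]] by (simp add: has_vector_derivative_def)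

lemma has_vector_derivative_line:
  assumes "(f has_derivative f') (at (p + t *\<^sub>R u))"
  shows "((\<lambda>t. f (p + t *\<^sub>R u)) has_vector_derivative f' u) (at t within J)"
  by (rule has_vector_derivative_compose_has_derivative[where c = "\<lambda>t. p + t *\<^sub>R u", OF _ assms])
    (auto intro!: derivative_eq_intros simp: has_vector_derivative_def)

text \<open>Openness is part of the notion because \<open>C_k_on\<close> has its meaning only on
  open sets.\<close>

definition C_inf_on :: "'e::euclidean_space set \<Rightarrow> ('e \<Rightarrow> 'f::euclidean_space) \<Rightarrow> bool" where
  "C_inf_on S f \<longleftrightarrow> open S \<and> (\<forall>k. C_k_on k S f)"

lemma C_inf_on_open: "C_inf_on S f \<Longrightarrow> open S" by (simp add: C_inf_on_def)

lemma C_inf_on_cong: "\<lbrakk>\<And>x. x \<in> S \<Longrightarrow> f x = g x\<rbrakk> \<Longrightarrow> C_inf_on S f \<longleftrightarrow> C_inf_on S g"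
  unfolding C_inf_on_def by (intro conj_cong refl all_cong1 C_k_on_cong) auto

lemma C_inf_on_subset: "C_inf_on S f \<Longrightarrow> open T \<Longrightarrow> T \<subseteq> S \<Longrightarrow> C_inf_on T f"
  unfolding C_inf_on_def using C_k_on_subset by blast

lemma C_inf_on_local:
  assumes "\<And>x. x \<in> S \<Longrightarrow> \<exists>T. x \<in> T \<and> C_inf_on T f" "open S" shows "C_inf_on S f"
proof -
  have "C_k_on k S f" for k
  proof (rule C_k_on_local)
    fix x assume "x \<in> S"
    then obtain T where "x \<in> T" "C_inf_on T f" using assms(1) by blast
    then show "\<exists>T. open T \<and> x \<in> T \<and> C_k_on k T f" unfolding C_inf_on_def by blast
  qed
  then show ?thesis using assms(2) by (simp add: C_inf_on_def)
qed

lemma C_inf_on_has_derivative: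
  "C_inf_on S f \<Longrightarrow> x \<in> S \<Longrightarrow> (f has_derivative fderiv f x) (at x)" unfolding C_inf_on_def using C_k_on_has_derivative by blast

lemma C_inf_on_continuous: "C_inf_on S f \<Longrightarrow> continuous_on S f" unfolding C_inf_on_def using C_k_on_imp_continuous_on by blast

lemma C_inf_on_const: "open S \<Longrightarrow> C_inf_on S (\<lambda>x. c)" by (simp add: C_inf_on_def C_k_on_const)

lemma C_inf_on_bounded_linear: "open S \<Longrightarrow> bounded_linear L \<Longrightarrow> C_inf_on S L" by (simp add: C_inf_on_def C_k_on_bounded_linear)

lemma C_inf_on_linear: "open S \<Longrightarrow> linear L \<Longrightarrow> C_inf_on S L" by (simp add: C_inf_on_bounded_linear linear_conv_bounded_linear)

lemma C_inf_on_id: "open S \<Longrightarrow> C_inf_on S (\<lambda>x. x)" by (simp add: C_inf_on_bounded_linear bounded_linear_ident)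

lemma C_inf_on_linear_comp: "bounded_linear L \<Longrightarrow> C_inf_on S f \<Longrightarrow> C_inf_on S (\<lambda>x. L (f x))"
  unfolding C_inf_on_def using C_k_on_linear_comp by blast

lemma C_inf_on_inner: "C_inf_on S f \<Longrightarrow> C_inf_on S (\<lambda>x. f x \<bullet> b)" by (rule C_inf_on_linear_comp[OF bounded_linear_inner_left])

lemma C_inf_on_add: "C_inf_on S f \<Longrightarrow> C_inf_on S g \<Longrightarrow> C_inf_on S (\<lambda>x. f x + g x)" unfolding C_inf_on_def using C_k_on_add by blast

lemma C_inf_on_bilinear:
  "bounded_bilinear B \<Longrightarrow> C_inf_on S f \<Longrightarrow> C_inf_on S g \<Longrightarrow> C_inf_on S (\<lambda>x. B (f x) (g x))"
  unfolding C_inf_on_def using C_k_on_bilinear by blast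

lemmas C_inf_on_mult = C_inf_on_bilinear[OF bounded_bilinear_mult]
lemmas C_inf_on_scaleR = C_inf_on_bilinear[OF bounded_bilinear_scaleR]

lemma C_inf_on_uminus: "C_inf_on S f \<Longrightarrow> C_inf_on S (\<lambda>x. - f x)" by (rule C_inf_on_linear_comp[OF bounded_linear_minus[OF bounded_linear_ident]])

lemma C_inf_on_diff: "C_inf_on S f \<Longrightarrow> C_inf_on S g \<Longrightarrow> C_inf_on S (\<lambda>x. f x - g x)"
  using C_inf_on_add[of S f "\<lambda>x. - g x"] C_inf_on_uminus[of S g] by simp

lemma C_inf_on_sum: "open S \<Longrightarrow> (\<And>i. i \<in> I \<Longrightarrow> C_inf_on S (f i)) \<Longrightarrow> C_inf_on S (\<lambda>x. \<Sum>i\<in>I. f i x)"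
  unfolding C_inf_on_def by (auto intro: C_k_on_sum)

lemma C_inf_on_Pair: "C_inf_on S f \<Longrightarrow> C_inf_on S g \<Longrightarrow> C_inf_on S (\<lambda>x. (f x, g x))" unfolding C_inf_on_def using C_k_on_Pair by blast

lemma C_inf_on_compose:
  "C_inf_on S f \<Longrightarrow> C_inf_on T g \<Longrightarrow> f ` S \<subseteq> T \<Longrightarrow> C_inf_on S (\<lambda>x. g (f x))"
  unfolding C_inf_on_def by (auto intro: C_k_on_compose)

lemma C_inf_on_frechet: "C_inf_on S f \<Longrightarrow> C_inf_on S (\<lambda>x. fderiv f x v)" unfolding C_inf_on_def by (metis C_k_on.simps(2))

lemma C_inf_on_linear_family:
  assumes "open S" "\<And>x. x \<in> S \<Longrightarrow> linear (A x)" "\<And>b. b \<in> Basis \<Longrightarrow> C_inf_on S (\<lambda>x. A x b)" "C_inf_on S u"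
  shows "C_inf_on S (\<lambda>x. A x (u x))" using assms C_k_on_linear_family[of S A _ u] unfolding C_inf_on_def by auto

lemma C_inf_on_frechet_family:
  assumes "C_inf_on S f" "C_inf_on S u"
  shows "C_inf_on S (\<lambda>x. fderiv f x (u x))"
proof (rule C_inf_on_linear_family[where A = "\<lambda>x. fderiv f x"])
  show "linear (fderiv f x)" if "x \<in> S" for x using C_inf_on_has_derivative[OF assms(1) that] by (rule has_derivative_linear)
qed (use assms in \<open>auto intro: C_inf_on_frechet simp: C_inf_on_open\<close>)

text \<open>The derivative of the reciprocal involves only the reciprocal itself and the derivative
  of \<open>f\<close>, so each induction step raises the class by one.\<close>

lemma C_inf_on_inverse:
  fixes f :: "'e::euclidean_space \<Rightarrow> real"
  assumes "C_inf_on S f" "\<And>x. x \<in> S \<Longrightarrow> f x \<noteq> 0"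
  shows "C_inf_on S (\<lambda>x. inverse (f x))"
proof -
  have "open S" using assms(1) by (rule C_inf_on_open)
  have "C_k_on k S (\<lambda>x. inverse (f x))" for k
  proof (induction k)
    case 0
    then show ?case using assms C_inf_on_continuous by (auto intro!: continuous_on_inverse)
  next
    case (Suc k)
    have "C_k_on k S (\<lambda>x. fderiv f x v)" for v using C_inf_on_frechet[OF assms(1)] by (simp add: C_inf_on_def)
    with Suc show ?case by (intro C_k_on_SucI[where f' = "\<lambda>x h. - (inverse (f x) * fderiv f x h * inverse (f x))"]
          \<open>open S\<close> Deriv.has_derivative_inverse C_inf_on_has_derivative[OF assms(1)] assms(2)
          C_k_on_linear_comp[OF _ bounded_linear_minus[OF bounded_linear_ident]]
          C_k_on_bilinear[OF _ bounded_bilinear_mult]) auto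
  qed
  with \<open>open S\<close> show ?thesis by (simp add: C_inf_on_def)
qed

section \<open>Cut-off functions, first-order expansions with smooth coefficients, symmetry of
  second derivatives\<close>

section \<open>Bump functions and Hadamard's lemma\<close>

text \<open>The power of \<open>inverse t\<close> is carried along so that the family is closed
  under differentiation: the derivative of \<open>exp_flat n\<close> is a combination of
  \<open>exp_flat (n + 1)\<close> and \<open>exp_flat (n + 2)\<close>.\<close>

definition exp_flat :: "nat \<Rightarrow> real \<Rightarrow> real" where
  "exp_flat n t = (if t > 0 then inverse t ^ n * exp (- inverse t) else 0)"

lemma exp_flat_tendsto_0: "(exp_flat n \<longlongrightarrow> 0) (at 0)"
proof -
  have r: "((\<lambda>t::real. inverse t ^ n / exp (inverse t)) \<longlongrightarrow> 0) (at_right 0)"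
    by (rule filterlim_compose[OF tendsto_power_div_exp_0 filterlim_inverse_at_top_right])
  show ?thesis
  proof (rule filterlim_split_at)
    show "(exp_flat n \<longlongrightarrow> 0) (at_right 0)" by (rule Lim_transform_eventually[OF r])
        (auto simp: exp_flat_def exp_minus divide_inverse eventually_at_right_field intro!: exI[of _ 1])
    show "(exp_flat n \<longlongrightarrow> 0) (at_left 0)" by (rule tendsto_eventually) (auto simp: exp_flat_def eventually_at_left_field intro!: exI[of _ "-1"])
  qed
qed

lemma exp_flat_deriv:
  "(exp_flat n has_real_derivative (exp_flat (n + 2) t - n * exp_flat (n + 1) t)) (at t)"
proof -
  consider "t > 0" | "t < 0" | "t = 0" by linarith
  then show ?thesis
  proof cases
    case 1
    have i: "(inverse has_real_derivative - (inverse t ^ 2)) (at t)" using DERIV_inverse[of t UNIV] 1 by (simp add: numeral_2_eq_2)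
    have p: "((\<lambda>t. inverse t ^ n) has_real_derivative - (n * inverse t ^ (n + 1))) (at t)"
      by (rule DERIV_cong[OF DERIV_power[OF i]]) (cases n; simp add: power2_eq_square)
    have e: "((\<lambda>t. exp (- inverse t)) has_real_derivative exp (- inverse t) * inverse t ^ 2) (at t)" using DERIV_fun_exp[OF DERIV_minus[OF i]] by simp
    have "((\<lambda>t. inverse t ^ n * exp (- inverse t)) has_real_derivative
        (exp_flat (n + 2) t - n * exp_flat (n + 1) t)) (at t)" by (rule DERIV_cong[OF DERIV_mult[OF p e]])
        (use 1 in \<open>simp add: exp_flat_def algebra_simps power2_eq_square\<close>)
    then show ?thesis by (rule has_field_derivative_transform_within_open[of _ _ _ "{0<..}"]) (use 1 in \<open>auto simp: exp_flat_def\<close>)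
  next
    case 2
    have "((\<lambda>t. 0) has_real_derivative (exp_flat (n + 2) t - n * exp_flat (n + 1) t)) (at t)" using 2 by (auto simp: exp_flat_def)
    then show ?thesis by (rule has_field_derivative_transform_within_open[of _ _ _ "{..<0}"]) (use 2 in \<open>auto simp: exp_flat_def\<close>)
  next
    case 3
    \<comment> \<open>The difference quotient at 0 is \<open>exp_flat (Suc n)\<close>, so the limit
      known for every exponent shows that the derivative is 0.\<close>
    have "((\<lambda>y. (exp_flat n y - exp_flat n 0) / (y - 0)) \<longlongrightarrow> 0) (at 0)" by (rule Lim_transform_eventually[OF exp_flat_tendsto_0[of "Suc n"]])
        (auto simp: exp_flat_def divide_inverse eventually_at intro!: exI[of _ 1])
    then show ?thesis using 3 by (simp add: has_field_derivative_iff exp_flat_def)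
  qed
qed

lemma exp_flat_C_k: "C_k_on k UNIV (exp_flat n)"
proof (induction k arbitrary: n)
  case 0
  have "isCont (exp_flat n) t" for t using exp_flat_deriv DERIV_isCont by blast
  then show ?case by (simp add: continuous_at_imp_continuous_on)
next
  case (Suc k)
  have "C_k_on k UNIV (\<lambda>t. (exp_flat (n + 2) t + (- real n) * exp_flat (n + 1) t) * v)" for v
    by (intro C_k_on_bilinear[OF _ bounded_bilinear_mult] C_k_on_add C_k_on_const Suc.IH) auto
  then show ?case by (intro C_k_on_SucI[where f' = "\<lambda>t v. (exp_flat (n + 2) t + (- real n) * exp_flat (n + 1) t) * v"])
      (use exp_flat_deriv[of n] in \<open>auto simp: has_field_derivative_def\<close>)
qed

lemma exp_flat_C_inf: "C_inf_on UNIV (exp_flat n)" by (simp add: C_inf_on_def exp_flat_C_k)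

text \<open>A quotient of flat functions of the squared distance: the numerator vanishes at distance
  at least \<open>2 * r\<close>, the other term of the denominator at distance at most
  \<open>r\<close>, and the two never vanish together.\<close>

lemma C_inf_bump:
  fixes z0 :: "'e::euclidean_space"
  assumes "0 < r"
  obtains \<rho> :: "'e \<Rightarrow> real" where "C_inf_on UNIV \<rho>" "\<And>x. dist z0 x \<le> r \<Longrightarrow> \<rho> x = 1"
    "\<And>x. dist z0 x \<ge> 2 * r \<Longrightarrow> \<rho> x = 0"
proof -
  define sq where "sq x = (x - z0) \<bullet> (x - z0)" for x
  have sq: "sq x = (dist z0 x)\<^sup>2" for x by (simp add: sq_def dist_norm power2_norm_eq_inner norm_minus_commute)
  have "C_inf_on UNIV sq" unfolding sq_def by (intro C_inf_on_bilinear[OF bounded_bilinear_inner] C_inf_on_diff C_inf_on_id C_inf_on_const) auto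
  then have c: "C_inf_on UNIV (\<lambda>x. exp_flat 0 (c * sq x + d))" for c d by (intro C_inf_on_compose[OF _ exp_flat_C_inf] C_inf_on_add C_inf_on_mult C_inf_on_const) auto
  define \<rho> where "\<rho> x = exp_flat 0 ((-1) * sq x + 4 * r\<^sup>2) *
      inverse (exp_flat 0 ((-1) * sq x + 4 * r\<^sup>2) + exp_flat 0 (1 * sq x + (- r\<^sup>2)))" for x
  have pos: "exp_flat 0 ((-1) * sq x + 4 * r\<^sup>2) + exp_flat 0 (1 * sq x + (- r\<^sup>2)) > 0" for x
  proof -
    have "r\<^sup>2 > 0" using assms by simp
    then have "(-1) * sq x + 4 * r\<^sup>2 > 0 \<or> 1 * sq x + (- r\<^sup>2) > 0" by linarith
    then show ?thesis by (auto simp: exp_flat_def intro: add_pos_nonneg add_nonneg_pos)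
  qed
  show ?thesis
  proof (rule that[of \<rho>])
    show "C_inf_on UNIV \<rho>" unfolding \<rho>_def by (intro C_inf_on_mult c C_inf_on_inverse C_inf_on_add) (use pos in \<open>metis less_irrefl\<close>)
    show "\<rho> x = 1" if "dist z0 x \<le> r" for x
    proof -
      have "sq x \<le> r\<^sup>2" using that assms by (simp add: sq power_mono)
      then show ?thesis using pos[of x] by (simp add: \<rho>_def exp_flat_def)
    qed
    show "\<rho> x = 0" if "dist z0 x \<ge> 2 * r" for x
    proof -
      have "(2 * r)\<^sup>2 \<le> sq x" unfolding sq by (rule power_mono) (use that assms in auto)
      then show ?thesis by (simp add: \<rho>_def exp_flat_def power_mult_distrib)
    qed
  qed
qed

text \<open>Multiplication by a bump function. The last conclusion, that \<open>h x\<close> is a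
  multiple of \<open>g x\<close>, serves to keep values inside a subspace that contains those of
  \<open>g\<close>.\<close>

lemma C_inf_extend:
  fixes g :: "'e::euclidean_space \<Rightarrow> 'f::euclidean_space"
  assumes "C_inf_on T g" "z0 \<in> T"
  obtains r h where "0 < r" "cball z0 r \<subseteq> T" "C_inf_on UNIV h" "\<And>x. x \<in> ball z0 (r/2) \<Longrightarrow> h x = g x"
    "\<And>x. x \<notin> cball z0 r \<Longrightarrow> h x = 0" "\<And>x. \<exists>c. x \<in> T \<longrightarrow> h x = c *\<^sub>R g x"
proof -
  have T: "open T" using assms(1) C_inf_on_open by blast
  obtain r where r: "0 < r" "cball z0 r \<subseteq> T" using T assms(2) open_contains_cball by blast
  obtain \<rho> :: "'e \<Rightarrow> real" where \<rho>: "C_inf_on UNIV \<rho>" "\<And>x. dist z0 x \<le> r/2 \<Longrightarrow> \<rho> x = 1"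
    "\<And>x. dist z0 x \<ge> 2 * (r/2) \<Longrightarrow> \<rho> x = 0" using C_inf_bump[of "r/2" z0] r by auto
  define h where "h x = (if x \<in> T then \<rho> x *\<^sub>R g x else 0)" for x
  have h0: "h x = 0" if "x \<notin> cball z0 r" for x using that \<rho>(3)[of x] by (auto simp: h_def)
  have "C_inf_on UNIV h"
  proof (rule C_inf_on_local)
    fix x
    show "\<exists>U. x \<in> U \<and> C_inf_on U h"
    proof (cases "x \<in> T")
      case True
      have "C_inf_on T (\<lambda>x. \<rho> x *\<^sub>R g x)" by (intro C_inf_on_scaleR assms(1) C_inf_on_subset[OF \<rho>(1)] T) auto
      then have "C_inf_on T h" using C_inf_on_cong[of T h "\<lambda>x. \<rho> x *\<^sub>R g x"] by (simp add: h_def)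
      with True show ?thesis by blast
    next
      case False
      have "open (- cball z0 r)" by (simp add: open_Compl)
      then have "C_inf_on (- cball z0 r) h" using C_inf_on_cong[of "- cball z0 r" h "\<lambda>x. 0"] C_inf_on_const h0 by auto
      with False r show ?thesis by blast
    qed
  qed simp
  moreover have "h x = g x" if "x \<in> ball z0 (r/2)" for x using that r \<rho>(2)[of x] by (auto simp: h_def subset_iff)
  moreover have "\<exists>c. x \<in> T \<longrightarrow> h x = c *\<^sub>R g x" for x by (auto simp: h_def)
  ultimately show ?thesis using that[OF r, of h] h0 by blast
qed

text \<open>The derivative as an element of the normed space of operators, the form needed for
  operator-valued integrals, for differentiation under the integral sign and for the inverse
  function theorem.\<close>

definition blinfun_deriv :: "('e::euclidean_space \<Rightarrow> 'f::euclidean_space) \<Rightarrow> 'e \<Rightarrow> 'e \<Rightarrow>\<^sub>L 'f" where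
  "blinfun_deriv f x = Blinfun (fderiv f x)"

lemma blinfun_deriv_apply:
  assumes "C_k_on (Suc k) S f" "x \<in> S"
  shows "blinfun_apply (blinfun_deriv f x) v = fderiv f x v" unfolding blinfun_deriv_def using has_derivative_bounded_linear[OF C_k_on_has_derivative[OF assms]]
  by (simp add: bounded_linear_Blinfun_apply)

lemma blinfun_deriv:
  assumes "C_k_on (Suc k) S f" "x \<in> S"
  shows "(f has_derivative blinfun_apply (blinfun_deriv f x)) (at x)" using C_k_on_has_derivative[OF assms] blinfun_deriv_apply[OF assms] by presburger

lemma continuous_on_blinfun_deriv:
  assumes "C_k_on (Suc k) S f" shows "continuous_on S (blinfun_deriv f)"
proof (rule continuous_on_blinfun_componentwise)
  fix i :: 'a
  have "continuous_on S (\<lambda>x. fderiv f x i)" by (rule C_k_on_imp_continuous_on[of k]) (use assms in simp)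
  then show "continuous_on S (\<lambda>x. blinfun_apply (blinfun_deriv f x) i)" by (rule continuous_on_eq) (simp add: blinfun_deriv_apply[OF assms])
qed

text \<open>Differentiation under the integral sign. The weight \<open>q\<close> makes the induction
  go through, since each derivative of the integrand produces another factor
  \<open>s\<close>.\<close>

lemma C_k_on_integral_segment:
  fixes h :: "'e::euclidean_space \<Rightarrow> 'f::euclidean_space" and q :: "real \<Rightarrow> real"
  assumes "C_inf_on UNIV h" "continuous_on {0..1} q"
  shows "C_k_on k UNIV (\<lambda>z. integral {0..1} (\<lambda>s. q s *\<^sub>R h (z0 + s *\<^sub>R (z - z0))))" using assms
proof (induction k arbitrary: h q)
  case 0
  have c: "continuous_on UNIV h" using C_inf_on_continuous 0 by blast
  have "continuous_on (UNIV \<times> cbox 0 1) (\<lambda>(z, s). q s *\<^sub>R h (z0 + s *\<^sub>R (z - z0)))" unfolding split_beta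
    by (intro continuous_intros continuous_on_compose2[OF c] continuous_on_compose2[OF 0(2)]) auto
  then show ?case using integral_continuous_on_param by fastforce
next
  case (Suc k)
  have h1: "C_k_on (Suc 0) UNIV h" using Suc.prems(1) by (auto simp: C_inf_on_def)
  have c: "continuous_on UNIV h" using C_inf_on_continuous Suc.prems(1) by blast
  have c': "continuous_on UNIV (blinfun_deriv h)" using continuous_on_blinfun_deriv[OF h1] .
  define fx where "fx z s = (q s * s) *\<^sub>R blinfun_deriv h (z0 + s *\<^sub>R (z - z0))" for z s
  have "((\<lambda>z. integral (cbox 0 1) (\<lambda>s. q s *\<^sub>R h (z0 + s *\<^sub>R (z - z0)))) has_derivative
      integral (cbox 0 1) (fx z)) (at z within UNIV)" for z
  proof (rule leibniz_rule)
    fix z s assume "s \<in> cbox 0 (1::real)"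
    have "((\<lambda>z. h (z0 + s *\<^sub>R (z - z0))) has_derivative
        (\<lambda>v. blinfun_apply (blinfun_deriv h (z0 + s *\<^sub>R (z - z0))) (s *\<^sub>R v))) (at z)" by (rule has_derivative_compose[OF _ blinfun_deriv[OF h1], simplified])
        (auto intro!: derivative_eq_intros)
    then show "((\<lambda>x. q s *\<^sub>R h (z0 + s *\<^sub>R (x - z0))) has_derivative blinfun_apply (fx z s)) (at z within UNIV)"
      by (auto intro!: derivative_eq_intros simp: fx_def blinfun.scaleR_left blinfun.scaleR_right)
  next
    show "(\<lambda>s. q s *\<^sub>R h (z0 + s *\<^sub>R (x - z0))) integrable_on cbox 0 1" for x
      by (intro integrable_continuous continuous_intros continuous_on_compose2[OF c] continuous_on_compose2[OF Suc.prems(2)]) auto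
    show "continuous_on (UNIV \<times> cbox 0 1) (\<lambda>(x, t). fx x t)" unfolding split_beta fx_def
      by (intro continuous_intros continuous_on_compose2[OF c'] continuous_on_compose2[OF Suc.prems(2)]) auto
  qed auto
  moreover have "blinfun_apply (integral (cbox 0 1) (fx z)) v =
      integral {0..1} (\<lambda>s. (q s * s) *\<^sub>R fderiv h (z0 + s *\<^sub>R (z - z0)) v)" for z v
  proof -
    have "fx z integrable_on cbox 0 1" unfolding fx_def
      by (intro integrable_continuous continuous_intros continuous_on_compose2[OF c'] continuous_on_compose2[OF Suc.prems(2)]) auto
    from integral_linear[OF this bounded_linear_blinfun_apply[OF bounded_linear_ident]]
      integral_linear[OF this blinfun.bounded_linear_left[of v]]
    show ?thesis by (simp add: o_def fx_def blinfun.scaleR_left blinfun_deriv_apply[OF h1])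
  qed
  moreover have "C_k_on k UNIV (\<lambda>z. integral {0..1} (\<lambda>s. (q s * s) *\<^sub>R fderiv h (z0 + s *\<^sub>R (z - z0)) v))" for v
    using Suc.prems by (intro Suc.IH C_inf_on_frechet continuous_intros) auto
  ultimately show ?case by (intro C_k_on_SucI[where f' = "\<lambda>z. blinfun_apply (integral (cbox 0 1) (fx z))"]) auto
qed

lemma segment_fundamental_theorem:
  fixes f :: "'e::euclidean_space \<Rightarrow> 'f::euclidean_space"
  assumes "C_k_on (Suc k) S f" "closed_segment a b \<subseteq> S"
  shows "((\<lambda>s. fderiv f (a + s *\<^sub>R (b - a)) (b - a)) has_integral (f b - f a)) {0..1}"
proof -
  have inS: "a + s *\<^sub>R (b - a) \<in> S" if "s \<in> {0..1}" for s
  proof -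
    have "a + s *\<^sub>R (b - a) = (1 - s) *\<^sub>R a + s *\<^sub>R b" by (simp add: algebra_simps)
    then show ?thesis using that assms(2) by (auto simp: closed_segment_def subset_iff)
  qed
  have "((\<lambda>s. fderiv f (a + s *\<^sub>R (b - a)) (b - a)) has_integral
      (f (a + 1 *\<^sub>R (b - a)) - f (a + 0 *\<^sub>R (b - a)))) {0..1}"
  proof (rule fundamental_theorem_of_calculus)
    fix s :: real assume s: "s \<in> {0..1}"
    show "((\<lambda>s. f (a + s *\<^sub>R (b - a))) has_vector_derivative
        fderiv f (a + s *\<^sub>R (b - a)) (b - a)) (at s within {0..1})" by (rule has_vector_derivative_line[OF C_k_on_has_derivative[OF assms(1) inS[OF s]]])
  qed simp
  then show ?thesis by simp
qed

text \<open>\<open>G b\<close> is the mean of the derivative in direction \<open>b\<close> over the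
  segment from \<open>z0\<close> to \<open>z\<close>; the expansion is the fundamental theorem of
  calculus along that segment.\<close>

lemma hadamard:
  fixes g :: "'e::euclidean_space \<Rightarrow> real"
  assumes "C_inf_on UNIV g"
  obtains G :: "'e \<Rightarrow> 'e \<Rightarrow> real" where "\<And>b. C_inf_on UNIV (G b)" "\<And>b. G b z0 = fderiv g z0 b"
    "\<And>z. g z = g z0 + (\<Sum>b\<in>Basis. ((z - z0) \<bullet> b) * G b z)"
proof -
  define G where "G b z = integral {0..1} (\<lambda>s. 1 *\<^sub>R fderiv g (z0 + s *\<^sub>R (z - z0)) b)" for b z
  have g1: "C_k_on (Suc 0) UNIV g" using assms by (auto simp: C_inf_on_def)
  have "C_inf_on UNIV (G b)" for b unfolding C_inf_on_def G_def using C_k_on_integral_segment[OF C_inf_on_frechet[OF assms], of "\<lambda>_. 1"] by auto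
  moreover have "G b z0 = fderiv g z0 b" for b by (simp add: G_def)
  moreover have "g z = g z0 + (\<Sum>b\<in>Basis. ((z - z0) \<bullet> b) * G b z)" for z
  proof -
    have lin: "linear (fderiv g x)" for x using C_inf_on_has_derivative[OF assms] has_derivative_linear by auto
    have c: "continuous_on UNIV (\<lambda>x. fderiv g x b)" for b using C_inf_on_continuous[OF C_inf_on_frechet[OF assms]] .
    have int: "(\<lambda>s. fderiv g (z0 + s *\<^sub>R (z - z0)) b) integrable_on {0..1}" for b
      by (intro integrable_continuous_interval continuous_on_compose2[OF c] continuous_intros) auto
    have "fderiv g x (z - z0) = (\<Sum>b\<in>Basis. ((z - z0) \<bullet> b) * fderiv g x b)" for x by (subst (1) euclidean_representation[symmetric, of "z - z0"])
        (simp only: linear_sum[OF lin] linear_cmul[OF lin] real_scaleR_def)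
    then have "g z - g z0 = integral {0..1} (\<lambda>s. \<Sum>b\<in>Basis. ((z - z0) \<bullet> b) * fderiv g (z0 + s *\<^sub>R (z - z0)) b)"
      using segment_fundamental_theorem[OF g1, of z0 z] by (simp add: integral_unique)
    also have "\<dots> = (\<Sum>b\<in>Basis. ((z - z0) \<bullet> b) * G b z)" unfolding G_def by (subst integral_sum) (auto intro!: integrable_on_mult_right int)
    finally show ?thesis by simp
  qed
  ultimately show ?thesis using that by blast
qed

text \<open>Differentiating the increment of \<open>f\<close> under the integral sign shows that the
  increment of the \<open>u\<close>-derivative along \<open>v\<close> is the integral of the
  \<open>u\<close>-derivative of the \<open>v\<close>-derivative. Differentiating this identity in
  the length \<open>t\<close> gives the claim.\<close>

lemma symmetric_second_derivative:
  fixes f :: "'e::euclidean_space \<Rightarrow> real"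
  assumes f: "C_inf_on S f" and x: "x \<in> S"
  shows "fderiv (\<lambda>y. fderiv f y u) x v =
    fderiv (\<lambda>y. fderiv f y v) x u"
proof -
  define g where "g w = (\<lambda>y. fderiv f y w)" for w
  have g: "C_inf_on S (g w)" for w unfolding g_def by (rule C_inf_on_frechet[OF f])
  define a where "a s t = x + s *\<^sub>R u + t *\<^sub>R v" for s t
  have o: "open ((\<lambda>p. a (fst p) (snd p)) -` S)" unfolding a_def by (intro open_vimage C_inf_on_open[OF f] continuous_intros)
  have "(0, 0) \<in> (\<lambda>p. a (fst p) (snd p)) -` S" using x by (simp add: a_def)
  then obtain e where e: "0 < e" "ball (0, 0) e \<subseteq> (\<lambda>p. a (fst p) (snd p)) -` S" by (rule openE[OF o]) (rule that)
  define r where "r = e / 3"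
  have r: "0 < r" using e(1) by (simp add: r_def)
  have aS: "a s t \<in> S" if "s \<in> {0..r}" "t \<in> {0..r}" for s t
  proof -
    have "norm (s, t) < e" by (rule le_less_trans[OF norm_Pair_le]) (use that e(1) in \<open>simp add: r_def\<close>)
    then have "(s, t) \<in> ball (0, 0) e" by (simp add: dist_norm norm_Pair)
    then show ?thesis using e(2) by auto
  qed
  have du: "((\<lambda>s. k (a s t)) has_vector_derivative fderiv k (a s t) u) (at s within X)"
    and dv: "((\<lambda>t. k (a s t)) has_vector_derivative fderiv k (a s t) v) (at t within X)"
    if k: "C_inf_on S k" and st: "s \<in> {0..r}" "t \<in> {0..r}" for k :: "'e \<Rightarrow> real" and s t X
    using has_vector_derivative_line[of k _ "x + t *\<^sub>R v" s u X] has_vector_derivative_line[of k _ "x + s *\<^sub>R u" t v X]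
      C_inf_on_has_derivative[OF k aS[OF st]] by (simp_all add: a_def ac_simps)
  have ca: "continuous_on X (\<lambda>p. a (c p) (d p))" if "continuous_on X c" "continuous_on X d" for X :: "'z::topological_space set" and c d
    unfolding a_def by (intro continuous_intros that)
  have cg: "continuous_on X (\<lambda>p. g w (a (c p) (d p)))" "continuous_on X (\<lambda>p. fderiv (g w) (a (c p) (d p)) z)"
    if "continuous_on X c" "continuous_on X d" "c ` X \<subseteq> {0..r}" "d ` X \<subseteq> {0..r}" for X :: "'z::topological_space set" and c d w z
  proof -
    have im: "(\<lambda>p. a (c p) (d p)) ` X \<subseteq> S" using aS that(3,4) by (simp add: image_subset_iff)
    show "continuous_on X (\<lambda>p. g w (a (c p) (d p)))" by (rule continuous_on_compose2[OF C_inf_on_continuous[OF g] ca[OF that(1,2)] im])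
    show "continuous_on X (\<lambda>p. fderiv (g w) (a (c p) (d p)) z)" by (rule continuous_on_compose2[OF C_inf_on_continuous[OF C_inf_on_frechet[OF g]] ca[OF that(1,2)] im])
  qed
  have eq: "g u (a 0 t) - g u x = integral {0..t} (\<lambda>ta. fderiv (g v) (a 0 ta) u)" if t: "t \<in> {0..r}" for t
  proof -
    have sub: "{0..t} \<subseteq> {0..r}" using t by auto
    have 1: "integral (cbox 0 t) (\<lambda>ta. g v (a s ta)) = f (a s t) - f (a s 0)" if s: "s \<in> {0..r}" for s unfolding g_def cbox_interval
      by (rule integral_unique[OF fundamental_theorem_of_calculus]) (use t s dv[OF f s] in auto)
    have "((\<lambda>s. integral (cbox 0 t) (\<lambda>ta. g v (a s ta))) has_vector_derivative
        integral (cbox 0 t) (\<lambda>ta. fderiv (g v) (a 0 ta) u)) (at 0 within {0..r})"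
    proof (rule leibniz_rule_vector_derivative)
      show "(\<lambda>ta. g v (a s ta)) integrable_on cbox 0 t" if "s \<in> {0..r}" for s by (intro integrable_continuous cg continuous_intros) (use that sub in auto)
      show "continuous_on ({0..r} \<times> cbox 0 t) (\<lambda>(s, ta). fderiv (g v) (a s ta) u)" unfolding split_beta by (intro cg continuous_intros) (use sub in auto)
    qed (use du[OF g] sub r in auto)
    then have "((\<lambda>s. f (a s t) - f (a s 0)) has_vector_derivative integral (cbox 0 t) (\<lambda>ta. fderiv (g v) (a 0 ta) u)) (at 0 within cbox 0 r)"
      by (simp add: cbox_interval) (rule has_vector_derivative_transform, use 1 r in auto)
    moreover have "((\<lambda>s. f (a s t) - f (a s 0)) has_vector_derivative g u (a 0 t) - g u (a 0 0)) (at 0 within cbox 0 r)"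
      unfolding g_def by (intro has_vector_derivative_diff du[OF f]) (use t r in auto)
    ultimately show ?thesis using vector_derivative_unique_within_closed_interval[OF r, of 0] r by (auto simp: a_def)
  qed
  have "((\<lambda>t. integral {0..t} (\<lambda>ta. fderiv (g v) (a 0 ta) u)) has_vector_derivative fderiv (g v) (a 0 0) u) (at 0 within {0..r})"
    by (rule integral_has_vector_derivative) (use r in \<open>auto intro!: cg continuous_intros\<close>)
  then have "((\<lambda>t. g u (a 0 t) - g u x) has_vector_derivative fderiv (g v) (a 0 0) u) (at 0 within cbox 0 r)"
    unfolding cbox_interval by (rule has_vector_derivative_transform[rotated 2]) (use eq r in auto)
  moreover have "((\<lambda>t. g u (a 0 t) - g u x) has_vector_derivative fderiv (g u) (a 0 0) v - 0) (at 0 within cbox 0 r)"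
    by (intro has_vector_derivative_diff dv[OF g] has_vector_derivative_const) (use r in auto)
  ultimately have "fderiv (g v) (a 0 0) u = fderiv (g u) (a 0 0) v - 0" using vector_derivative_unique_within_closed_interval[OF r, of 0] r by simp
  then show ?thesis by (simp add: a_def g_def)
qed


section \<open>Picard iteration with parameters, and solutions of class k in time and
  parameter\<close>

section \<open>Smooth dependence of solutions of differential equations on parameters\<close>

text \<open>The scaled mean is the integral from 0 to \<open>t\<close>, for either sign of
  \<open>t\<close>. In this form Picard's operator integrates over the fixed interval
  \<open>{0..1}\<close>.\<close>

lemma has_vector_derivative_mean_integral:
  fixes f :: "real \<Rightarrow> 'z::banach"
  assumes f: "continuous_on {-e..e} f" and t: "t \<in> {-e..e}"
  shows "((\<lambda>t. t *\<^sub>R integral {0..1} (\<lambda>sg. f (t * sg))) has_vector_derivative f t) (at t within {-e..e})"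
proof -
  define I where "I t = integral {-e..t} f" for t
  have I: "(I has_vector_derivative f t) (at t within {-e..e})" if "t \<in> {-e..e}" for t unfolding I_def using integral_has_vector_derivative[OF f that] .
  have mul: "t * sg \<in> {-e..e}" if "t \<in> {-e..e}" "sg \<in> {0..1}" for t sg :: real
  proof -
    have "\<bar>t * sg\<bar> \<le> \<bar>t\<bar> * 1" unfolding abs_mult using that by (intro mult_left_mono) auto
    then show ?thesis using that by auto
  qed
  have "t *\<^sub>R integral {0..1} (\<lambda>sg. f (t * sg)) = I t - I 0" if t: "t \<in> {-e..e}" for t
  proof -
    have "((\<lambda>sg. t *\<^sub>R f (t * sg)) has_integral (I (t * 1) - I (t * 0))) {0..1}"
    proof (rule fundamental_theorem_of_calculus)
      fix sg :: real assume sg: "sg \<in> {0..1}"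
      have d: "((\<lambda>sg. t * sg) has_vector_derivative t) (at sg within {0..1})" by (auto intro!: derivative_eq_intros)
      have "(I has_vector_derivative f (t * sg)) (at (t * sg) within (\<lambda>sg. t * sg) ` {0..1})"
        by (rule has_vector_derivative_within_subset[OF I[OF mul[OF t sg]]]) (use mul[OF t] in auto)
      from vector_diff_chain_within[OF d this]
      show "((\<lambda>sg. I (t * sg)) has_vector_derivative t *\<^sub>R f (t * sg)) (at sg within {0..1})" by (simp add: o_def)
    qed simp
    from integral_unique[OF this] show ?thesis by simp
  qed
  moreover have "((\<lambda>t. I t - I 0) has_vector_derivative f t) (at t within {-e..e})" using I[OF t] by (auto intro!: derivative_eq_intros)
  ultimately show ?thesis
    by (subst has_vector_derivative_cong_ev[OF _ _]) (use t in \<open>auto simp: has_vector_derivative_def intro: has_derivative_transform_within[where d=1]\<close>)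
qed

lemma norm_integral_unit_interval_le:
  fixes f :: "real \<Rightarrow> 'z::banach"
  assumes "f integrable_on cbox 0 1" "\<And>x. x \<in> cbox 0 1 \<Longrightarrow> norm (f x) \<le> B"
  shows "norm (integral (cbox 0 1) f) \<le> B"
proof -
  have "0 \<le> B" using order_trans[OF norm_ge_zero assms(2)[of 0]] by simp
  from integrable_bound[OF this assms] show ?thesis by simp
qed

text \<open>Picard iteration as one contraction on bounded continuous functions of time and
  parameter together, so that the solution is jointly continuous by construction.\<close>

lemma picard_parametric:
  fixes F :: "real \<Rightarrow> 'q::euclidean_space \<Rightarrow> 'z::banach \<Rightarrow> 'z"
  assumes eps: "0 \<le> e" "0 \<le> L" "e * L \<le> 1/2"
    and Q: "compact Q" "convex Q" "Q \<noteq> {}"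
    and contF: "continuous_on ({-e..e} \<times> Q \<times> UNIV) (\<lambda>(s, q, z). F s q z)"
    and lip: "\<And>s q z z'. \<lbrakk>s \<in> {-e..e}; q \<in> Q\<rbrakk> \<Longrightarrow> norm (F s q z - F s q z') \<le> L * norm (z - z')"
    and contv: "continuous_on Q v"
  obtains Z where "continuous_on ({-e..e} \<times> Q) (\<lambda>(t, q). Z t q)" "\<And>q. q \<in> Q \<Longrightarrow> Z 0 q = v q"
    "\<And>t q. \<lbrakk>t \<in> {-e..e}; q \<in> Q\<rbrakk> \<Longrightarrow>
        ((\<lambda>t. Z t q) has_vector_derivative F t q (Z t q)) (at t within {-e..e})"
proof -
  \<comment> \<open>Clamping time by \<open>ka\<close> and projecting the parameter by
    \<open>c\<close> defines the operator on all of \<open>real \<times> 'q\<close>, where the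
    complete space of bounded continuous functions lives.\<close>
  define ka where "ka t = max (-e) (min e t)" for t :: real
  define c where "c = closest_point Q"
  have ka: "ka t \<in> {-e..e}" "\<bar>ka t\<bar> \<le> e" for t using eps by (auto simp: ka_def)
  have ka_id: "ka t = t" if "t \<in> {-e..e}" for t using that by (auto simp: ka_def)
  have cQ: "c q \<in> Q" for q using Q by (simp add: c_def closest_point_in_set compact_imp_closed)
  have c_id: "c q = q" if "q \<in> Q" for q using that by (simp add: c_def closest_point_self)
  have c_cont: "continuous_on A c" for A unfolding c_def using Q continuous_on_closest_point by (metis compact_imp_closed)
  have ka_cont: "continuous_on A ka" for A unfolding ka_def by (intro continuous_intros)
  have mul: "ka t * sg \<in> {-e..e}" if "sg \<in> {0..1}" for t sg :: real
  proof -
    have "\<bar>ka t * sg\<bar> \<le> \<bar>ka t\<bar> * 1" unfolding abs_mult using that by (intro mult_left_mono) auto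
    then show ?thesis using ka(2)[of t] by auto
  qed
  have contF': "continuous_on X (\<lambda>x. F (a x) (b x) (d x))"
    if "continuous_on X a" "continuous_on X b" "continuous_on X d" "a ` X \<subseteq> {-e..e}" "b ` X \<subseteq> Q" for X :: "'x::topological_space set" and a b d
    by (rule continuous_on_compose2[OF contF, of X "\<lambda>x. (a x, b x, d x)", simplified]) (use that in \<open>auto intro!: continuous_intros\<close>)
  define T0 :: "(real \<times> 'q \<Rightarrow> 'z) \<Rightarrow> real \<times> 'q \<Rightarrow> 'z" where
    "T0 g = (\<lambda>(t, q). v (c q) + ka t *\<^sub>R integral (cbox 0 1) (\<lambda>sg. F (ka t * sg) (c q) (g (ka t * sg, q))))" for g
  have cont_integrand: "continuous_on (UNIV \<times> cbox 0 1)
      (\<lambda>(x, sg). F (ka (fst x) * sg) (c (snd x)) (g (ka (fst x) * sg, snd x)))" if "continuous_on UNIV g" for g :: "real \<times> 'q \<Rightarrow> 'z"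
    unfolding split_beta by (intro contF' continuous_intros continuous_on_compose2[OF ka_cont] continuous_on_compose2[OF c_cont]
        continuous_on_compose2[OF that]) (use mul cQ in auto)
  have T0_cont: "continuous_on UNIV (T0 g)" if g: "continuous_on UNIV g" for g unfolding T0_def split_beta
    by (intro continuous_intros continuous_on_compose2[OF contv] continuous_on_compose2[OF ka_cont]
        continuous_on_compose2[OF c_cont] integral_continuous_on_param[where f = "\<lambda>x sg. F (ka (fst x) * sg) (c (snd x)) (g (ka (fst x) * sg, snd x))"] cont_integrand[OF g])
      (use cQ in auto)
  have intg: "(\<lambda>sg. F (ka t * sg) (c q) (g (ka t * sg, q))) integrable_on cbox 0 1" if "continuous_on UNIV g" for g :: "real \<times> 'q \<Rightarrow> 'z" and t q
    by (intro integrable_continuous contF' continuous_intros continuous_on_compose2[OF that]) (use mul cQ in auto)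
  obtain B0 where B0: "norm (F s q 0) \<le> B0" if "s \<in> {-e..e}" "q \<in> Q" for s q
  proof -
    have "compact ((\<lambda>(s, q). F s q 0) ` ({-e..e} \<times> Q))"
      unfolding split_beta by (intro compact_continuous_image contF' continuous_intros compact_Times Q compact_Icc) auto
    then obtain B where "\<forall>x\<in>(\<lambda>(s, q). F s q 0) ` ({-e..e} \<times> Q). norm x \<le> B" using compact_imp_bounded bounded_iff by metis
    then show ?thesis using that[of B] by force
  qed
  obtain Bv where Bv: "norm (v q) \<le> Bv" if "q \<in> Q" for q
  proof -
    have "compact (v ` Q)" by (intro compact_continuous_image contv Q)
    then obtain B where "\<forall>x\<in>v ` Q. norm x \<le> B" using compact_imp_bounded bounded_iff by metis
    then show ?thesis using that[of B] by force
  qed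
  have T0_bcontfun: "T0 (apply_bcontfun g) \<in> bcontfun" for g
  proof (rule bcontfun_normI)
    fix x :: "real \<times> 'q"
    obtain t q where x: "x = (t, q)" by (cases x)
    have gn: "norm (apply_bcontfun g y) \<le> norm g" for y by (rule norm_bounded)
    have "norm (F (ka t * sg) (c q) (apply_bcontfun g (ka t * sg, q))) \<le> B0 + L * norm g" if "sg \<in> cbox 0 1" for sg
    proof -
      have "norm (F (ka t * sg) (c q) (apply_bcontfun g (ka t * sg, q))) \<le> norm (F (ka t * sg) (c q) 0) +
          norm (F (ka t * sg) (c q) (apply_bcontfun g (ka t * sg, q)) - F (ka t * sg) (c q) 0)" by (rule norm_triangle_sub)
      also have "\<dots> \<le> B0 + L * norm (apply_bcontfun g (ka t * sg, q) - 0)" by (intro add_mono B0 lip mul cQ) (use that in auto)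
      also have "\<dots> \<le> B0 + L * norm g" using gn eps by (simp add: mult_left_mono)
      finally show ?thesis .
    qed
    then have "norm (integral (cbox 0 1) (\<lambda>sg. F (ka t * sg) (c q) (apply_bcontfun g (ka t * sg, q)))) \<le> B0 + L * norm g"
      by (intro norm_integral_unit_interval_le intg) simp_all
    then have "norm (ka t *\<^sub>R integral (cbox 0 1) (\<lambda>sg. F (ka t * sg) (c q) (apply_bcontfun g (ka t * sg, q)))) \<le> e * (B0 + L * norm g)"
      unfolding norm_scaleR by (intro mult_mono) (use ka(2)[of t] eps in auto)
    then show "norm (T0 (apply_bcontfun g) x) \<le> Bv + e * (B0 + L * norm g)" unfolding x T0_def prod.case by (intro order_trans[OF norm_triangle_ineq] add_mono Bv cQ)
  qed (intro T0_cont, simp)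
  define T where "T g = Bcontfun (T0 (apply_bcontfun g))" for g
  have T: "apply_bcontfun (T g) = T0 (apply_bcontfun g)" for g unfolding T_def using Bcontfun_inverse[OF T0_bcontfun] .
  have "dist (T g) (T h) \<le> 1/2 * dist g h" for g h
  proof (rule dist_bound)
    fix x :: "real \<times> 'q"
    obtain t q where x: "x = (t, q)" by (cases x)
    have gh: "norm (apply_bcontfun g y - apply_bcontfun h y) \<le> dist g h" for y using dist_bounded[of g y h] by (simp add: dist_norm)
    have cg: "continuous_on UNIV (apply_bcontfun g)" "continuous_on UNIV (apply_bcontfun h)" by simp_all
    have bd: "norm (F (ka t * sg) (c q) (apply_bcontfun g (ka t * sg, q)) - F (ka t * sg) (c q) (apply_bcontfun h (ka t * sg, q))) \<le> L * dist g h"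
      if "sg \<in> cbox 0 1" for sg by (rule order_trans[OF lip mult_left_mono[OF gh]]) (use that mul cQ eps in auto)
    have "dist (T0 (apply_bcontfun g) x) (T0 (apply_bcontfun h) x) =
        \<bar>ka t\<bar> * norm (integral (cbox 0 1) (\<lambda>sg. F (ka t * sg) (c q) (apply_bcontfun g (ka t * sg, q)) - F (ka t * sg) (c q) (apply_bcontfun h (ka t * sg, q))))"
      unfolding x T0_def prod.case dist_norm integral_diff[OF intg[OF cg(1)] intg[OF cg(2)]] by (simp add: scaleR_diff_right[symmetric])
    also have "\<dots> \<le> e * (L * dist g h)" by (intro mult_mono norm_integral_unit_interval_le integrable_diff intg cg bd ka) (use eps in auto)
    also have "\<dots> = (e * L) * dist g h" by simp
    also have "\<dots> \<le> 1/2 * dist g h" by (intro mult_right_mono eps) auto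
    finally show "dist (apply_bcontfun (T g) x) (apply_bcontfun (T h) x) \<le> 1/2 * dist g h" by (simp add: T)
  qed
  then obtain g where g: "T g = g" using banach_fix_type[of "1/2" T] by auto
  define Z where "Z t q = apply_bcontfun g (t, q)" for t q
  have Z: "Z t q = v q + t *\<^sub>R integral {0..1} (\<lambda>sg. F (t * sg) q (Z (t * sg) q))" if "t \<in> {-e..e}" "q \<in> Q" for t q
    unfolding Z_def by (subst g[symmetric], subst T) (simp add: T0_def ka_id[OF that(1)] c_id[OF that(2)])
  have Z_cont: "continuous_on UNIV (\<lambda>(t, q). Z t q)" by (simp add: Z_def)
  show ?thesis
  proof (rule that[of Z])
    show "continuous_on ({-e..e} \<times> Q) (\<lambda>(t, q). Z t q)" using Z_cont continuous_on_subset by blast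
    show "Z 0 q = v q" if "q \<in> Q" for q using Z[of 0 q] that eps by simp
    fix t q assume tq: "t \<in> {-e..e}" "q \<in> Q"
    have "continuous_on {-e..e} (\<lambda>t. F t q (Z t q))"
      by (intro contF' continuous_on_compose2[OF Z_cont, of _ "\<lambda>t. (t, q)", simplified] continuous_intros) (use tq in auto)
    from has_vector_derivative_mean_integral[OF this tq(1)]
    have "((\<lambda>t. v q + t *\<^sub>R integral {0..1} (\<lambda>sg. F (t * sg) q (Z (t * sg) q))) has_vector_derivative F t q (Z t q)) (at t within {-e..e})"
      using has_vector_derivative_add[OF has_vector_derivative_const] by fastforce
    then show "((\<lambda>t. Z t q) has_vector_derivative F t q (Z t q)) (at t within {-e..e})" by (rule has_vector_derivative_transform[OF tq(1), rotated]) (use Z tq in auto)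
  qed
qed

text \<open>Let \<open>m\<close> be a point where \<open>norm (\<Delta> t)\<close> is largest. The
  mean value inequality from \<open>t0\<close> to \<open>m\<close> bounds this maximum by half of
  itself.\<close>

lemma ode_zero_unique:
  fixes \<Delta> :: "real \<Rightarrow> 'z::real_normed_vector"
  assumes d: "\<And>t. t \<in> {a..b} \<Longrightarrow> (\<Delta> has_vector_derivative \<Delta>' t) (at t within {a..b})"
    and b: "\<And>t. t \<in> {a..b} \<Longrightarrow> norm (\<Delta>' t) \<le> L * norm (\<Delta> t)"
    and L: "0 \<le> L" "(b - a) * L \<le> 1/2" and t0: "t0 \<in> {a..b}" "\<Delta> t0 = 0" and t: "t \<in> {a..b}"
  shows "\<Delta> t = 0"
proof -
  have "continuous_on {a..b} \<Delta>" using d by (meson continuous_on_eq_continuous_within has_vector_derivative_continuous)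
  then obtain m where m: "m \<in> {a..b}" "\<And>s. s \<in> {a..b} \<Longrightarrow> norm (\<Delta> s) \<le> norm (\<Delta> m)"
    using continuous_attains_sup[OF compact_Icc _ continuous_on_norm, of a b \<Delta>] t0(1) by blast
  have "norm (\<Delta> m - \<Delta> t0) \<le> (L * norm (\<Delta> m)) * norm (m - t0)"
  proof (rule differentiable_bound[where f' = "\<lambda>t x. x *\<^sub>R \<Delta>' t" and S = "{a..b}"])
    show "(\<Delta> has_derivative (\<lambda>x. x *\<^sub>R \<Delta>' s)) (at s within {a..b})" if "s \<in> {a..b}" for s
      using d[OF that] by (simp add: has_vector_derivative_def)
    show "onorm (\<lambda>x. x *\<^sub>R \<Delta>' s) \<le> L * norm (\<Delta> m)" if "s \<in> {a..b}" for s
    proof (rule onorm_le)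
      have "norm (\<Delta>' s) \<le> L * norm (\<Delta> m)" by (rule order_trans[OF b[OF that]]) (use m(2)[OF that] L in \<open>auto intro: mult_left_mono\<close>)
      then show "norm (x *\<^sub>R \<Delta>' s) \<le> L * norm (\<Delta> m) * norm x" for x by (simp add: mult.commute[of _ "\<bar>x\<bar>"] mult_left_mono)
    qed
  qed (use m t0 in auto)
  also have "\<dots> \<le> (L * norm (\<Delta> m)) * (b - a)" by (intro mult_left_mono) (use m t0 L in auto)
  also have "\<dots> = ((b - a) * L) * norm (\<Delta> m)" by simp
  also have "\<dots> \<le> 1/2 * norm (\<Delta> m)" by (intro mult_right_mono L) auto
  finally have "norm (\<Delta> m) = 0" using t0 by simp
  then show ?thesis using m(2)[OF t] by simp
qed

text \<open>The difference of two solutions is an operator applied to the difference of the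
  parameters. The operator solves a linear equation whose coefficients are continuous in both
  parameters, also where these coincide; so it is continuous up to the diagonal, and its diagonal
  value \<open>Z\<close> is the derivative in the parameter. The applications get such coefficients
  from Hadamard's lemma where the data are not linear already.\<close>

lemma ode_parameter_derivative:
  fixes Y :: "real \<times> 'p::euclidean_space \<Rightarrow> 'z::euclidean_space"
    and A :: "real \<Rightarrow> 'p \<Rightarrow> 'p \<Rightarrow> 'z \<Rightarrow>\<^sub>L 'z"
    and C :: "real \<Rightarrow> 'p \<Rightarrow> 'p \<Rightarrow> 'p \<Rightarrow>\<^sub>L 'z"
    and e L :: real
  defines "J \<equiv> {-e..e}"
  assumes eps: "0 < e" "0 \<le> L" "e * L \<le> 1/4" and Q: "compact Q" "convex Q" "Q \<noteq> {}"
    and A: "continuous_on (J \<times> Q \<times> Q) (\<lambda>(t, p, p'). A t p p')"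
      "\<And>t p p'. \<lbrakk>t \<in> J; p \<in> Q; p' \<in> Q\<rbrakk> \<Longrightarrow> norm (A t p p') \<le> L"
    and C: "continuous_on (J \<times> Q \<times> Q) (\<lambda>(t, p, p'). C t p p')"
    and C0: "continuous_on (Q \<times> Q) (\<lambda>(p, p'). C0 p p')"
    and Y: "\<And>t p p'. \<lbrakk>t \<in> J; p \<in> Q; p' \<in> Q\<rbrakk> \<Longrightarrow> ((\<lambda>t. Y (t, p) - Y (t, p')) has_vector_derivative
        blinfun_apply (A t p p') (Y (t, p) - Y (t, p')) + blinfun_apply (C t p p') (p - p')) (at t within J)"
    and Y0: "\<And>p p'. \<lbrakk>p \<in> Q; p' \<in> Q\<rbrakk> \<Longrightarrow> Y (0, p) - Y (0, p') = blinfun_apply (C0 p p') (p - p')"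
    and Yt: "\<And>t p. \<lbrakk>t \<in> J; p \<in> Q\<rbrakk> \<Longrightarrow> ((\<lambda>t. Y (t, p)) has_vector_derivative Y' (t, p)) (at t within J)"
  obtains Z :: "real \<Rightarrow> 'p \<Rightarrow> 'p \<Rightarrow>\<^sub>L 'z" where
    "continuous_on (J \<times> Q) (\<lambda>(t, p). Z t p)" "\<And>p. p \<in> Q \<Longrightarrow> Z 0 p = C0 p p"
    "\<And>t p. \<lbrakk>t \<in> J; p \<in> Q\<rbrakk> \<Longrightarrow> ((\<lambda>t. Z t p) has_vector_derivative (A t p p o\<^sub>L Z t p) + C t p p) (at t within J)"
    "\<And>t p. \<lbrakk>t \<in> {-e<..<e}; p \<in> interior Q\<rbrakk> \<Longrightarrow>
      (Y has_derivative (\<lambda>(s, h). s *\<^sub>R Y' (t, p) + blinfun_apply (Z t p) h)) (at (t, p))"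
proof -
  have eps': "0 \<le> e" "e * L \<le> 1/2" using eps by auto
  have cA: "continuous_on X (\<lambda>x. A (a x) (b x) (d x))"
    if "continuous_on X a" "continuous_on X b" "continuous_on X d" "a ` X \<subseteq> J" "b ` X \<subseteq> Q" "d ` X \<subseteq> Q"
    for X :: "'x::topological_space set" and a b d by (rule continuous_on_compose2[OF A(1), of X "\<lambda>x. (a x, b x, d x)", simplified])
      (use that in \<open>auto intro!: continuous_intros\<close>)
  have cC: "continuous_on X (\<lambda>x. C (a x) (b x) (d x))"
    if "continuous_on X a" "continuous_on X b" "continuous_on X d" "a ` X \<subseteq> J" "b ` X \<subseteq> Q" "d ` X \<subseteq> Q"
    for X :: "'x::topological_space set" and a b d by (rule continuous_on_compose2[OF C, of X "\<lambda>x. (a x, b x, d x)", simplified])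
      (use that in \<open>auto intro!: continuous_intros\<close>)
  obtain ZZ where ZZ: "continuous_on (J \<times> (Q \<times> Q)) (\<lambda>(t, q). ZZ t q)"
    "\<And>q. q \<in> Q \<times> Q \<Longrightarrow> ZZ 0 q = (\<lambda>(p, p'). C0 p p') q"
    "\<And>t q. \<lbrakk>t \<in> J; q \<in> Q \<times> Q\<rbrakk> \<Longrightarrow> ((\<lambda>t. ZZ t q) has_vector_derivative
        ((A t (fst q) (snd q) o\<^sub>L ZZ t q) + C t (fst q) (snd q))) (at t within J)" unfolding J_def
  proof (rule picard_parametric[of e L "Q \<times> Q" "\<lambda>t q z. (A t (fst q) (snd q) o\<^sub>L z) + C t (fst q) (snd q)" "\<lambda>(p, p'). C0 p p'"])
    show "continuous_on ({-e..e} \<times> (Q \<times> Q) \<times> UNIV) (\<lambda>(s, q, z). (A s (fst q) (snd q) o\<^sub>L z) + C s (fst q) (snd q))" unfolding split_beta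
      by (intro continuous_intros cA cC bounded_bilinear.continuous_on[OF bounded_bilinear_blinfun_compose])
        (auto simp: J_def)
    show "norm ((A s (fst q) (snd q) o\<^sub>L z) + C s (fst q) (snd q) - ((A s (fst q) (snd q) o\<^sub>L z') + C s (fst q) (snd q))) \<le> L * norm (z - z')"
      if "s \<in> {-e..e}" "q \<in> Q \<times> Q" for s q z z'
    proof -
      have "(A s (fst q) (snd q) o\<^sub>L z) + C s (fst q) (snd q) - ((A s (fst q) (snd q) o\<^sub>L z') + C s (fst q) (snd q)) = A s (fst q) (snd q) o\<^sub>L (z - z')"
        by (simp add: bounded_bilinear.diff_right[OF bounded_bilinear_blinfun_compose])
      also have "norm \<dots> \<le> norm (A s (fst q) (snd q)) * norm (z - z')" by (rule norm_blinfun_compose)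
      also have "\<dots> \<le> L * norm (z - z')" by (intro mult_right_mono A) (use that in \<open>auto simp: J_def\<close>)
      finally show ?thesis .
    qed
  qed (use eps' eps Q C0 in \<open>auto intro: compact_Times convex_Times\<close>)
  \<comment> \<open>Both sides solve the same linear equation with the same value at time 0, so
    their difference \<Delta> is zero by \<open>ode_zero_unique\<close>.\<close>
  have id: "Y (t, p) - Y (t, p') = blinfun_apply (ZZ t (p, p')) (p - p')" if t: "t \<in> J" and pp: "p \<in> Q" "p' \<in> Q" for t p p'
  proof -
    define \<Delta> where "\<Delta> t = Y (t, p) - Y (t, p') - blinfun_apply (ZZ t (p, p')) (p - p')" for t
    have "\<Delta> t = 0"
    proof (rule ode_zero_unique[where a = "-e" and b = e and \<Delta>' = "\<lambda>t. blinfun_apply (A t p p') (\<Delta> t)" and L = L and ?t0.0 = 0])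
      fix s assume s: "s \<in> {-e..e}"
      have z: "((\<lambda>t. blinfun_apply (ZZ t (p, p')) (p - p')) has_vector_derivative
          blinfun_apply ((A s p p' o\<^sub>L ZZ s (p, p')) + C s p p') (p - p')) (at s within {-e..e})"
        using bounded_linear.has_vector_derivative[OF blinfun.bounded_linear_left ZZ(3)[of s "(p, p')"]] s pp by (simp add: J_def)
      have s': "s \<in> J" using s by (simp add: J_def)
      show "(\<Delta> has_vector_derivative blinfun_apply (A s p p') (\<Delta> s)) (at s within {-e..e})" unfolding \<Delta>_def
        by (rule has_vector_derivative_eq_rhs[OF has_vector_derivative_diff[OF Y[OF s' pp, unfolded J_def] z]])
          (simp add: blinfun.add_left blinfun.diff_right)
      show "norm (blinfun_apply (A s p p') (\<Delta> s)) \<le> L * norm (\<Delta> s)" using order_trans[OF norm_blinfun mult_right_mono[OF A(2)[OF s' pp] norm_ge_zero]] .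
    qed (use eps t ZZ(2)[of "(p, p')"] Y0[OF pp] pp in \<open>auto simp: J_def \<Delta>_def\<close>)
    then show ?thesis by (simp add: \<Delta>_def)
  qed
  define Z where "Z t p = ZZ t (p, p)" for t p
  have cZZ: "continuous_on (J \<times> Q \<times> Q) (\<lambda>(t, q). ZZ t q)" using ZZ(1) by simp
  have Z_cont: "continuous_on (J \<times> Q) (\<lambda>(t, p). Z t p)" unfolding Z_def split_beta
    by (rule continuous_on_compose2[OF cZZ, of _ "\<lambda>x. (fst x, snd x, snd x)", simplified]) (auto intro!: continuous_intros)
  show ?thesis
  proof (rule that[of Z])
    show "continuous_on (J \<times> Q) (\<lambda>(t, p). Z t p)" by (rule Z_cont)
    show "Z 0 p = C0 p p" if "p \<in> Q" for p using ZZ(2)[of "(p, p)"] that by (simp add: Z_def)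
    show "((\<lambda>t. Z t p) has_vector_derivative (A t p p o\<^sub>L Z t p) + C t p p) (at t within J)" if "t \<in> J" "p \<in> Q" for t p
      using ZZ(3)[of t "(p, p)"] that by (simp add: Z_def)
    fix t p assume t: "t \<in> {-e<..<e}" and p: "p \<in> interior Q"
    have conv: "convex (interior Q)" by (rule convex_interior[OF Q(2)])
    have iQ: "q \<in> interior Q \<Longrightarrow> q \<in> Q" for q using interior_subset by auto
    \<comment> \<open>The partial derivatives in \<open>t\<close> and in \<open>p\<close>, the
      latter continuous in both variables, combine to a total derivative.\<close>
    have "((\<lambda>(t, p). Y (t, p)) has_derivative (\<lambda>(tx, ty). tx *\<^sub>R Y' (t, p) + blinfun_apply (Z t p) ty)) (at (t, p) within {-e<..<e} \<times> interior Q)"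
    proof (rule has_derivative_partialsI)
      show "((\<lambda>t. Y (t, p)) has_derivative (\<lambda>tx. tx *\<^sub>R Y' (t, p))) (at t within {-e<..<e})"
        using has_vector_derivative_within_subset[OF Yt[of t p], of "{-e<..<e}"] t p iQ by (fastforce simp: has_vector_derivative_def J_def)
      show "((\<lambda>p. Y (s, p)) has_derivative blinfun_apply (Z s q)) (at q within interior Q)" if s: "s \<in> {-e<..<e}" and q: "q \<in> interior Q" for s q
      proof -
        have sJ: "s \<in> J" using s by (auto simp: J_def)
        have "((\<lambda>p. ZZ s (p, q)) \<longlongrightarrow> ZZ s (q, q)) (at q within Q)"
        proof -
          have "continuous_on Q (\<lambda>p. ZZ s (p, q))" by (rule continuous_on_compose2[OF cZZ, of _ "\<lambda>p. (s, p, q)", simplified])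
              (use sJ q iQ in \<open>auto intro!: continuous_intros\<close>)
          then show ?thesis using iQ[OF q] by (simp add: continuous_on_def)
        qed
        then have "((\<lambda>p. norm (ZZ s (p, q) - ZZ s (q, q))) \<longlongrightarrow> 0) (at q within Q)" by (simp add: tendsto_norm_zero_iff LIM_zero_iff)
        then have lim: "((\<lambda>p. norm (ZZ s (p, q) - ZZ s (q, q))) \<longlongrightarrow> 0) (at q within interior Q)" by (rule tendsto_within_subset) (rule interior_subset)
        have "((\<lambda>p. norm (Y (s, p) - Y (s, q) - blinfun_apply (Z s q) (p - q)) / norm (p - q)) \<longlongrightarrow> 0) (at q within interior Q)"
        proof (rule tendsto_sandwich[OF _ _ tendsto_const lim])
          show "\<forall>\<^sub>F p in at q within interior Q. norm (Y (s, p) - Y (s, q) - blinfun_apply (Z s q) (p - q)) / norm (p - q) \<le> norm (ZZ s (p, q) - ZZ s (q, q))"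
            unfolding eventually_at_filter
          proof (rule always_eventually, intro allI impI)
            fix p assume "p \<noteq> q" "p \<in> interior Q"
            have "Y (s, p) - Y (s, q) - blinfun_apply (Z s q) (p - q) = blinfun_apply (ZZ s (p, q) - ZZ s (q, q)) (p - q)"
              using id[OF sJ iQ iQ] \<open>p \<in> interior Q\<close> q by (simp add: Z_def blinfun.diff_left)
            then have "norm (Y (s, p) - Y (s, q) - blinfun_apply (Z s q) (p - q)) \<le> norm (ZZ s (p, q) - ZZ s (q, q)) * norm (p - q)" using norm_blinfun by metis
            then show "norm (Y (s, p) - Y (s, q) - blinfun_apply (Z s q) (p - q)) / norm (p - q) \<le> norm (ZZ s (p, q) - ZZ s (q, q))"
              using \<open>p \<noteq> q\<close> by (simp add: field_simps)
          qed
        qed simp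
        then show ?thesis by (simp add: has_derivative_iff_norm blinfun.bounded_linear_right)
      qed
      have "continuous_on ({-e<..<e} \<times> interior Q) (\<lambda>(t, p). Z t p)" by (rule continuous_on_subset[OF Z_cont]) (use iQ in \<open>auto simp: J_def\<close>)
      then show "continuous (at (t, p) within {-e<..<e} \<times> interior Q) (\<lambda>(t, p). Z t p)" using t p by (simp add: continuous_on_eq_continuous_within)
    qed (use p conv in auto)
    moreover have "at (t, p) within {-e<..<e} \<times> interior Q = at (t, p)" by (rule at_within_open) (use t p in \<open>auto intro: open_Times\<close>)
    ultimately show "(Y has_derivative (\<lambda>(s, h). s *\<^sub>R Y' (t, p) + blinfun_apply (Z t p) h)) (at (t, p))" by (simp add: split_beta)
  qed
qed

lemma blinfun_apply_integral_unit:
  assumes "f integrable_on cbox 0 (1::real)"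
  shows "blinfun_apply (integral (cbox 0 1) f) v = integral (cbox 0 1) (\<lambda>s. blinfun_apply (f s) v)"
  using integral_linear[OF assms blinfun.bounded_linear_left[of v]] by (simp add: o_def)

text \<open>\<open>H\<close> is the mean of the derivative over a segment, restricted to parameter
  directions by the inclusion \<iota>. On the diagonal the segment is a point and the mean is the
  derivative itself.\<close>

lemma partial_hadamard:
  fixes h :: "real \<times> 'p::euclidean_space \<Rightarrow> 'z::euclidean_space"
  assumes h: "C_k_on (Suc k) S h" and JQ: "J \<times> Q \<subseteq> S" and Q: "convex Q"
  obtains H :: "real \<Rightarrow> 'p \<Rightarrow> 'p \<Rightarrow> 'p \<Rightarrow>\<^sub>L 'z" where
    "continuous_on (J \<times> Q \<times> Q) (\<lambda>(t, p, p'). H t p p')"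
    "\<And>t p p'. \<lbrakk>t \<in> J; p \<in> Q; p' \<in> Q\<rbrakk> \<Longrightarrow> h (t, p) - h (t, p') = blinfun_apply (H t p p') (p - p')"
    "\<And>t p v. \<lbrakk>t \<in> J; p \<in> Q\<rbrakk> \<Longrightarrow> blinfun_apply (H t p p) v = fderiv h (t, p) (0, v)"
proof -
  define \<iota> :: "'p \<Rightarrow>\<^sub>L (real \<times> 'p)" where "\<iota> = Blinfun (\<lambda>v. (0, v))"
  have \<iota>: "blinfun_apply \<iota> v = (0, v)" for v
    unfolding \<iota>_def by (simp add: bounded_linear_Blinfun_apply bounded_linear_Pair bounded_linear_zero bounded_linear_ident)
  have inQ: "p' + sg *\<^sub>R (p - p') \<in> Q" if "p \<in> Q" "p' \<in> Q" "sg \<in> cbox 0 1" for p p' sg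
  proof -
    have "p' + sg *\<^sub>R (p - p') = (1 - sg) *\<^sub>R p' + sg *\<^sub>R p" by (simp add: algebra_simps)
    then show ?thesis using Q that by (simp add: convex_alt)
  qed
  define f where "f t p p' sg = (blinfun_deriv h (t, p' + sg *\<^sub>R (p - p')) o\<^sub>L \<iota>)" for t p p' sg
  have cf: "continuous_on (X \<times> cbox 0 1) (\<lambda>(x, sg). f (a x) (b x) (c x) sg)"
    if "continuous_on X a" "continuous_on X b" "continuous_on X c" "a ` X \<subseteq> J" "b ` X \<subseteq> Q" "c ` X \<subseteq> Q"
    for X :: "'x::topological_space set" and a b c
  proof -
    have 1: "continuous_on (X \<times> cbox 0 1) (\<lambda>x. a (fst x))" "continuous_on (X \<times> cbox 0 1) (\<lambda>x. b (fst x))"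
      "continuous_on (X \<times> cbox 0 1) (\<lambda>x. c (fst x))" using that by (auto intro!: continuous_on_compose2[OF _ continuous_on_fst[OF continuous_on_id]])
    show ?thesis unfolding split_beta f_def by (intro bounded_bilinear.continuous_on[OF bounded_bilinear_blinfun_compose] continuous_on_const
          continuous_on_compose2[OF continuous_on_blinfun_deriv[OF h]] continuous_intros 1) (use that JQ inQ in \<open>force simp: image_subset_iff subset_iff\<close>)
  qed
  define H where "H t p p' = integral (cbox 0 1) (f t p p')" for t p p'
  have int: "f t p p' integrable_on cbox 0 1" if "t \<in> J" "p \<in> Q" "p' \<in> Q" for t p p'
  proof (rule integrable_continuous)
    have "continuous_on ({0::real} \<times> cbox 0 1) (\<lambda>(x, sg). f t p p' sg)" by (rule cf) (use that in auto)
    from continuous_on_compose2[OF this, of "cbox 0 1" "\<lambda>sg. (0, sg)"]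
    have "continuous_on (cbox 0 1) (\<lambda>sg. (\<lambda>(x, sg). f t p p' sg) (0::real, sg))" by (simp add: continuous_on_Pair image_subset_iff)
    then show "continuous_on (cbox 0 1) (f t p p')" by simp
  qed
  have app: "blinfun_apply (f t p p' sg) v = fderiv h (t, p' + sg *\<^sub>R (p - p')) (0, v)" if "t \<in> J" "p \<in> Q" "p' \<in> Q" "sg \<in> cbox 0 1" for t p p' sg v
    unfolding f_def using inQ[OF that(2-4)] that JQ by (auto simp: \<iota> blinfun_deriv_apply[OF h])
  show ?thesis
  proof (rule that[of H])
    show "continuous_on (J \<times> Q \<times> Q) (\<lambda>(t, p, p'). H t p p')" unfolding H_def split_beta
      by (rule integral_continuous_on_param[OF cf]) (auto intro!: continuous_intros)
    fix t p p' assume tp: "t \<in> J" "p \<in> Q" "p' \<in> Q"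
    have "closed_segment (t, p') (t, p) \<subseteq> S"
    proof
      fix x assume "x \<in> closed_segment (t, p') (t, p)"
      then obtain u where "0 \<le> u" "u \<le> 1" "x = (t, p' + u *\<^sub>R (p - p'))" by (auto simp: closed_segment_def algebra_simps)
      then show "x \<in> S" using inQ[of p p' u] tp JQ by auto
    qed
    from segment_fundamental_theorem[OF h this]
    have "((\<lambda>s. fderiv h (t, p' + s *\<^sub>R (p - p')) (0, p - p')) has_integral h (t, p) - h (t, p')) {0..1}" by simp
    then show "h (t, p) - h (t, p') = blinfun_apply (H t p p') (p - p')" unfolding H_def blinfun_apply_integral_unit[OF int[OF tp]]
      by (subst integral_cong[OF app[OF tp]]) (auto simp: integral_unique)
  next
    fix t p v assume tp: "t \<in> J" "p \<in> Q"
    show "blinfun_apply (H t p p) v = fderiv h (t, p) (0, v)" unfolding H_def blinfun_apply_integral_unit[OF int[OF tp tp(2)]] by (subst integral_cong[OF app[OF tp tp(2)]]) auto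
  qed
qed

text \<open>The previous lemma for a map that is constant in an auxiliary time variable.\<close>

lemma hadamard_operator:
  fixes f :: "'p::euclidean_space \<Rightarrow> 'z::euclidean_space"
  assumes f: "C_k_on (Suc k) S f" "open S" and Q: "Q \<subseteq> S" "convex Q"
  obtains H :: "'p \<Rightarrow> 'p \<Rightarrow> 'p \<Rightarrow>\<^sub>L 'z" where
    "continuous_on (Q \<times> Q) (\<lambda>(p, p'). H p p')"
    "\<And>p p'. \<lbrakk>p \<in> Q; p' \<in> Q\<rbrakk> \<Longrightarrow> f p - f p' = blinfun_apply (H p p') (p - p')"
    "\<And>p v. p \<in> Q \<Longrightarrow> blinfun_apply (H p p) v = fderiv f p v"
proof -
  define h where "h = (\<lambda>x::real \<times> 'p. f (snd x))"
  have op: "open (UNIV \<times> S)" using f by (simp add: open_Times)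
  have hk: "C_k_on (Suc k) (UNIV \<times> S) h" unfolding h_def by (rule C_k_on_compose[OF op f(2) C_k_on_bounded_linear[OF op bounded_linear_snd] f(1)]) auto
  have 0: "{0} \<times> Q \<subseteq> UNIV \<times> S" using Q by auto
  obtain H where *: "continuous_on ({0} \<times> Q \<times> Q) (\<lambda>(t, p, p'). H t p p')"
    "\<And>t p p'. \<lbrakk>t \<in> {0}; p \<in> Q; p' \<in> Q\<rbrakk> \<Longrightarrow> h (t, p) - h (t, p') = blinfun_apply (H t p p') (p - p')"
    "\<And>t p v. \<lbrakk>t \<in> {0}; p \<in> Q\<rbrakk> \<Longrightarrow> blinfun_apply (H t p p) v = fderiv h (t, p) (0, v)" using partial_hadamard[OF hk 0 Q(2)] by blast
  note H = *(1) *(2)[OF singletonI] *(3)[OF singletonI]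
  show ?thesis
  proof (rule that[of "H 0"])
    show "continuous_on (Q \<times> Q) (\<lambda>(p, p'). H 0 p p')" using continuous_on_compose2[OF H(1), of "Q \<times> Q" "\<lambda>x. (0, fst x, snd x)"]
      by (force simp: split_beta intro!: continuous_intros)
    show "f p - f p' = blinfun_apply (H 0 p p') (p - p')" if "p \<in> Q" "p' \<in> Q" for p p' using H(2)[OF that] by (simp add: h_def)
    show "blinfun_apply (H 0 p p) v = fderiv f p v" if "p \<in> Q" for p v
    proof -
      have "(h has_derivative (\<lambda>x. fderiv f p (snd x))) (at (0, p))" unfolding h_def
        using has_derivative_compose[where f = snd and g = f, OF bounded_linear_imp_has_derivative[OF bounded_linear_snd]]
          C_k_on_has_derivative[OF f(1), of p] that Q by fastforce
      from frechet_derivative_at[OF this] show ?thesis using H(3)[OF that] by (metis snd_conv)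
    qed
  qed
qed

text \<open>The directional derivatives of a solution with respect to the parameter solve the
  linearised equation; the hypothesis \<open>loc\<close> is what \<open>ode_parameter_derivative\<close> provides locally.\<close>

lemma ode_directional_derivatives:
  fixes Y :: "real \<times> 'p::euclidean_space \<Rightarrow> 'z::euclidean_space"
  assumes z: "\<And>v x. z v x = fderiv Y x (0, v)"
    and P: "open P"
    and loc: "\<And>t0 p0. \<lbrakk>t0 \<in> {-e<..<e}; p0 \<in> P\<rbrakk> \<Longrightarrow> \<exists>d Q Z. \<bar>t0\<bar> < d \<and> p0 \<in> interior Q \<and>
      continuous_on ({-d..d} \<times> Q) (\<lambda>(t, p). Z t p) \<and> (\<forall>p\<in>Q. \<forall>v. blinfun_apply (Z 0 p) v = y0' p v) \<and>
      (\<forall>t\<in>{-d..d}. \<forall>p\<in>Q. \<exists>W. ((\<lambda>t. Z t p) has_vector_derivative W) (at t within {-d..d}) \<and>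
          (\<forall>v. blinfun_apply W v = A (t, p) (blinfun_apply (Z t p) v) + B v (t, p))) \<and>
      (\<forall>t\<in>{-d<..<d}. \<forall>p\<in>interior Q. (Y has_derivative (\<lambda>(s, h). s *\<^sub>R Y' (t, p) + blinfun_apply (Z t p) h)) (at (t, p)))"
  shows "\<And>t p. \<lbrakk>t \<in> {-e<..<e}; p \<in> P\<rbrakk> \<Longrightarrow> (Y has_derivative (\<lambda>x. fst x *\<^sub>R Y' (t, p) + z (snd x) (t, p))) (at (t, p))"
    and "continuous_on ({-e<..<e} \<times> P) (z v)"
    and "\<And>t p. \<lbrakk>t \<in> {-e<..<e}; p \<in> P\<rbrakk> \<Longrightarrow>
      ((\<lambda>t. z v (t, p)) has_vector_derivative A (t, p) (z v (t, p)) + B v (t, p)) (at t)"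
    and "\<And>p. \<lbrakk>0 < e; p \<in> P\<rbrakk> \<Longrightarrow> z v (0, p) = y0' p v"
proof -
  have main: "(Y has_derivative (\<lambda>x. fst x *\<^sub>R Y' (t0, p0) + z (snd x) (t0, p0))) (at (t0, p0)) \<and>
      isCont (z v) (t0, p0) \<and>
      ((\<lambda>t. z v (t, p0)) has_vector_derivative A (t0, p0) (z v (t0, p0)) + B v (t0, p0)) (at t0) \<and>
      z v (0, p0) = y0' p0 v" if t0: "t0 \<in> {-e<..<e}" and p0: "p0 \<in> P" for t0 p0 v
  proof -
    obtain d Q Z where *: "\<bar>t0\<bar> < d" "p0 \<in> interior Q"
      "continuous_on ({-d..d} \<times> Q) (\<lambda>(t, p). Z t p)" "\<forall>p\<in>Q. \<forall>v. blinfun_apply (Z 0 p) v = y0' p v"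
      "\<forall>t\<in>{-d..d}. \<forall>p\<in>Q. \<exists>W. ((\<lambda>t. Z t p) has_vector_derivative W) (at t within {-d..d}) \<and>
          (\<forall>v. blinfun_apply W v = A (t, p) (blinfun_apply (Z t p) v) + B v (t, p))"
      and der: "\<And>t p. \<lbrakk>t \<in> {-d<..<d}; p \<in> interior Q\<rbrakk> \<Longrightarrow>
         (Y has_derivative (\<lambda>(s, h). s *\<^sub>R Y' (t, p) + blinfun_apply (Z t p) h)) (at (t, p))" using loc[OF t0 p0] by blast
    have iQ: "q \<in> interior Q \<Longrightarrow> q \<in> Q" for q using interior_subset by auto
    have zZ: "z v (t, p) = blinfun_apply (Z t p) v" if "t \<in> {-d<..<d}" "p \<in> interior Q" for t p v
      unfolding z using frechet_derivative_at[OF der[OF that]] by (metis (no_types, lifting) case_prod_conv scaleR_zero_left add_0)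
    have t0': "t0 \<in> {-d<..<d}" using *(1) by auto
    have 1: "(Y has_derivative (\<lambda>x. fst x *\<^sub>R Y' (t0, p0) + z (snd x) (t0, p0))) (at (t0, p0))"
      using der[OF t0' *(2)] by (simp add: case_prod_beta' zZ[OF t0' *(2)])
    have op: "open ({-d<..<d} \<times> interior Q)" by (intro open_Times) auto
    have "continuous_on ({-d<..<d} \<times> interior Q) (\<lambda>x. blinfun_apply ((\<lambda>(t, p). Z t p) x) v)"
      by (intro continuous_intros continuous_on_subset[OF *(3)]) (use iQ in auto)
    then have "continuous_on ({-d<..<d} \<times> interior Q) (z v)" by (rule continuous_on_eq) (auto simp: zZ)
    then have 2: "isCont (z v) (t0, p0)" using op t0' *(2) by (simp add: continuous_on_eq_continuous_at)
    have "t0 \<in> {-d..d}" using t0' by auto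
    then obtain W where W: "((\<lambda>t. Z t p0) has_vector_derivative W) (at t0 within {-d..d})"
      "\<And>v. blinfun_apply W v = A (t0, p0) (blinfun_apply (Z t0 p0) v) + B v (t0, p0)" using *(5) iQ[OF *(2)] by blast
    have "((\<lambda>t. Z t p0) has_vector_derivative W) (at t0)" using W(1) t0' at_within_interior[of t0 "{-d..d}"] by simp
    then have "((\<lambda>t. blinfun_apply (Z t p0) v) has_vector_derivative blinfun_apply W v) (at t0)"
      by (rule bounded_linear.has_vector_derivative[OF blinfun.bounded_linear_left])
    then have 3: "((\<lambda>t. z v (t, p0)) has_vector_derivative A (t0, p0) (z v (t0, p0)) + B v (t0, p0)) (at t0)" unfolding W(2) zZ[OF t0' *(2)]
      by (rule has_vector_derivative_transform_within_open[OF _ _ t0']) (use *(2) zZ in auto)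
    have "z v (0, p0) = y0' p0 v" using *(1,2,4) iQ zZ[of 0 p0 v] by auto
    with 1 2 3 show ?thesis by blast
  qed
  show "continuous_on ({-e<..<e} \<times> P) (z v)" using main by (auto intro!: continuous_at_imp_continuous_on)
  show "(Y has_derivative (\<lambda>x. fst x *\<^sub>R Y' (t, p) + z (snd x) (t, p))) (at (t, p))"
    "((\<lambda>t. z v (t, p)) has_vector_derivative A (t, p) (z v (t, p)) + B v (t, p)) (at t)" if "t \<in> {-e<..<e}" "p \<in> P" for t p using main[OF that] by blast+
  show "z v (0, p) = y0' p v" if "0 < e" "p \<in> P" for p using main[of 0 p] that by auto
qed

text \<open>Each directional derivative \<open>z v\<close> of the solution solves an equation with
  the same linear part and an inhomogeneity \<open>B v\<close> built from the solution and
  derivatives of the data. So the induction hypothesis for \<open>k\<close> applies to these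
  derivatives, which gives class \<open>Suc k\<close> for the solution.\<close>

lemma linear_ode_C_k:
  fixes Y :: "real \<times> 'p::euclidean_space \<Rightarrow> 'z::euclidean_space"
    and A :: "real \<times> 'p \<Rightarrow> 'z \<Rightarrow> 'z" and e L :: real
  defines "S P \<equiv> {-e<..<e} \<times> P"
  assumes eps: "0 < e" "0 \<le> L" "e * L \<le> 1/4" and P: "open P"
    and lin: "\<And>x. x \<in> S P \<Longrightarrow> linear (A x)" "\<And>x z. x \<in> S P \<Longrightarrow> norm (A x z) \<le> L * norm z"
    and A: "\<And>b. C_k_on k (S P) (\<lambda>x. A x b)" and g: "C_k_on k (S P) g" and y0: "C_k_on k P y0"
    and contY: "continuous_on (S P) Y"
    and ode: "\<And>t p. \<lbrakk>t \<in> {-e<..<e}; p \<in> P\<rbrakk> \<Longrightarrow>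
      ((\<lambda>t. Y (t, p)) has_vector_derivative A (t, p) (Y (t, p)) + g (t, p)) (at t)"
    and init: "\<And>p. p \<in> P \<Longrightarrow> Y (0, p) = y0 p"
  shows "C_k_on k (S P) Y" using A g y0 contY ode init
proof (induction k arbitrary: g y0 Y)
  case 0
  then show ?case by simp
next
  case (Suc k)
  have opS: "open (S P)" unfolding S_def using P by (simp add: open_Times)
  have Ak: "C_k_on k (S P) (\<lambda>x. A x b)" for b by (rule C_k_on_Suc_imp[OF Suc.prems(1)])
  have Yk: "C_k_on k (S P) Y" by (rule Suc.IH[OF Ak C_k_on_Suc_imp[OF Suc.prems(2)] C_k_on_Suc_imp[OF Suc.prems(3)] Suc.prems(4-6)])
  \<comment> \<open>The terms that arise when the equation for \<open>Y\<close> is differentiated in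
    direction \<open>(0, v)\<close>, apart from \<open>A\<close> applied to the derivative of
    \<open>Y\<close>.\<close>
  define B where "B v x = (\<Sum>b\<in>Basis. (Y x \<bullet> b) *\<^sub>R fderiv (\<lambda>x. A x b) x (0, v)) + fderiv g x (0, v)" for v x
  define z where "z v x = fderiv Y x (0, v)" for v x
  have Bk: "C_k_on k (S P) (B v)" for v
  proof -
    have "C_k_on k (S P) (\<lambda>x. fderiv (\<lambda>x. A x b) x (0, v))" for b using Suc.prems(1) by simp
    moreover have "C_k_on k (S P) (\<lambda>x. fderiv g x (0, v))" using Suc.prems(2) by simp
    ultimately show ?thesis unfolding B_def by (intro C_k_on_add C_k_on_sum C_k_on_bilinear[OF _ bounded_bilinear_scaleR] opS
          C_k_on_linear_comp[OF opS bounded_linear_inner_left] Yk)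
  qed
  have loc: "\<exists>d Q Z. \<bar>t0\<bar> < d \<and> p0 \<in> interior Q \<and>
      continuous_on ({-d..d} \<times> Q) (\<lambda>(t, p). Z t p) \<and> (\<forall>p\<in>Q. \<forall>v. blinfun_apply (Z 0 p) v = fderiv y0 p v) \<and>
      (\<forall>t\<in>{-d..d}. \<forall>p\<in>Q. \<exists>W. ((\<lambda>t. Z t p) has_vector_derivative W) (at t within {-d..d}) \<and>
          (\<forall>v. blinfun_apply W v = A (t, p) (blinfun_apply (Z t p) v) + B v (t, p))) \<and>
      (\<forall>t\<in>{-d<..<d}. \<forall>p\<in>interior Q. (Y has_derivative (\<lambda>(s, h). s *\<^sub>R (A (t, p) (Y (t, p)) + g (t, p)) + blinfun_apply (Z t p) h)) (at (t, p)))"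
    if t0: "t0 \<in> {-e<..<e}" and p0: "p0 \<in> P" for t0 p0
  proof -
    \<comment> \<open>Strictly between the absolute value of \<open>t0\<close> and \<open>e\<close>,
      so that a compact time interval around \<open>t0\<close> lies inside the domain.\<close>
    define d where "d = (\<bar>t0\<bar> + e) / 2"
    have d: "\<bar>t0\<bar> < d" "d < e" "0 < d" using t0 eps by (auto simp: d_def)
    have dL: "d * L \<le> 1/4" using d eps mult_right_mono[of d e L] by simp
    obtain r where r: "0 < r" "cball p0 r \<subseteq> P" using P p0 open_contains_cball by blast
    define Q where "Q = cball p0 r"
    have Q: "compact Q" "convex Q" "Q \<noteq> {}" "Q \<subseteq> P" "p0 \<in> interior Q" using r by (auto simp: Q_def interior_cball)
    have JQ: "{-d..d} \<times> Q \<subseteq> S P" using d Q by (auto simp: S_def)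
    have "\<exists>H :: real \<Rightarrow> 'p \<Rightarrow> 'p \<Rightarrow> 'p \<Rightarrow>\<^sub>L 'z. continuous_on ({-d..d} \<times> Q \<times> Q) (\<lambda>(t, p, p'). H t p p') \<and>
        (\<forall>t\<in>{-d..d}. \<forall>p\<in>Q. \<forall>p'\<in>Q. A (t, p) b - A (t, p') b = blinfun_apply (H t p p') (p - p')) \<and>
        (\<forall>t\<in>{-d..d}. \<forall>p\<in>Q. \<forall>v. blinfun_apply (H t p p) v = fderiv (\<lambda>x. A x b) (t, p) (0, v))" for b
    proof -
      obtain H :: "real \<Rightarrow> 'p \<Rightarrow> 'p \<Rightarrow> 'p \<Rightarrow>\<^sub>L 'z" where H: "continuous_on ({-d..d} \<times> Q \<times> Q) (\<lambda>(t, p, p'). H t p p')"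
        "\<And>t p p'. t \<in> {-d..d} \<Longrightarrow> p \<in> Q \<Longrightarrow> p' \<in> Q \<Longrightarrow> A (t, p) b - A (t, p') b = blinfun_apply (H t p p') (p - p')"
        "\<And>t p v. t \<in> {-d..d} \<Longrightarrow> p \<in> Q \<Longrightarrow> blinfun_apply (H t p p) v = fderiv (\<lambda>x. A x b) (t, p) (0, v)"
        by (rule partial_hadamard[OF Suc.prems(1)[of b] JQ Q(2)], rule that)
      show ?thesis by (intro exI[of _ H] conjI ballI allI H)
    qed
    then have "\<forall>b. \<exists>H :: real \<Rightarrow> 'p \<Rightarrow> 'p \<Rightarrow> 'p \<Rightarrow>\<^sub>L 'z. continuous_on ({-d..d} \<times> Q \<times> Q) (\<lambda>(t, p, p'). H t p p') \<and>
        (\<forall>t\<in>{-d..d}. \<forall>p\<in>Q. \<forall>p'\<in>Q. A (t, p) b - A (t, p') b = blinfun_apply (H t p p') (p - p')) \<and>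
        (\<forall>t\<in>{-d..d}. \<forall>p\<in>Q. \<forall>v. blinfun_apply (H t p p) v = fderiv (\<lambda>x. A x b) (t, p) (0, v))" by (rule allI)
    from choice[OF this] obtain HA where
      "\<forall>b. continuous_on ({-d..d} \<times> Q \<times> Q) (\<lambda>(t, p, p'). HA b t p p' :: 'p \<Rightarrow>\<^sub>L 'z) \<and>
        (\<forall>t\<in>{-d..d}. \<forall>p\<in>Q. \<forall>p'\<in>Q. A (t, p) b - A (t, p') b = blinfun_apply (HA b t p p') (p - p')) \<and>
        (\<forall>t\<in>{-d..d}. \<forall>p\<in>Q. \<forall>v. blinfun_apply (HA b t p p) v = fderiv (\<lambda>x. A x b) (t, p) (0, v))" by (rule exE)
    then have HA: "\<And>b. continuous_on ({-d..d} \<times> Q \<times> Q) (\<lambda>(t, p, p'). HA b t p p' :: 'p \<Rightarrow>\<^sub>L 'z)"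
      "\<And>b t p p'. t \<in> {-d..d} \<Longrightarrow> p \<in> Q \<Longrightarrow> p' \<in> Q \<Longrightarrow> A (t, p) b - A (t, p') b = blinfun_apply (HA b t p p') (p - p')"
      "\<And>b t p v. t \<in> {-d..d} \<Longrightarrow> p \<in> Q \<Longrightarrow> blinfun_apply (HA b t p p) v = fderiv (\<lambda>x. A x b) (t, p) (0, v)" by blast+
    obtain Hg :: "real \<Rightarrow> 'p \<Rightarrow> 'p \<Rightarrow> 'p \<Rightarrow>\<^sub>L 'z" where Hg: "continuous_on ({-d..d} \<times> Q \<times> Q) (\<lambda>(t, p, p'). Hg t p p')"
      "\<And>t p p'. t \<in> {-d..d} \<Longrightarrow> p \<in> Q \<Longrightarrow> p' \<in> Q \<Longrightarrow> g (t, p) - g (t, p') = blinfun_apply (Hg t p p') (p - p')"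
      "\<And>t p v. t \<in> {-d..d} \<Longrightarrow> p \<in> Q \<Longrightarrow> blinfun_apply (Hg t p p) v = fderiv g (t, p) (0, v)"
      by (rule partial_hadamard[OF Suc.prems(2) JQ Q(2)], rule that)
    obtain C0 :: "'p \<Rightarrow> 'p \<Rightarrow> 'p \<Rightarrow>\<^sub>L 'z" where C0: "continuous_on (Q \<times> Q) (\<lambda>(p, p'). C0 p p')"
      "\<And>p p'. p \<in> Q \<Longrightarrow> p' \<in> Q \<Longrightarrow> y0 p - y0 p' = blinfun_apply (C0 p p') (p - p')"
      "\<And>p v. p \<in> Q \<Longrightarrow> blinfun_apply (C0 p p) v = fderiv y0 p v" by (rule hadamard_operator[OF Suc.prems(3) P Q(4,2)], rule that)
    define AA where "AA t p p' = Blinfun (A (t, p))" for t and p p' :: 'p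
    have AA: "blinfun_apply (AA t p p') y = A (t, p) y" if "t \<in> {-d..d}" "p \<in> Q" for t p p' y
    proof -
      have "(t, p) \<in> S P" using JQ that by blast
      then have "bounded_linear (A (t, p))" using lin(1) by (simp add: linear_conv_bounded_linear)
      then show ?thesis by (simp add: AA_def bounded_linear_Blinfun_apply)
    qed
    define C where "C t p p' = (\<Sum>b\<in>Basis. (Y (t, p') \<bullet> b) *\<^sub>R HA b t p p') + Hg t p p'" for t p p'
    have linA: "A x y = (\<Sum>b\<in>Basis. (y \<bullet> b) *\<^sub>R A x b)" if "x \<in> S P" for x y by (subst (1) euclidean_representation[symmetric, of y])
        (simp only: linear_sum[OF lin(1)[OF that]] linear_cmul[OF lin(1)[OF that]])
    have odeY: "((\<lambda>t. Y (t, p)) has_vector_derivative A (t, p) (Y (t, p)) + g (t, p)) (at t within {-d..d})" if "t \<in> {-d..d}" "p \<in> Q" for t p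
      by (rule has_vector_derivative_at_within[OF Suc.prems(5)]) (use that d Q in auto)
    have contYc: "continuous_on ({-d..d} \<times> Q \<times> Q) (\<lambda>(t, p, p'). Y (t, p'))"
      unfolding split_beta by (rule continuous_on_compose2[OF Suc.prems(4)]) (use JQ in \<open>auto intro!: continuous_intros\<close>)
    obtain Z where Z: "continuous_on ({-d..d} \<times> Q) (\<lambda>(t, p). Z t p)" "\<And>p. p \<in> Q \<Longrightarrow> Z 0 p = C0 p p"
      "\<And>t p. \<lbrakk>t \<in> {-d..d}; p \<in> Q\<rbrakk> \<Longrightarrow> ((\<lambda>t. Z t p) has_vector_derivative (AA t p p o\<^sub>L Z t p) + C t p p) (at t within {-d..d})"
      "\<And>t p. \<lbrakk>t \<in> {-d<..<d}; p \<in> interior Q\<rbrakk> \<Longrightarrow>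
        (Y has_derivative (\<lambda>(s, h). s *\<^sub>R (\<lambda>x. A x (Y x) + g x) (t, p) + blinfun_apply (Z t p) h)) (at (t, p))"
    proof (rule ode_parameter_derivative[OF d(3) eps(2) dL Q(1-3), of AA C C0 Y "\<lambda>x. A x (Y x) + g x"])
      show "continuous_on ({-d..d} \<times> Q \<times> Q) (\<lambda>(t, p, p'). AA t p p')"
      proof (rule continuous_on_blinfun_componentwise)
        fix i :: 'z
        have "continuous_on ({-d..d} \<times> Q \<times> Q) (\<lambda>x. A (fst x, fst (snd x)) i)"
          by (rule continuous_on_compose2[OF C_k_on_imp_continuous_on[OF Ak]]) (use JQ in \<open>auto intro!: continuous_intros\<close>)
        then show "continuous_on ({-d..d} \<times> Q \<times> Q) (\<lambda>x. blinfun_apply (case x of (t, p, p') \<Rightarrow> AA t p p') i)"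
          by (rule continuous_on_eq) (auto simp: AA)
      qed
      show "norm (AA t p p') \<le> L" if "t \<in> {-d..d}" "p \<in> Q" "p' \<in> Q" for t p p'
      proof (rule norm_blinfun_bound[OF eps(2)])
        have "(t, p) \<in> S P" using JQ that by blast
        then show "norm (blinfun_apply (AA t p p') y) \<le> L * norm y" for y using lin(2) that by (simp add: AA)
      qed
      show "continuous_on ({-d..d} \<times> Q \<times> Q) (\<lambda>(t, p, p'). C t p p')"
        unfolding C_def using HA(1) Hg(1) contYc unfolding split_beta by (intro continuous_intros)
      show "((\<lambda>t. Y (t, p) - Y (t, p')) has_vector_derivative
          blinfun_apply (AA t p p') (Y (t, p) - Y (t, p')) + blinfun_apply (C t p p') (p - p')) (at t within {-d..d})"
        if t: "t \<in> {-d..d}" and p: "p \<in> Q" and p': "p' \<in> Q" for t p p'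
      proof (rule has_vector_derivative_eq_rhs[OF has_vector_derivative_diff[OF odeY[OF t p] odeY[OF t p']]])
        have tp: "(t, p) \<in> S P" "(t, p') \<in> S P" using JQ t p p' by auto
        have "A (t, p) (Y (t, p')) - A (t, p') (Y (t, p')) = (\<Sum>b\<in>Basis. (Y (t, p') \<bullet> b) *\<^sub>R (A (t, p) b - A (t, p') b))"
          unfolding linA[OF tp(1), of "Y (t, p')"] linA[OF tp(2), of "Y (t, p')"] by (simp add: sum_subtractf scaleR_diff_right)
        also have "\<dots> = blinfun_apply (\<Sum>b\<in>Basis. (Y (t, p') \<bullet> b) *\<^sub>R HA b t p p') (p - p')"
          by (simp add: HA(2)[OF t p p'] blinfun.sum_left blinfun.scaleR_left)
        finally show "A (t, p) (Y (t, p)) + g (t, p) - (A (t, p') (Y (t, p')) + g (t, p')) =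
            blinfun_apply (AA t p p') (Y (t, p) - Y (t, p')) + blinfun_apply (C t p p') (p - p')"
          using Hg(2)[OF t p p'] linear_diff[OF lin(1)[OF tp(1)], of "Y (t, p)" "Y (t, p')"] by (simp add: AA[OF t p] C_def blinfun.add_left algebra_simps)
      qed
      show "Y (0, p) - Y (0, p') = blinfun_apply (C0 p p') (p - p')" if "p \<in> Q" "p' \<in> Q" for p p' using that Q C0(2) Suc.prems(6) by (simp add: subset_iff)
    qed (use C0 odeY in auto)
    show ?thesis
    proof (intro exI conjI ballI)
      show "\<bar>t0\<bar> < d" "p0 \<in> interior Q" using d Q by auto
      show "continuous_on ({-d..d} \<times> Q) (\<lambda>(t, p). Z t p)" by (rule Z)
      show "\<forall>v. blinfun_apply (Z 0 p) v = fderiv y0 p v" if "p \<in> Q" for p using Z(2)[OF that] C0(3)[OF that] by simp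
      show "((\<lambda>t. Z t p) has_vector_derivative (AA t p p o\<^sub>L Z t p) + C t p p) (at t within {-d..d})"
        if "t \<in> {-d..d}" "p \<in> Q" for t p by (rule Z(3)[OF that])
      show "\<forall>v. blinfun_apply ((AA t p p o\<^sub>L Z t p) + C t p p) v = A (t, p) (blinfun_apply (Z t p) v) + B v (t, p)" if "t \<in> {-d..d}" "p \<in> Q" for t p
        using that by (simp add: AA C_def B_def blinfun.add_left blinfun.sum_left blinfun.scaleR_left HA(3) Hg(3))
      show "(Y has_derivative (\<lambda>(s, h). s *\<^sub>R (A (t, p) (Y (t, p)) + g (t, p)) + blinfun_apply (Z t p) h)) (at (t, p))"
        if "t \<in> {-d<..<d}" "p \<in> interior Q" for t p using Z(4)[OF that] by simp
    qed
  qed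
  note dir = ode_directional_derivatives[where Y = Y and Y' = "\<lambda>x. A x (Y x) + g x" and y0' = "\<lambda>p. fderiv y0 p"
      and A = A and B = B, OF z_def P loc]
  have zk: "C_k_on k (S P) (z v)" for v
  proof (rule Suc.IH[OF Ak Bk])
    show "C_k_on k P (\<lambda>p. fderiv y0 p v)" using Suc.prems(3) by simp
    show "continuous_on (S P) (z v)" using dir(2) unfolding S_def .
    show "((\<lambda>t. z v (t, p)) has_vector_derivative A (t, p) (z v (t, p)) + B v (t, p)) (at t)" if "t \<in> {-e<..<e}" "p \<in> P" for t p using dir(3) that by auto
    show "z v (0, p) = fderiv y0 p v" if "p \<in> P" for p using dir(4) that eps by auto
  qed
  show ?case
  proof (rule C_k_on_SucI[OF opS, where f' = "\<lambda>x w. fst w *\<^sub>R (A x (Y x) + g x) + z (snd w) x"])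
    show "(Y has_derivative (\<lambda>w. fst w *\<^sub>R (A x (Y x) + g x) + z (snd w) x)) (at x)" if "x \<in> S P" for x
      using dir(1)[where t = "fst x" and p = "snd x"] that by (auto simp: S_def)
    show "C_k_on k (S P) (\<lambda>x. fst v *\<^sub>R (A x (Y x) + g x) + z (snd v) x)" for v by (rule C_k_on_add[OF opS C_k_on_linear_comp[OF opS bounded_linear_scaleR_right
            C_k_on_add[OF opS C_k_on_linear_family[OF opS lin(1) Ak Yk] C_k_on_Suc_imp[OF Suc.prems(2)]]] zk])
  qed
qed

text \<open>Composing the field with the nearest-point projection onto a ball \<open>K\<close> makes
  it globally Lipschitz; for short times the solutions do not leave \<open>K\<close>, so the
  projection does not affect them. Smoothness is a bootstrap: if \<open>Y\<close> is of class k, the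
  linearised equation along \<open>Y\<close> has coefficients of class k, and by
  \<open>linear_ode_C_k\<close> the first derivatives of \<open>Y\<close> are of class k
  too.\<close>

theorem local_flow:
  fixes f :: "'s::euclidean_space \<Rightarrow> 's"
  assumes f: "C_inf_on Om f" and p0: "p0 \<in> Om"
  obtains d ee Y where "0 < d" "0 < ee" "\<And>p. p \<in> ball p0 d \<Longrightarrow> Y (0, p) = p"
    "\<And>t p. \<lbrakk>t \<in> {-ee<..<ee}; p \<in> ball p0 d\<rbrakk> \<Longrightarrow> Y (t, p) \<in> Om"
    "\<And>t p. \<lbrakk>t \<in> {-ee<..<ee}; p \<in> ball p0 d\<rbrakk> \<Longrightarrow> ((\<lambda>t. Y (t, p)) has_vector_derivative f (Y (t, p))) (at t)"
    "C_inf_on ({-ee<..<ee} \<times> ball p0 d) Y"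
proof -
  have op: "open Om" using f C_inf_on_open by blast
  have f1: "C_k_on (Suc 0) Om f" using f unfolding C_inf_on_def by blast
  obtain r0 where r0: "0 < r0" "cball p0 r0 \<subseteq> Om" using op p0 open_contains_cball by blast
  define r where "r = r0 / 2"
  define K where "K = cball p0 (2 * r)"
  define Q where "Q = cball p0 r"
  have r: "0 < r" using r0 by (simp add: r_def)
  have K: "compact K" "convex K" "K \<subseteq> Om" "K \<noteq> {}" "Q \<subseteq> K" using r r0 by (auto simp: K_def Q_def r_def)
  have Q: "compact Q" "convex Q" "Q \<noteq> {}" "interior Q = ball p0 r" using r by (auto simp: Q_def interior_cball)
  obtain H :: "'s \<Rightarrow> 's \<Rightarrow> 's \<Rightarrow>\<^sub>L 's" where H: "continuous_on (K \<times> K) (\<lambda>(p, p'). H p p')"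
    "\<And>p p'. p \<in> K \<Longrightarrow> p' \<in> K \<Longrightarrow> f p - f p' = blinfun_apply (H p p') (p - p')"
    "\<And>p v. p \<in> K \<Longrightarrow> blinfun_apply (H p p) v = fderiv f p v" by (rule hadamard_operator[OF f1 op K(3,2)], rule that)
  have "compact ((\<lambda>(p, p'). H p p') ` (K \<times> K))" by (intro compact_continuous_image H compact_Times K)
  then obtain L0 where "\<forall>x\<in>(\<lambda>(p, p'). H p p') ` (K \<times> K). norm x \<le> L0" using compact_imp_bounded bounded_iff by metis
  then have L0: "norm (H p p') \<le> L0" if "p \<in> K" "p' \<in> K" for p p' using that by force
  define L where "L = \<bar>L0\<bar> + 1"
  have L: "0 < L" "norm (H p p') \<le> L" if "p \<in> K" "p' \<in> K" for p p' using L0[OF that] by (auto simp: L_def)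
  have Lpos: "0 < L" by (simp add: L_def)
  have fc: "continuous_on K f" using C_inf_on_continuous[OF f] K continuous_on_subset by blast
  then have "compact (f ` K)" by (intro compact_continuous_image K)
  then obtain B0 where "\<forall>x\<in>f ` K. norm x \<le> B0" using compact_imp_bounded bounded_iff by metis
  then have B0: "norm (f p) \<le> B0" if "p \<in> K" for p using that by force
  define B where "B = \<bar>B0\<bar> + 1"
  have B: "0 < B" "\<And>p. p \<in> K \<Longrightarrow> norm (f p) \<le> B" using B0 by (auto simp: B_def intro: order_trans)
     (smt (verit) B0)
  \<comment> \<open>The first bound makes \<open>ee * L\<close> at most 1/4, as the iteration and
    its linearisation require; the second keeps a solution within distance \<open>r\<close> of its
    initial point, hence in \<open>K\<close>.\<close>
  define ee where "ee = min (1 / (4 * L)) (r / B)"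
  have eps: "0 < ee" using Lpos B r by (simp add: ee_def)
  have "ee * L \<le> 1 / (4 * L) * L" using Lpos by (intro mult_right_mono) (auto simp: ee_def)
  then have epsL: "ee * L \<le> 1/4" using Lpos by simp
  have "ee * B \<le> r / B * B" using B(1) by (intro mult_right_mono) (auto simp: ee_def)
  then have epsB: "ee * B \<le> r" using B(1) by simp
  define cp where "cp = closest_point K"
  have cpK: "cp x \<in> K" for x using K by (simp add: cp_def closest_point_in_set compact_imp_closed)
  have cp_cont: "continuous_on UNIV cp" unfolding cp_def using K by (intro continuous_on_closest_point) (auto simp: compact_imp_closed)
  obtain Z where Z: "continuous_on ({-ee..ee} \<times> Q) (\<lambda>(t, q). Z t q)" "\<And>q. q \<in> Q \<Longrightarrow> Z 0 q = q"
    "\<And>t q. \<lbrakk>t \<in> {-ee..ee}; q \<in> Q\<rbrakk> \<Longrightarrow> ((\<lambda>t. Z t q) has_vector_derivative f (cp (Z t q))) (at t within {-ee..ee})"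
  proof (rule picard_parametric[of ee L Q "\<lambda>s q z. f (cp z)" "\<lambda>q. q"])
    show "continuous_on ({-ee..ee} \<times> Q \<times> UNIV) (\<lambda>(s, q, z). f (cp z))" unfolding split_beta
      by (rule continuous_on_compose2[OF fc], rule continuous_on_compose2[OF cp_cont]) (auto intro!: continuous_intros cpK)
    show "norm (f (cp z) - f (cp z')) \<le> L * norm (z - z')" for z z'
    proof -
      have "norm (f (cp z) - f (cp z')) \<le> norm (H (cp z) (cp z')) * norm (cp z - cp z')" unfolding H(2)[OF cpK cpK] by (rule norm_blinfun)
      also have "\<dots> \<le> L * norm (z - z')" using closest_point_lipschitz[of K z z'] K Lpos L(2)[OF cpK cpK]
        by (intro mult_mono) (auto simp: cp_def dist_norm compact_imp_closed)
      finally show ?thesis .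
    qed
  qed (use eps epsL Lpos Q in \<open>auto intro: continuous_intros\<close>)
  have ZK: "Z t q \<in> K" if t: "t \<in> {-ee..ee}" and q: "q \<in> Q" for t q
  proof -
    have "norm (Z t q - Z 0 q) \<le> B * norm (t - 0)"
    proof (rule differentiable_bound[where f' = "\<lambda>t x. x *\<^sub>R f (cp (Z t q))" and S = "{-ee..ee}"])
      show "((\<lambda>t. Z t q) has_derivative (\<lambda>x. x *\<^sub>R f (cp (Z s q)))) (at s within {-ee..ee})" if "s \<in> {-ee..ee}" for s
        using Z(3)[OF that q] by (simp add: has_vector_derivative_def)
      show "onorm (\<lambda>x. x *\<^sub>R f (cp (Z s q))) \<le> B" for s
        by (rule onorm_le) (use B(2)[OF cpK] in \<open>simp add: mult.commute[of _ "\<bar>_\<bar>"] mult_left_mono\<close>)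
    qed (use t eps in auto)
    also have "\<dots> \<le> B * ee" using t B(1) by (intro mult_left_mono) auto
    also have "\<dots> \<le> r" using epsB by (simp add: mult.commute)
    finally have "norm (Z t q - q) \<le> r" using Z(2)[OF q] by simp
    moreover have "dist p0 (Z t q) \<le> dist p0 q + norm (Z t q - q)" by (metis dist_norm dist_triangle norm_minus_commute)
    ultimately show ?thesis using q by (simp add: Q_def K_def)
  qed
  have Zode: "((\<lambda>t. Z t q) has_vector_derivative f (Z t q)) (at t within {-ee..ee})" if "t \<in> {-ee..ee}" "q \<in> Q" for t q
    using Z(3)[OF that] ZK[OF that] by (simp add: cp_def closest_point_self)
  define Y where "Y x = Z (fst x) (snd x)" for x
  define P where "P = ball p0 r"
  have P: "open P" "P \<subseteq> Q" by (auto simp: P_def Q_def)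
  have Zc: "continuous_on X (\<lambda>x. Z (a x) (b x))" if "continuous_on X a" "continuous_on X b" "a ` X \<subseteq> {-ee..ee}" "b ` X \<subseteq> Q"
    for X :: "'x::topological_space set" and a b by (rule continuous_on_compose2[OF Z(1), of X "\<lambda>x. (a x, b x)", simplified])
      (use that in \<open>auto intro!: continuous_intros\<close>)
  \<comment> \<open>\<open>W\<close> is the derivative of the flow in the initial point. Its
    equation is the linearised one, because \<open>H\<close> on the diagonal is the derivative of
    \<open>f\<close>.\<close>
  obtain W where W: "continuous_on ({-ee..ee} \<times> Q) (\<lambda>(t, p). W t p)" "\<And>p. p \<in> Q \<Longrightarrow> W 0 p = id_blinfun"
      "\<And>t p. \<lbrakk>t \<in> {-ee..ee}; p \<in> Q\<rbrakk> \<Longrightarrow> ((\<lambda>t. W t p) has_vector_derivative (H (Z t p) (Z t p) o\<^sub>L W t p) + 0) (at t within {-ee..ee})"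
      "\<And>t p. \<lbrakk>t \<in> {-ee<..<ee}; p \<in> interior Q\<rbrakk> \<Longrightarrow>
        (Y has_derivative (\<lambda>(s, h). s *\<^sub>R (\<lambda>x. f (Y x)) (t, p) + blinfun_apply (W t p) h)) (at (t, p))"
  proof (rule ode_parameter_derivative[OF eps less_imp_le[OF Lpos] epsL Q(1-3), of "\<lambda>t p p'. H (Z t p) (Z t p')" "\<lambda>_ _ _. 0" "\<lambda>_ _. id_blinfun" Y "\<lambda>x. f (Y x)"])
    show "continuous_on ({-ee..ee} \<times> Q \<times> Q) (\<lambda>(t, p, p'). H (Z t p) (Z t p'))" unfolding split_beta
      by (rule continuous_on_compose2[OF H(1), of _ "\<lambda>x. (Z (fst x) (fst (snd x)), Z (fst x) (snd (snd x)))", simplified])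
        (auto intro!: continuous_intros Zc ZK)
    show "((\<lambda>t. Y (t, p) - Y (t, p')) has_vector_derivative
        blinfun_apply (H (Z t p) (Z t p')) (Y (t, p) - Y (t, p')) + blinfun_apply 0 (p - p')) (at t within {-ee..ee})" if "t \<in> {-ee..ee}" "p \<in> Q" "p' \<in> Q" for t p p'
      using has_vector_derivative_diff[OF Zode[OF that(1,2)] Zode[OF that(1,3)]] H(2)[OF ZK[OF that(1,2)] ZK[OF that(1,3)]] by (simp add: Y_def)
  qed (use L ZK Zode Z(2) in \<open>auto simp: Y_def split_beta intro!: continuous_intros\<close>)
  define z where "z v x = fderiv Y x (0, v)" for v x
  have Y_in: "Y x \<in> Om" "Y x \<in> K" if "x \<in> {-ee<..<ee} \<times> P" for x
  proof -
    have "fst x \<in> {-ee..ee}" "snd x \<in> Q" using that P(2) by auto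
    from ZK[OF this] show "Y x \<in> Om" "Y x \<in> K" using K(3) unfolding Y_def by blast+
  qed
  have loc: "\<exists>d Q Z. \<bar>t0\<bar> < d \<and> q0 \<in> interior Q \<and>
      continuous_on ({-d..d} \<times> Q) (\<lambda>(t, p). Z t p) \<and> (\<forall>p\<in>Q. \<forall>v. blinfun_apply (Z 0 p) v = v) \<and>
      (\<forall>t\<in>{-d..d}. \<forall>p\<in>Q. \<exists>W. ((\<lambda>t. Z t p) has_vector_derivative W) (at t within {-d..d}) \<and>
          (\<forall>v. blinfun_apply W v = fderiv f (Y (t, p)) (blinfun_apply (Z t p) v) + 0)) \<and>
      (\<forall>t\<in>{-d<..<d}. \<forall>p\<in>interior Q. (Y has_derivative (\<lambda>(s, h). s *\<^sub>R f (Y (t, p)) + blinfun_apply (Z t p) h)) (at (t, p)))"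
    if t0: "t0 \<in> {-ee<..<ee}" and q0: "q0 \<in> P" for t0 q0
  proof (intro exI conjI ballI)
    show "\<bar>t0\<bar> < ee" using t0 by auto
    show "q0 \<in> interior Q" using q0 Q(4) by (simp add: P_def)
    show "continuous_on ({-ee..ee} \<times> Q) (\<lambda>(t, p). W t p)" by (rule W)
    show "\<forall>v. blinfun_apply (W 0 p) v = v" if "p \<in> Q" for p using W(2)[OF that] by simp
    show "((\<lambda>t. W t p) has_vector_derivative (H (Z t p) (Z t p) o\<^sub>L W t p) + 0) (at t within {-ee..ee})"
      if "t \<in> {-ee..ee}" "p \<in> Q" for t p by (rule W(3)[OF that])
    show "\<forall>v. blinfun_apply ((H (Z t p) (Z t p) o\<^sub>L W t p) + 0) v = fderiv f (Y (t, p)) (blinfun_apply (W t p) v) + 0"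
      if "t \<in> {-ee..ee}" "p \<in> Q" for t p using H(3)[OF ZK[OF that]] by (simp add: Y_def)
    show "(Y has_derivative (\<lambda>(s, h). s *\<^sub>R f (Y (t, p)) + blinfun_apply (W t p) h)) (at (t, p))"
      if "t \<in> {-ee<..<ee}" "p \<in> interior Q" for t p using W(4)[OF that] by simp
  qed
  note dir = ode_directional_derivatives[where Y = Y and Y' = "\<lambda>x. f (Y x)" and y0' = "\<lambda>p v. v"
      and A = "\<lambda>x. fderiv f (Y x)" and B = "\<lambda>v x. 0" and e = ee, OF z_def P(1) loc]
  have opS: "open ({-ee<..<ee} \<times> P)" using P by (simp add: open_Times)
  have Yk: "C_k_on k ({-ee<..<ee} \<times> P) Y" for k
  proof (induction k)
    case 0
    have "continuous_on ({-ee<..<ee} \<times> P) Y" unfolding Y_def by (rule Zc) (use P in \<open>auto intro!: continuous_intros\<close>)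
    then show ?case by simp
  next
    case (Suc k)
    have Yim: "Y ` ({-ee<..<ee} \<times> P) \<subseteq> Om" using Y_in by blast
    have fk: "C_k_on k Om f" "\<And>b. C_k_on k Om (\<lambda>y. fderiv f y b)" using f C_inf_on_frechet[OF f] unfolding C_inf_on_def by blast+
    have Ak: "C_k_on k ({-ee<..<ee} \<times> P) (\<lambda>x. fderiv f (Y x) b)" for b by (rule C_k_on_compose[OF opS op Suc fk(2) Yim])
    have zk: "C_k_on k ({-ee<..<ee} \<times> P) (z v)" for v
    proof (rule linear_ode_C_k[OF eps less_imp_le[OF Lpos] epsL P(1), where A = "\<lambda>x. fderiv f (Y x)" and g = "\<lambda>x. 0" and ?y0.0 = "\<lambda>p. v"])
      show "linear (fderiv f (Y x))" if "x \<in> {-ee<..<ee} \<times> P" for x using C_inf_on_has_derivative[OF f Y_in(1)[OF that]] by (rule has_derivative_linear)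
      show "norm (fderiv f (Y x) u) \<le> L * norm u" if "x \<in> {-ee<..<ee} \<times> P" for x u
        using order_trans[OF norm_blinfun mult_right_mono[OF L(2)[OF Y_in(2)[OF that] Y_in(2)[OF that]] norm_ge_zero]]
          H(3)[OF Y_in(2)[OF that]] by metis
      show "continuous_on ({-ee<..<ee} \<times> P) (z v)" by (rule dir(2))
      show "((\<lambda>t. z v (t, p)) has_vector_derivative fderiv f (Y (t, p)) (z v (t, p)) + 0) (at t)"
        if "t \<in> {-ee<..<ee}" "p \<in> P" for t p by (rule dir(3)[OF _ _ that])
      show "z v (0, p) = v" if "p \<in> P" for p by (rule dir(4)[OF _ _ eps that])
    qed (use Ak opS P in \<open>auto intro: C_k_on_const\<close>)
    show ?case
    proof (rule C_k_on_SucI[OF opS, where f' = "\<lambda>x w. fst w *\<^sub>R f (Y x) + z (snd w) x"])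
      show "(Y has_derivative (\<lambda>w. fst w *\<^sub>R f (Y x) + z (snd w) x)) (at x)" if "x \<in> {-ee<..<ee} \<times> P" for x
        using dir(1)[where t = "fst x" and p = "snd x"] that by auto
      show "C_k_on k ({-ee<..<ee} \<times> P) (\<lambda>x. fst v *\<^sub>R f (Y x) + z (snd v) x)" for v
        by (rule C_k_on_add[OF opS C_k_on_linear_comp[OF opS bounded_linear_scaleR_right C_k_on_compose[OF opS op Suc fk(1) Yim]] zk])
    qed
  qed
  show ?thesis
  proof (rule that[OF r eps, of Y])
    show "Y (0, p) = p" if "p \<in> ball p0 r" for p using Z(2)[of p] that P by (auto simp: Y_def P_def)
    show "Y (t, p) \<in> Om" if "t \<in> {-ee<..<ee}" "p \<in> ball p0 r" for t p using Y_in(1)[of "(t, p)"] that by (auto simp: P_def)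
    show "C_inf_on ({-ee<..<ee} \<times> ball p0 r) Y" using Yk opS by (simp add: C_inf_on_def P_def)
    show "((\<lambda>t. Y (t, p)) has_vector_derivative f (Y (t, p))) (at t)" if "t \<in> {-ee<..<ee}" "p \<in> ball p0 r" for t p
    proof -
      have "((\<lambda>t. Y (t, p)) has_vector_derivative f (Y (t, p))) (at t within {-ee..ee})" using Zode[of t p] that P by (auto simp: Y_def P_def)
      then show ?thesis using at_within_interior[of t "{-ee..ee}"] that by simp
    qed
  qed
qed

section \<open>Smoothness of inverses of linear families, and of local inverses of maps\<close>

section \<open>The smooth inverse function theorem\<close>

text \<open>Let the constant \<open>M\<close> of the proof bound the inverse of \<open>A y0\<close>.
  If \<open>A y\<close> is within \<open>1 / (2 * M)\<close> of \<open>A y0\<close> in operator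
  norm, half of \<open>norm x\<close> can be absorbed, and \<open>2 * M\<close> bounds the inverse
  of \<open>A y\<close>.\<close>

lemma inverse_family_estimate:
  fixes A :: "'e::euclidean_space \<Rightarrow> 'b::euclidean_space \<Rightarrow> 'b"
  assumes S: "open S" and lin: "\<And>y. y \<in> S \<Longrightarrow> linear (A y)" "\<And>y. y \<in> S \<Longrightarrow> bij (A y)"
    and c: "\<And>v. continuous_on S (\<lambda>y. A y v)" and y0: "y0 \<in> S"
  obtains M where "\<forall>\<^sub>F y in at y0. y \<in> S \<and> (\<forall>w. norm (inv (A y) w) \<le> M * norm w)" "0 < M"
proof -
  define Ab where "Ab y = Blinfun (A y)" for y
  have Ab: "blinfun_apply (Ab y) v = A y v" if "y \<in> S" for y v using lin(1)[OF that] by (simp add: Ab_def bounded_linear_Blinfun_apply linear_conv_bounded_linear)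
  have "continuous_on S Ab" by (rule continuous_on_blinfun_componentwise, rule continuous_on_eq[OF c]) (simp add: Ab)
  then have "isCont Ab y0" using S y0 continuous_on_eq_continuous_at by blast
  obtain I where I: "linear I" "\<And>x. I (A y0 x) = x" using linear_injective_isomorphism[OF lin(1)[OF y0]] lin(2)[OF y0] bij_is_inj by metis
  obtain M where M: "0 < M" "\<And>x. norm (I x) \<le> M * norm x" using linear_bounded_pos[OF I(1)] by metis
  have "\<forall>\<^sub>F y in at y0. dist (Ab y) (Ab y0) < 1 / (2 * M)" using \<open>isCont Ab y0\<close> M(1) unfolding isCont_def by (intro tendstoD) auto
  moreover have "\<forall>\<^sub>F y in at y0. y \<in> S" using S y0 eventually_at_topological by blast
  ultimately have "\<forall>\<^sub>F y in at y0. y \<in> S \<and> (\<forall>w. norm (inv (A y) w) \<le> 2 * M * norm w)"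
  proof eventually_elim
    case (elim y)
    have "norm (inv (A y) w) \<le> 2 * M * norm w" for w
    proof -
      define x where "x = inv (A y) w"
      have w: "A y x = w" using lin(2)[OF elim(2)] by (simp add: x_def bij_is_surj surj_f_inv_f)
      have "norm x \<le> M * norm (A y0 x)" using M(2)[of "A y0 x"] I(2) by simp
      also have "A y0 x = w - blinfun_apply (Ab y - Ab y0) x" using Ab elim(2) y0 w by (simp add: blinfun.diff_left)
      also have "M * norm (w - blinfun_apply (Ab y - Ab y0) x) \<le> M * (norm w + 1 / (2 * M) * norm x)"
      proof (rule mult_left_mono)
        have "norm (blinfun_apply (Ab y - Ab y0) x) \<le> 1 / (2 * M) * norm x"
          by (rule order_trans[OF norm_blinfun mult_right_mono]) (use elim(1) in \<open>auto simp: dist_norm\<close>)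
        then show "norm (w - blinfun_apply (Ab y - Ab y0) x) \<le> norm w + 1 / (2 * M) * norm x" using norm_triangle_ineq4[of w "blinfun_apply (Ab y - Ab y0) x"] by linarith
      qed (use M in auto)
      also have "\<dots> = M * norm w + norm x / 2" using M(1) by (simp add: distrib_left)
      finally show ?thesis by (simp add: x_def)
    qed
    with elim show ?case by blast
  qed
  then show ?thesis using that M(1) by simp
qed

text \<open>With \<open>u = inv (A y0) v\<close> one has
  \<open>inv (A y) v - u = inv (A y) (v - A y u)\<close>, which is small by the uniform bound on the
  inverses.\<close>

lemma inverse_family_continuous:
  fixes A :: "'e::euclidean_space \<Rightarrow> 'b::euclidean_space \<Rightarrow> 'b"
  assumes S: "open S" and lin: "\<And>y. y \<in> S \<Longrightarrow> linear (A y)" "\<And>y. y \<in> S \<Longrightarrow> bij (A y)"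
    and c: "\<And>v. continuous_on S (\<lambda>y. A y v)"
  shows "continuous_on S (\<lambda>y. inv (A y) v)"
proof (rule continuous_at_imp_continuous_on, rule ballI)
  fix y0 assume y0: "y0 \<in> S"
  obtain M where M: "\<forall>\<^sub>F y in at y0. y \<in> S \<and> (\<forall>w. norm (inv (A y) w) \<le> M * norm w)" "0 < M"
    by (rule inverse_family_estimate[OF assms y0]) (assumption | (rule that, assumption+))+
  define u where "u = inv (A y0) v"
  have u: "A y0 u = v" using lin(2)[OF y0] by (simp add: u_def bij_is_surj surj_f_inv_f)
  have "isCont (\<lambda>y. A y u) y0" using c[of u] S y0 by (simp add: continuous_on_eq_continuous_at)
  then have "((\<lambda>y. A y u) \<longlongrightarrow> v) (at y0)" using u by (simp add: isCont_def)
  then have lim: "((\<lambda>y. M * norm (v - A y u)) \<longlongrightarrow> 0) (at y0)" by (auto intro!: tendsto_eq_intros)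
  have "((\<lambda>y. norm (inv (A y) v - u)) \<longlongrightarrow> 0) (at y0)"
  proof (rule tendsto_sandwich[OF _ _ tendsto_const lim])
    show "\<forall>\<^sub>F y in at y0. norm (inv (A y) v - u) \<le> M * norm (v - A y u)" using M(1)
    proof eventually_elim
      case (elim y)
      then have y: "linear (A y)" "bij (A y)" using lin by auto
      have "inv (A y) (v - A y u) = inv (A y) v - u"
        using linear_diff[OF inj_linear_imp_inv_linear[OF y(1) bij_is_inj[OF y(2)]], of v "A y u"] inv_f_f[OF bij_is_inj[OF y(2)]] by simp
      then show ?case using elim by metis
    qed
  qed simp
  then show "isCont (\<lambda>y. inv (A y) v) y0" by (simp add: isCont_def u_def[symmetric] tendsto_norm_zero_iff LIM_zero_iff)
qed

text \<open>The derivative of the inverse is minus the inverse, times the derivative of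
  \<open>A\<close>, times the inverse. It is of class k when the inverse is, so the induction runs
  as for reciprocals.\<close>

lemma inverse_family_C_k:
  fixes A :: "'e::euclidean_space \<Rightarrow> 'b::euclidean_space \<Rightarrow> 'b"
  assumes S: "open S" and lin: "\<And>y. y \<in> S \<Longrightarrow> linear (A y)" "\<And>y. y \<in> S \<Longrightarrow> bij (A y)"
    and A: "\<And>v. C_k_on k S (\<lambda>y. A y v)"
  shows "C_k_on k S (\<lambda>y. inv (A y) v)" using A
proof (induction k arbitrary: v)
  case 0
  then show ?case using inverse_family_continuous[OF S lin] by simp
next
  case (Suc k)
  have Ak: "C_k_on k S (\<lambda>y. A y v)" for v by (rule C_k_on_Suc_imp[OF Suc.prems])
  have IH: "C_k_on k S (\<lambda>y. inv (A y) v)" for v by (rule Suc.IH[OF Ak])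
  have linI: "linear (inv (A y))" if "y \<in> S" for y using lin[OF that] by (simp add: bij_is_inj inj_linear_imp_inv_linear)
  have cI: "continuous_on S (\<lambda>y. inv (A y) w)" for w by (rule inverse_family_continuous[OF S lin]) (use C_k_on_imp_continuous_on[OF Ak] in auto)
  define D where "D y u = fderiv (\<lambda>y. A y u) y" for y u
  have D: "((\<lambda>y. A y u) has_derivative D y u) (at y)" if "y \<in> S" for y u unfolding D_def by (rule C_k_on_has_derivative[OF Suc.prems that])
  have der: "((\<lambda>y. inv (A y) v) has_derivative (\<lambda>h. - inv (A y0) (D y0 (inv (A y0) v) h))) (at y0)" if y0: "y0 \<in> S" for y0
  proof -
    obtain M where M: "\<forall>\<^sub>F y in at y0. y \<in> S \<and> (\<forall>w. norm (inv (A y) w) \<le> M * norm w)" "0 < M"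
      by (rule inverse_family_estimate[OF S lin C_k_on_imp_continuous_on[OF Ak] y0]) (assumption | (rule that, assumption+))+
    define u where "u = inv (A y0) v"
    have u: "A y0 u = v" using lin(2)[OF y0] by (simp add: u_def bij_is_surj surj_f_inv_f)
    have linD: "linear (D y0 u)" using D[OF y0] by (rule has_derivative_linear)
    have l1: "((\<lambda>y. norm (A y u - A y0 u - D y0 u (y - y0)) / norm (y - y0)) \<longlongrightarrow> 0) (at y0)" using D[OF y0, of u] by (simp add: has_derivative_iff_norm)
    have "((\<lambda>y. inv (A y) w) \<longlongrightarrow> inv (A y0) w) (at y0)" for w using cI[of w] S y0 by (simp add: continuous_on_eq_continuous_at isCont_def)
    then have l2: "((\<lambda>y. norm (inv (A y) w - inv (A y0) w)) \<longlongrightarrow> 0) (at y0)" for w by (simp add: tendsto_norm_zero_iff LIM_zero_iff)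
    have lim: "((\<lambda>y. M * (norm (A y u - A y0 u - D y0 u (y - y0)) / norm (y - y0)) +
        (\<Sum>b\<in>Basis. norm (inv (A y) (D y0 u b) - inv (A y0) (D y0 u b)))) \<longlongrightarrow> M * 0 + (\<Sum>b\<in>(Basis::'e set). 0)) (at y0)"
      by (rule tendsto_add[OF tendsto_mult[OF tendsto_const l1] tendsto_sum[OF l2]])
    have "((\<lambda>y. norm (inv (A y) v - inv (A y0) v - (- inv (A y0) (D y0 u (y - y0)))) / norm (y - y0)) \<longlongrightarrow> 0) (at y0)"
    proof (rule tendsto_sandwich[OF _ _ tendsto_const lim[unfolded mult_zero_right sum.neutral_const add_0]])
      have "\<forall>\<^sub>F y in at y0. y \<noteq> y0" by (simp add: eventually_at_filter)
      then show "\<forall>\<^sub>F y in at y0. norm (inv (A y) v - inv (A y0) v - (- inv (A y0) (D y0 u (y - y0)))) / norm (y - y0) \<le>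
          M * (norm (A y u - A y0 u - D y0 u (y - y0)) / norm (y - y0)) +
          (\<Sum>b\<in>Basis. norm (inv (A y) (D y0 u b) - inv (A y0) (D y0 u b)))" using M(1)
      proof eventually_elim
        case (elim y)
        define w where "w = D y0 u (y - y0)"
        have yS: "y \<in> S" using elim by blast
        have li: "linear (inv (A y))" "linear (inv (A y0))" using linI yS y0 by auto
        have iu: "inv (A y) (A y u) = u" using lin(2)[OF yS] by (simp add: bij_is_inj inv_f_f)
        \<comment> \<open>The remainder consists of \<open>inv (A y)\<close> applied to the Taylor
          remainder of \<open>A y u\<close> and of the variation of the inverse on \<open>w\<close>.
          Both are small relative to \<open>norm (y - y0)\<close>.\<close>
        have "inv (A y) v - inv (A y0) v - (- inv (A y0) w) = - inv (A y) (A y u - A y0 u - w) - (inv (A y) w - inv (A y0) w)"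
          unfolding u using iu by (simp add: linear_diff[OF li(1)] u u_def[symmetric])
        then have "norm (inv (A y) v - inv (A y0) v - (- inv (A y0) w)) \<le> norm (inv (A y) (A y u - A y0 u - w)) + norm (inv (A y) w - inv (A y0) w)"
          using norm_triangle_ineq4[of "- inv (A y) (A y u - A y0 u - w)" "inv (A y) w - inv (A y0) w"] unfolding norm_minus_cancel by (simp only:)
        also have "\<dots> \<le> M * norm (A y u - A y0 u - w) + norm (inv (A y) w - inv (A y0) w)" using elim by auto
        also have "norm (inv (A y) w - inv (A y0) w) \<le> (\<Sum>b\<in>Basis. norm (inv (A y) (D y0 u b) - inv (A y0) (D y0 u b))) * norm (y - y0)"
        proof -
          have "w = (\<Sum>b\<in>Basis. ((y - y0) \<bullet> b) *\<^sub>R D y0 u b)" unfolding w_def by (subst (1) euclidean_representation[symmetric, of "y - y0"])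
              (simp only: linear_sum[OF linD] linear_cmul[OF linD])
          then have "inv (A y) w - inv (A y0) w = (\<Sum>b\<in>Basis. ((y - y0) \<bullet> b) *\<^sub>R (inv (A y) (D y0 u b) - inv (A y0) (D y0 u b)))"
            by (simp add: linear_sum[OF li(1)] linear_cmul[OF li(1)] linear_sum[OF li(2)] linear_cmul[OF li(2)] scaleR_diff_right sum_subtractf)
          also have "norm \<dots> \<le> (\<Sum>b\<in>Basis. norm (y - y0) * norm (inv (A y) (D y0 u b) - inv (A y0) (D y0 u b)))"
            by (intro sum_norm_le) (auto intro!: mult_right_mono simp: Basis_le_norm)
          also have "\<dots> = (\<Sum>b\<in>Basis. norm (inv (A y) (D y0 u b) - inv (A y0) (D y0 u b))) * norm (y - y0)" by (simp add: sum_distrib_left[symmetric] mult.commute)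
          finally show ?thesis .
        qed
        finally show ?case using elim(1) by (simp add: w_def field_simps)
      qed
    qed simp
    moreover have "bounded_linear (\<lambda>h. - inv (A y0) (D y0 u h))"
      using linear_compose[OF linD linI[OF y0]] by (auto simp: linear_conv_bounded_linear[symmetric] o_def linear_compose_neg)
    ultimately show ?thesis by (simp add: has_derivative_iff_norm u_def)
  qed
  have "C_k_on k S (\<lambda>y. D y (inv (A y) v) h)" for h
  proof -
    have 1: "C_k_on k S (\<lambda>y. D y b h)" for b using Suc.prems by (simp add: D_def)
    have 2: "linear (\<lambda>u. D y u h)" if "y \<in> S" for y
    proof -
      have "D y (a + b) h = D y a h + D y b h" for a b
      proof -
        have "((\<lambda>y. A y a + A y b) has_derivative (\<lambda>h. D y a h + D y b h)) (at y)" by (intro has_derivative_add D that)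
        then have "((\<lambda>y. A y (a + b)) has_derivative (\<lambda>h. D y a h + D y b h)) (at y)"
          by (rule has_derivative_transform_within_open[OF _ S that]) (simp add: linear_add[OF lin(1)])
        from has_derivative_unique[OF this D[OF that]] show ?thesis by metis
      qed
      moreover have "D y (r *\<^sub>R a) h = r *\<^sub>R D y a h" for r a
      proof -
        have "((\<lambda>y. r *\<^sub>R A y a) has_derivative (\<lambda>h. r *\<^sub>R D y a h)) (at y)" by (intro has_derivative_scaleR_right D that)
        then have "((\<lambda>y. A y (r *\<^sub>R a)) has_derivative (\<lambda>h. r *\<^sub>R D y a h)) (at y)"
          by (rule has_derivative_transform_within_open[OF _ S that]) (simp add: linear_cmul[OF lin(1)])
        from has_derivative_unique[OF this D[OF that]] show ?thesis by metis
      qed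
      ultimately show ?thesis by (rule linearI)
    qed
    show ?thesis by (rule C_k_on_linear_family[OF S 2 1 IH])
  qed
  then have "C_k_on k S (\<lambda>y. - inv (A y) (D y (inv (A y) v) h))" for h
    by (intro C_k_on_linear_comp[OF S bounded_linear_minus[OF bounded_linear_ident]] C_k_on_linear_family[OF S linI IH])
  then show ?case by (intro C_k_on_SucI[OF S der])
qed

lemma inverse_family_C_inf:
  fixes A :: "'e::euclidean_space \<Rightarrow> 'b::euclidean_space \<Rightarrow> 'b"
  assumes "open S" "\<And>y. y \<in> S \<Longrightarrow> linear (A y)" "\<And>y. y \<in> S \<Longrightarrow> bij (A y)" "\<And>v. C_inf_on S (\<lambda>y. A y v)"
  shows "C_inf_on S (\<lambda>y. inv (A y) v)" using assms unfolding C_inf_on_def by (auto intro: inverse_family_C_k)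

text \<open>The inverse function theorem provides a local inverse with derivative
  \<open>inv (f' (g y))\<close>. This expression is of class k as soon as \<open>g\<close> is, which
  lifts \<open>g\<close> from each class to the next.\<close>

theorem smooth_inverse_function:
  fixes f :: "'e::euclidean_space \<Rightarrow> 'e"
  assumes f: "C_inf_on U f" and x0: "x0 \<in> U" and inj: "inj (fderiv f x0)"
  obtains U' V g where "open U'" "U' \<subseteq> U" "x0 \<in> U'" "homeomorphism U' V f g" "C_inf_on V g"
proof -
  have f1: "C_k_on (Suc 0) U f" using f unfolding C_inf_on_def by blast
  have op: "open U" using f by (rule C_inf_on_open)
  have lin: "linear (fderiv f x0)" using C_inf_on_has_derivative[OF f x0] by (rule has_derivative_linear)
  obtain I where I: "linear I" "\<And>x. I (fderiv f x0 x) = x" using linear_injective_isomorphism[OF lin inj] by blast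
  have "Blinfun I o\<^sub>L blinfun_deriv f x0 = id_blinfun"
    using I by (intro blinfun_eqI) (simp add: bounded_linear_Blinfun_apply linear_conv_bounded_linear blinfun_deriv_apply[OF f1 x0])
  then obtain U' V g g' where *: "open U'" "U' \<subseteq> U" "x0 \<in> U'" "open V" "f x0 \<in> V" "homeomorphism U' V f g"
    "\<And>y. y \<in> V \<Longrightarrow> (g has_derivative (g' y)) (at y)"
    "\<And>y. y \<in> V \<Longrightarrow> g' y = inv (blinfun_apply (blinfun_deriv f (g y)))"
    "\<And>y. y \<in> V \<Longrightarrow> bij (blinfun_apply (blinfun_deriv f (g y)))"
    using inverse_function_theorem[OF op blinfun_deriv[OF f1] continuous_on_blinfun_deriv[OF f1] x0] by blast
  have gU: "g y \<in> U" if "y \<in> V" for y using that * by (auto simp: homeomorphism_def)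
  have eq: "blinfun_apply (blinfun_deriv f (g y)) = fderiv f (g y)" if "y \<in> V" for y by (rule ext) (rule blinfun_deriv_apply[OF f1 gU[OF that]])
  have "C_k_on k V g" for k
  proof (induction k)
    case 0
    then show ?case using *(6) by (simp add: homeomorphism_def)
  next
    case (Suc k)
    have "C_k_on k V (\<lambda>y. inv (fderiv f (g y)) v)" for v
    proof (rule inverse_family_C_k[OF *(4)])
      show "linear (fderiv f (g y))" if "y \<in> V" for y using C_inf_on_has_derivative[OF f gU[OF that]] by (rule has_derivative_linear)
      show "bij (fderiv f (g y))" if "y \<in> V" for y using *(9)[OF that] eq[OF that] by simp
      show "C_k_on k V (\<lambda>y. fderiv f (g y) v)" for v by (rule C_k_on_compose[OF *(4) op Suc]) (use C_inf_on_frechet[OF f] gU in \<open>auto simp: C_inf_on_def\<close>)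
    qed
    then show ?case by (intro C_k_on_SucI[OF *(4), where f' = "\<lambda>y. inv (fderiv f (g y))"]) (use *(7,8) eq in auto)
  qed
  then have "C_inf_on V g" using *(4) by (simp add: C_inf_on_def)
  with *(1-3,6) show ?thesis using that by blast
qed

section \<open>Smoothness at a point of a manifold, independently of the chart\<close>

section \<open>Smooth functions on manifolds\<close>

lemma smooth_on_iff_C_inf_on:
  "smooth_on S f \<longleftrightarrow> (\<forall>x\<in>S. \<exists>T g. x \<in> T \<and> C_inf_on T g \<and> (\<forall>y\<in>S \<inter> T. g y = f y))"
  unfolding smooth_on_def C_inf_on_def by meson

lemma smooth_onE:
  assumes "smooth_on S f" "x \<in> S"
  obtains T g where "x \<in> T" "C_inf_on T g" "\<And>y. y \<in> S \<inter> T \<Longrightarrow> g y = f y"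
proof -
  have "\<exists>T g. x \<in> T \<and> C_inf_on T g \<and> (\<forall>y\<in>S \<inter> T. g y = f y)" using assms unfolding smooth_on_iff_C_inf_on by (rule bspec)
  then show ?thesis by (elim exE conjE) (rule that, assumption+, erule bspec)
qed

lemma smooth_on_C_inf_on: "C_inf_on T g \<Longrightarrow> S \<subseteq> T \<Longrightarrow> (\<And>x. x \<in> S \<Longrightarrow> f x = g x) \<Longrightarrow> smooth_on S f"
  unfolding smooth_on_iff_C_inf_on by (intro ballI exI[of _ T] exI[of _ g]) auto

lemma C_inf_on_preimage:
  assumes "C_inf_on T g" "open U" shows "open {y \<in> T. g y \<in> U}"
proof -
  have "open (T \<inter> g -` U)" using C_inf_on_continuous[OF assms(1)] C_inf_on_open[OF assms(1)] assms(2) by (rule continuous_open_preimage)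
  moreover have "T \<inter> g -` U = {y \<in> T. g y \<in> U}" by auto
  ultimately show ?thesis by simp
qed

text \<open>The local content of \<open>smooth_manifold\<close>, expressed by open sets. Separation
  and countability are kept apart so that products can be handled on this level;
  \<open>smooth_manifoldI\<close> leads back.\<close>

definition smooth_atlas :: "('a, 'e::euclidean_space) manifold \<Rightarrow> bool" where
  "smooth_atlas M \<longleftrightarrow> \<Union> (fst ` atlas M) = points M \<and>
     (\<forall>(U, \<phi>)\<in>atlas M. openin (mtop M) U \<and> inj_on \<phi> U \<and>
        (\<forall>T. open T \<longrightarrow> openin (mtop M) {x \<in> U. \<phi> x \<in> T}) \<and>
        (\<forall>W\<subseteq>U. openin (mtop M) W \<longrightarrow> openin (top_of_set (model M)) (\<phi> ` W))) \<and>
     (\<forall>(U, \<phi>)\<in>atlas M. \<forall>(V, \<psi>)\<in>atlas M. smooth_on (\<phi> ` (U \<inter> V)) (\<psi> \<circ> inv_into U \<phi>))"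

lemma smooth_manifold_imp_atlas:
  assumes "smooth_manifold M" shows "smooth_atlas M"
proof -
  have "openin (mtop M) U \<and> inj_on \<phi> U \<and> (\<forall>T. open T \<longrightarrow> openin (mtop M) {x \<in> U. \<phi> x \<in> T}) \<and>
        (\<forall>W\<subseteq>U. openin (mtop M) W \<longrightarrow> openin (top_of_set (model M)) (\<phi> ` W))" if "(U, \<phi>) \<in> atlas M" for U \<phi>
  proof -
    have U: "openin (mtop M) U" "openin (top_of_set (model M)) (\<phi> ` U)"
      and h: "homeomorphic_map (subtopology (mtop M) U) (top_of_set (\<phi> ` U)) \<phi>" using assms that unfolding smooth_manifold_def by fast+
    have ts: "topspace (subtopology (mtop M) U) = U" using openin_subset[OF U(1)] by auto
    have "inj_on \<phi> U" using homeomorphic_imp_injective_map[OF h] ts by simp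
    moreover have "openin (mtop M) {x \<in> U. \<phi> x \<in> T}" if "open T" for T
    proof -
      have "openin (subtopology (mtop M) U) {x \<in> topspace (subtopology (mtop M) U). \<phi> x \<in> \<phi> ` U \<inter> T}"
        by (rule openin_continuous_map_preimage[OF homeomorphic_imp_continuous_map[OF h]])
          (simp add: openin_open that, blast intro: that)
      moreover have "{x \<in> U. \<phi> x \<in> \<phi> ` U \<inter> T} = {x \<in> U. \<phi> x \<in> T}" by auto
      ultimately have "openin (subtopology (mtop M) U) {x \<in> U. \<phi> x \<in> T}" unfolding ts by simp
      then show ?thesis using U(1) openin_trans_full by blast
    qed
    moreover have "openin (top_of_set (model M)) (\<phi> ` W)" if "W \<subseteq> U" "openin (mtop M) W" for W
    proof -
      have "openin (subtopology (mtop M) U) W" using that by (simp add: openin_subset_topspace_eq openin_subtopology) blast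
      then have "openin (top_of_set (\<phi> ` U)) (\<phi> ` W)" using homeomorphic_map_openness_eq[OF h] by blast
      then show ?thesis using U(2) openin_trans by blast
    qed
    ultimately show ?thesis using U(1) by blast
  qed
  then show ?thesis using assms unfolding smooth_manifold_def smooth_atlas_def by auto
qed

lemma smooth_atlas_chartD:
  assumes "smooth_atlas M" "(U, \<phi>) \<in> atlas M"
  shows chart_open: "openin (mtop M) U" and chart_inj: "inj_on \<phi> U"
    and chart_preimage_open: "open T \<Longrightarrow> openin (mtop M) {x \<in> U. \<phi> x \<in> T}"
    and chart_image_open: "W \<subseteq> U \<Longrightarrow> openin (mtop M) W \<Longrightarrow> openin (top_of_set (model M)) (\<phi> ` W)"
proof -
  have "\<forall>(U, \<phi>)\<in>atlas M. openin (mtop M) U \<and> inj_on \<phi> U \<and>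
        (\<forall>T. open T \<longrightarrow> openin (mtop M) {x \<in> U. \<phi> x \<in> T}) \<and>
        (\<forall>W\<subseteq>U. openin (mtop M) W \<longrightarrow> openin (top_of_set (model M)) (\<phi> ` W))"
    by (rule conjunct1[OF conjunct2[OF assms(1)[unfolded smooth_atlas_def]]])
  from bspec[OF this assms(2)]
  show "openin (mtop M) U" "inj_on \<phi> U" "open T \<Longrightarrow> openin (mtop M) {x \<in> U. \<phi> x \<in> T}"
    "W \<subseteq> U \<Longrightarrow> openin (mtop M) W \<Longrightarrow> openin (top_of_set (model M)) (\<phi> ` W)" by simp_all
qed

lemma chart_transition:
  assumes "smooth_atlas M" "(U, \<phi>) \<in> atlas M" "(V, \<psi>) \<in> atlas M"
  shows "smooth_on (\<phi> ` (U \<inter> V)) (\<psi> \<circ> inv_into U \<phi>)"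
proof -
  have "\<forall>(U, \<phi>)\<in>atlas M. \<forall>(V, \<psi>)\<in>atlas M. smooth_on (\<phi> ` (U \<inter> V)) (\<psi> \<circ> inv_into U \<phi>)"
    by (rule conjunct2[OF conjunct2[OF assms(1)[unfolded smooth_atlas_def]]])
  from bspec[OF this assms(2)] assms(3) show ?thesis by auto
qed

lemma chart_exists:
  assumes "smooth_atlas M" "x \<in> points M" obtains U \<phi> where "(U, \<phi>) \<in> atlas M" "x \<in> U"
proof -
  have "x \<in> \<Union> (fst ` atlas M)" using assms unfolding smooth_atlas_def by simp
  then show ?thesis using that by auto
qed

lemma chart_model: "smooth_atlas M \<Longrightarrow> (U, \<phi>) \<in> atlas M \<Longrightarrow> x \<in> U \<Longrightarrow> \<phi> x \<in> model M"
  using chart_image_open[OF _ _ subset_refl chart_open] openin_imp_subset by blast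

lemma smooth_manifold_subspace: "smooth_manifold M \<Longrightarrow> subspace (model M)" unfolding smooth_manifold_def by simp

text \<open>Smoothness at one point, witnessed in one chart. Agreement is asked for on
  \<open>S\<close> only, so that functions on a level set of a map or on the total space of a bundle
  are covered through local extensions.\<close>

definition smooth_at :: "('a, 'e::euclidean_space) manifold \<Rightarrow> 'a set \<Rightarrow> 'a \<Rightarrow> ('a \<Rightarrow> 'f::euclidean_space) \<Rightarrow> bool" where
  "smooth_at M S x f \<longleftrightarrow> (\<exists>U \<psi> W T g. (U, \<psi>) \<in> atlas M \<and> openin (mtop M) W \<and> x \<in> W \<and> W \<subseteq> U \<and>
     C_inf_on T g \<and> \<psi> ` W \<subseteq> T \<and> (\<forall>y\<in>W \<inter> S. f y = g (\<psi> y)))"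

lemma smooth_atI:
  "\<lbrakk>(U, \<psi>) \<in> atlas M; openin (mtop M) W; x \<in> W; W \<subseteq> U; C_inf_on T g; \<psi> ` W \<subseteq> T; \<And>y. y \<in> W \<Longrightarrow> y \<in> S \<Longrightarrow> f y = g (\<psi> y)\<rbrakk>
   \<Longrightarrow> smooth_at M S x f" unfolding smooth_at_def by blast

lemma smooth_atE:
  assumes "smooth_at M S x f"
  obtains U \<psi> W T g where "(U, \<psi>) \<in> atlas M" "openin (mtop M) W" "x \<in> W" "W \<subseteq> U" "C_inf_on T g" "\<psi> ` W \<subseteq> T"
    "\<And>y. y \<in> W \<Longrightarrow> y \<in> S \<Longrightarrow> f y = g (\<psi> y)"
  using assms unfolding smooth_at_def by (elim exE conjE) (rule that, assumption+, erule bspec, rule IntI)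

text \<open>Changes of charts are smooth, so a witness in one chart can be moved to any chart around
  the point.\<close>

lemma smooth_at_chartE:
  assumes M: "smooth_atlas M" and f: "smooth_at M S x f" and chart: "(U, \<psi>) \<in> atlas M" and x: "x \<in> U"
  obtains W T g where "openin (mtop M) W" "x \<in> W" "W \<subseteq> U" "C_inf_on T g" "\<psi> ` W \<subseteq> T" "\<And>y. y \<in> W \<Longrightarrow> y \<in> S \<Longrightarrow> f y = g (\<psi> y)"
proof -
  obtain U0 \<psi>0 W0 T0 g0 where *: "(U0, \<psi>0) \<in> atlas M" "openin (mtop M) W0" "x \<in> W0" "W0 \<subseteq> U0"
    "C_inf_on T0 g0" "\<psi>0 ` W0 \<subseteq> T0" "\<And>y. y \<in> W0 \<Longrightarrow> y \<in> S \<Longrightarrow> f y = g0 (\<psi>0 y)" by (rule smooth_atE[OF f], rule that)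
  have px: "\<psi> x \<in> \<psi> ` (U \<inter> U0)" using x * by auto
  obtain T1 g1 where T1: "\<psi> x \<in> T1" "C_inf_on T1 g1"
    "\<And>y. y \<in> \<psi> ` (U \<inter> U0) \<inter> T1 \<Longrightarrow> g1 y = (\<psi>0 \<circ> inv_into U \<psi>) y"
    by (rule smooth_onE[OF chart_transition[OF M chart *(1)] px], rule that)
  have inv: "inv_into U \<psi> (\<psi> y) = y" if "y \<in> U" for y using chart_inj[OF M chart] that by simp
  have g1: "g1 (\<psi> y) = \<psi>0 y" if "y \<in> U" "y \<in> U0" "\<psi> y \<in> T1" for y using T1(3)[of "\<psi> y"] that inv by simp
  define W where "W = W0 \<inter> {y \<in> U. \<psi> y \<in> T1}"
  define T where "T = {y \<in> T1. g1 y \<in> T0}"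
  have oT: "open T" unfolding T_def using T1(2) C_inf_on_open[OF *(5)] by (rule C_inf_on_preimage)
  show ?thesis
  proof (rule that)
    show "openin (mtop M) W" unfolding W_def by (intro openin_Int *(2) chart_preimage_open[OF M chart] C_inf_on_open[OF T1(2)])
    show "x \<in> W" "W \<subseteq> U" using x *(3) T1(1) by (auto simp: W_def)
    show "C_inf_on T (\<lambda>y. g0 (g1 y))" by (rule C_inf_on_compose[OF C_inf_on_subset[OF T1(2) oT] *(5)]) (auto simp: T_def)
    show "\<psi> ` W \<subseteq> T" using *(4,6) g1 by (auto simp: T_def W_def subset_iff image_subset_iff)
    show "f y = g0 (g1 (\<psi> y))" if "y \<in> W" "y \<in> S" for y using that *(4,7) g1 by (auto simp: W_def subset_iff)
  qed
qed

text \<open>Links the definition by extensions in every chart with the pointwise notion used from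
  here on.\<close>

lemma smooth_fun_on_iff:
  assumes M: "smooth_atlas M" and S: "S \<subseteq> points M"
  shows "smooth_fun_on M S f \<longleftrightarrow> (\<forall>x\<in>S. smooth_at M S x f)"
proof
  assume f: "smooth_fun_on M S f"
  show "\<forall>x\<in>S. smooth_at M S x f"
  proof
    fix x assume x: "x \<in> S"
    obtain U \<psi> where c: "(U, \<psi>) \<in> atlas M" "x \<in> U" using chart_exists[OF M] S x by blast
    have sm: "smooth_on (\<psi> ` (U \<inter> S)) (f \<circ> inv_into U \<psi>)" using bspec[OF f[unfolded smooth_fun_on_def] c(1)] by simp
    have px: "\<psi> x \<in> \<psi> ` (U \<inter> S)" using c x by blast
    obtain T g where T: "\<psi> x \<in> T" "C_inf_on T g" "\<And>y. y \<in> \<psi> ` (U \<inter> S) \<inter> T \<Longrightarrow> g y = (f \<circ> inv_into U \<psi>) y"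
      by (rule smooth_onE[OF sm px], rule that)
    show "smooth_at M S x f"
    proof (rule smooth_atI[OF c(1)])
      show "openin (mtop M) {y \<in> U. \<psi> y \<in> T}" by (rule chart_preimage_open[OF M c(1) C_inf_on_open[OF T(2)]])
      show "C_inf_on T g" by (rule T)
      show "f y = g (\<psi> y)" if "y \<in> {y \<in> U. \<psi> y \<in> T}" "y \<in> S" for y using T(3)[of "\<psi> y"] that inv_into_f_f[OF chart_inj[OF M c(1)]] by auto
    qed (use c T in auto)
  qed
next
  assume f: "\<forall>x\<in>S. smooth_at M S x f"
  have "smooth_on (\<psi> ` (U \<inter> S)) (f \<circ> inv_into U \<psi>)" if c: "(U, \<psi>) \<in> atlas M" for U \<psi> unfolding smooth_on_iff_C_inf_on
  proof
    fix z assume "z \<in> \<psi> ` (U \<inter> S)"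
    then obtain x where x: "x \<in> U" "x \<in> S" "z = \<psi> x" by blast
    obtain W T g where W: "openin (mtop M) W" "x \<in> W" "W \<subseteq> U" "C_inf_on T g" "\<psi> ` W \<subseteq> T" "\<And>y. y \<in> W \<Longrightarrow> y \<in> S \<Longrightarrow> f y = g (\<psi> y)"
      by (rule smooth_at_chartE[OF M bspec[OF f x(2)] c x(1)], rule that)
    \<comment> \<open>Restricting to \<open>O1\<close> ensures that a point of the chart image comes
      from \<open>W\<close>, where \<open>f\<close> and the extension \<open>g\<close> are known to
      agree.\<close>
    obtain O1 where O1: "open O1" "\<psi> ` W = model M \<inter> O1" using chart_image_open[OF M c W(3,1)] unfolding openin_open by blast
    have inv: "inv_into U \<psi> (\<psi> y) = y" if "y \<in> U" for y using chart_inj[OF M c] that by simp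
    have oT: "open (O1 \<inter> T)" using O1(1) C_inf_on_open[OF W(4)] by (rule open_Int)
    have "g y = (f \<circ> inv_into U \<psi>) y" if "y \<in> \<psi> ` (U \<inter> S) \<inter> (O1 \<inter> T)" for y
    proof -
      from that obtain y' where y': "y' \<in> U" "y' \<in> S" "y = \<psi> y'" "y \<in> O1" by blast
      then have "y \<in> \<psi> ` W" using O1(2) chart_model[OF M c] by auto
      then have "y' \<in> W" using y' W(3) chart_inj[OF M c] by (auto dest: inj_onD)
      then show ?thesis using W(6) y' inv by simp
    qed
    moreover have "z \<in> O1 \<inter> T" using x W O1 by auto
    moreover have "C_inf_on (O1 \<inter> T) g" by (rule C_inf_on_subset[OF W(4) oT]) auto
    ultimately show "\<exists>T g. z \<in> T \<and> C_inf_on T g \<and> (\<forall>y\<in>\<psi> ` (U \<inter> S) \<inter> T. g y = (f \<circ> inv_into U \<psi>) y)" by blast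
  qed
  then show "smooth_fun_on M S f" unfolding smooth_fun_on_def by auto
qed

lemma smooth_functions_iff:
  "smooth_atlas M \<Longrightarrow> f \<in> smooth_functions M \<longleftrightarrow> (\<forall>x\<in>points M. smooth_at M (points M) x f)"
  unfolding smooth_functions_def using smooth_fun_on_iff[of M "points M" f] by simp

lemma smooth_at_mono: "smooth_at M S x f \<Longrightarrow> S' \<subseteq> S \<Longrightarrow> smooth_at M S' x f"
  unfolding smooth_at_def by (elim exE conjE, intro exI conjI) (assumption | auto)+

lemma smooth_at_cong:
  assumes M: "smooth_atlas M" and f: "smooth_at M S x f" and W: "openin (mtop M) W" "x \<in> W"
    and eq: "\<And>y. y \<in> W \<Longrightarrow> y \<in> S' \<Longrightarrow> y \<in> S \<and> g y = f y"
  shows "smooth_at M S' x g"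
proof -
  obtain U \<psi> W0 T h where *: "(U, \<psi>) \<in> atlas M" "openin (mtop M) W0" "x \<in> W0" "W0 \<subseteq> U"
    "C_inf_on T h" "\<psi> ` W0 \<subseteq> T" "\<And>y. y \<in> W0 \<Longrightarrow> y \<in> S \<Longrightarrow> f y = h (\<psi> y)" by (rule smooth_atE[OF f], rule that)
  show ?thesis by (rule smooth_atI[OF *(1) openin_Int[OF *(2) W(1)] _ _ *(5)]) (use * W eq in auto)
qed

lemma smooth_at_compose:
  assumes M: "smooth_atlas M" and e: "smooth_at M S x \<eta>" and x: "x \<in> S" and h: "C_inf_on T h" "\<eta> x \<in> T"
    and W: "openin (mtop M) W" "x \<in> W" and eq: "\<And>y. y \<in> W \<Longrightarrow> y \<in> S \<Longrightarrow> f y = h (\<eta> y)"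
  shows "smooth_at M S x f"
proof -
  obtain U \<psi> W0 T0 g where *: "(U, \<psi>) \<in> atlas M" "openin (mtop M) W0" "x \<in> W0" "W0 \<subseteq> U"
    "C_inf_on T0 g" "\<psi> ` W0 \<subseteq> T0" "\<And>y. y \<in> W0 \<Longrightarrow> y \<in> S \<Longrightarrow> \<eta> y = g (\<psi> y)" by (rule smooth_atE[OF e], rule that)
  define T1 where "T1 = {z \<in> T0. g z \<in> T}"
  have oT1: "open T1" unfolding T1_def using *(5) C_inf_on_open[OF h(1)] by (rule C_inf_on_preimage)
  show ?thesis
  proof (rule smooth_atI[OF *(1)])
    show "openin (mtop M) (W0 \<inter> W \<inter> {y \<in> U. \<psi> y \<in> T1})" by (intro openin_Int *(2) W(1) chart_preimage_open[OF M *(1)] oT1)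
    show "C_inf_on T1 (\<lambda>z. h (g z))" by (rule C_inf_on_compose[OF C_inf_on_subset[OF *(5) oT1] h(1)]) (auto simp: T1_def)
    show "x \<in> W0 \<inter> W \<inter> {y \<in> U. \<psi> y \<in> T1}" using *(3,4,6) *(7)[of x] x h(2) W(2) by (auto simp: T1_def)
    show "f y = h (g (\<psi> y))" if "y \<in> W0 \<inter> W \<inter> {y \<in> U. \<psi> y \<in> T1}" "y \<in> S" for y using that eq *(7) by auto
  qed auto
qed

lemma smooth_at_Pair:
  assumes M: "smooth_atlas M" and f: "smooth_at M S x f" and g: "smooth_at M S x g"
  shows "smooth_at M S x (\<lambda>y. (f y, g y))"
proof -
  obtain U \<psi> W0 T0 f' where *: "(U, \<psi>) \<in> atlas M" "openin (mtop M) W0" "x \<in> W0" "W0 \<subseteq> U"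
    "C_inf_on T0 f'" "\<psi> ` W0 \<subseteq> T0" "\<And>y. y \<in> W0 \<Longrightarrow> y \<in> S \<Longrightarrow> f y = f' (\<psi> y)" by (rule smooth_atE[OF f], rule that)
  have xU: "x \<in> U" using * by auto
  obtain W1 T1 g' where **: "openin (mtop M) W1" "x \<in> W1" "W1 \<subseteq> U" "C_inf_on T1 g'" "\<psi> ` W1 \<subseteq> T1"
    "\<And>y. y \<in> W1 \<Longrightarrow> y \<in> S \<Longrightarrow> g y = g' (\<psi> y)" by (rule smooth_at_chartE[OF M g *(1) xU], rule that)
  have o: "open (T0 \<inter> T1)" using C_inf_on_open[OF *(5)] C_inf_on_open[OF **(4)] by blast
  show ?thesis by (rule smooth_atI[OF *(1) openin_Int[OF *(2) **(1)] _ _ C_inf_on_Pair[OF C_inf_on_subset[OF *(5) o] C_inf_on_subset[OF **(4) o]]]) (use * ** in auto)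
qed

lemma smooth_at_const:
  assumes "smooth_atlas M" "x \<in> points M" shows "smooth_at M S x (\<lambda>y. c)"
proof -
  obtain U \<phi> where c: "(U, \<phi>) \<in> atlas M" "x \<in> U" using chart_exists[OF assms] by blast
  show ?thesis by (rule smooth_atI[OF c(1) chart_open[OF assms(1) c(1)] c(2) subset_refl C_inf_on_const[OF open_UNIV]]) auto
qed

lemma smooth_at_points:
  assumes "smooth_at M S x f" shows "x \<in> points M"
proof -
  obtain W where "openin (mtop M) W" "x \<in> W" by (rule smooth_atE[OF assms], rule that)
  then show ?thesis using openin_subset by blast
qed

lemma smooth_at_map:
  assumes "smooth_atlas M" "smooth_at M S x \<eta>" "x \<in> S" "C_inf_on UNIV h"
  shows "smooth_at M S x (\<lambda>y. h (\<eta> y))" by (rule smooth_at_compose[OF assms UNIV_I openin_topspace smooth_at_points[OF assms(2)]]) simp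

lemma smooth_at_linear:
  "smooth_atlas M \<Longrightarrow> smooth_at M S x \<eta> \<Longrightarrow> x \<in> S \<Longrightarrow> bounded_linear h \<Longrightarrow> smooth_at M S x (\<lambda>y. h (\<eta> y))"
  by (rule smooth_at_map) (auto intro: C_inf_on_bounded_linear)

lemma smooth_at_binop:
  assumes "smooth_atlas M" "smooth_at M S x f" "smooth_at M S x g" "x \<in> S" "C_inf_on UNIV (\<lambda>z. h (fst z) (snd z))"
  shows "smooth_at M S x (\<lambda>y. h (f y) (g y))" using smooth_at_map[OF assms(1) smooth_at_Pair[OF assms(1-3)] assms(4,5)] by simp

lemma smooth_at_add: "smooth_atlas M \<Longrightarrow> smooth_at M S x f \<Longrightarrow> smooth_at M S x g \<Longrightarrow> x \<in> S \<Longrightarrow> smooth_at M S x (\<lambda>y. f y + g y)"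
  by (rule smooth_at_binop[where h = "(+)"])
    (assumption | intro C_inf_on_add C_inf_on_bounded_linear bounded_linear_fst bounded_linear_snd open_UNIV)+

lemma smooth_at_bilinear:
  "smooth_atlas M \<Longrightarrow> bounded_bilinear h \<Longrightarrow> smooth_at M S x f \<Longrightarrow> smooth_at M S x g \<Longrightarrow> x \<in> S \<Longrightarrow> smooth_at M S x (\<lambda>y. h (f y) (g y))"
  by (rule smooth_at_binop[where h = h])
    (assumption | rule C_inf_on_bilinear C_inf_on_bounded_linear bounded_linear_fst bounded_linear_snd open_UNIV)+

lemma smooth_at_sum:
  "smooth_atlas M \<Longrightarrow> x \<in> S \<Longrightarrow> x \<in> points M \<Longrightarrow> (\<And>i. i \<in> I \<Longrightarrow> smooth_at M S x (f i)) \<Longrightarrow> smooth_at M S x (\<lambda>y. \<Sum>i\<in>I. f i y)"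
  by (induction I rule: infinite_finite_induct) (auto intro: smooth_at_const smooth_at_add)

lemma smooth_at_componentwise:
  assumes "smooth_atlas M" "x \<in> S" "x \<in> points M" "\<And>b. b \<in> Basis \<Longrightarrow> smooth_at M S x (\<lambda>y. f y \<bullet> b)"
  shows "smooth_at M S x f"
proof -
  have "smooth_at M S x (\<lambda>y. \<Sum>b\<in>Basis. (f y \<bullet> b) *\<^sub>R b)"
    by (intro smooth_at_sum assms smooth_at_bilinear[OF _ bounded_bilinear_scaleR] smooth_at_const)
  then show ?thesis by (simp add: euclidean_representation)
qed

lemma smooth_at_preimage_open:
  assumes M: "smooth_atlas M" and f: "\<And>x. x \<in> S \<Longrightarrow> smooth_at M S x f" and S: "openin (mtop M) S" and T: "open T"
  shows "openin (mtop M) {x \<in> S. f x \<in> T}"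
proof (subst openin_subopen, rule ballI)
  fix x assume x: "x \<in> {x \<in> S. f x \<in> T}"
  then obtain U \<psi> W T0 g where *: "(U, \<psi>) \<in> atlas M" "openin (mtop M) W" "x \<in> W" "W \<subseteq> U"
    "C_inf_on T0 g" "\<psi> ` W \<subseteq> T0" "\<And>y. y \<in> W \<Longrightarrow> y \<in> S \<Longrightarrow> f y = g (\<psi> y)" using smooth_atE[OF f[of x]] by blast
  have "openin (mtop M) (S \<inter> W \<inter> {y \<in> U. \<psi> y \<in> {z \<in> T0. g z \<in> T}})"
    by (intro openin_Int S *(2) chart_preimage_open[OF M *(1)] C_inf_on_preimage[OF *(5) T])
  moreover have "x \<in> S \<inter> W \<inter> {y \<in> U. \<psi> y \<in> {z \<in> T0. g z \<in> T}}" using x * by auto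
  moreover have "S \<inter> W \<inter> {y \<in> U. \<psi> y \<in> {z \<in> T0. g z \<in> T}} \<subseteq> {x \<in> S. f x \<in> T}" using *(7) by auto
  ultimately show "\<exists>T'. openin (mtop M) T' \<and> x \<in> T' \<and> T' \<subseteq> {x \<in> S. f x \<in> T}" by blast
qed

section \<open>Charts and smoothness on the product of a linear space with a manifold\<close>

section \<open>Products with vector spaces\<close>

lemma points_vec_manifold [simp]: "points (vec_manifold E) = E" by (simp add: vec_manifold_def)

lemma smooth_manifold_vec_manifold:
  assumes "subspace E" shows "smooth_manifold (vec_manifold E)"
proof -
  have "second_countable (top_of_set E)"
  proof (rule second_countable_subtopology)
    obtain B :: "'a set set" where B: "countable B" "\<And>C. C \<in> B \<Longrightarrow> open C" "\<And>S. open S \<Longrightarrow> \<exists>U. U \<subseteq> B \<and> S = \<Union>U"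
      using univ_second_countable by blast
    have "\<exists>V\<in>B. x \<in> V \<and> V \<subseteq> U" if "open U" "x \<in> U" for U x
    proof -
      from B(3)[OF that(1)] obtain W where W: "W \<subseteq> B \<and> U = \<Union>W" by (rule exE)
      then show ?thesis using that(2) by auto
    qed
    then show "second_countable (euclidean :: 'a topology)" unfolding second_countable_def using B(1,2) by (intro exI[of _ B]) auto
  qed
  moreover have "homeomorphic_map (subtopology (top_of_set E) E) (top_of_set E) id" by (simp add: subtopology_subtopology homeomorphic_map_id)
  moreover have "smooth_on E (inv_into E id)" by (rule smooth_on_C_inf_on[OF C_inf_on_id[OF open_UNIV]]) (auto simp: inv_into_def)
  ultimately show ?thesis using assms by (simp add: smooth_manifold_def vec_manifold_def Hausdorff_space_subtopology Hausdorff_space_euclidean id_def[symmetric])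
qed

lemma openin_prod_rectangleE:
  assumes "openin (prod_topology X Y) W" "(x, y) \<in> W"
  obtains A B where "openin X A" "openin Y B" "x \<in> A" "y \<in> B" "A \<times> B \<subseteq> W"
proof -
  have "\<exists>A B. openin X A \<and> openin Y B \<and> x \<in> A \<and> y \<in> B \<and> A \<times> B \<subseteq> W" using assms unfolding openin_prod_topology_alt by simp
  then show ?thesis by (elim exE conjE) (rule that)
qed

lemma smooth_atlas_prod:
  fixes M :: "('a, 'e::euclidean_space) manifold" and N :: "('b, 'f::euclidean_space) manifold"
  assumes M: "smooth_atlas M" and N: "smooth_atlas N"
  shows "smooth_atlas (prod_manifold M N)"
proof -
  let ?Q = "prod_manifold M N"
  have top: "mtop ?Q = prod_topology (mtop M) (mtop N)" "model ?Q = model M \<times> model N"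
    "atlas ?Q = {(U \<times> V, map_prod \<phi> \<psi>) | U \<phi> V \<psi>. (U, \<phi>) \<in> atlas M \<and> (V, \<psi>) \<in> atlas N}" by (simp_all add: prod_manifold_def)
  have cover: "\<Union> (fst ` atlas ?Q) = points ?Q"
  proof -
    have "\<Union> (fst ` atlas ?Q) = \<Union> (fst ` atlas M) \<times> \<Union> (fst ` atlas N)" unfolding top by (force simp: image_iff)
    then show ?thesis using M N unfolding smooth_atlas_def top by simp
  qed
  have charts: "openin (mtop ?Q) (U \<times> V) \<and> inj_on (map_prod \<phi> \<psi>) (U \<times> V) \<and>
      (\<forall>T. open T \<longrightarrow> openin (mtop ?Q) {x \<in> U \<times> V. map_prod \<phi> \<psi> x \<in> T}) \<and>
      (\<forall>W\<subseteq>U \<times> V. openin (mtop ?Q) W \<longrightarrow> openin (top_of_set (model ?Q)) (map_prod \<phi> \<psi> ` W))"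
    if c: "(U, \<phi>) \<in> atlas M" "(V, \<psi>) \<in> atlas N" for U V \<phi> \<psi>
  proof (intro conjI allI impI)
    show "openin (mtop ?Q) (U \<times> V)" unfolding top openin_prod_Times_iff using chart_open[OF M c(1)] chart_open[OF N c(2)] by simp
    show "inj_on (map_prod \<phi> \<psi>) (U \<times> V)" by (rule map_prod_inj_on[OF chart_inj[OF M c(1)] chart_inj[OF N c(2)]])
    fix T :: "('e \<times> 'f) set" assume T: "open T"
    show "openin (mtop ?Q) {x \<in> U \<times> V. map_prod \<phi> \<psi> x \<in> T}" unfolding top openin_prod_topology_alt
    proof (intro allI impI)
      fix x y assume xy: "(x, y) \<in> {x \<in> U \<times> V. map_prod \<phi> \<psi> x \<in> T}"
      then obtain A B where AB: "open A" "open B" "(\<phi> x, \<psi> y) \<in> A \<times> B" "A \<times> B \<subseteq> T" using T by (auto elim: open_prod_elim)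
      have "openin (mtop M) {x \<in> U. \<phi> x \<in> A}" "openin (mtop N) {x \<in> V. \<psi> x \<in> B}"
        using chart_preimage_open[OF M c(1) AB(1)] chart_preimage_open[OF N c(2) AB(2)] .
      then show "\<exists>A B. openin (mtop M) A \<and> openin (mtop N) B \<and> x \<in> A \<and> y \<in> B \<and> A \<times> B \<subseteq> {x \<in> U \<times> V. map_prod \<phi> \<psi> x \<in> T}"
        by (rule_tac exI[of _ "{x \<in> U. \<phi> x \<in> A}"], rule_tac exI[of _ "{x \<in> V. \<psi> x \<in> B}"]) (use xy AB in auto)
    qed
  next
    fix W assume W: "W \<subseteq> U \<times> V" "openin (mtop ?Q) W"
    show "openin (top_of_set (model ?Q)) (map_prod \<phi> \<psi> ` W)"
    proof (subst openin_subopen, rule ballI)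
      fix z assume "z \<in> map_prod \<phi> \<psi> ` W"
      then obtain x y where xy: "(x, y) \<in> W" "z = (\<phi> x, \<psi> y)" by auto
      obtain A B where AB: "openin (mtop M) A" "openin (mtop N) B" "x \<in> A" "y \<in> B" "A \<times> B \<subseteq> W"
        by (rule openin_prod_rectangleE[OF W(2)[unfolded top] xy(1)], rule that)
      have sub: "A \<subseteq> U" "B \<subseteq> V" using AB W by auto
      have "openin (top_of_set (model M \<times> model N)) (\<phi> ` A \<times> \<psi> ` B)"
        by (intro openin_Times chart_image_open[OF M c(1) sub(1) AB(1)] chart_image_open[OF N c(2) sub(2) AB(2)])
      then show "\<exists>T. openin (top_of_set (model ?Q)) T \<and> z \<in> T \<and> T \<subseteq> map_prod \<phi> \<psi> ` W"
        unfolding top by (intro exI[of _ "\<phi> ` A \<times> \<psi> ` B"]) (use xy AB in force)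
    qed
  qed
  have trans: "smooth_on (map_prod \<phi> \<psi> ` (U \<times> V \<inter> U' \<times> V')) (map_prod \<phi>' \<psi>' \<circ> inv_into (U \<times> V) (map_prod \<phi> \<psi>))"
    if c: "(U, \<phi>) \<in> atlas M" "(V, \<psi>) \<in> atlas N" "(U', \<phi>') \<in> atlas M" "(V', \<psi>') \<in> atlas N" for U V \<phi> \<psi> U' V' \<phi>' \<psi>'
    unfolding smooth_on_iff_C_inf_on
  proof
    fix z assume "z \<in> map_prod \<phi> \<psi> ` (U \<times> V \<inter> U' \<times> V')"
    then obtain x y where xy: "x \<in> U \<inter> U'" "y \<in> V \<inter> V'" "z = (\<phi> x, \<psi> y)" by auto
    have px: "\<phi> x \<in> \<phi> ` (U \<inter> U')" "\<psi> y \<in> \<psi> ` (V \<inter> V')" using xy by auto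
    obtain T1 g1 where 1: "\<phi> x \<in> T1" "C_inf_on T1 g1" "\<And>y. y \<in> \<phi> ` (U \<inter> U') \<inter> T1 \<Longrightarrow> g1 y = (\<phi>' \<circ> inv_into U \<phi>) y"
      by (rule smooth_onE[OF chart_transition[OF M c(1,3)] px(1)], rule that)
    obtain T2 g2 where 2: "\<psi> y \<in> T2" "C_inf_on T2 g2" "\<And>y. y \<in> \<psi> ` (V \<inter> V') \<inter> T2 \<Longrightarrow> g2 y = (\<psi>' \<circ> inv_into V \<psi>) y"
      by (rule smooth_onE[OF chart_transition[OF N c(2,4)] px(2)], rule that)
    have o: "open (T1 \<times> T2)" using C_inf_on_open[OF 1(2)] C_inf_on_open[OF 2(2)] by (rule open_Times)
    have "C_inf_on (T1 \<times> T2) (\<lambda>p. (g1 (fst p), g2 (snd p)))" by (intro C_inf_on_Pair C_inf_on_compose[OF _ 1(2)] C_inf_on_compose[OF _ 2(2)]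
          C_inf_on_bounded_linear[OF o] bounded_linear_fst bounded_linear_snd) auto
    moreover have "(g1 (fst p), g2 (snd p)) = (map_prod \<phi>' \<psi>' \<circ> inv_into (U \<times> V) (map_prod \<phi> \<psi>)) p"
      if p: "p \<in> map_prod \<phi> \<psi> ` (U \<times> V \<inter> U' \<times> V') \<inter> T1 \<times> T2" for p
    proof -
      from p obtain a b where ab: "a \<in> U \<inter> U'" "b \<in> V \<inter> V'" "p = map_prod \<phi> \<psi> (a, b)" "\<phi> a \<in> T1" "\<psi> b \<in> T2" by auto
      have "inv_into (U \<times> V) (map_prod \<phi> \<psi>) p = (a, b)"
        unfolding ab(3) by (rule inv_into_f_f[OF map_prod_inj_on[OF chart_inj[OF M c(1)] chart_inj[OF N c(2)]]]) (use ab in auto)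
      moreover have "g1 (\<phi> a) = \<phi>' a" "g2 (\<psi> b) = \<psi>' b"
        using 1(3)[of "\<phi> a"] 2(3)[of "\<psi> b"] ab inv_into_f_f[OF chart_inj[OF M c(1)], of a] inv_into_f_f[OF chart_inj[OF N c(2)], of b] by auto
      ultimately show ?thesis using ab(3) by simp
    qed
    moreover have "z \<in> T1 \<times> T2" using xy(3) 1(1) 2(1) by simp
    ultimately show "\<exists>T g. z \<in> T \<and> C_inf_on T g \<and> (\<forall>y\<in>map_prod \<phi> \<psi> ` (U \<times> V \<inter> U' \<times> V') \<inter> T. g y = (map_prod \<phi>' \<psi>' \<circ> inv_into (U \<times> V) (map_prod \<phi> \<psi>)) y)"
      by (intro exI[of _ "T1 \<times> T2"] exI[of _ "\<lambda>p. (g1 (fst p), g2 (snd p))"]) simp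
  qed
  show ?thesis unfolding smooth_atlas_def
  proof (intro conjI)
    show "\<Union> (fst ` atlas ?Q) = points ?Q" by (rule cover)
  qed (use charts trans in \<open>auto simp: top(3)\<close>)
qed

lemma smooth_at_vec_prodI:
  fixes K :: "'p::euclidean_space \<times> 'a \<Rightarrow> 'f::euclidean_space"
  assumes "(U, \<psi>) \<in> atlas M" "openin (mtop M) W" "x \<in> W" "W \<subseteq> U"
    and "openin (top_of_set E) A" "p \<in> A" "C_inf_on T g" "\<And>q y. q \<in> A \<Longrightarrow> y \<in> W \<Longrightarrow> (q, \<psi> y) \<in> T"
    and "\<And>q y. q \<in> A \<Longrightarrow> y \<in> W \<Longrightarrow> (q, y) \<in> S \<Longrightarrow> K (q, y) = g (q, \<psi> y)"
  shows "smooth_at (prod_manifold (vec_manifold E) M) S (p, x) K"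
proof (rule smooth_atI[where U = "E \<times> U" and \<psi> = "map_prod id \<psi>" and W = "A \<times> W" and T = T and g = g])
  show "(E \<times> U, map_prod id \<psi>) \<in> atlas (prod_manifold (vec_manifold E) M)" using assms(1) by (auto simp: prod_manifold_def vec_manifold_def)
  show "openin (mtop (prod_manifold (vec_manifold E) M)) (A \<times> W)" using assms(2,5) by (simp add: prod_manifold_def vec_manifold_def openin_prod_Times_iff)
  show "A \<times> W \<subseteq> E \<times> U" using assms(4,5) openin_imp_subset by blast
qed (use assms in auto)

text \<open>The neighbourhood is shrunk to a rectangle, so that parameter and point can be varied
  independently.\<close>

lemma smooth_at_vec_prodE:
  fixes K :: "'p::euclidean_space \<times> 'a \<Rightarrow> 'f::euclidean_space"
  assumes M: "smooth_atlas M" and E: "subspace E" and K: "smooth_at (prod_manifold (vec_manifold E) M) S (p, x) K"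
    and c: "(U, \<psi>) \<in> atlas M" "x \<in> U"
  obtains A W T g where "openin (top_of_set E) A" "p \<in> A" "openin (mtop M) W" "x \<in> W" "W \<subseteq> U" "C_inf_on T g"
    "\<And>q y. q \<in> A \<Longrightarrow> y \<in> W \<Longrightarrow> (q, \<psi> y) \<in> T"
    "\<And>q y. q \<in> A \<Longrightarrow> y \<in> W \<Longrightarrow> (q, y) \<in> S \<Longrightarrow> K (q, y) = g (q, \<psi> y)"
proof -
  have at: "smooth_atlas (prod_manifold (vec_manifold E) M)" by (intro smooth_atlas_prod smooth_manifold_imp_atlas smooth_manifold_vec_manifold M E)
  have ch: "(E \<times> U, map_prod id \<psi>) \<in> atlas (prod_manifold (vec_manifold E) M)" using c by (auto simp: prod_manifold_def vec_manifold_def)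
  have "(p, x) \<in> E \<times> U" using smooth_at_points[OF K] c by (simp add: prod_manifold_def vec_manifold_def)
  from smooth_at_chartE[OF at K ch this]
  obtain W T g where W: "openin (prod_topology (top_of_set E) (mtop M)) W" "(p, x) \<in> W" "W \<subseteq> E \<times> U" "C_inf_on T g"
      "map_prod id \<psi> ` W \<subseteq> T" "\<And>y. y \<in> W \<Longrightarrow> y \<in> S \<Longrightarrow> K y = g (map_prod id \<psi> y)"
    by (auto simp: prod_manifold_def vec_manifold_def)
  obtain A B where AB: "openin (top_of_set E) A" "openin (mtop M) B" "p \<in> A" "x \<in> B" "A \<times> B \<subseteq> W" by (rule openin_prod_rectangleE[OF W(1,2)], rule that)
  show ?thesis
  proof (rule that[OF AB(1,3,2,4) _ W(4)])
    show "B \<subseteq> U" using AB W by auto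
    show "(q, \<psi> y) \<in> T" if "q \<in> A" "y \<in> B" for q y
    proof -
      have "(q, y) \<in> W" using AB(5) that by blast
      from imageI[OF this, of "map_prod id \<psi>"] show ?thesis using W(5) by auto
    qed
    show "K (q, y) = g (q, \<psi> y)" if "q \<in> A" "y \<in> B" "(q, y) \<in> S" for q y using W(6)[of "(q, y)"] AB that by auto
  qed
qed

section \<open>Global smooth functions with prescribed germs\<close>

section \<open>Local extensions and coordinates\<close>

text \<open>The counterpart of \<open>smooth_functions\<close> for maps into a Euclidean space,
  phrased with the pointwise notion.\<close>

definition smooth_everywhere :: "('a, 'e::euclidean_space) manifold \<Rightarrow> ('a \<Rightarrow> 'f::euclidean_space) \<Rightarrow> bool" where
  "smooth_everywhere M f \<longleftrightarrow> (\<forall>x\<in>points M. smooth_at M (points M) x f)"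

lemma smooth_everywhereD: "smooth_everywhere M f \<Longrightarrow> x \<in> points M \<Longrightarrow> smooth_at M (points M) x f" by (simp add: smooth_everywhere_def)

lemma smooth_everywhere_map:
  "smooth_atlas M \<Longrightarrow> smooth_everywhere M \<eta> \<Longrightarrow> C_inf_on UNIV h \<Longrightarrow> smooth_everywhere M (\<lambda>y. h (\<eta> y))"
  unfolding smooth_everywhere_def by (auto intro: smooth_at_map)

lemma smooth_everywhere_inner: "smooth_atlas M \<Longrightarrow> smooth_everywhere M \<eta> \<Longrightarrow> smooth_everywhere M (\<lambda>y. \<eta> y \<bullet> u)"
  by (rule smooth_everywhere_map) (auto intro: C_inf_on_bounded_linear bounded_linear_inner_left)

lemma smooth_everywhere_bilinear:
  "smooth_atlas M \<Longrightarrow> bounded_bilinear h \<Longrightarrow> smooth_everywhere M f \<Longrightarrow> smooth_everywhere M g \<Longrightarrow> smooth_everywhere M (\<lambda>y. h (f y) (g y))"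
  unfolding smooth_everywhere_def by (auto intro: smooth_at_bilinear)

lemma smooth_everywhere_const: "smooth_atlas M \<Longrightarrow> smooth_everywhere M (\<lambda>y. c)" unfolding smooth_everywhere_def by (auto intro: smooth_at_const)

lemma smooth_everywhere_sum:
  "smooth_atlas M \<Longrightarrow> (\<And>i. i \<in> I \<Longrightarrow> smooth_everywhere M (f i)) \<Longrightarrow> smooth_everywhere M (\<lambda>y. \<Sum>i\<in>I. f i y)"
  unfolding smooth_everywhere_def by (auto intro: smooth_at_sum)

lemma smooth_everywhere_componentwise:
  "smooth_atlas M \<Longrightarrow> (\<And>b. b \<in> Basis \<Longrightarrow> smooth_everywhere M (\<lambda>y. f y \<bullet> b)) \<Longrightarrow> smooth_everywhere M f"
  unfolding smooth_everywhere_def by (auto intro: smooth_at_componentwise)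

lemma smooth_functions_eq: "smooth_atlas M \<Longrightarrow> f \<in> smooth_functions M \<longleftrightarrow> smooth_everywhere M f"
  by (simp add: smooth_functions_iff smooth_everywhere_def)

lemma smooth_functions_combine:
  "smooth_atlas M \<Longrightarrow> f \<in> smooth_functions M \<Longrightarrow> g \<in> smooth_functions M \<Longrightarrow> (\<lambda>y. a * f y + b * g y) \<in> smooth_functions M"
  unfolding smooth_functions_iff by (intro ballI smooth_at_add smooth_at_linear[OF _ _ _ bounded_linear_mult_right]) auto

lemma smooth_functions_mult:
  "smooth_atlas M \<Longrightarrow> f \<in> smooth_functions M \<Longrightarrow> g \<in> smooth_functions M \<Longrightarrow> (\<lambda>y. f y * g y) \<in> smooth_functions M"
  by (simp add: smooth_functions_eq smooth_everywhere_bilinear[OF _ bounded_bilinear_mult])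

lemma smooth_functions_const: "smooth_atlas M \<Longrightarrow> (\<lambda>y. c) \<in> smooth_functions M" by (simp add: smooth_functions_eq smooth_everywhere_const)

lemma smooth_functions_sum:
  "smooth_atlas M \<Longrightarrow> (\<And>i. i \<in> I \<Longrightarrow> f i \<in> smooth_functions M) \<Longrightarrow> (\<lambda>y. \<Sum>i\<in>I. f i y) \<in> smooth_functions M"
  by (simp add: smooth_functions_eq smooth_everywhere_sum)

lemma smooth_functions_cong_points:
  assumes M: "smooth_atlas M" and f: "f \<in> smooth_functions M" and eq: "\<And>x. x \<in> points M \<Longrightarrow> g x = f x"
  shows "g \<in> smooth_functions M" unfolding smooth_functions_iff[OF M]
proof
  fix x assume "x \<in> points M"
  then show "smooth_at M (points M) x g" using smooth_at_cong[OF M _ openin_topspace, of "points M" x f "points M" g] f eq unfolding smooth_functions_iff[OF M] by simp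
qed

lemma smooth_everywhere_preimage_open:
  "smooth_atlas M \<Longrightarrow> smooth_everywhere M f \<Longrightarrow> open T \<Longrightarrow> openin (mtop M) {x \<in> points M. f x \<in> T}"
  unfolding smooth_everywhere_def by (intro smooth_at_preimage_open) auto

text \<open>The part of the chart domain over \<open>C\<close> is compact, hence closed in the
  Hausdorff space \<open>M\<close>, and the function vanishes on the open complement.\<close>

lemma smooth_everywhere_extend_by_zero:
  assumes M: "smooth_manifold M" and c: "(U, \<psi>) \<in> atlas M" and h: "C_inf_on UNIV h"
    and C: "compact C" "C \<inter> model M \<subseteq> \<psi> ` U" "\<And>z. z \<notin> C \<Longrightarrow> h z = 0"
  shows "smooth_everywhere M (\<lambda>y. if y \<in> U then h (\<psi> y) else 0)" unfolding smooth_everywhere_def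
proof
  fix x assume x: "x \<in> points M"
  have at: "smooth_atlas M" using M by (rule smooth_manifold_imp_atlas)
  show "smooth_at M (points M) x (\<lambda>y. if y \<in> U then h (\<psi> y) else 0)"
  proof (cases "x \<in> U")
    case True
    show ?thesis by (rule smooth_atI[OF c chart_open[OF at c] True subset_refl h]) auto
  next
    case False
    define D where "D = {y \<in> U. \<psi> y \<in> C}"
    have hom: "homeomorphic_map (subtopology (mtop M) U) (top_of_set (\<psi> ` U)) \<psi>" using M c unfolding smooth_manifold_def by auto
    have ts: "topspace (subtopology (mtop M) U) = U" using openin_subset[OF chart_open[OF at c]] by auto
    have "\<psi> ` D = C \<inter> model M"
    proof
      show "\<psi> ` D \<subseteq> C \<inter> model M" using chart_model[OF at c] by (auto simp: D_def)
      show "C \<inter> model M \<subseteq> \<psi> ` D" using C(2) by (auto simp: D_def)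
    qed
    moreover have "compact (C \<inter> model M)" using C(1) closed_subspace[OF smooth_manifold_subspace[OF M]] by (rule compact_Int_closed)
    ultimately have "compactin (top_of_set (\<psi> ` U)) (\<psi> ` D)" by (auto simp: compactin_subtopology D_def)
    then have "compactin (subtopology (mtop M) U) D" using homeomorphic_map_compactness_eq[OF hom, of D] ts by (auto simp: D_def)
    then have "compactin (mtop M) D" by (simp add: compactin_subtopology)
    then have "closedin (mtop M) D" using M unfolding smooth_manifold_def by (intro compactin_imp_closedin) auto
    then have "openin (mtop M) (points M - D)" by (rule openin_diff[OF openin_topspace])
    moreover have "x \<in> points M - D" using x False by (simp add: D_def)
    ultimately show ?thesis by (rule smooth_at_cong[OF at smooth_at_const[OF at x, where c = 0]]) (auto simp: D_def C(3))
  qed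
qed

text \<open>Derivations act on functions defined on all of \<open>M\<close>; a cut-off in a chart
  turns a germ into such a function.\<close>

lemma smooth_extension:
  assumes M: "smooth_manifold M" and f: "smooth_at M (points M) x f"
  obtains F W where "smooth_everywhere M F" "openin (mtop M) W" "x \<in> W" "\<And>y. y \<in> W \<Longrightarrow> F y = f y"
proof -
  have at: "smooth_atlas M" using M by (rule smooth_manifold_imp_atlas)
  obtain U \<psi> W T g where *: "(U, \<psi>) \<in> atlas M" "openin (mtop M) W" "x \<in> W" "W \<subseteq> U" "C_inf_on T g" "\<psi> ` W \<subseteq> T"
    "\<And>y. y \<in> W \<Longrightarrow> y \<in> points M \<Longrightarrow> f y = g (\<psi> y)" by (rule smooth_atE[OF f], rule that)
  obtain O1 where O1: "open O1" "\<psi> ` W = model M \<inter> O1" using chart_image_open[OF at *(1,4,2)] unfolding openin_open by blast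
  have o: "open (T \<inter> O1)" using C_inf_on_open[OF *(5)] O1(1) by (rule open_Int)
  have z: "\<psi> x \<in> T \<inter> O1" using * O1(2) by auto
  obtain r h where h: "0 < r" "cball (\<psi> x) r \<subseteq> T \<inter> O1" "C_inf_on UNIV h" "\<And>z. z \<in> ball (\<psi> x) (r/2) \<Longrightarrow> h z = g z"
    "\<And>z. z \<notin> cball (\<psi> x) r \<Longrightarrow> h z = 0" by (rule C_inf_extend[OF C_inf_on_subset[OF *(5) o Int_lower1] z], rule that)
  show ?thesis
  proof (rule that)
    show "smooth_everywhere M (\<lambda>y. if y \<in> U then h (\<psi> y) else 0)"
      by (rule smooth_everywhere_extend_by_zero[OF M *(1) h(3) compact_cball _ h(5)]) (use h(2) O1(2) *(4) in blast)
    show "openin (mtop M) (W \<inter> {y \<in> U. \<psi> y \<in> ball (\<psi> x) (r/2)})" by (intro openin_Int *(2) chart_preimage_open[OF at *(1)] open_ball)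
    show "x \<in> W \<inter> {y \<in> U. \<psi> y \<in> ball (\<psi> x) (r/2)}" using * h(1) by auto
    show "(if y \<in> U then h (\<psi> y) else 0) = f y" if "y \<in> W \<inter> {y \<in> U. \<psi> y \<in> ball (\<psi> x) (r/2)}" for y
      using that h(4)[of "\<psi> y"] *(7)[of y] openin_subset[OF *(2)] by auto
  qed
qed

lemma smooth_bump:
  assumes M: "smooth_manifold M" and W: "openin (mtop M) W" "x \<in> W"
  obtains \<rho> :: "'a \<Rightarrow> real" where "\<rho> \<in> smooth_functions M" "\<rho> x = 1" "\<And>y. y \<notin> W \<Longrightarrow> \<rho> y = 0"
proof -
  have at: "smooth_atlas M" using M by (rule smooth_manifold_imp_atlas)
  have xM: "x \<in> points M" using W openin_subset by blast
  obtain U \<psi> where c: "(U, \<psi>) \<in> atlas M" "x \<in> U" by (rule chart_exists[OF at xM], rule that)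
  have oWU: "openin (mtop M) (W \<inter> U)" using W(1) chart_open[OF at c(1)] by (rule openin_Int)
  obtain O1 where O1: "open O1" "\<psi> ` (W \<inter> U) = model M \<inter> O1" using chart_image_open[OF at c(1) Int_lower2 oWU] unfolding openin_open by blast
  have z: "\<psi> x \<in> O1" using W c O1(2) by auto
  obtain r h where h: "0 < r" "cball (\<psi> x) r \<subseteq> O1" "C_inf_on UNIV h" "\<And>z. z \<in> ball (\<psi> x) (r/2) \<Longrightarrow> h z = (1::real)"
    "\<And>z. z \<notin> cball (\<psi> x) r \<Longrightarrow> h z = 0" by (rule C_inf_extend[OF C_inf_on_const[OF O1(1)] z], rule that)
  show ?thesis
  proof (rule that)
    show "(\<lambda>y. if y \<in> U then h (\<psi> y) else 0) \<in> smooth_functions M" unfolding smooth_functions_eq[OF at]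
      by (rule smooth_everywhere_extend_by_zero[OF M c(1) h(3) compact_cball _ h(5)]) (use h(2) O1(2) in blast)
    show "(if x \<in> U then h (\<psi> x) else 0) = 1" using c h(1) h(4)[of "\<psi> x"] by simp
    show "(if y \<in> U then h (\<psi> y) else 0) = 0" if y: "y \<notin> W" for y
    proof (cases "y \<in> U")
      case True
      have "\<psi> y \<notin> \<psi> ` (W \<inter> U)" using y True chart_inj[OF at c(1)] by (auto dest: inj_onD)
      then have "\<psi> y \<notin> cball (\<psi> x) r" using O1(2) h(2) chart_model[OF at c(1) True] by auto
      then show ?thesis using h(5) by simp
    qed simp
  qed
qed

text \<open>A globally defined substitute for a chart near \<open>x\<close>, on whose components
  derivations can act. Its values stay in the model because the cut-off only rescales
  vectors.\<close>

lemma smooth_coordinates: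
  assumes M: "smooth_manifold M" and x: "x \<in> points M"
  obtains U \<psi> W th where "(U, \<psi>) \<in> atlas M" "openin (mtop M) W" "x \<in> W" "W \<subseteq> U" "\<And>y. y \<in> W \<Longrightarrow> th y = \<psi> y"
    "\<And>y. th y \<in> model M" "smooth_everywhere M th"
proof -
  have at: "smooth_atlas M" using M by (rule smooth_manifold_imp_atlas)
  note V = smooth_manifold_subspace[OF M]
  obtain U \<psi> where c: "(U, \<psi>) \<in> atlas M" "x \<in> U" by (rule chart_exists[OF at x], rule that)
  obtain O1 where O1: "open O1" "\<psi> ` U = model M \<inter> O1" using chart_image_open[OF at c(1) subset_refl chart_open[OF at c(1)]] unfolding openin_open by blast
  have z: "\<psi> x \<in> O1" using c O1(2) by auto
  obtain r h where h: "0 < r" "cball (\<psi> x) r \<subseteq> O1" "C_inf_on UNIV h" "\<And>z. z \<in> ball (\<psi> x) (r/2) \<Longrightarrow> h z = z"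
    "\<And>z. z \<notin> cball (\<psi> x) r \<Longrightarrow> h z = 0" "\<And>z. \<exists>c. z \<in> O1 \<longrightarrow> h z = c *\<^sub>R z"
    by (rule C_inf_extend[OF C_inf_on_id[OF O1(1)] z], rule that)
  show ?thesis
  proof (rule that)
    show "(U, \<psi>) \<in> atlas M" by (rule c)
    show "openin (mtop M) {y \<in> U. \<psi> y \<in> ball (\<psi> x) (r/2)}" by (intro chart_preimage_open[OF at c(1)] open_ball)
    show "x \<in> {y \<in> U. \<psi> y \<in> ball (\<psi> x) (r/2)}" using c h(1) by auto
    show "(if y \<in> U then h (\<psi> y) else 0) = \<psi> y" if "y \<in> {y \<in> U. \<psi> y \<in> ball (\<psi> x) (r/2)}" for y using that h(4)[of "\<psi> y"] by simp
    show "(if y \<in> U then h (\<psi> y) else 0) \<in> model M" for y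
    proof (cases "y \<in> U")
      case True
      then have "\<psi> y \<in> O1" "\<psi> y \<in> model M" using O1(2) by auto
      then show ?thesis using h(6)[of "\<psi> y"] True subspace_scale[OF V] by auto
    qed (simp add: subspace_0[OF V])
    show "smooth_everywhere M (\<lambda>y. if y \<in> U then h (\<psi> y) else 0)"
      by (rule smooth_everywhere_extend_by_zero[OF M c(1) h(3) compact_cball _ h(5)]) (use h(2) O1(2) in blast)
  qed auto
qed

section \<open>Derivations at a point, the chain rule, and covectors as differentials\<close>

section \<open>Tangent vectors and covectors\<close>

lemma tangent_linear:
  "v \<in> tangent_space M x \<Longrightarrow> f \<in> smooth_functions M \<Longrightarrow> g \<in> smooth_functions M \<Longrightarrow>
    v (\<lambda>y. a * f y + b * g y) = a * v f + b * v g" unfolding tangent_space_def by simp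

lemma tangent_leibniz:
  "v \<in> tangent_space M x \<Longrightarrow> f \<in> smooth_functions M \<Longrightarrow> g \<in> smooth_functions M \<Longrightarrow>
    v (\<lambda>y. f y * g y) = f x * v g + g x * v f" unfolding tangent_space_def by simp

lemma tangent_not_smooth: "v \<in> tangent_space M x \<Longrightarrow> f \<notin> smooth_functions M \<Longrightarrow> v f = 0" unfolding tangent_space_def by simp

lemma tangent_add:
  "v \<in> tangent_space M x \<Longrightarrow> f \<in> smooth_functions M \<Longrightarrow> g \<in> smooth_functions M \<Longrightarrow> v (\<lambda>y. f y + g y) = v f + v g"
  using tangent_linear[of v M x f g 1 1] by simp

lemma tangent_const:
  assumes "smooth_atlas M" "v \<in> tangent_space M x" shows "v (\<lambda>y. c) = 0"
proof -
  note s = smooth_functions_const[OF assms(1)]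
  have "v (\<lambda>y. 1) = 0" using tangent_leibniz[OF assms(2) s s, of 1 1] by simp
  then show ?thesis using tangent_linear[OF assms(2) s s, of c 1 0 1] by simp
qed

lemma tangent_scale:
  assumes "smooth_atlas M" "v \<in> tangent_space M x" "f \<in> smooth_functions M"
  shows "v (\<lambda>y. c * f y) = c * v f" using tangent_linear[OF assms(2,3,3), of c 0] by simp

lemma tangent_sum:
  assumes "smooth_atlas M" "v \<in> tangent_space M x" "\<And>i. i \<in> I \<Longrightarrow> f i \<in> smooth_functions M"
  shows "v (\<lambda>y. \<Sum>i\<in>I. f i y) = (\<Sum>i\<in>I. v (f i))" using assms(3) by (induction I rule: infinite_finite_induct)
    (auto simp: tangent_const[OF assms(1,2)] tangent_add[OF assms(2)] smooth_functions_sum[OF assms(1)])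

text \<open>A bump function that is 1 at \<open>x\<close> and zero off \<open>W\<close> annihilates
  \<open>f - g\<close>. In Leibniz's rule at \<open>x\<close> the term with the derivative of the
  bump drops out, and what remains is \<open>v\<close> on \<open>f - g\<close>.\<close>

lemma tangent_local:
  assumes M: "smooth_manifold M" and v: "v \<in> tangent_space M x" and fg: "f \<in> smooth_functions M" "g \<in> smooth_functions M"
    and W: "openin (mtop M) W" "x \<in> W" and eq: "\<And>y. y \<in> W \<Longrightarrow> f y = g y"
  shows "v f = v g"
proof -
  have at: "smooth_atlas M" using M by (rule smooth_manifold_imp_atlas)
  obtain \<rho> :: "'a \<Rightarrow> real" where \<rho>: "\<rho> \<in> smooth_functions M" "\<rho> x = 1" "\<And>y. y \<notin> W \<Longrightarrow> \<rho> y = 0"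
    by (rule smooth_bump[OF M W], rule that)
  define d where "d y = 1 * f y + (-1) * g y" for y
  have d: "d \<in> smooth_functions M" unfolding d_def by (rule smooth_functions_combine[OF at fg])
  have "(\<lambda>y. \<rho> y * d y) = (\<lambda>y. 0)"
  proof
    fix y show "\<rho> y * d y = 0" using \<rho>(3)[of y] eq[of y] by (cases "y \<in> W") (auto simp: d_def)
  qed
  then have "0 = \<rho> x * v d + d x * v \<rho>" using tangent_leibniz[OF v \<rho>(1) d] tangent_const[OF at v, of 0] by simp
  then have "v d = 0" using \<rho>(2) eq[OF W(2)] by (simp add: d_def)
  then show ?thesis using tangent_linear[OF v fg, of 1 "-1"] by (simp add: d_def[abs_def])
qed

text \<open>The differential of the vector-valued map \<eta> applied to the derivation
  \<open>v\<close>.\<close>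

definition vec_apply :: "(('a \<Rightarrow> real) \<Rightarrow> real) \<Rightarrow> ('a \<Rightarrow> 'f::euclidean_space) \<Rightarrow> 'f" where
  "vec_apply v \<eta> = (\<Sum>b\<in>Basis. v (\<lambda>y. \<eta> y \<bullet> b) *\<^sub>R b)"

lemma vec_apply_inner_Basis: "b \<in> Basis \<Longrightarrow> vec_apply v \<eta> \<bullet> b = v (\<lambda>y. \<eta> y \<bullet> b)"
  by (simp add: vec_apply_def inner_sum_left inner_Basis if_distrib cong: if_cong)

text \<open>Hadamard's lemma writes the composite as a constant plus products of the centred
  components of \<eta> with smooth functions. The centred components vanish at \<open>x\<close>, so
  Leibniz's rule keeps only the values of the other factors there, which are the partial derivatives
  of \<open>g\<close>.\<close>

lemma tangent_chain:
  fixes \<eta> :: "'a \<Rightarrow> 'f::euclidean_space"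
  assumes M: "smooth_manifold M" and v: "v \<in> tangent_space M x" and x: "x \<in> points M" and e: "smooth_everywhere M \<eta>"
    and f: "f \<in> smooth_functions M" and g: "C_inf_on T g" "\<eta> x \<in> T"
    and W: "openin (mtop M) W" "x \<in> W" and eq: "\<And>y. y \<in> W \<Longrightarrow> f y = g (\<eta> y)"
  shows "v f = fderiv g (\<eta> x) (vec_apply v \<eta>)"
proof -
  have at: "smooth_atlas M" using M by (rule smooth_manifold_imp_atlas)
  obtain r h where h: "0 < r" "cball (\<eta> x) r \<subseteq> T" "C_inf_on UNIV h" "\<And>z. z \<in> ball (\<eta> x) (r/2) \<Longrightarrow> h z = g z"
    by (rule C_inf_extend[OF g], rule that)
  have eb: "(\<lambda>y. \<eta> y \<bullet> b) \<in> smooth_functions M" for b unfolding smooth_functions_eq[OF at] by (rule smooth_everywhere_inner[OF at e])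
  have hf: "(\<lambda>y. h (\<eta> y)) \<in> smooth_functions M" unfolding smooth_functions_eq[OF at] by (rule smooth_everywhere_map[OF at e h(3)])
  have "v f = v (\<lambda>y. h (\<eta> y))" by (rule tangent_local[OF M v f hf openin_Int[OF W(1) smooth_everywhere_preimage_open[OF at e open_ball[of "\<eta> x" "r/2"]]]])
      (use W x h(1) h(4) eq in auto)
  also have "\<dots> = fderiv h (\<eta> x) (vec_apply v \<eta>)"
  proof -
    obtain G where G: "\<And>b. C_inf_on UNIV (G b)" "\<And>b. G b (\<eta> x) = fderiv h (\<eta> x) b"
      "\<And>z. h z = h (\<eta> x) + (\<Sum>b\<in>Basis. ((z - \<eta> x) \<bullet> b) * G b z)" by (rule hadamard[OF h(3), of "\<eta> x"], rule that)
    define k where "k b y = 1 * (\<eta> y \<bullet> b) + (- 1) * (\<eta> x \<bullet> b)" for b y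
    have ks: "k b \<in> smooth_functions M" for b unfolding k_def by (rule smooth_functions_combine[OF at eb smooth_functions_const[OF at]])
    have vk: "v (k b) = v (\<lambda>y. \<eta> y \<bullet> b)" for b
      using tangent_linear[OF v eb smooth_functions_const[OF at, of "\<eta> x \<bullet> b"], of 1 b "-1"] tangent_const[OF at v] by (simp add: k_def[abs_def])
    have Gs: "(\<lambda>y. G b (\<eta> y)) \<in> smooth_functions M" for b unfolding smooth_functions_eq[OF at] by (rule smooth_everywhere_map[OF at e G(1)])
    have "v (\<lambda>y. h (\<eta> y)) = v (\<lambda>y. h (\<eta> x) + (\<Sum>b\<in>Basis. k b y * G b (\<eta> y)))" by (subst G(3)) (simp add: k_def inner_diff_left)
    also have "\<dots> = (\<Sum>b\<in>Basis. v (\<lambda>y. k b y * G b (\<eta> y)))"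
      by (simp add: tangent_add[OF v] smooth_functions_const[OF at] smooth_functions_sum[OF at] smooth_functions_mult[OF at ks Gs]
          tangent_const[OF at v] tangent_sum[OF at v])
    also have "\<dots> = (\<Sum>b\<in>Basis. v (\<lambda>y. \<eta> y \<bullet> b) * fderiv h (\<eta> x) b)"
      by (simp add: tangent_leibniz[OF v ks Gs] vk G(2)) (simp add: k_def mult.commute)
    also have "\<dots> = fderiv h (\<eta> x) (vec_apply v \<eta>)" using has_derivative_linear[OF C_inf_on_has_derivative[OF h(3) UNIV_I]]
      by (simp add: vec_apply_def linear_sum linear_cmul)
    finally show ?thesis .
  qed
  also have "fderiv h (\<eta> x) = fderiv g (\<eta> x)"
  proof -
    have "(g has_derivative fderiv h (\<eta> x)) (at (\<eta> x))"
      by (rule has_derivative_transform_within_open[OF C_inf_on_has_derivative[OF h(3) UNIV_I] open_ball[of "\<eta> x" "r/2"]]) (use h(1,4) in auto)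
    from frechet_derivative_at[OF this] show ?thesis .
  qed
  finally show ?thesis .
qed

lemma vec_apply_chain:
  fixes \<eta> :: "'a \<Rightarrow> 'f::euclidean_space" and f :: "'a \<Rightarrow> 'h::euclidean_space"
  assumes M: "smooth_manifold M" and v: "v \<in> tangent_space M x" and x: "x \<in> points M" and e: "smooth_everywhere M \<eta>"
    and f: "smooth_everywhere M f" and g: "C_inf_on T g" "\<eta> x \<in> T"
    and W: "openin (mtop M) W" "x \<in> W" and eq: "\<And>y. y \<in> W \<Longrightarrow> f y = g (\<eta> y)"
  shows "vec_apply v f = fderiv g (\<eta> x) (vec_apply v \<eta>)"
proof (rule euclidean_eqI)
  fix b :: 'h assume b: "b \<in> Basis"
  have at: "smooth_atlas M" using M by (rule smooth_manifold_imp_atlas)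
  have "vec_apply v f \<bullet> b = v (\<lambda>y. f y \<bullet> b)" using b by (rule vec_apply_inner_Basis)
  also have "\<dots> = fderiv (\<lambda>z. g z \<bullet> b) (\<eta> x) (vec_apply v \<eta>)" by (rule tangent_chain[OF M v x e _ C_inf_on_inner[OF g(1)] g(2) W])
      (use eq smooth_everywhere_inner[OF at f] in \<open>auto simp: smooth_functions_eq[OF at]\<close>)
  also have "\<dots> = fderiv g (\<eta> x) (vec_apply v \<eta>) \<bullet> b"
    using frechet_derivative_at[OF has_derivative_inner_left[OF C_inf_on_has_derivative[OF g], of b]] by metis
  finally show "vec_apply v f \<bullet> b = fderiv g (\<eta> x) (vec_apply v \<eta>) \<bullet> b" .
qed

lemma vec_apply_linear:
  fixes \<eta> :: "'a \<Rightarrow> 'f::euclidean_space" and L :: "'f \<Rightarrow> 'h::euclidean_space"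
  assumes M: "smooth_manifold M" and v: "v \<in> tangent_space M x" and x: "x \<in> points M" and e: "smooth_everywhere M \<eta>"
    and L: "linear L"
  shows "vec_apply v (\<lambda>y. L (\<eta> y)) = L (vec_apply v \<eta>)"
proof -
  have at: "smooth_atlas M" using M by (rule smooth_manifold_imp_atlas)
  have LC: "C_inf_on UNIV L" by (rule C_inf_on_linear[OF open_UNIV L])
  have "fderiv L (\<eta> x) = L" by (rule frechet_derivative_at[symmetric], rule bounded_linear_imp_has_derivative) (use L in \<open>simp add: linear_conv_bounded_linear\<close>)
  then show ?thesis using vec_apply_chain[OF M v x e smooth_everywhere_map[OF at e LC] LC UNIV_I openin_topspace x refl] by simp
qed

lemma linear_projection_exists:
  fixes V :: "'e::euclidean_space set"
  assumes "subspace V"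
  obtains \<pi> where "linear \<pi>" "\<And>x. \<pi> x \<in> V" "\<And>x. x \<in> V \<Longrightarrow> \<pi> x = x"
proof -
  obtain B where B: "B \<subseteq> V" "pairwise orthogonal B" "\<And>x. x \<in> B \<Longrightarrow> norm x = 1" "independent B" "span B = V"
    using orthonormal_basis_subspace[OF assms] by metis
  define \<pi> where "\<pi> x = (\<Sum>b\<in>B. (x \<bullet> b) *\<^sub>R b)" for x
  have fin: "finite B" using B(4) by (rule independent_imp_finite)
  show ?thesis
  proof (rule that[of \<pi>])
    show "linear \<pi>" unfolding \<pi>_def by (rule linearI) (auto simp: inner_add_left scaleR_add_left sum.distrib scaleR_sum_right)
    show "\<pi> x \<in> V" for x unfolding \<pi>_def using B(1) by (intro subspace_sum[OF assms] subspace_scale[OF assms]) auto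
    show "\<pi> x = x" if "x \<in> V" for x unfolding \<pi>_def using orthonormal_basis_expand[OF B(2,3) _ fin] that B(5) by simp
  qed
qed

text \<open>A linear projection onto \<open>V\<close> fixes \<eta>, and it commutes with the action
  of \<open>v\<close>.\<close>

lemma vec_apply_in_subspace:
  assumes M: "smooth_manifold M" and v: "v \<in> tangent_space M x" and x: "x \<in> points M" and e: "smooth_everywhere M \<eta>"
    and V: "subspace V" "\<And>y. \<eta> y \<in> V"
  shows "vec_apply v \<eta> \<in> V"
proof -
  obtain \<pi> where \<pi>: "linear \<pi>" "\<And>x. \<pi> x \<in> V" "\<And>x. x \<in> V \<Longrightarrow> \<pi> x = x" by (rule linear_projection_exists[OF V(1)], rule that)
  have "(\<lambda>y. \<pi> (\<eta> y)) = \<eta>" using \<pi>(3) V(2) by auto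
  then have "vec_apply v \<eta> = \<pi> (vec_apply v \<eta>)" using vec_apply_linear[OF M v x e \<pi>(1)] by simp
  then show ?thesis using \<pi>(2) by metis
qed

lemma vec_apply_inner:
  assumes M: "smooth_manifold M" and v: "v \<in> tangent_space M x" and e: "smooth_everywhere M \<eta>"
  shows "vec_apply v \<eta> \<bullet> u = v (\<lambda>y. \<eta> y \<bullet> u)"
proof -
  have at: "smooth_atlas M" using M by (rule smooth_manifold_imp_atlas)
  have eb: "(\<lambda>y. \<eta> y \<bullet> b) \<in> smooth_functions M" for b unfolding smooth_functions_eq[OF at] by (rule smooth_everywhere_inner[OF at e])
  have cs: "(\<lambda>y. (u \<bullet> b) * (\<eta> y \<bullet> b)) \<in> smooth_functions M" for b using smooth_functions_mult[OF at smooth_functions_const[OF at] eb] .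
  have "(\<lambda>y. \<eta> y \<bullet> u) = (\<lambda>y. \<Sum>b\<in>Basis. (u \<bullet> b) * (\<eta> y \<bullet> b))"
    by (rule ext, subst euclidean_inner) (simp add: mult.commute)
  then have "v (\<lambda>y. \<eta> y \<bullet> u) = (\<Sum>b\<in>Basis. (u \<bullet> b) * v (\<lambda>y. \<eta> y \<bullet> b))"
    by (simp add: tangent_sum[OF at v cs] tangent_scale[OF at v eb])
  then show ?thesis by (simp only: vec_apply_def inner_sum_left inner_scaleR_left) (simp add: inner_commute mult.commute)
qed

lemma vec_apply_Pair:
  "vec_apply v (\<lambda>y. (f y, g y)) = (vec_apply v f, vec_apply v g)"
proof (rule euclidean_eqI)
  fix b :: "'a \<times> 'b" assume b: "b \<in> Basis"
  then show "vec_apply v (\<lambda>y. (f y, g y)) \<bullet> b = (vec_apply v f, vec_apply v g) \<bullet> b"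
    by (subst vec_apply_inner_Basis[OF b]) (auto simp: Basis_prod_def vec_apply_inner_Basis)
qed

text \<open>The coordinate vector at \<open>x\<close> in direction \<open>w\<close>. The value 0 on
  functions that are not smooth follows the convention of \<open>tangent_space\<close>.\<close>

definition chart_direction ::
    "('a, 'e::euclidean_space) manifold \<Rightarrow> 'a set \<Rightarrow> ('a \<Rightarrow> 'e) \<Rightarrow> 'a \<Rightarrow> 'e \<Rightarrow> (('a \<Rightarrow> real) \<Rightarrow> real)" where
  "chart_direction M U \<psi> x w = (\<lambda>f. if f \<in> smooth_functions M then deriv (\<lambda>t. f (inv_into U \<psi> (\<psi> x + t *\<^sub>R w))) 0 else 0)"

lemma chart_direction_deriv:
  assumes M: "smooth_manifold M" and c: "(U, \<psi>) \<in> atlas M" and w: "w \<in> model M"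
    and W: "openin (mtop M) W" "x \<in> W" "W \<subseteq> U" and g: "C_inf_on T g" "\<psi> ` W \<subseteq> T" and f: "\<And>y. y \<in> W \<Longrightarrow> f y = g (\<psi> y)"
  shows "((\<lambda>t. f (inv_into U \<psi> (\<psi> x + t *\<^sub>R w))) has_real_derivative fderiv g (\<psi> x) w) (at 0)"
proof -
  have at: "smooth_atlas M" using M by (rule smooth_manifold_imp_atlas)
  note V = smooth_manifold_subspace[OF M]
  obtain O1 where O1: "open O1" "\<psi> ` W = model M \<inter> O1" using chart_image_open[OF at c W(3,1)] unfolding openin_open by blast
  have "\<psi> x \<in> T" using W g by auto
  then have "\<psi> x + 0 *\<^sub>R w \<in> T" by simp
  from has_vector_derivative_line[OF C_inf_on_has_derivative[OF g(1) this]]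
  have 1: "((\<lambda>t. g (\<psi> x + t *\<^sub>R w)) has_real_derivative fderiv g (\<psi> x) w) (at 0)" by (simp add: has_real_derivative_iff_has_vector_derivative)
  have 2: "open {t. \<psi> x + t *\<^sub>R w \<in> O1}"
    using continuous_open_vimage[OF O1(1), of "\<lambda>t. \<psi> x + t *\<^sub>R w"] by (auto simp: vimage_def intro!: continuous_intros)
  show ?thesis
  proof (rule has_field_derivative_transform_within_open[OF 1 2])
    show "0 \<in> {t. \<psi> x + t *\<^sub>R w \<in> O1}" using W O1(2) by auto
    fix t assume "t \<in> {t. \<psi> x + t *\<^sub>R w \<in> O1}"
    moreover have "\<psi> x \<in> model M" using chart_model[OF at c] W by auto
    ultimately have "\<psi> x + t *\<^sub>R w \<in> \<psi> ` W" unfolding O1(2) using w V by (auto intro: subspace_add subspace_scale)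
    then obtain y where y: "y \<in> W" "\<psi> x + t *\<^sub>R w = \<psi> y" by auto
    have "inv_into U \<psi> (\<psi> y) = y" using inv_into_f_f[OF chart_inj[OF at c]] y W by auto
    then show "g (\<psi> x + t *\<^sub>R w) = f (inv_into U \<psi> (\<psi> x + t *\<^sub>R w))" using f[OF y(1)] y(2) by simp
  qed
qed

lemma chart_direction_eq:
  assumes M: "smooth_manifold M" and c: "(U, \<psi>) \<in> atlas M" and w: "w \<in> model M"
    and W: "openin (mtop M) W" "x \<in> W" "W \<subseteq> U" and g: "C_inf_on T g" "\<psi> ` W \<subseteq> T" and f: "\<And>y. y \<in> W \<Longrightarrow> f y = g (\<psi> y)"
    and fs: "f \<in> smooth_functions M"
  shows "chart_direction M U \<psi> x w f = fderiv g (\<psi> x) w" using DERIV_imp_deriv[OF chart_direction_deriv[OF M c w W g f]] fs by (simp add: chart_direction_def)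

lemma chart_direction_tangent:
  assumes M: "smooth_manifold M" and c: "(U, \<psi>) \<in> atlas M" and w: "w \<in> model M" and x: "x \<in> U"
  shows "chart_direction M U \<psi> x w \<in> tangent_space M x"
proof -
  have at: "smooth_atlas M" using M by (rule smooth_manifold_imp_atlas)
  have xM: "x \<in> points M" using x openin_subset[OF chart_open[OF at c]] by auto
  have d: "((\<lambda>t. f (inv_into U \<psi> (\<psi> x + t *\<^sub>R w))) has_real_derivative chart_direction M U \<psi> x w f) (at 0)" if f: "f \<in> smooth_functions M" for f
  proof -
    have fx: "smooth_at M (points M) x f" using f xM unfolding smooth_functions_iff[OF at] by blast
    obtain W T g where W: "openin (mtop M) W" "x \<in> W" "W \<subseteq> U" "C_inf_on T g" "\<psi> ` W \<subseteq> T" "\<And>y. y \<in> W \<Longrightarrow> y \<in> points M \<Longrightarrow> f y = g (\<psi> y)"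
      by (rule smooth_at_chartE[OF at fx c x], rule that)
    have eq: "f y = g (\<psi> y)" if "y \<in> W" for y using W(6) that openin_subset[OF W(1)] by auto
    show ?thesis using chart_direction_deriv[OF M c w W(1-5) eq] chart_direction_eq[OF M c w W(1-5) eq f] by simp
  qed
  have inv: "inv_into U \<psi> (\<psi> x) = x" using inv_into_f_f[OF chart_inj[OF at c] x] .
  show ?thesis unfolding tangent_space_def
  proof (intro CollectI conjI ballI allI impI)
    fix f g a b assume f: "f \<in> smooth_functions M" and g: "g \<in> smooth_functions M"
    have "((\<lambda>t. a * f (inv_into U \<psi> (\<psi> x + t *\<^sub>R w)) + b * g (inv_into U \<psi> (\<psi> x + t *\<^sub>R w))) has_real_derivative
        a * chart_direction M U \<psi> x w f + b * chart_direction M U \<psi> x w g) (at 0)" by (intro DERIV_add DERIV_cmult d f g)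
    from DERIV_unique[OF d[OF smooth_functions_combine[OF at f g]] this]
    show "chart_direction M U \<psi> x w (\<lambda>y. a * f y + b * g y) = a * chart_direction M U \<psi> x w f + b * chart_direction M U \<psi> x w g" .
  next
    fix f g assume f: "f \<in> smooth_functions M" and g: "g \<in> smooth_functions M"
    have "((\<lambda>t. f (inv_into U \<psi> (\<psi> x + t *\<^sub>R w)) * g (inv_into U \<psi> (\<psi> x + t *\<^sub>R w))) has_real_derivative
        chart_direction M U \<psi> x w f * g (inv_into U \<psi> (\<psi> x + 0 *\<^sub>R w)) + chart_direction M U \<psi> x w g * f (inv_into U \<psi> (\<psi> x + 0 *\<^sub>R w))) (at 0)"
      by (rule DERIV_mult[OF d[OF f] d[OF g]])
    from DERIV_unique[OF d[OF smooth_functions_mult[OF at f g]] this]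
    show "chart_direction M U \<psi> x w (\<lambda>y. f y * g y) = f x * chart_direction M U \<psi> x w g + g x * chart_direction M U \<psi> x w f"
      by (simp add: inv mult.commute)
  qed (simp add: chart_direction_def)
qed

lemma tangent_space_combine:
  assumes "v \<in> tangent_space M x" "w \<in> tangent_space M x"
  shows "(\<lambda>f. a * v f + b * w f) \<in> tangent_space M x" using assms unfolding tangent_space_def by (auto simp: algebra_simps)

lemma zero_in_tangent_space: "(\<lambda>f. 0) \<in> tangent_space M x" unfolding tangent_space_def by auto

lemma tangent_space_sum: "(\<And>i. i \<in> I \<Longrightarrow> v i \<in> tangent_space M x) \<Longrightarrow> (\<lambda>f. \<Sum>i\<in>I. c i * v i f) \<in> tangent_space M x"
proof (induction I rule: infinite_finite_induct)
  case (insert i I)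
  then show ?case using tangent_space_combine[of "v i" M x "\<lambda>f. \<Sum>i\<in>I. c i * v i f" "c i" 1] by simp
qed (auto intro: zero_in_tangent_space)

lemma cotangent_linear:
  "\<alpha> \<in> cotangent_space M x \<Longrightarrow> v \<in> tangent_space M x \<Longrightarrow> w \<in> tangent_space M x \<Longrightarrow>
    \<alpha> (\<lambda>f. a * v f + b * w f) = a * \<alpha> v + b * \<alpha> w" unfolding cotangent_space_def by simp

lemma cotangent_sum:
  assumes a: "\<alpha> \<in> cotangent_space M x"
  shows "(\<And>i. i \<in> I \<Longrightarrow> v i \<in> tangent_space M x) \<Longrightarrow> \<alpha> (\<lambda>f. \<Sum>i\<in>I. c i * v i f) = (\<Sum>i\<in>I. c i * \<alpha> (v i))"
proof (induction I rule: infinite_finite_induct)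
  case (insert i I)
  then show ?case using cotangent_linear[OF a, of "v i" "\<lambda>f. \<Sum>i\<in>I. c i * v i f" "c i" 1] by (simp add: tangent_space_sum)
qed (use cotangent_linear[OF a zero_in_tangent_space zero_in_tangent_space, of 0 0] in auto)

lemma differential_in_cotangent_space: "f \<in> smooth_functions M \<Longrightarrow> differential M f x \<in> cotangent_space M x"
  unfolding cotangent_space_def differential_def by (auto simp: tangent_space_combine)

text \<open>The coordinate vectors for an orthonormal basis of the model span the tangent space, so
  \<alpha> agrees with the differential of the combination of coordinates that has the same values
  on them. Statements about covectors reduce to functions through this.\<close>

lemma cotangent_is_differential:
  assumes M: "smooth_manifold M" and x: "x \<in> points M" and a: "\<alpha> \<in> cotangent_space M x"
  obtains f where "f \<in> smooth_functions M" "\<alpha> = differential M f x"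
proof -
  have at: "smooth_atlas M" using M by (rule smooth_manifold_imp_atlas)
  note V = smooth_manifold_subspace[OF M]
  obtain U \<psi> W th where c: "(U, \<psi>) \<in> atlas M" "openin (mtop M) W" "x \<in> W" "W \<subseteq> U" "\<And>y. y \<in> W \<Longrightarrow> th y = \<psi> y"
    "\<And>y. th y \<in> model M" "smooth_everywhere M th" by (rule smooth_coordinates[OF M x], rule that)
  have xU: "x \<in> U" using c by auto
  obtain B where B: "B \<subseteq> model M" "pairwise orthogonal B" "\<And>x. x \<in> B \<Longrightarrow> norm x = 1" "independent B" "span B = model M"
    using orthonormal_basis_subspace[OF V] by metis
  have fin: "finite B" using B(4) by (rule independent_imp_finite)
  define ta where "ta b = chart_direction M U \<psi> x b" for b
  have ta: "ta b \<in> tangent_space M x" if "b \<in> B" for b unfolding ta_def by (rule chart_direction_tangent[OF M c(1) _ xU]) (use B that in auto)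
  have thb: "(\<lambda>y. th y \<bullet> b) \<in> smooth_functions M" for b unfolding smooth_functions_eq[OF at] by (rule smooth_everywhere_inner[OF at c(7)])
  define F where "F y = (\<Sum>b\<in>B. \<alpha> (ta b) * (th y \<bullet> b))" for y
  have Fs: "(\<lambda>y. \<alpha> (ta b) * (th y \<bullet> b)) \<in> smooth_functions M" for b using smooth_functions_mult[OF at smooth_functions_const[OF at] thb] .
  have F: "F \<in> smooth_functions M" unfolding F_def by (rule smooth_functions_sum[OF at Fs])
  \<comment> \<open>By the chain rule in the chart, a derivation is the combination of coordinate
    vectors whose coefficients are its values on the coordinates.\<close>
  have expand: "v = (\<lambda>f. \<Sum>b\<in>B. v (\<lambda>y. th y \<bullet> b) * ta b f)" if v: "v \<in> tangent_space M x" for v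
  proof
    fix f
    show "v f = (\<Sum>b\<in>B. v (\<lambda>y. th y \<bullet> b) * ta b f)"
    proof (cases "f \<in> smooth_functions M")
      case False
      then show ?thesis using tangent_not_smooth[OF v] by (simp add: ta_def chart_direction_def)
    next
      case True
      have fx: "smooth_at M (points M) x f" using True x unfolding smooth_functions_iff[OF at] by blast
      obtain W' T g where W: "openin (mtop M) W'" "x \<in> W'" "W' \<subseteq> U" "C_inf_on T g" "\<psi> ` W' \<subseteq> T" "\<And>y. y \<in> W' \<Longrightarrow> y \<in> points M \<Longrightarrow> f y = g (\<psi> y)"
        by (rule smooth_at_chartE[OF at fx c(1) xU], rule that)
      have eq: "f y = g (\<psi> y)" if "y \<in> W'" for y using W(6) that openin_subset[OF W(1)] by auto
      have tx: "th x = \<psi> x" "th x \<in> T" using c W by auto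
      have lin: "linear (fderiv g (th x))" using C_inf_on_has_derivative[OF W(4) tx(2)] by (rule has_derivative_linear)
      have vV: "vec_apply v th \<in> span B" unfolding B(5) by (rule vec_apply_in_subspace[OF M v x c(7) V c(6)])
      have "v f = fderiv g (th x) (vec_apply v th)" by (rule tangent_chain[OF M v x c(7) True W(4) tx(2) openin_Int[OF c(2) W(1)]]) (use c W eq in auto)
      also have "vec_apply v th = (\<Sum>b\<in>B. (vec_apply v th \<bullet> b) *\<^sub>R b)" using orthonormal_basis_expand[OF B(2,3) vV fin] by simp
      also have "fderiv g (th x) \<dots> = (\<Sum>b\<in>B. (vec_apply v th \<bullet> b) * fderiv g (th x) b)" by (simp add: linear_sum[OF lin] linear_cmul[OF lin])
      also have "\<dots> = (\<Sum>b\<in>B. v (\<lambda>y. th y \<bullet> b) * ta b f)"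
      proof (rule sum.cong[OF refl])
        fix b assume "b \<in> B"
        then have "b \<in> model M" using B by auto
        from chart_direction_eq[OF M c(1) this W(1-5) eq True]
        show "(vec_apply v th \<bullet> b) * fderiv g (th x) b = v (\<lambda>y. th y \<bullet> b) * ta b f" by (simp add: ta_def tx(1) vec_apply_inner[OF M v c(7)])
      qed
      finally show ?thesis .
    qed
  qed
  have "\<alpha> = differential M F x"
  proof
    fix v
    show "\<alpha> v = differential M F x v"
    proof (cases "v \<in> tangent_space M x")
      case True
      have "\<alpha> v = (\<Sum>b\<in>B. v (\<lambda>y. th y \<bullet> b) * \<alpha> (ta b))" by (subst (1) expand[OF True]) (rule cotangent_sum[OF a ta])
      also have "\<dots> = v F" unfolding F_def by (simp add: tangent_sum[OF at True Fs] tangent_scale[OF at True thb] mult.commute)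
      finally show ?thesis using True by (simp add: differential_def)
    qed (use a in \<open>auto simp: cotangent_space_def differential_def\<close>)
  qed
  with F show ?thesis by (rule that)
qed

section \<open>Smoothness of maps tested on the functions they pull back\<close>

section \<open>Smooth families of functions\<close>

abbreviation param_manifold :: "('a, 'e::euclidean_space) manifold \<Rightarrow> ('p::euclidean_space \<times> 'a, 'p \<times> 'e) manifold" where
  "param_manifold M \<equiv> prod_manifold (vec_manifold UNIV) M"

lemma points_prod_manifold [simp]: "points (prod_manifold M N) = points M \<times> points N" by (simp add: prod_manifold_def)

lemma smooth_atlas_vec_prod: "smooth_atlas M \<Longrightarrow> subspace E \<Longrightarrow> smooth_atlas (prod_manifold (vec_manifold E) M)"
  by (rule smooth_atlas_prod[OF smooth_manifold_imp_atlas[OF smooth_manifold_vec_manifold]])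

lemma smooth_at_vec_prod_fst:
  assumes M: "smooth_atlas M" and E: "subspace E" and px: "p \<in> E" "x \<in> points M" and L: "C_inf_on UNIV L"
  shows "smooth_at (prod_manifold (vec_manifold E) M) S (p, x) (\<lambda>z. L (fst z))"
proof -
  obtain U \<psi> where c: "(U, \<psi>) \<in> atlas M" "x \<in> U" by (rule chart_exists[OF M px(2)], rule that)
  show ?thesis
  proof (rule smooth_at_vec_prodI[OF c(1) chart_open[OF M c(1)] c(2) subset_refl openin_subtopology_self px(1)])
    show "C_inf_on UNIV (\<lambda>z. L (fst z))" by (rule C_inf_on_compose[OF C_inf_on_bounded_linear[OF open_UNIV bounded_linear_fst] L]) simp
  qed auto
qed

lemma smooth_at_vec_prod_snd:
  fixes E :: "'p::euclidean_space set"
  assumes M: "smooth_atlas M" and E: "subspace E" and p: "p \<in> E" and f: "smooth_at M S' x f" and S: "\<And>z. z \<in> S \<Longrightarrow> snd z \<in> S'"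
  shows "smooth_at (prod_manifold (vec_manifold E) M) S (p, x) (\<lambda>z. f (snd z))"
proof -
  obtain U \<psi> W T g where *: "(U, \<psi>) \<in> atlas M" "openin (mtop M) W" "x \<in> W" "W \<subseteq> U" "C_inf_on T g" "\<psi> ` W \<subseteq> T"
    "\<And>y. y \<in> W \<Longrightarrow> y \<in> S' \<Longrightarrow> f y = g (\<psi> y)" by (rule smooth_atE[OF f], rule that)
  show ?thesis
  proof (rule smooth_at_vec_prodI[OF *(1-4) openin_subtopology_self p])
    have o: "open ((UNIV :: 'p set) \<times> T)" using C_inf_on_open[OF *(5)] by (intro open_Times) auto
    show "C_inf_on ((UNIV :: 'p set) \<times> T) (\<lambda>z. g (snd z))" by (rule C_inf_on_compose[OF C_inf_on_bounded_linear[OF o bounded_linear_snd] *(5)]) auto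
    show "(q, \<psi> y) \<in> UNIV \<times> T" if "y \<in> W" for q y using *(6) that by auto
    show "f (snd (q, y)) = g (snd (q, \<psi> y))" if "y \<in> W" "(q, y) \<in> S" for q y using *(7) S[OF that(2)] that by simp
  qed
qed

lemma smooth_at_nbhd:
  assumes M: "smooth_atlas M" and f: "smooth_at M (points M) x f" and T: "open T" "f x \<in> T"
  obtains W where "openin (mtop M) W" "x \<in> W" "\<And>y. y \<in> W \<Longrightarrow> f y \<in> T"
proof -
  obtain U \<psi> W T0 g where *: "(U, \<psi>) \<in> atlas M" "openin (mtop M) W" "x \<in> W" "W \<subseteq> U" "C_inf_on T0 g" "\<psi> ` W \<subseteq> T0"
    "\<And>y. y \<in> W \<Longrightarrow> y \<in> points M \<Longrightarrow> f y = g (\<psi> y)" by (rule smooth_atE[OF f], rule that)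
  have eq: "f y = g (\<psi> y)" if "y \<in> W" for y using *(7) that openin_subset[OF *(2)] by auto
  show ?thesis
  proof (rule that)
    show "openin (mtop M) (W \<inter> {y \<in> U. \<psi> y \<in> {z \<in> T0. g z \<in> T}})"
      by (intro openin_Int *(2) chart_preimage_open[OF M *(1)] C_inf_on_preimage[OF *(5) T(1)])
    show "x \<in> W \<inter> {y \<in> U. \<psi> y \<in> {z \<in> T0. g z \<in> T}}" using * T(2) eq[OF *(3)] by auto
    show "f y \<in> T" if "y \<in> W \<inter> {y \<in> U. \<psi> y \<in> {z \<in> T0. g z \<in> T}}" for y using that eq[of y] by auto
  qed
qed

text \<open>Continuity recovered from smooth pullbacks: the set where the pullback of a bump
  function is positive is mapped into \<open>W\<close>.\<close>

lemma pullback_nbhd: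
  assumes P: "smooth_atlas P" and M: "smooth_manifold M" and \<Phi>: "\<And>f. f \<in> smooth_functions M \<Longrightarrow> smooth_at P (points P) x (\<lambda>y. f (\<Phi> y))"
    and W: "openin (mtop M) W" "\<Phi> x \<in> W"
  obtains W' where "openin (mtop P) W'" "x \<in> W'" "\<And>y. y \<in> W' \<Longrightarrow> \<Phi> y \<in> W"
proof -
  obtain \<rho> :: "_ \<Rightarrow> real" where \<rho>: "\<rho> \<in> smooth_functions M" "\<rho> (\<Phi> x) = 1" "\<And>y. y \<notin> W \<Longrightarrow> \<rho> y = 0"
    by (rule smooth_bump[OF M W], rule that)
  have "\<rho> (\<Phi> x) \<in> {0<..}" using \<rho>(2) by simp
  obtain W' where W': "openin (mtop P) W'" "x \<in> W'" "\<And>y. y \<in> W' \<Longrightarrow> \<rho> (\<Phi> y) \<in> {0<..}"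
    by (rule smooth_at_nbhd[OF P \<Phi>[OF \<rho>(1)] open_greaterThan \<open>\<rho> (\<Phi> x) \<in> {0<..}\<close>], rule that)
  have "\<Phi> y \<in> W" if "y \<in> W'" for y using W'(3)[OF that] \<rho>(3)[of "\<Phi> y"] by (cases "\<Phi> y \<in> W") auto
  with W'(1,2) show ?thesis by (rule that)
qed

lemma smooth_at_pullback_vec:
  assumes P: "smooth_atlas P" and M: "smooth_manifold M" and x: "x \<in> points P" and \<Phi>: "\<And>f. f \<in> smooth_functions M \<Longrightarrow> smooth_at P (points P) x (\<lambda>y. f (\<Phi> y))"
    and e: "smooth_everywhere M \<eta>"
  shows "smooth_at P (points P) x (\<lambda>y. \<eta> (\<Phi> y))"
proof -
  have at: "smooth_atlas M" using M by (rule smooth_manifold_imp_atlas)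
  show ?thesis by (rule smooth_at_componentwise[OF P x x]) (auto intro!: \<Phi> smooth_everywhere_inner[OF at e] simp: smooth_functions_eq[OF at])
qed

text \<open>\<Phi> is known to be smooth only through the functions it pulls back. Global
  coordinates \<open>th\<close> around \<open>\<Phi> x\<close> turn the composite into a smooth
  function of the Euclidean vector \<open>(q y, th (\<Phi> y))\<close>.\<close>

lemma smooth_at_param_pullback:
  fixes K :: "'p::euclidean_space \<times> 'a \<Rightarrow> 'f::euclidean_space" and M :: "('a, 'e::euclidean_space) manifold"
  assumes P: "smooth_atlas P" and M: "smooth_manifold M" and E: "subspace E" and x: "x \<in> points P"
    and q: "smooth_at P (points P) x q" and qE: "\<And>y. y \<in> points P \<Longrightarrow> q y \<in> E"
    and \<Phi>: "\<And>f. f \<in> smooth_functions M \<Longrightarrow> smooth_at P (points P) x (\<lambda>y. f (\<Phi> y))" and \<Phi>M: "\<And>y. y \<in> points P \<Longrightarrow> \<Phi> y \<in> points M"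
    and K: "smooth_at (prod_manifold (vec_manifold E) M) (E \<times> points M) (q x, \<Phi> x) K"
  shows "smooth_at P (points P) x (\<lambda>y. K (q y, \<Phi> y))"
proof -
  have at: "smooth_atlas M" using M by (rule smooth_manifold_imp_atlas)
  obtain U \<psi> W th where c: "(U, \<psi>) \<in> atlas M" "openin (mtop M) W" "\<Phi> x \<in> W" "W \<subseteq> U" "\<And>y. y \<in> W \<Longrightarrow> th y = \<psi> y"
    "\<And>y. th y \<in> model M" "smooth_everywhere M th" by (rule smooth_coordinates[OF M \<Phi>M[OF x]], rule that)
  have xU: "\<Phi> x \<in> U" using c by auto
  obtain A W2 T g where A: "openin (top_of_set E) A" "q x \<in> A" "openin (mtop M) W2" "\<Phi> x \<in> W2" "W2 \<subseteq> U" "C_inf_on T g"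
    "\<And>q y. q \<in> A \<Longrightarrow> y \<in> W2 \<Longrightarrow> (q, \<psi> y) \<in> T"
    "\<And>q y. q \<in> A \<Longrightarrow> y \<in> W2 \<Longrightarrow> (q, y) \<in> E \<times> points M \<Longrightarrow> K (q, y) = g (q, \<psi> y)"
    by (rule smooth_at_vec_prodE[OF at E K c(1) xU], rule that)
  obtain A' where A': "open A'" "A = E \<inter> A'" using A(1) unfolding openin_open by blast
  have qxA: "q x \<in> A'" using A(2) A'(2) by auto
  obtain W3 where W3: "openin (mtop P) W3" "x \<in> W3" "\<And>y. y \<in> W3 \<Longrightarrow> q y \<in> A'" by (rule smooth_at_nbhd[OF P q A'(1) qxA], rule that)
  have WW: "openin (mtop M) (W \<inter> W2)" "\<Phi> x \<in> W \<inter> W2" using c A by auto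
  obtain W4 where W4: "openin (mtop P) W4" "x \<in> W4" "\<And>y. y \<in> W4 \<Longrightarrow> \<Phi> y \<in> W \<inter> W2"
    by (rule pullback_nbhd[where \<Phi> = \<Phi>, OF P M \<Phi> WW]) (assumption | (rule that, assumption+))+
  have pr: "smooth_at P (points P) x (\<lambda>y. (q y, th (\<Phi> y)))" by (rule smooth_at_Pair[OF P q smooth_at_pullback_vec[OF P M x \<Phi> c(7)]])
  show ?thesis
  proof (rule smooth_at_compose[OF P pr x A(6) _ openin_Int[OF W3(1) W4(1)]])
    show "(q x, th (\<Phi> x)) \<in> T" using A(7)[OF A(2,4)] c(5)[OF c(3)] by simp
    show "x \<in> W3 \<inter> W4" using W3 W4 by auto
    show "K (q y, \<Phi> y) = g (q y, th (\<Phi> y))" if "y \<in> W3 \<inter> W4" "y \<in> points P" for y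
      using that A(8)[of "q y" "\<Phi> y"] W3(3)[of y] W4(3)[of y] A'(2) c(5)[of "\<Phi> y"] qE[of y] \<Phi>M[of y] by auto
  qed
qed

lemma smooth_at_pullback:
  fixes K :: "'a \<Rightarrow> 'f::euclidean_space" and M :: "('a, 'e::euclidean_space) manifold"
  assumes P: "smooth_atlas P" and M: "smooth_manifold M" and x: "x \<in> points P"
    and \<Phi>: "\<And>f. f \<in> smooth_functions M \<Longrightarrow> smooth_at P (points P) x (\<lambda>y. f (\<Phi> y))" and \<Phi>M: "\<And>y. y \<in> points P \<Longrightarrow> \<Phi> y \<in> points M"
    and K: "smooth_at M (points M) (\<Phi> x) K"
  shows "smooth_at P (points P) x (\<lambda>y. K (\<Phi> y))"
proof -
  have at: "smooth_atlas M" using M by (rule smooth_manifold_imp_atlas)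
  have "smooth_at (param_manifold M) (UNIV \<times> points M) ((0::real), \<Phi> x) (\<lambda>z. K (snd z))" by (rule smooth_at_vec_prod_snd[OF at subspace_UNIV UNIV_I K]) auto
  then show ?thesis
    using smooth_at_param_pullback[where q = "\<lambda>y. 0::real" and \<Phi> = \<Phi> and K = "\<lambda>z. K (snd z)", OF P M subspace_UNIV x smooth_at_const[OF P x] UNIV_I \<Phi> \<Phi>M]
    by simp
qed

section \<open>Hamiltonian vector fields as derivations, linear and local in the Hamiltonian\<close>

section \<open>Poisson brackets and Hamiltonian vector fields\<close>

locale poisson =
  fixes M :: "('a, 'e::euclidean_space) manifold" and \<pi> :: "'a bivector"
  assumes PM: "poisson_manifold M \<pi>"
begin

abbreviation "\<C> \<equiv> smooth_functions M"
abbreviation "smooth_at_param \<equiv> smooth_at (param_manifold M) (UNIV \<times> points M)"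
abbreviation "pb \<equiv> bracket M \<pi>"
abbreviation "ham \<equiv> hamiltonian_vf M \<pi>"

lemma M: "smooth_manifold M" using PM by (simp add: poisson_manifold_def)
lemma at: "smooth_atlas M" using M by (rule smooth_manifold_imp_atlas)

lemma bracket_smooth: "f \<in> \<C> \<Longrightarrow> g \<in> \<C> \<Longrightarrow> pb f g \<in> \<C>"
  using PM by (simp add: poisson_manifold_def poisson_structure_def smooth_bivector_field_def)

lemma jacobi:
  "f \<in> \<C> \<Longrightarrow> g \<in> \<C> \<Longrightarrow> h \<in> \<C> \<Longrightarrow> x \<in> points M \<Longrightarrow>
    pb f (pb g h) x + pb g (pb h f) x + pb h (pb f g) x = 0" using PM by (simp add: poisson_manifold_def poisson_structure_def)

lemma bivector: "bivector_field M \<pi>" using PM by (simp add: poisson_manifold_def poisson_structure_def smooth_bivector_field_def)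

lemma bivector_skew:
  "x \<in> points M \<Longrightarrow> \<alpha> \<in> cotangent_space M x \<Longrightarrow> \<beta> \<in> cotangent_space M x \<Longrightarrow> \<pi> x \<alpha> \<beta> = - \<pi> x \<beta> \<alpha>"
  by (rule conjunct1[OF bivector[unfolded bivector_field_def, rule_format]])

lemma bivector_linear:
  assumes "x \<in> points M" "\<alpha> \<in> cotangent_space M x" "\<beta> \<in> cotangent_space M x" "c \<in> cotangent_space M x"
  shows "\<pi> x (\<lambda>v. a * \<alpha> v + b * \<beta> v) c = a * \<pi> x \<alpha> c + b * \<pi> x \<beta> c"
proof -
  have "\<forall>c\<in>cotangent_space M x. \<forall>a b. \<pi> x (\<lambda>v. a * \<alpha> v + b * \<beta> v) c = a * \<pi> x \<alpha> c + b * \<pi> x \<beta> c"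
    by (rule conjunct2[OF bivector[unfolded bivector_field_def, rule_format, OF assms(1-3)]])
  from bspec[OF this assms(4)] show ?thesis by simp
qed

lemma bracket_skew:
  "x \<in> points M \<Longrightarrow> f \<in> \<C> \<Longrightarrow> g \<in> \<C> \<Longrightarrow> pb f g x = - pb g f x"
  unfolding bracket_def by (rule bivector_skew) (auto intro: differential_in_cotangent_space)

lemma hamiltonian_vf_tangent:
  assumes x: "x \<in> points M" and h: "h \<in> \<C>"
  shows "ham h x \<in> tangent_space M x"
proof -
  have 1: "differential M (\<lambda>y. a * f y + b * g y) x = (\<lambda>v. a * differential M f x v + b * differential M g x v)" if "f \<in> \<C>" "g \<in> \<C>" for f g a b
    by (rule ext) (simp add: differential_def tangent_linear[OF _ that])
  have 2: "differential M (\<lambda>y. f y * g y) x = (\<lambda>v. f x * differential M g x v + g x * differential M f x v)" if "f \<in> \<C>" "g \<in> \<C>" for f g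
    by (rule ext) (simp add: differential_def tangent_leibniz[OF _ that])
  show ?thesis unfolding tangent_space_def by (auto simp: hamiltonian_vf_def bracket_def 1 2 smooth_functions_combine[OF at] smooth_functions_mult[OF at]
        bivector_linear[OF x differential_in_cotangent_space differential_in_cotangent_space differential_in_cotangent_space[OF h]])
qed

lemma hamiltonian_vf_apply: "g \<in> \<C> \<Longrightarrow> ham h x g = pb g h x" by (simp add: hamiltonian_vf_def)

lemma hamiltonian_vf_combine:
  assumes x: "x \<in> points M" and h: "h \<in> \<C>" "k \<in> \<C>"
  shows "ham (\<lambda>y. a * h y + b * k y) x = (\<lambda>g. a * ham h x g + b * ham k x g)"
proof
  fix g
  show "ham (\<lambda>y. a * h y + b * k y) x g = a * ham h x g + b * ham k x g"
  proof (cases "g \<in> \<C>")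
    case True
    have "pb (\<lambda>y. a * h y + b * k y) g x = a * pb h g x + b * pb k g x" using tangent_linear[OF hamiltonian_vf_tangent[OF x True] h, of a b] h
      by (simp add: hamiltonian_vf_apply smooth_functions_combine[OF at])
    then show ?thesis using True h by (simp add: hamiltonian_vf_apply bracket_skew[OF x True] smooth_functions_combine[OF at])
  qed (simp add: hamiltonian_vf_def)
qed

lemma hamiltonian_vf_scale:
  "x \<in> points M \<Longrightarrow> h \<in> \<C> \<Longrightarrow> ham (\<lambda>y. a * h y) x = (\<lambda>g. a * ham h x g)" using hamiltonian_vf_combine[of x h h a 0] by simp

text \<open>Skew-symmetry carries the locality of derivations from the first slot of the bracket to
  the second.\<close>

lemma hamiltonian_vf_cong:
  assumes x: "x \<in> points M" and h: "h \<in> \<C>" "k \<in> \<C>" and W: "openin (mtop M) W" "x \<in> W"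
    and eq: "\<And>y. y \<in> W \<Longrightarrow> h y = k y"
  shows "ham h x = ham k x"
proof
  fix g
  show "ham h x g = ham k x g"
  proof (cases "g \<in> \<C>")
    case True
    have "pb h g x = pb k g x" using tangent_local[OF M hamiltonian_vf_tangent[OF x True] h W eq] h by (simp add: hamiltonian_vf_apply)
    then show ?thesis using True h by (simp add: hamiltonian_vf_apply bracket_skew[OF x True])
  qed (simp add: hamiltonian_vf_def)
qed

lemma hamiltonian_vf_const: "x \<in> points M \<Longrightarrow> ham (\<lambda>y. c) x = (\<lambda>g. 0)"
proof
  fix g assume x: "x \<in> points M"
  show "ham (\<lambda>y. c) x g = 0"
  proof (cases "g \<in> \<C>")
    case True
    have "pb (\<lambda>y. c) g x = 0" using tangent_const[OF at hamiltonian_vf_tangent[OF x True], of c] by (simp add: hamiltonian_vf_apply smooth_functions_const[OF at])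
    then show ?thesis using True by (simp add: hamiltonian_vf_apply bracket_skew[OF x True smooth_functions_const[OF at]])
  qed (simp add: hamiltonian_vf_def)
qed

lemma hamiltonian_vf_sum:
  assumes x: "x \<in> points M"
  shows "(\<And>i. i \<in> I \<Longrightarrow> h i \<in> \<C>) \<Longrightarrow>
    ham (\<lambda>y. \<Sum>i\<in>I. c i * h i y) x = (\<lambda>g. \<Sum>i\<in>I. c i * ham (h i) x g)"
proof (induction I rule: infinite_finite_induct)
  case (insert i I)
  have s: "(\<lambda>y. \<Sum>i\<in>I. c i * h i y) \<in> \<C>"
    using insert.prems by (intro smooth_functions_sum[OF at] smooth_functions_mult[OF at smooth_functions_const[OF at]]) auto
  show ?case using hamiltonian_vf_combine[OF x _ s, of "h i" "c i" 1] insert by simp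
qed (simp_all add: hamiltonian_vf_const[OF x])

text \<open>The bracket of a vector-valued function with \<open>h\<close>, that is, the velocity of
  \<eta> along the flow of \<open>h\<close>.\<close>

definition bracket_vec :: "('a \<Rightarrow> 'f::euclidean_space) \<Rightarrow> ('a \<Rightarrow> real) \<Rightarrow> 'a \<Rightarrow> 'f" where
  "bracket_vec \<eta> h x = vec_apply (ham h x) \<eta>"

lemma bracket_vec_smooth:
  fixes \<eta> :: "'a \<Rightarrow> 'f::euclidean_space"
  assumes e: "smooth_everywhere M \<eta>" and h: "h \<in> \<C>"
  shows "smooth_everywhere M (bracket_vec \<eta> h)"
proof (rule smooth_everywhere_componentwise[OF at])
  fix b :: 'f assume b: "b \<in> Basis"
  have eb: "(\<lambda>y. \<eta> y \<bullet> b) \<in> \<C>" unfolding smooth_functions_eq[OF at] by (rule smooth_everywhere_inner[OF at e])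
  have "(\<lambda>y. bracket_vec \<eta> h y \<bullet> b) = pb (\<lambda>y. \<eta> y \<bullet> b) h"
    using b eb by (simp add: bracket_vec_def vec_apply_inner_Basis hamiltonian_vf_apply fun_eq_iff)
  then show "smooth_everywhere M (\<lambda>y. bracket_vec \<eta> h y \<bullet> b)" using bracket_smooth[OF eb h] by (simp add: smooth_functions_eq[OF at])
qed

lemma bracket_chain:
  fixes \<eta> :: "'a \<Rightarrow> 'f::euclidean_space"
  assumes x: "x \<in> points M" and e: "smooth_everywhere M \<eta>" and h: "h \<in> \<C>"
    and f: "f \<in> \<C>" and g: "C_inf_on T g" "\<eta> x \<in> T"
    and W: "openin (mtop M) W" "x \<in> W" and eq: "\<And>y. y \<in> W \<Longrightarrow> f y = g (\<eta> y)"
  shows "pb f h x = fderiv g (\<eta> x) (bracket_vec \<eta> h x)"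
  using tangent_chain[OF M hamiltonian_vf_tangent[OF x h] x e f g W eq] f by (simp add: hamiltonian_vf_apply bracket_vec_def)

section \<open>Reparametrisation and uniqueness of Hamiltonian curves\<close>

section \<open>Integral curves of Hamiltonian vector fields\<close>

lemma integral_curve_in_points: "integral_curve M X J c \<Longrightarrow> t \<in> J \<Longrightarrow> c t \<in> points M" unfolding integral_curve_def continuous_map_def by auto

lemma integral_curve_deriv:
  "integral_curve M X J c \<Longrightarrow> t \<in> J \<Longrightarrow> g \<in> \<C> \<Longrightarrow>
    ((\<lambda>s. g (c s)) has_real_derivative X (c t) g) (at t within J)" unfolding integral_curve_def by simp

lemma integral_curve_vec:
  fixes \<eta> :: "'a \<Rightarrow> 'f::euclidean_space"
  assumes g: "integral_curve M X J c" and t: "t \<in> J" and e: "smooth_everywhere M \<eta>"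
  shows "((\<lambda>s. \<eta> (c s)) has_vector_derivative vec_apply (X (c t)) \<eta>) (at t within J)" unfolding has_vector_derivative_def
proof (subst has_derivative_componentwise_within, rule ballI)
  fix b :: 'f assume b: "b \<in> Basis"
  have eb: "(\<lambda>y. \<eta> y \<bullet> b) \<in> \<C>" unfolding smooth_functions_eq[OF at] by (rule smooth_everywhere_inner[OF at e])
  show "((\<lambda>s. \<eta> (c s) \<bullet> b) has_derivative (\<lambda>s. s *\<^sub>R vec_apply (X (c t)) \<eta> \<bullet> b)) (at t within J)"
    by (rule has_derivative_eq_rhs[OF integral_curve_deriv[OF g t eb, unfolded has_field_derivative_def]])
      (simp add: fun_eq_iff vec_apply_inner_Basis[OF b])
qed

lemma integral_curve_subset:
  assumes "integral_curve M X J c" "J' \<subseteq> J" shows "integral_curve M X J' c" using assms unfolding integral_curve_def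
  by (auto intro: continuous_map_from_subtopology_mono DERIV_subset)

lemma integral_curve_cong:
  assumes "integral_curve M X J c" "\<And>t. t \<in> J \<Longrightarrow> X (c t) = X' (c t)"
  shows "integral_curve M X' J c" using assms unfolding integral_curve_def by simp

text \<open>Running through the curve with speed \<open>c\<close> multiplies its velocity by
  \<open>c\<close>, and the Hamiltonian vector field is linear in the Hamiltonian.\<close>

lemma integral_curve_affine:
  assumes g: "integral_curve M (ham h) J cv" and h: "h \<in> \<C>" and J: "\<And>s. s \<in> J' \<Longrightarrow> c * s + d \<in> J"
  shows "integral_curve M (ham (\<lambda>y. c * h y)) J' (\<lambda>s. cv (c * s + d))" unfolding integral_curve_def
proof (intro conjI ballI)
  have "continuous_map (top_of_set J') (top_of_set J) (\<lambda>s. c * s + d)" using J by (auto simp: continuous_map_in_subtopology intro!: continuous_intros)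
  moreover have "continuous_map (top_of_set J) (mtop M) cv" using g by (simp add: integral_curve_def)
  ultimately have "continuous_map (top_of_set J') (mtop M) (cv \<circ> (\<lambda>s. c * s + d))" by (rule continuous_map_compose)
  then show "continuous_map (top_of_set J') (mtop M) (\<lambda>s. cv (c * s + d))" by (simp add: o_def)
  fix t f assume t: "t \<in> J'" and f: "f \<in> \<C>"
  have 1: "((\<lambda>s. f (cv s)) has_real_derivative ham h (cv (c * t + d)) f) (at (c * t + d) within (\<lambda>s. c * s + d) ` J')"
    by (rule DERIV_subset[OF integral_curve_deriv[OF g J[OF t] f]]) (use J in auto)
  have 2: "((\<lambda>s. c * s + d) has_real_derivative c) (at t within J')" by (auto intro!: derivative_eq_intros)
  have p: "cv (c * t + d) \<in> points M" using integral_curve_in_points[OF g J[OF t]] .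
  from DERIV_image_chain[OF 1 2]
  show "((\<lambda>s. f (cv (c * s + d))) has_real_derivative ham (\<lambda>y. c * h y) (cv (c * t + d)) f) (at t within J')"
    by (simp add: hamiltonian_vf_scale[OF p h] o_def mult.commute)
qed

lemma C_inf_locally_lipschitz:
  fixes g :: "'x::euclidean_space \<Rightarrow> 'y::euclidean_space"
  assumes g: "C_inf_on T g" and z: "z \<in> T"
  obtains r L where "0 < r" "0 \<le> L" "cball z r \<subseteq> T" "\<And>a b. a \<in> cball z r \<Longrightarrow> b \<in> cball z r \<Longrightarrow> norm (g a - g b) \<le> L * norm (a - b)"
proof -
  have op: "open T" using g by (rule C_inf_on_open)
  have g1: "C_k_on (Suc 0) T g" using g unfolding C_inf_on_def by blast
  obtain r where r: "0 < r" "cball z r \<subseteq> T" using op z open_contains_cball by blast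
  obtain H :: "'x \<Rightarrow> 'x \<Rightarrow> 'x \<Rightarrow>\<^sub>L 'y" where H: "continuous_on (cball z r \<times> cball z r) (\<lambda>(p, p'). H p p')"
    "\<And>p p'. p \<in> cball z r \<Longrightarrow> p' \<in> cball z r \<Longrightarrow> g p - g p' = blinfun_apply (H p p') (p - p')"
    by (rule hadamard_operator[OF g1 op r(2) convex_cball], rule that)
  have "compact ((\<lambda>(p, p'). H p p') ` (cball z r \<times> cball z r))" by (intro compact_continuous_image H compact_Times compact_cball)
  then obtain L0 where "\<forall>x\<in>(\<lambda>(p, p'). H p p') ` (cball z r \<times> cball z r). norm x \<le> L0" using compact_imp_bounded bounded_iff by metis
  then have L0: "norm (H p p') \<le> \<bar>L0\<bar>" if "p \<in> cball z r" "p' \<in> cball z r" for p p' using that by force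
  have "norm (g a - g b) \<le> \<bar>L0\<bar> * norm (a - b)" if "a \<in> cball z r" "b \<in> cball z r" for a b
    unfolding H(2)[OF that] by (rule order_trans[OF norm_blinfun mult_right_mono[OF L0[OF that] norm_ge_zero]])
  with r show ?thesis using that[of r "\<bar>L0\<bar>"] by simp
qed

lemma integral_curve_nbhd:
  assumes g: "integral_curve M X J c" and t: "t \<in> J" and W: "openin (mtop M) W" "c t \<in> W"
  shows "\<exists>A. openin (top_of_set J) A \<and> t \<in> A \<and> (\<forall>s\<in>A. c s \<in> W)"
proof -
  have "openin (top_of_set J) {s \<in> topspace (top_of_set J). c s \<in> W}" using g W(1) unfolding integral_curve_def by (intro openin_continuous_map_preimage) auto
  then show ?thesis using t W(2) by (intro exI[of _ "{s \<in> J. c s \<in> W}"]) simp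
qed

text \<open>Agreement is an open condition on time by local uniqueness in a chart, disagreement is
  open because \<open>M\<close> is Hausdorff, and \<open>J\<close> is connected.\<close>

lemma integral_curve_unique:
  assumes h: "h \<in> \<C>" and J: "convex J"
    and g1: "integral_curve M (ham h) J cv1" and g2: "integral_curve M (ham h) J cv2"
    and t0: "t0 \<in> J" "cv1 t0 = cv2 t0" and t: "t \<in> J"
  shows "cv1 t = cv2 t"
proof -
  have local: "\<exists>A. openin (top_of_set J) A \<and> a \<in> A \<and> (\<forall>s\<in>A. cv1 s = cv2 s)" if a: "a \<in> J" and eq: "cv1 a = cv2 a" for a
  proof -
    define x where "x = cv1 a"
    have x: "x \<in> points M" using integral_curve_in_points[OF g1 a] by (simp add: x_def)
    obtain U \<psi> W th where c: "(U, \<psi>) \<in> atlas M" "openin (mtop M) W" "x \<in> W" "W \<subseteq> U" "\<And>y. y \<in> W \<Longrightarrow> th y = \<psi> y"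
      "\<And>y. th y \<in> model M" "smooth_everywhere M th" by (rule smooth_coordinates[OF M x], rule that)
    have xU: "x \<in> U" using c by auto
    obtain W1 T g where W1: "openin (mtop M) W1" "x \<in> W1" "W1 \<subseteq> U" "C_inf_on T g" "\<psi> ` W1 \<subseteq> T"
      "\<And>y. y \<in> W1 \<Longrightarrow> y \<in> points M \<Longrightarrow> bracket_vec th h y = g (\<psi> y)"
      by (rule smooth_at_chartE[OF at smooth_everywhereD[OF bracket_vec_smooth[OF c(7) h] x] c(1) xU], rule that)
    have "\<psi> x \<in> T" using W1 by auto
    then obtain r L where L: "0 < r" "0 \<le> L" "cball (\<psi> x) r \<subseteq> T" "\<And>a b. a \<in> cball (\<psi> x) r \<Longrightarrow> b \<in> cball (\<psi> x) r \<Longrightarrow> norm (g a - g b) \<le> L * norm (a - b)"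
      using C_inf_locally_lipschitz[OF W1(4)] by metis
    define W2 where "W2 = W \<inter> W1 \<inter> {y \<in> U. \<psi> y \<in> ball (\<psi> x) r}"
    have W2: "openin (mtop M) W2" unfolding W2_def by (intro openin_Int c W1 chart_preimage_open[OF at c(1)] open_ball)
    have xW2: "cv1 a \<in> W2" "cv2 a \<in> W2" using c W1 xU L(1) eq by (auto simp: W2_def x_def)
    obtain A1 A2 where A1: "openin (top_of_set J) A1" "a \<in> A1" "\<forall>s\<in>A1. cv1 s \<in> W2"
      and A2: "openin (top_of_set J) A2" "a \<in> A2" "\<forall>s\<in>A2. cv2 s \<in> W2"
      using integral_curve_nbhd[OF g1 a W2 xW2(1)] integral_curve_nbhd[OF g2 a W2 xW2(2)] by blast
    have "openin (top_of_set J) (A1 \<inter> A2)" "a \<in> A1 \<inter> A2" using A1 A2 by auto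
    then obtain e0 where e0: "0 < e0" "ball a e0 \<inter> J \<subseteq> A1 \<inter> A2" unfolding openin_contains_ball by blast
    \<comment> \<open>Makes \<open>e * L\<close> at most 1/2, as \<open>ode_zero_unique\<close>
      requires; \<open>L + 1\<close> avoids dividing by zero.\<close>
    define e where "e = min e0 (1 / (2 * (L + 1)))"
    have e: "0 < e" "e \<le> e0" using e0(1) L(2) by (auto simp: e_def)
    have eL: "d * L \<le> 1/2" if "0 \<le> d" "d < e" for d
    proof -
      have "d * L \<le> 1 / (2 * (L + 1)) * (L + 1)" using that L(2) by (intro mult_mono) (auto simp: e_def)
      also have "\<dots> = 1/2" using L(2) by (simp add: field_simps)
      finally show ?thesis .
    qed
    have "cv1 s = cv2 s" if s: "s \<in> ball a e \<inter> J" for s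
    proof -
      define l u where "l = min a s" and "u = max a s"
      have lu: "{l..u} \<subseteq> J"
        using J a s unfolding l_def u_def by (metis Int_iff closed_segment_eq_real_ivl convex_contains_segment min_def max_def linorder_not_le order_less_imp_le)
      have near: "r' \<in> A1 \<inter> A2" if "r' \<in> {l..u}" for r'
      proof -
        have "dist a r' < e0" using that s e(2) by (auto simp: l_def u_def dist_real_def split: if_splits)
        then show ?thesis using e0(2) lu that by (auto simp: subset_iff)
      qed
      have in2: "cv1 r' \<in> W2" "cv2 r' \<in> W2" if "r' \<in> {l..u}" for r' using near[OF that] A1(3) A2(3) by auto
      have der: "((\<lambda>s. th (cv s)) has_vector_derivative g (th (cv r'))) (at r' within {l..u})"
        if gm: "integral_curve M (ham h) J cv" and r': "r' \<in> {l..u}" and gW: "cv r' \<in> W2" for cv r'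
      proof -
        have "bracket_vec th h (cv r') = g (th (cv r'))" using W1(6)[of "cv r'"] c(5)[of "cv r'"] gW openin_subset[OF W2] by (auto simp: W2_def)
        then show ?thesis using integral_curve_vec[OF integral_curve_subset[OF gm lu] r' c(7)] by (simp add: bracket_vec_def)
      qed
      have "th (cv1 s) - th (cv2 s) = 0"
      proof (rule ode_zero_unique[where a = l and b = u and \<Delta> = "\<lambda>s. th (cv1 s) - th (cv2 s)" and \<Delta>' = "\<lambda>s. g (th (cv1 s)) - g (th (cv2 s))" and ?t0.0 = a and L = L])
        fix r' assume r': "r' \<in> {l..u}"
        show "((\<lambda>s. th (cv1 s) - th (cv2 s)) has_vector_derivative g (th (cv1 r')) - g (th (cv2 r'))) (at r' within {l..u})"
          by (intro has_vector_derivative_diff der g1 g2 r' in2)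
        show "norm (g (th (cv1 r')) - g (th (cv2 r'))) \<le> L * norm (th (cv1 r') - th (cv2 r'))" by (rule L(4)) (use in2[OF r'] c(5) in \<open>auto simp: W2_def\<close>)
      next
        have "0 \<le> u - l" "u - l < e" using s by (auto simp: u_def l_def dist_real_def)
        then show "(u - l) * L \<le> 1/2" by (rule eL)
      qed (use L eq in \<open>auto simp: l_def u_def\<close>)
      moreover have "cv1 s \<in> W2" "cv2 s \<in> W2" using in2[of s] by (auto simp: l_def u_def)
      ultimately have "\<psi> (cv1 s) = \<psi> (cv2 s)" "cv1 s \<in> U" "cv2 s \<in> U" using c(5) by (auto simp: W2_def)
      then show ?thesis using chart_inj[OF at c(1)] by (auto dest: inj_onD)
    qed
    moreover have "openin (top_of_set J) (ball a e \<inter> J)" by (metis open_ball openin_open_Int inf_commute)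
    ultimately show ?thesis using a e(1) by (intro exI[of _ "ball a e \<inter> J"]) auto
  qed
  show ?thesis
  proof (rule connected_induction_simple[OF convex_connected[OF J] t0(1) t, where P = "\<lambda>t. cv1 t = cv2 t"])
    show "cv1 t0 = cv2 t0" by (rule t0)
    fix a assume a: "a \<in> J"
    show "\<exists>T. openin (top_of_set J) T \<and> a \<in> T \<and> (\<forall>x\<in>T. \<forall>y\<in>T. cv1 x = cv2 x \<longrightarrow> cv1 y = cv2 y)"
    proof (cases "cv1 a = cv2 a")
      case True
      then obtain A where "openin (top_of_set J) A" "a \<in> A" "\<forall>s\<in>A. cv1 s = cv2 s" using local[OF a] by blast
      then show ?thesis by (intro exI[of _ A]) auto
    next
      case False
      have "Hausdorff_space (mtop M)" using M by (simp add: smooth_manifold_def)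
      then obtain B1 B2 where B: "openin (mtop M) B1" "openin (mtop M) B2" "cv1 a \<in> B1" "cv2 a \<in> B2" "disjnt B1 B2"
        using False integral_curve_in_points[OF g1 a] integral_curve_in_points[OF g2 a] unfolding Hausdorff_space_def by metis
      obtain A1 A2 where A1: "openin (top_of_set J) A1" "a \<in> A1" "\<forall>s\<in>A1. cv1 s \<in> B1"
        and A2: "openin (top_of_set J) A2" "a \<in> A2" "\<forall>s\<in>A2. cv2 s \<in> B2" using integral_curve_nbhd[OF g1 a B(1,3)] integral_curve_nbhd[OF g2 a B(2,4)] by blast
      have "cv1 s \<noteq> cv2 s" if "s \<in> A1 \<inter> A2" for s using that A1(3) A2(3) B(5) unfolding disjnt_iff by auto
      then show ?thesis using A1(1,2) A2(1,2) by (intro exI[of _ "A1 \<inter> A2"]) auto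
    qed
  qed
qed

end

section \<open>Existence: local flows of a linear family of Hamiltonians, smooth in the
  parameter\<close>

context poisson
begin

text \<open>The derivative condition on bump functions implies continuity: near each time the curve
  stays where a bump that vanishes off \<open>B\<close> is positive.\<close>

lemma integral_curveI:
  assumes p: "\<And>t. t \<in> J \<Longrightarrow> c t \<in> points M"
    and d: "\<And>t g. t \<in> J \<Longrightarrow> g \<in> \<C> \<Longrightarrow> ((\<lambda>s. g (c s)) has_real_derivative X (c t) g) (at t within J)"
  shows "integral_curve M X J c" unfolding integral_curve_def continuous_map_def
proof (intro conjI ballI allI impI d)
  show "c \<in> topspace (top_of_set J) \<rightarrow> points M" using p by auto
  fix B assume B: "openin (mtop M) B"
  show "openin (top_of_set J) {t \<in> topspace (top_of_set J). c t \<in> B}"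
  proof (subst openin_subopen, rule ballI)
    fix t assume t: "t \<in> {t \<in> topspace (top_of_set J). c t \<in> B}"
    then have tB: "c t \<in> B" by simp
    obtain \<rho> :: "'a \<Rightarrow> real" where \<rho>: "\<rho> \<in> \<C>" "\<rho> (c t) = 1" "\<And>y. y \<notin> B \<Longrightarrow> \<rho> y = 0"
      by (rule smooth_bump[OF M B tB], rule that)
    have "continuous_on J (\<lambda>s. \<rho> (c s))" using d[OF _ \<rho>(1)] by (meson DERIV_continuous continuous_on_eq_continuous_within)
    then have "openin (top_of_set J) (J \<inter> (\<lambda>s. \<rho> (c s)) -` {0<..})" by (rule continuous_openin_preimage_gen) simp
    moreover have "J \<inter> (\<lambda>s. \<rho> (c s)) -` {0<..} \<subseteq> {t \<in> topspace (top_of_set J). c t \<in> B}" using \<rho>(3) by force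
    ultimately show "\<exists>T. openin (top_of_set J) T \<and> t \<in> T \<and> T \<subseteq> {t \<in> topspace (top_of_set J). c t \<in> B}"
      using t \<rho>(2) by (intro exI[of _ "J \<inter> (\<lambda>s. \<rho> (c s)) -` {0<..}"]) auto
  qed
qed

text \<open>A finite-dimensional space of Hamiltonians, parametrised so that all their flows form
  one map depending on \<open>p\<close>.\<close>

definition linear_family :: "('p::euclidean_space \<Rightarrow> 'a \<Rightarrow> real) \<Rightarrow> 'p \<Rightarrow> 'a \<Rightarrow> real" where
  "linear_family k p = (\<lambda>y. \<Sum>i\<in>Basis. (p \<bullet> i) * k i y)"

lemma linear_family_smooth:
  "(\<And>i. i \<in> Basis \<Longrightarrow> k i \<in> \<C>) \<Longrightarrow> linear_family k p \<in> \<C>"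
  unfolding linear_family_def by (intro smooth_functions_sum[OF at] smooth_functions_mult[OF at smooth_functions_const[OF at]])

lemma linear_family_scale: "linear_family k (c *\<^sub>R p) = (\<lambda>y. c * linear_family k p y)" by (simp add: linear_family_def sum_distrib_left mult.assoc fun_eq_iff)

lemma linear_family_add: "linear_family k (p + q) y = linear_family k p y + linear_family k q y" by (simp add: linear_family_def inner_add_left algebra_simps sum.distrib)

lemma bracket_vec_linear_family:
  assumes x: "x \<in> points M" and k: "\<And>i. i \<in> Basis \<Longrightarrow> k i \<in> \<C>"
  shows "bracket_vec \<eta> (linear_family k p) x = (\<Sum>i\<in>Basis. (p \<bullet> i) *\<^sub>R bracket_vec \<eta> (k i) x)"
proof -
  have "ham (linear_family k p) x = (\<lambda>g. \<Sum>i\<in>Basis. (p \<bullet> i) * ham (k i) x g)" unfolding linear_family_def by (rule hamiltonian_vf_sum[OF x k])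
  then show ?thesis unfolding bracket_vec_def vec_apply_def by (simp add: scaleR_sum_left scaleR_sum_right) (rule sum.swap)
qed

text \<open>The parameter is added to the state with velocity zero, so that smoothness of
  \<open>local_flow\<close> in its initial point includes smoothness in \<open>p\<close>. Flowing
  for a fixed short time \<open>ta\<close> with parameter \<open>p\<close> divided by
  \<open>ta\<close> is flowing for time 1 with \<open>p\<close>; this trades short time for small
  \<open>p\<close>.\<close>

lemma local_hamiltonian_flow:
  fixes k :: "'p::euclidean_space \<Rightarrow> 'a \<Rightarrow> real"
  assumes k: "\<And>i. i \<in> Basis \<Longrightarrow> k i \<in> \<C>" and x0: "x0 \<in> points M"
  obtains dd W' Fl where "0 < dd" "openin (mtop M) W'" "x0 \<in> W'"
    "\<And>p x. norm p < dd \<Longrightarrow> x \<in> W' \<Longrightarrow> \<exists>cv. integral_curve M (ham (linear_family k p)) {0..1} cv \<and> cv 0 = x \<and> cv 1 = Fl (p, x)"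
    "\<And>p x f. norm p < dd \<Longrightarrow> x \<in> W' \<Longrightarrow> f \<in> \<C> \<Longrightarrow>
        smooth_at_param (p, x) (\<lambda>z. f (Fl z))"
proof -
  note V = smooth_manifold_subspace[OF M]
  obtain U \<psi> W th where c: "(U, \<psi>) \<in> atlas M" "openin (mtop M) W" "x0 \<in> W" "W \<subseteq> U" "\<And>y. y \<in> W \<Longrightarrow> th y = \<psi> y"
    "\<And>y. th y \<in> model M" "smooth_everywhere M th" by (rule smooth_coordinates[OF M x0], rule that)
  have xU: "x0 \<in> U" using c by auto
  obtain \<pi>V where \<pi>V: "linear \<pi>V" "\<And>x. \<pi>V x \<in> model M" "\<And>x. x \<in> model M \<Longrightarrow> \<pi>V x = x"
    by (rule linear_projection_exists[OF V], rule that)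
  define \<Xi> where "\<Xi> z = (\<Sum>i\<in>Basis. (fst z \<bullet> i) *\<^sub>R bracket_vec th (k i) (snd z))" for z :: "'p \<times> 'a"
  have atP: "smooth_atlas (param_manifold M :: ('p \<times> 'a, 'p \<times> 'e) manifold)" by (rule smooth_atlas_vec_prod[OF at subspace_UNIV])
  have sm: "smooth_at_param (0, x0) \<Xi>" unfolding \<Xi>_def
  proof (rule smooth_at_sum[OF atP])
    fix i :: 'p assume i: "i \<in> Basis"
    show "smooth_at_param (0, x0) (\<lambda>z. (fst z \<bullet> i) *\<^sub>R bracket_vec th (k i) (snd z))"
    proof (rule smooth_at_bilinear[OF atP bounded_bilinear_scaleR])
      show "smooth_at_param (0, x0) (\<lambda>z. fst z \<bullet> i)"
        by (rule smooth_at_vec_prod_fst[OF at subspace_UNIV UNIV_I x0 C_inf_on_bounded_linear[OF open_UNIV bounded_linear_inner_left]])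
      show "smooth_at_param (0, x0) (\<lambda>z. bracket_vec th (k i) (snd z))"
        by (rule smooth_at_vec_prod_snd[OF at subspace_UNIV UNIV_I smooth_everywhereD[OF bracket_vec_smooth[OF c(7) k[OF i]] x0]]) auto
    qed (use x0 in auto)
  qed (use x0 in auto)
  obtain A W2 T G where A: "openin (top_of_set UNIV) A" "0 \<in> A" "openin (mtop M) W2" "x0 \<in> W2" "W2 \<subseteq> U" "C_inf_on T G"
    "\<And>q y. q \<in> A \<Longrightarrow> y \<in> W2 \<Longrightarrow> (q, \<psi> y) \<in> T"
    "\<And>q y. q \<in> A \<Longrightarrow> y \<in> W2 \<Longrightarrow> (q, y) \<in> UNIV \<times> points M \<Longrightarrow> \<Xi> (q, y) = G (q, \<psi> y)"
    by (rule smooth_at_vec_prodE[OF at subspace_UNIV sm c(1) xU], rule that)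
  have Aop: "open A" using A(1) by simp
  define W1 where "W1 = W \<inter> W2"
  have W1: "openin (mtop M) W1" "x0 \<in> W1" "W1 \<subseteq> U" using c A by (auto simp: W1_def)
  obtain O1 where O1: "open O1" "\<psi> ` W1 = model M \<inter> O1" using chart_image_open[OF at c(1) W1(3,1)] unfolding openin_open by blast
  define Om where "Om = T \<inter> A \<times> O1"
  have oOm: "open Om" unfolding Om_def using C_inf_on_open[OF A(6)] Aop O1(1) by (intro open_Int open_Times)
  \<comment> \<open>\<open>G\<close> is merely some smooth extension to an open set of the ambient
    space; projecting by \<open>\<pi>V\<close> makes the velocity lie in the model.\<close>
  define Fd where "Fd z = (0 :: 'p, \<pi>V (G z))" for z
  have Fd: "C_inf_on Om Fd" unfolding Fd_def
    by (rule C_inf_on_Pair[OF C_inf_on_const[OF oOm] C_inf_on_linear_comp[OF \<pi>V(1)[unfolded linear_conv_bounded_linear] C_inf_on_subset[OF A(6) oOm]]])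
      (simp add: Om_def)
  have xO: "\<psi> x0 \<in> O1" using W1 O1(2) by auto
  have p0: "(0, \<psi> x0) \<in> Om" using A(2,4,7) xO by (simp add: Om_def)
  obtain dd0 e Y where Y: "0 < dd0" "0 < e" "\<And>p. p \<in> ball (0, \<psi> x0) dd0 \<Longrightarrow> Y (0, p) = p"
    "\<And>t p. \<lbrakk>t \<in> {-e<..<e}; p \<in> ball (0, \<psi> x0) dd0\<rbrakk> \<Longrightarrow> Y (t, p) \<in> Om"
    "\<And>t p. \<lbrakk>t \<in> {-e<..<e}; p \<in> ball (0, \<psi> x0) dd0\<rbrakk> \<Longrightarrow> ((\<lambda>t. Y (t, p)) has_vector_derivative Fd (Y (t, p))) (at t)"
    "C_inf_on ({-e<..<e} \<times> ball (0, \<psi> x0) dd0) Y" by (rule local_flow[OF Fd p0], rule that)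
  define ta where "ta = e / 2"
  have ta: "0 < ta" "ta < e" using Y(2) by (auto simp: ta_def)
  have dsnd: "((\<lambda>t. snd (Y (t, p))) has_vector_derivative \<pi>V (G (Y (t, p)))) (at t)"
    and dfst: "((\<lambda>t. fst (Y (t, p))) has_vector_derivative 0) (at t)" if "t \<in> {-e<..<e}" "p \<in> ball (0, \<psi> x0) dd0" for t p
    using bounded_linear.has_vector_derivative[OF bounded_linear_snd Y(5)[OF that]]
      bounded_linear.has_vector_derivative[OF bounded_linear_fst Y(5)[OF that]] by (auto simp: Fd_def)
  have const: "f t = f 0" if "\<And>t. t \<in> {-e<..<e} \<Longrightarrow> (f has_vector_derivative 0) (at t)" "t \<in> {-e<..<e}"
    for f :: "real \<Rightarrow> 'x::real_normed_vector" and t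
  proof -
    have "\<exists>c. \<forall>x\<in>{-e<..<e}. f x = c"
      using has_vector_derivative_zero_constant[of "{-e<..<e}" f] that(1) has_vector_derivative_at_within by (metis convex_real_interval(8))
    then show ?thesis using that(2) Y(2) by auto
  qed
  have Yfst: "fst (Y (t, (q, z))) = q" if "t \<in> {-e<..<e}" "(q, z) \<in> ball (0, \<psi> x0) dd0" for t q z
    using const[of "\<lambda>t. fst (Y (t, (q, z)))" t] dfst that Y(3)[OF that(2)] by simp
  \<comment> \<open>The component of the solution transverse to the model has derivative zero and
    starts at zero.\<close>
  have YV: "snd (Y (t, (q, z))) \<in> model M" if "t \<in> {-e<..<e}" "(q, z) \<in> ball (0, \<psi> x0) dd0" "z \<in> model M" for t q z
  proof -
    define D where "D t = snd (Y (t, (q, z))) - \<pi>V (snd (Y (t, (q, z))))" for t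
    have "(D has_vector_derivative 0) (at t)" if "t \<in> {-e<..<e}" for t
    proof -
      note d = dsnd[OF that \<open>(q, z) \<in> ball (0, \<psi> x0) dd0\<close>]
      have "bounded_linear \<pi>V" using \<pi>V(1) by (simp add: linear_conv_bounded_linear)
      from has_vector_derivative_diff[OF d bounded_linear.has_vector_derivative[OF this d]]
      show ?thesis using \<pi>V(2,3) by (simp add: D_def[abs_def])
    qed
    then have "D t = D 0" using const that(1) by blast
    then have "snd (Y (t, (q, z))) = \<pi>V (snd (Y (t, (q, z))))" using Y(3)[OF that(2)] \<pi>V(3)[OF that(3)] by (simp add: D_def)
    then show ?thesis using \<pi>V(2) by metis
  qed
  have inv: "inv_into U \<psi> (\<psi> y) = y" if "y \<in> U" for y using inv_into_f_f[OF chart_inj[OF at c(1)] that] .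
  have in1: "inv_into U \<psi> (snd (Y (t, (q, z)))) \<in> W1" "\<psi> (inv_into U \<psi> (snd (Y (t, (q, z))))) = snd (Y (t, (q, z)))"
    if "t \<in> {-e<..<e}" "(q, z) \<in> ball (0, \<psi> x0) dd0" "z \<in> model M" for t q z
  proof -
    have "snd (Y (t, (q, z))) \<in> \<psi> ` W1" unfolding O1(2) using YV[OF that] Y(4)[OF that(1,2)] by (auto simp: Om_def)
    then obtain y where y: "y \<in> W1" "snd (Y (t, (q, z))) = \<psi> y" by auto
    then show "inv_into U \<psi> (snd (Y (t, (q, z)))) \<in> W1" "\<psi> (inv_into U \<psi> (snd (Y (t, (q, z))))) = snd (Y (t, (q, z)))" using inv W1(3) by auto
  qed
  define Fl where "Fl z = inv_into U \<psi> (snd (Y (ta, ((1 / ta) *\<^sub>R fst z, \<psi> (snd z)))))" for z :: "'p \<times> 'a"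
  define W' where "W' = W1 \<inter> {y \<in> U. \<psi> y \<in> ball (\<psi> x0) (dd0 / 2)}"
  have W': "openin (mtop M) W'" unfolding W'_def by (intro openin_Int W1 chart_preimage_open[OF at c(1)] open_ball)
  have inball: "((1 / ta) *\<^sub>R p, \<psi> x) \<in> ball (0, \<psi> x0) dd0" if "norm p < ta * dd0 / 2" "x \<in> W'" for p :: 'p and x
  proof -
    have "dist (0, \<psi> x0) ((1 / ta) *\<^sub>R p, \<psi> x) \<le> norm ((1 / ta) *\<^sub>R p) + norm (\<psi> x0 - \<psi> x)"
      using norm_Pair_le[of "- ((1 / ta) *\<^sub>R p)" "\<psi> x0 - \<psi> x"] by (simp add: dist_norm)
    also have "\<dots> < dd0 / 2 + dd0 / 2" using that ta(1) by (intro add_strict_mono) (auto simp: W'_def dist_norm field_simps)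
    finally show ?thesis by simp
  qed
  show ?thesis
  proof (rule that[of "ta * dd0 / 2" W' Fl])
    show "0 < ta * dd0 / 2" using ta Y(1) by simp
    show "openin (mtop M) W'" by (rule W')
    show "x0 \<in> W'" using W1 xU Y(1) by (auto simp: W'_def)
  next
    fix p :: 'p and x assume p: "norm p < ta * dd0 / 2" and x: "x \<in> W'"
    define q where "q = (1 / ta) *\<^sub>R p"
    have b: "(q, \<psi> x) \<in> ball (0, \<psi> x0) dd0" using inball[OF p x] by (simp add: q_def)
    have xm: "\<psi> x \<in> model M" "x \<in> U" using x chart_model[OF at c(1)] by (auto simp: W'_def)
    define cv where "cv t = inv_into U \<psi> (snd (Y (t, (q, \<psi> x))))" for t
    have g1: "cv t \<in> W1" "\<psi> (cv t) = snd (Y (t, (q, \<psi> x)))" if "t \<in> {-e<..<e}" for t using in1[OF that b xm(1)] by (auto simp: cv_def)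
    have "integral_curve M (ham (linear_family k q)) {-e<..<e} cv"
    proof (rule integral_curveI)
      show gp: "cv t \<in> points M" if "t \<in> {-e<..<e}" for t using g1(1)[OF that] openin_subset[OF W1(1)] by auto
      fix t f assume t: "t \<in> {-e<..<e}" and f: "f \<in> \<C>"
      have fx: "smooth_at M (points M) (cv t) f" using f gp[OF t] unfolding smooth_functions_iff[OF at] by blast
      have gU: "cv t \<in> U" using g1[OF t] W1(3) by auto
      obtain W3 T3 g3 where W3: "openin (mtop M) W3" "cv t \<in> W3" "W3 \<subseteq> U" "C_inf_on T3 g3" "\<psi> ` W3 \<subseteq> T3" "\<And>y. y \<in> W3 \<Longrightarrow> y \<in> points M \<Longrightarrow> f y = g3 (\<psi> y)"
        by (rule smooth_at_chartE[OF at fx c(1) gU], rule that)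
      have f3: "f y = g3 (\<psi> y)" if "y \<in> W3" for y using W3(6) that openin_subset[OF W3(1)] by auto
      obtain O3 where O3: "open O3" "\<psi> ` W3 = model M \<inter> O3" using chart_image_open[OF at c(1) W3(3,1)] unfolding openin_open by blast
      have T3: "\<psi> (cv t) \<in> T3" using W3 by auto
      note d = dsnd[OF t b]
      have "((\<lambda>s. g3 (snd (Y (s, (q, \<psi> x))))) has_vector_derivative fderiv g3 (snd (Y (t, (q, \<psi> x)))) (\<pi>V (G (Y (t, (q, \<psi> x)))))) (at t)"
        by (rule has_vector_derivative_compose_has_derivative[OF d C_inf_on_has_derivative[OF W3(4)]]) (use T3 g1(2)[OF t] in simp)
      then have 1: "((\<lambda>s. g3 (\<psi> (cv s))) has_vector_derivative fderiv g3 (\<psi> (cv t)) (\<pi>V (G (Y (t, (q, \<psi> x)))))) (at t)" unfolding g1(2)[OF t]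
        by (rule has_vector_derivative_transform_within_open[OF _ open_greaterThanLessThan t]) (use g1(2) in simp)
      have opS: "open {s \<in> {-e<..<e}. snd (Y (s, (q, \<psi> x))) \<in> O3}"
      proof -
        have "continuous_on {-e<..<e} (\<lambda>s. snd (Y (s, (q, \<psi> x))))" by (intro continuous_at_imp_continuous_on ballI has_vector_derivative_continuous[OF dsnd[OF _ b]])
        from continuous_open_preimage[OF this open_greaterThanLessThan O3(1)] show ?thesis by (simp add: Int_def vimage_def)
      qed
      have 2: "((\<lambda>s. f (cv s)) has_vector_derivative fderiv g3 (\<psi> (cv t)) (\<pi>V (G (Y (t, (q, \<psi> x)))))) (at t)"
      proof (rule has_vector_derivative_transform_within_open[OF 1 opS])
        show "t \<in> {s \<in> {-e<..<e}. snd (Y (s, (q, \<psi> x))) \<in> O3}" using imageI[OF W3(2), of \<psi>] O3(2) g1(2)[OF t] t by auto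
        fix s assume s: "s \<in> {s \<in> {-e<..<e}. snd (Y (s, (q, \<psi> x))) \<in> O3}"
        then have sI: "s \<in> {-e<..<e}" by simp
        have "\<psi> (cv s) \<in> \<psi> ` W3" unfolding O3(2) using s g1[OF sI] YV[OF sI b xm(1)] by auto
        then have "cv s \<in> W3" using W3(3) g1(1)[OF sI] W1(3) chart_inj[OF at c(1)] by (auto dest: inj_onD)
        then show "g3 (\<psi> (cv s)) = f (cv s)" using f3 by simp
      qed
      have gW: "cv t \<in> W" "cv t \<in> W2" using g1(1)[OF t] by (auto simp: W1_def)
      have qA: "q \<in> A" using Y(4)[OF t b] Yfst[OF t b] by (auto simp: Om_def)
      have Yt: "Y (t, (q, \<psi> x)) = (q, \<psi> (cv t))" using Yfst[OF t b] g1(2)[OF t] by (metis prod.collapse)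
      have "\<Xi> (q, cv t) = G (q, \<psi> (cv t))" by (rule A(8)[OF qA gW(2)]) (use gp[OF t] in simp)
      moreover have "\<Xi> (q, cv t) = bracket_vec th (linear_family k q) (cv t)" by (simp add: \<Xi>_def bracket_vec_linear_family[OF gp[OF t] k])
      moreover have "bracket_vec th (linear_family k q) (cv t) \<in> model M" unfolding bracket_vec_def
        by (rule vec_apply_in_subspace[OF M hamiltonian_vf_tangent[OF gp[OF t] linear_family_smooth[OF k]] gp[OF t] c(7) V c(6)])
      ultimately have GV: "\<pi>V (G (Y (t, (q, \<psi> x)))) = bracket_vec th (linear_family k q) (cv t)" using \<pi>V(3) by (simp add: Yt)
      have "pb f (linear_family k q) (cv t) = fderiv g3 (th (cv t)) (bracket_vec th (linear_family k q) (cv t))"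
        by (rule bracket_chain[OF gp[OF t] c(7) linear_family_smooth[OF k] f W3(4) _ openin_Int[OF c(2) W3(1)]]) (use gW W3(2) T3 f3 c(5) in auto)
      then have "ham (linear_family k q) (cv t) f = fderiv g3 (\<psi> (cv t)) (\<pi>V (G (Y (t, (q, \<psi> x)))))"
        using GV c(5)[OF gW(1)] by (simp add: hamiltonian_vf_apply[OF f])
      with 2 show "((\<lambda>s. f (cv s)) has_real_derivative ham (linear_family k q) (cv t) f) (at t within {-e<..<e})"
        by (simp add: has_real_derivative_iff_has_vector_derivative has_vector_derivative_at_within)
    qed
    moreover have "ta * s + 0 \<in> {-e<..<e}" if "s \<in> {0..1}" for s
    proof -
      have "ta * s \<le> ta * 1" "0 \<le> ta * s" using that ta by (auto intro: mult_left_mono)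
      then show ?thesis using ta unfolding greaterThanLessThan_iff by linarith
    qed
    moreover have "linear_family k q \<in> \<C>" by (rule linear_family_smooth[OF k])
    ultimately have "integral_curve M (ham (\<lambda>y. ta * linear_family k q y)) {0..1} (\<lambda>s. cv (ta * s + 0))" by (intro integral_curve_affine)
    moreover have "(\<lambda>y. ta * linear_family k q y) = linear_family k p" unfolding linear_family_scale[symmetric] q_def using ta(1) by simp
    moreover have "cv (ta * 0 + 0) = x" using Y(3)[OF b] inv[OF xm(2)] by (simp add: cv_def)
    moreover have "cv (ta * 1 + 0) = Fl (p, x)" by (simp add: cv_def Fl_def q_def)
    ultimately show "\<exists>cv. integral_curve M (ham (linear_family k p)) {0..1} cv \<and> cv 0 = x \<and> cv 1 = Fl (p, x)"
      by (intro exI[of _ "\<lambda>s. cv (ta * s + 0)"]) simp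
  next
    fix p :: 'p and x f assume p: "norm p < ta * dd0 / 2" and x: "x \<in> W'" and f: "f \<in> \<C>"
    have b: "((1 / ta) *\<^sub>R p, \<psi> x) \<in> ball (0, \<psi> x0) dd0" by (rule inball[OF p x])
    have xm: "\<psi> x \<in> model M" "x \<in> U" using x chart_model[OF at c(1)] by (auto simp: W'_def)
    have taI: "ta \<in> {-e<..<e}" using ta by auto
    define y1 where "y1 = Fl (p, x)"
    have y1: "y1 \<in> W1" "\<psi> y1 = snd (Y (ta, ((1 / ta) *\<^sub>R p, \<psi> x)))" using in1[OF taI b xm(1)] by (auto simp: y1_def Fl_def)
    have y1M: "y1 \<in> points M" "y1 \<in> U" using y1(1) openin_subset[OF W1(1)] W1(3) by auto
    have fx: "smooth_at M (points M) y1 f" using f y1M(1) unfolding smooth_functions_iff[OF at] by blast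
    obtain W3 T3 g3 where W3: "openin (mtop M) W3" "y1 \<in> W3" "W3 \<subseteq> U" "C_inf_on T3 g3" "\<psi> ` W3 \<subseteq> T3" "\<And>y. y \<in> W3 \<Longrightarrow> y \<in> points M \<Longrightarrow> f y = g3 (\<psi> y)"
      by (rule smooth_at_chartE[OF at fx c(1) y1M(2)], rule that)
    obtain O4 where O4: "open O4" "\<psi> ` W3 = model M \<inter> O4" using chart_image_open[OF at c(1) W3(3,1)] unfolding openin_open by blast
    define B where "B = (\<lambda>w :: 'p \<times> 'e. ((1 / ta) *\<^sub>R fst w, snd w)) -` ball (0, \<psi> x0) dd0"
    have oB: "open B" unfolding B_def by (intro open_vimage open_ball continuous_intros)
    define Hm where "Hm w = snd (Y (ta, ((1 / ta) *\<^sub>R fst w, snd w)))" for w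
    have "C_inf_on B (\<lambda>w. Y (ta, ((1 / ta) *\<^sub>R fst w, snd w)))"
    proof (rule C_inf_on_compose[OF _ Y(6)])
      show "C_inf_on B (\<lambda>w. (ta, ((1 / ta) *\<^sub>R fst w, snd w)))"
        by (rule C_inf_on_Pair[OF C_inf_on_const[OF oB] C_inf_on_Pair[OF C_inf_on_linear_comp[OF bounded_linear_scaleR_right
            C_inf_on_bounded_linear[OF oB bounded_linear_fst]] C_inf_on_bounded_linear[OF oB bounded_linear_snd]]])
    qed (use taI in \<open>auto simp: B_def\<close>)
    then have Hm: "C_inf_on B Hm" unfolding Hm_def by (rule C_inf_on_linear_comp[OF bounded_linear_snd])
    have oTO: "open (T3 \<inter> O4)" using C_inf_on_open[OF W3(4)] O4(1) by (rule open_Int)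
    define T' where "T' = {w \<in> B. Hm w \<in> T3 \<inter> O4}"
    have oT': "open T'" unfolding T'_def by (rule C_inf_on_preimage[OF Hm oTO])
    have "\<psi> y1 \<in> T3 \<inter> O4" using W3(2,5) O4(2) by auto
    then have "(p, \<psi> x) \<in> T'" using b y1(2) by (simp add: T'_def B_def Hm_def)
    then obtain A0 B0 where AB: "open A0" "open B0" "(p, \<psi> x) \<in> A0 \<times> B0" "A0 \<times> B0 \<subseteq> T'" using open_prod_elim[OF oT'] by metis
    show "smooth_at_param (p, x) (\<lambda>z. f (Fl z))"
    proof (rule smooth_at_vec_prodI[OF c(1)])
      show "openin (mtop M) (W' \<inter> {y \<in> U. \<psi> y \<in> B0})" by (intro openin_Int W' chart_preimage_open[OF at c(1)] AB(2))
      show "x \<in> W' \<inter> {y \<in> U. \<psi> y \<in> B0}" using x xm AB(3) by auto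
      show "openin (top_of_set UNIV) A0" using AB(1) by simp
      show "p \<in> A0" using AB(3) by auto
      show "C_inf_on T' (\<lambda>w. g3 (Hm w))" by (rule C_inf_on_compose[OF C_inf_on_subset[OF Hm oT'] W3(4)]) (auto simp: T'_def)
      show Tin: "(q, \<psi> y) \<in> T'" if "q \<in> A0" "y \<in> W' \<inter> {y \<in> U. \<psi> y \<in> B0}" for q y using AB(4) that by auto
      fix q y assume qy: "q \<in> A0" "y \<in> W' \<inter> {y \<in> U. \<psi> y \<in> B0}" "(q, y) \<in> UNIV \<times> points M"
      have qT: "(q, \<psi> y) \<in> T'" by (rule Tin[OF qy(1,2)])
      have bq: "((1 / ta) *\<^sub>R q, \<psi> y) \<in> ball (0, \<psi> x0) dd0" using qT by (simp add: T'_def B_def)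
      have ym: "\<psi> y \<in> model M" using qy(2) chart_model[OF at c(1)] by auto
      have fl: "Fl (q, y) \<in> W1" "\<psi> (Fl (q, y)) = Hm (q, \<psi> y)" using in1[OF taI bq ym] by (auto simp: Fl_def Hm_def)
      have "\<psi> (Fl (q, y)) \<in> \<psi> ` W3" unfolding O4(2) fl(2) using qT YV[OF taI bq ym] by (auto simp: T'_def Hm_def)
      then have "Fl (q, y) \<in> W3" using W3(3) fl(1) W1(3) chart_inj[OF at c(1)] by (auto dest: inj_onD)
      then show "f (Fl (q, y)) = g3 (Hm (q, \<psi> y))" using W3(6) fl(2) openin_subset[OF W3(1)] by auto
    qed auto
  qed
qed

end

section \<open>Time-one maps of a linear family of complete Hamiltonian vector fields\<close>

locale poisson_flow = poisson M \<pi> for M :: "('a, 'e::euclidean_space) manifold" and \<pi> :: "'a bivector" +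
  fixes k :: "'p::euclidean_space \<Rightarrow> 'a \<Rightarrow> real"
  assumes k: "\<And>i. i \<in> Basis \<Longrightarrow> k i \<in> smooth_functions M"
    and complete: "\<And>p. complete_vf M (hamiltonian_vf M \<pi> (linear_family k p))"
begin

abbreviation h :: "'p \<Rightarrow> 'a \<Rightarrow> real" where "h \<equiv> linear_family k"

lemma h_smooth: "h p \<in> \<C>" by (rule linear_family_smooth[OF k])

text \<open>The time-one map of the flow of \<open>h p\<close>; the map for time \<open>t\<close> is
  \<open>\<phi> (t *\<^sub>R p)\<close>.\<close>

definition \<phi> :: "'p \<Rightarrow> 'a \<Rightarrow> 'a" where
  "\<phi> p x = (SOME \<gamma>. \<gamma> 0 = x \<and> integral_curve M (ham (h p)) UNIV \<gamma>) 1"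

text \<open>By uniqueness the curve chosen for \<open>t *\<^sub>R p\<close> is the rescaled curve
  chosen for \<open>p\<close>, so the choices for all multiples of \<open>p\<close> fit
  together.\<close>

lemma flow_curve:
  assumes x: "x \<in> points M"
  shows "integral_curve M (ham (h p)) UNIV (\<lambda>t. \<phi> (t *\<^sub>R p) x)" and flow_0: "\<phi> 0 x = x"
proof -
  define c where "c p = (SOME c. c 0 = x \<and> integral_curve M (ham (h p)) UNIV c)" for p
  have c: "c p 0 = x \<and> integral_curve M (ham (h p)) UNIV (c p)" for p
  proof -
    have "\<exists>c. c 0 = x \<and> integral_curve M (ham (h p)) UNIV c" using complete[of p] x by (simp add: complete_vf_def)
    from someI_ex[OF this] show ?thesis by (simp only: c_def)
  qed
  have eq: "\<phi> (t *\<^sub>R p) x = c p t" for t p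
  proof -
    have "integral_curve M (ham (h (t *\<^sub>R p))) UNIV (\<lambda>s. c p (t * s + 0))"
      unfolding linear_family_scale by (rule integral_curve_affine[OF conjunct2[OF c] h_smooth]) simp
    from integral_curve_unique[OF h_smooth convex_UNIV conjunct2[OF c] this, of 0 1]
    have "c (t *\<^sub>R p) 1 = c p t" using c by simp
    then show ?thesis by (simp add: \<phi>_def c_def)
  qed
  show "integral_curve M (ham (h p)) UNIV (\<lambda>t. \<phi> (t *\<^sub>R p) x)" using c[of p] by (simp add: eq)
  show "\<phi> 0 x = x" using eq[of 0 0] c[of 0] by simp
qed

lemma flow_in: "x \<in> points M \<Longrightarrow> \<phi> p x \<in> points M" using integral_curve_in_points[OF flow_curve(1), of x 1 p] by simp

lemma flow_deriv:
  "x \<in> points M \<Longrightarrow> f \<in> \<C> \<Longrightarrow>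
    ((\<lambda>t. f (\<phi> (t *\<^sub>R p) x)) has_real_derivative pb f (h p) (\<phi> (t *\<^sub>R p) x)) (at t)"
  using integral_curve_deriv[OF flow_curve(1) UNIV_I] by (simp add: hamiltonian_vf_apply)

lemma flow_eq:
  assumes "integral_curve M (ham (h p)) {0..1} c" shows "c 1 = \<phi> p (c 0)"
proof -
  have "c 0 \<in> points M" using integral_curve_in_points[OF assms, of 0] by simp
  from integral_curve_unique[OF h_smooth convex_real_interval(5) assms integral_curve_subset[OF flow_curve(1)[OF this] subset_UNIV], of 0 1]
  show ?thesis using flow_0[OF \<open>c 0 \<in> points M\<close>] by simp
qed

lemma flow_add_collinear:
  assumes x: "x \<in> points M" shows "\<phi> ((s + t) *\<^sub>R p) x = \<phi> (s *\<^sub>R p) (\<phi> (t *\<^sub>R p) x)"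
proof -
  have "integral_curve M (ham (\<lambda>y. 1 * h p y)) UNIV (\<lambda>s. \<phi> ((1 * s + t) *\<^sub>R p) x)"
    by (rule integral_curve_affine[OF flow_curve(1)[OF x] h_smooth]) simp
  then have 1: "integral_curve M (ham (h p)) UNIV (\<lambda>s. \<phi> ((s + t) *\<^sub>R p) x)" by simp
  show ?thesis using integral_curve_unique[OF h_smooth convex_UNIV 1 flow_curve(1)[OF flow_in[OF x]], where ?t0.0 = 0 and t = s] flow_0[OF flow_in[OF x]] by simp
qed

text \<open>Continuation along the time interval. Smoothness at \<open>(p0, x0)\<close> of the map
  for \<open>s *\<^sub>R p\<close> passes between nearby values of \<open>s\<close> by composing
  with a local flow around \<open>\<phi> (a *\<^sub>R p0) x0\<close>. At \<open>s = 0\<close> the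
  map is the projection to \<open>x\<close>, and connectedness of \<open>{0..1}\<close> leads to
  \<open>s = 1\<close>.\<close>

lemma flow_smooth:
  assumes f: "f \<in> \<C>" and x0: "x0 \<in> points M"
  shows "smooth_at_param (p0, x0) (\<lambda>z. f (\<phi> (fst z) (snd z)))"
proof -
  define P :: "('p \<times> 'a, 'p \<times> 'e) manifold" where "P = param_manifold M"
  have atP: "smooth_atlas P" unfolding P_def by (rule smooth_atlas_vec_prod[OF at subspace_UNIV])
  have pP: "points P = UNIV \<times> points M" by (simp add: P_def)
  define Q where "Q s \<longleftrightarrow> (\<forall>f\<in>\<C>. smooth_at P (points P) (p0, x0) (\<lambda>z. f (\<phi> (s *\<^sub>R fst z) (snd z))))" for s
  have "Q 1"
  proof (rule connected_induction_simple[OF connected_Icc, of 0 0 1 1 Q])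
    show "Q 0" unfolding Q_def
    proof
      fix f assume f: "f \<in> \<C>"
      have fx: "smooth_at M (points M) x0 f" using f x0 unfolding smooth_functions_iff[OF at] by blast
      have "smooth_at P (points P) (p0, x0) (\<lambda>z. f (snd z))" unfolding P_def by (rule smooth_at_vec_prod_snd[OF at subspace_UNIV UNIV_I fx]) auto
      then show "smooth_at P (points P) (p0, x0) (\<lambda>z. f (\<phi> (0 *\<^sub>R fst z) (snd z)))"
        by (rule smooth_at_cong[OF atP _ openin_topspace]) (use x0 in \<open>auto simp: pP flow_0\<close>)
    qed
    fix a :: real assume a: "a \<in> {0..1}"
    define y where "y = \<phi> (a *\<^sub>R p0) x0"
    have y: "y \<in> points M" unfolding y_def by (rule flow_in[OF x0])
    obtain d W' Fl where Fl: "0 < d" "openin (mtop M) W'" "y \<in> W'"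
      "\<And>p x. norm p < d \<Longrightarrow> x \<in> W' \<Longrightarrow> \<exists>c. integral_curve M (ham (h p)) {0..1} c \<and> c 0 = x \<and> c 1 = Fl (p, x)"
      "\<And>p x f. norm p < d \<Longrightarrow> x \<in> W' \<Longrightarrow> f \<in> \<C> \<Longrightarrow>
        smooth_at_param (p, x) (\<lambda>z. f (Fl z))" by (rule local_hamiltonian_flow[OF k y]) (assumption | (rule that, assumption+))+
    have Fl_eq: "Fl (p, x) = \<phi> p x" if px: "norm p < d" "x \<in> W'" for p x
    proof -
      obtain c where "integral_curve M (ham (h p)) {0..1} c" "c 0 = x" "c 1 = Fl (p, x)" using Fl(4)[OF px] by auto
      then show ?thesis using flow_eq by metis
    qed
    have yW: "(\<lambda>t. \<phi> (t *\<^sub>R p0) x0) a \<in> W'" using Fl(3) by (simp add: y_def)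
    obtain A1 where A1: "openin (top_of_set UNIV) A1" "a \<in> A1" "\<forall>s\<in>A1. \<phi> (s *\<^sub>R p0) x0 \<in> W'"
      using integral_curve_nbhd[OF flow_curve(1)[OF x0] UNIV_I Fl(2) yW] by auto
    \<comment> \<open>The added 1 keeps the radius \<open>r\<close> below meaningful when
      \<open>p0 = 0\<close>.\<close>
    define nn where "nn = norm p0 + 1"
    define r where "r = d / (2 * nn)"
    have np: "nn > 0" unfolding nn_def by (smt (verit) norm_ge_zero)
    have r: "0 < r" using Fl(1) np by (simp add: r_def)
    define T where "T = {0..1} \<inter> (A1 \<inter> ball a r)"
    have close: "norm ((s' - s) *\<^sub>R p0) < d" if "s \<in> T" "s' \<in> T" for s s'
    proof -
      have "\<bar>s' - s\<bar> < 2 * r" using that by (auto simp: T_def dist_real_def)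
      then have "\<bar>s' - s\<bar> * norm p0 \<le> (2 * r) * norm p0" by (intro mult_right_mono) auto
      also have "\<dots> < (2 * r) * nn" using r by (simp add: nn_def)
      also have "\<dots> = d" using np by (simp add: r_def)
      finally show ?thesis by simp
    qed
    show "\<exists>T. openin (top_of_set {0..1}) T \<and> a \<in> T \<and> (\<forall>s\<in>T. \<forall>s'\<in>T. Q s \<longrightarrow> Q s')"
    proof (intro exI[of _ T] conjI ballI impI)
      show "openin (top_of_set {0..1}) T" unfolding T_def using A1(1) by (intro openin_open_Int open_Int) auto
      show "a \<in> T" using a A1(2) r by (simp add: T_def)
      fix s s' assume s: "s \<in> T" "s' \<in> T" and Qs: "Q s"
      define q where "q z = (s' - s) *\<^sub>R fst z" for z :: "'p \<times> 'a"
      define \<Phi> where "\<Phi> z = \<phi> (s *\<^sub>R fst z) (snd z)" for z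
      have sW: "\<Phi> (p0, x0) \<in> W'" using A1(3) s(1) by (auto simp: \<Phi>_def T_def)
      have qs: "smooth_at P (points P) (p0, x0) q" unfolding q_def P_def
        using smooth_at_vec_prod_fst[OF at subspace_UNIV UNIV_I x0 C_inf_on_bounded_linear[OF open_UNIV bounded_linear_scaleR_right]] .
      show "Q s'" unfolding Q_def
      proof
        fix f assume f: "f \<in> \<C>"
        have cl: "norm (q (p0, x0)) < d" using close[OF s] by (simp add: q_def)
        have db: "q (p0, x0) \<in> ball 0 d" using cl by simp
        obtain W3 where W3: "openin (mtop P) W3" "(p0, x0) \<in> W3" "\<And>y. y \<in> W3 \<Longrightarrow> q y \<in> ball 0 d"
          by (rule smooth_at_nbhd[OF atP qs open_ball db], rule that)
        obtain W4 where W4: "openin (mtop P) W4" "(p0, x0) \<in> W4" "\<And>y. y \<in> W4 \<Longrightarrow> \<Phi> y \<in> W'"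
          using pullback_nbhd[where \<Phi> = \<Phi> and x = "(p0, x0)", OF atP M _ Fl(2) sW] Qs by (auto simp: Q_def \<Phi>_def)
        have sm: "smooth_at P (points P) (p0, x0) (\<lambda>z. f (Fl (q z, \<Phi> z)))"
        proof (rule smooth_at_param_pullback[where K = "\<lambda>z. f (Fl z)" and q = q and \<Phi> = \<Phi>, OF atP M subspace_UNIV _ qs UNIV_I])
          show "smooth_at P (points P) (p0, x0) (\<lambda>y. f (\<Phi> y))" if "f \<in> \<C>" for f using Qs that by (simp add: Q_def \<Phi>_def)
          show "smooth_at_param (q (p0, x0), \<Phi> (p0, x0)) (\<lambda>z. f (Fl z))" by (rule Fl(5)[OF cl sW f])
        qed (use x0 flow_in in \<open>auto simp: pP \<Phi>_def\<close>)
        show "smooth_at P (points P) (p0, x0) (\<lambda>z. f (\<phi> (s' *\<^sub>R fst z) (snd z)))"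
        proof (rule smooth_at_cong[OF atP sm openin_Int[OF W3(1) W4(1)]])
          show "(p0, x0) \<in> W3 \<inter> W4" using W3(2) W4(2) by simp
          fix z assume z: "z \<in> W3 \<inter> W4" "z \<in> points P"
          have "Fl (q z, \<Phi> z) = \<phi> (q z) (\<Phi> z)" using Fl_eq W3(3)[of z] W4(3)[of z] z by auto
          also have "\<dots> = \<phi> (s' *\<^sub>R fst z) (snd z)" using flow_add_collinear[of "snd z" "s' - s" s "fst z"] z by (auto simp: q_def \<Phi>_def pP)
          finally show "z \<in> points P \<and> f (\<phi> (s' *\<^sub>R fst z) (snd z)) = f (Fl (q z, \<Phi> z))" using z by simp
        qed
      qed
    qed
  qed auto
  then show ?thesis using f by (simp add: Q_def P_def)
qed

end

context poisson
begin

lemma bracket_locally_const_right: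
  assumes f: "f \<in> \<C>" and g: "g \<in> \<C>" and x: "x \<in> points M" and c: "\<And>y. y \<in> points M \<Longrightarrow> g y = c"
  shows "pb f g x = 0" using hamiltonian_vf_cong[OF x g smooth_functions_const[OF at] openin_topspace x c] hamiltonian_vf_const[OF x, of c]
  by (simp flip: hamiltonian_vf_apply[OF f])

lemma bracket_cong:
  assumes x: "x \<in> points M" and h: "h \<in> \<C>" and f: "f \<in> \<C>" "g \<in> \<C>"
    and W: "openin (mtop M) W" "x \<in> W" and eq: "\<And>y. y \<in> W \<Longrightarrow> f y = g y"
  shows "pb f h x = pb g h x" using tangent_local[OF M hamiltonian_vf_tangent[OF x h] f W eq] f by (simp add: hamiltonian_vf_apply)

lemma vec_apply_Pair_const:
  fixes th :: "'a \<Rightarrow> 'f::euclidean_space" and c :: "'g::euclidean_space"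
  assumes "v \<in> tangent_space M x"
  shows "vec_apply v (\<lambda>y. (c, th y)) = (0, vec_apply v th)" by (simp add: vec_apply_Pair vec_apply_def[of v "\<lambda>y. c"] tangent_const[OF at assms])

text \<open>The chain rule with a frozen parameter \<open>s\<close>: the constant component of the
  pair \<open>(s, th y)\<close> contributes no derivative.\<close>

lemma bracket_param_chain:
  fixes th :: "'a \<Rightarrow> 'f::euclidean_space" and s :: "'g::euclidean_space"
  assumes x: "x \<in> points M" and e: "smooth_everywhere M th" and h: "h \<in> \<C>" and f: "f \<in> \<C>"
    and g: "C_inf_on T g" "(s, th x) \<in> T" and W: "openin (mtop M) W" "x \<in> W" and eq: "\<And>y. y \<in> W \<Longrightarrow> f y = g (s, th y)"
  shows "pb f h x = fderiv g (s, th x) (0, bracket_vec th h x)"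
proof -
  have C: "C_inf_on UNIV (\<lambda>w::'f. (s, w))" by (intro C_inf_on_Pair C_inf_on_const C_inf_on_id open_UNIV)
  show ?thesis using bracket_chain[OF x smooth_everywhere_map[OF at e C] h f g W eq]
      vec_apply_Pair_const[OF hamiltonian_vf_tangent[OF x h], of s th] by (simp add: bracket_vec_def)
qed

end

context poisson_flow
begin

lemma flow_pullback_smooth:
  assumes f: "f \<in> \<C>" shows "(\<lambda>x. f (\<phi> p x)) \<in> \<C>" unfolding smooth_functions_iff[OF at]
proof
  fix x assume x: "x \<in> points M"
  have "smooth_at M (points M) x (\<lambda>y. (\<lambda>z. f (\<phi> (fst z) (snd z))) (p, y))"
    by (rule smooth_at_param_pullback[where q = "\<lambda>y. p" and \<Phi> = "\<lambda>y. y" and K = "\<lambda>z. f (\<phi> (fst z) (snd z))",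
          OF at M subspace_UNIV x smooth_at_const[OF at x] UNIV_I _ _ flow_smooth[OF f x]]) (use x in \<open>auto simp: smooth_functions_iff[OF at]\<close>)
  then show "smooth_at M (points M) x (\<lambda>x. f (\<phi> p x))" by simp
qed

text \<open>Both sides are the derivative of \<open>f (\<phi> ((s + t) *\<^sub>R p) z)\<close> at
  \<open>t = 0\<close>: once with the step \<open>t\<close> taken first, once read along the curve
  at time \<open>s\<close>.\<close>

lemma flow_deriv_shift:
  assumes z: "z \<in> points M" and f: "f \<in> \<C>"
  shows "pb (\<lambda>x. f (\<phi> (s *\<^sub>R p) x)) (h p) z = pb f (h p) (\<phi> (s *\<^sub>R p) z)"
proof -
  have 1: "((\<lambda>t. f (\<phi> (s *\<^sub>R p) (\<phi> (t *\<^sub>R p) z))) has_real_derivative pb (\<lambda>x. f (\<phi> (s *\<^sub>R p) x)) (h p) z) (at 0)"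
    using flow_deriv[OF z flow_pullback_smooth[OF f, of "s *\<^sub>R p"], of p 0] flow_0[OF z] by simp
  have "((\<lambda>t. f (\<phi> ((s + t) *\<^sub>R p) z)) has_real_derivative pb f (h p) (\<phi> (s *\<^sub>R p) z) * 1) (at 0)"
    by (rule DERIV_chain2[where g = "\<lambda>t. s + t" and f = "\<lambda>t. f (\<phi> (t *\<^sub>R p) z)"])
      (use flow_deriv[OF z f, of p s] in \<open>auto intro!: derivative_eq_intros\<close>)
  then have 2: "((\<lambda>t. f (\<phi> (s *\<^sub>R p) (\<phi> (t *\<^sub>R p) z))) has_real_derivative pb f (h p) (\<phi> (s *\<^sub>R p) z)) (at 0)"
    by (simp add: flow_add_collinear[OF z])
  show ?thesis by (rule DERIV_unique[OF 1 2])
qed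

text \<open>Near \<open>(s0, z0)\<close> the function becomes a smooth function \<open>ka\<close> of
  time and coordinates, so that mixed derivatives can be computed in Euclidean space. The last
  conclusion writes any other smooth map, such as a velocity, in the same coordinates.\<close>

lemma flow_local_representation:
  assumes f: "f \<in> \<C>" and z0: "z0 \<in> points M"
  obtains A W T ka th where "open A" "s0 \<in> A" "openin (mtop M) W" "z0 \<in> W" "smooth_everywhere M (th :: 'a \<Rightarrow> 'e)"
    "C_inf_on T (ka :: real \<times> 'e \<Rightarrow> real)" "\<And>s z. s \<in> A \<Longrightarrow> z \<in> W \<Longrightarrow> (s, th z) \<in> T"
    "\<And>s z. s \<in> A \<Longrightarrow> z \<in> W \<Longrightarrow> f (\<phi> (s *\<^sub>R p) z) = ka (s, th z)"
    "\<And>s z. s \<in> A \<Longrightarrow> z \<in> W \<Longrightarrow> fderiv ka (s, th z) (1, 0) = pb f (h p) (\<phi> (s *\<^sub>R p) z)"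
    "\<And>\<eta> :: 'a \<Rightarrow> 'e. smooth_everywhere M \<eta> \<Longrightarrow> \<exists>W' T' g. openin (mtop M) W' \<and> z0 \<in> W' \<and> C_inf_on T' g \<and>
        (\<forall>y\<in>W'. th y \<in> T' \<and> \<eta> y = g (th y))"
proof -
  obtain U \<psi> W th where c: "(U, \<psi>) \<in> atlas M" "openin (mtop M) W" "z0 \<in> W" "W \<subseteq> U" "\<And>y. y \<in> W \<Longrightarrow> th y = \<psi> y"
    "\<And>y. th y \<in> model M" "smooth_everywhere M th" by (rule smooth_coordinates[OF M z0], rule that)
  have zU: "z0 \<in> U" using c by auto
  define P :: "(real \<times> 'a, real \<times> 'e) manifold" where "P = param_manifold M"
  have atP: "smooth_atlas P" unfolding P_def by (rule smooth_atlas_vec_prod[OF at subspace_UNIV])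
  have pP: "points P = UNIV \<times> points M" by (simp add: P_def)
  have sm: "smooth_at_param (s0, z0) (\<lambda>z. f (\<phi> (fst z *\<^sub>R p) (snd z)))"
  proof -
    have q: "smooth_at P (points P) (s0, z0) (\<lambda>z. fst z *\<^sub>R p)" unfolding P_def
      by (rule smooth_at_vec_prod_fst[OF at subspace_UNIV UNIV_I z0 C_inf_on_bounded_linear[OF open_UNIV bounded_linear_scaleR_left]])
    have "smooth_at P (points P) (s0, z0) (\<lambda>y. (\<lambda>z. f (\<phi> (fst z) (snd z))) (fst y *\<^sub>R p, snd y))"
    proof (rule smooth_at_param_pullback[where q = "\<lambda>z. fst z *\<^sub>R p" and \<Phi> = snd and K = "\<lambda>z. f (\<phi> (fst z) (snd z))", OF atP M subspace_UNIV _ q UNIV_I])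
      fix g assume g: "g \<in> \<C>"
      then have "smooth_at M (points M) z0 g" using z0 unfolding smooth_functions_iff[OF at] by blast
      then show "smooth_at P (points P) (s0, z0) (\<lambda>y. g (snd y))" unfolding P_def by (rule smooth_at_vec_prod_snd[OF at subspace_UNIV UNIV_I]) auto
    next
      show "smooth_at_param (fst (s0, z0) *\<^sub>R p, snd (s0, z0)) (\<lambda>z. f (\<phi> (fst z) (snd z)))" using flow_smooth[OF f z0] by simp
    qed (use z0 in \<open>auto simp: pP\<close>)
    then show ?thesis by (simp add: P_def)
  qed
  obtain A W2 T ka where A: "openin (top_of_set UNIV) A" "s0 \<in> A" "openin (mtop M) W2" "z0 \<in> W2" "W2 \<subseteq> U" "C_inf_on T ka"
    "\<And>q y. q \<in> A \<Longrightarrow> y \<in> W2 \<Longrightarrow> (q, \<psi> y) \<in> T"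
    "\<And>q y. q \<in> A \<Longrightarrow> y \<in> W2 \<Longrightarrow> (q, y) \<in> UNIV \<times> points M \<Longrightarrow> f (\<phi> (fst (q, y) *\<^sub>R p) (snd (q, y))) = ka (q, \<psi> y)"
    by (rule smooth_at_vec_prodE[OF at subspace_UNIV sm c(1) zU], rule that)
  have Aop: "open A" using A(1) by simp
  have WW: "openin (mtop M) (W \<inter> W2)" "z0 \<in> W \<inter> W2" using c A by auto
  have rep: "f (\<phi> (s *\<^sub>R p) z) = ka (s, th z)" "(s, th z) \<in> T" if "s \<in> A" "z \<in> W \<inter> W2" for s z
  proof -
    have "z \<in> points M" using that openin_subset[OF A(3)] by auto
    then show "f (\<phi> (s *\<^sub>R p) z) = ka (s, th z)" "(s, th z) \<in> T" using A(7,8)[of s z] that c(5)[of z] by auto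
  qed
  show ?thesis
  proof (rule that[OF Aop A(2) WW c(7) A(6) rep(2) rep(1)])
    fix s z assume s: "s \<in> A" and z: "z \<in> W \<inter> W2"
    have zM: "z \<in> points M" using z openin_subset[OF A(3)] by auto
    have "(0, th z) + s *\<^sub>R (1, 0) \<in> T" using rep(2)[OF s z] by simp
    from has_vector_derivative_line[OF C_inf_on_has_derivative[OF A(6) this], of UNIV]
    have "((\<lambda>t. ka (t, th z)) has_real_derivative fderiv ka (s, th z) (1, 0)) (at s)" by (simp add: has_real_derivative_iff_has_vector_derivative)
    then have "((\<lambda>t. f (\<phi> (t *\<^sub>R p) z)) has_real_derivative fderiv ka (s, th z) (1, 0)) (at s)"
      by (rule has_field_derivative_transform_within_open[OF _ Aop s]) (use rep(1) z in simp)
    from DERIV_unique[OF this flow_deriv[OF zM f]]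
    show "fderiv ka (s, th z) (1, 0) = pb f (h p) (\<phi> (s *\<^sub>R p) z)" .
  next
    fix \<eta> :: "'a \<Rightarrow> 'e" assume e: "smooth_everywhere M \<eta>"
    obtain W3 T3 g where W3: "openin (mtop M) W3" "z0 \<in> W3" "W3 \<subseteq> U" "C_inf_on T3 g" "\<psi> ` W3 \<subseteq> T3" "\<And>y. y \<in> W3 \<Longrightarrow> y \<in> points M \<Longrightarrow> \<eta> y = g (\<psi> y)"
      by (rule smooth_at_chartE[OF at smooth_everywhereD[OF e z0] c(1) zU], rule that)
    show "\<exists>W' T' g. openin (mtop M) W' \<and> z0 \<in> W' \<and> C_inf_on T' g \<and> (\<forall>y\<in>W'. th y \<in> T' \<and> \<eta> y = g (th y))"
      by (rule exI[of _ "W \<inter> W3"], rule exI[of _ T3], rule exI[of _ g]) (use c W3 openin_subset[OF W3(1)] in auto)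
  qed
qed

end

section \<open>Constant brackets: the flows form an action of a vector space\<close>

locale commuting_flow = poisson_flow M \<pi> k
  for M :: "('a, 'e::euclidean_space) manifold" and \<pi> :: "'a bivector" and k :: "'p::euclidean_space \<Rightarrow> 'a \<Rightarrow> real" +
  fixes \<sigma> :: "'p \<Rightarrow> 'p \<Rightarrow> real"
  assumes bracket_h: "\<And>p q x. x \<in> points M \<Longrightarrow> bracket M \<pi> (h p) (h q) x = \<sigma> p q"
begin

text \<open>In Jacobi's identity the term with \<open>{h p, h q}\<close> vanishes because this
  bracket is constant. So the vector fields of \<open>h p\<close> and \<open>h q\<close> commute as
  derivations.\<close>

lemma brackets_with_h_commute:
  assumes f: "f \<in> \<C>" and x: "x \<in> points M"
  shows "pb (pb f (h p)) (h q) x = pb (pb f (h q)) (h p) x"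
proof -
  have 1: "pb (pb f (h p)) (h q) x = - pb (h q) (pb f (h p)) x" by (rule bracket_skew[OF x bracket_smooth[OF f h_smooth] h_smooth])
  have "pb (h p) (pb (h q) f) x = - pb (pb (h q) f) (h p) x" by (rule bracket_skew[OF x h_smooth bracket_smooth[OF h_smooth f]])
  also have "pb (pb (h q) f) (h p) x = pb (\<lambda>y. -1 * pb f (h q) y) (h p) x" by (rule bracket_cong[OF x h_smooth bracket_smooth[OF h_smooth f] _ openin_topspace x])
      (use bracket_skew[OF _ f h_smooth] bracket_smooth[OF f h_smooth] in \<open>auto intro: smooth_functions_mult[OF at smooth_functions_const[OF at, of "-1"], simplified]\<close>)
  also have "\<dots> = - pb (pb f (h q)) (h p) x"
  proof -
    have s: "(\<lambda>y. -1 * pb f (h q) y) \<in> \<C>" by (rule smooth_functions_mult[OF at smooth_functions_const[OF at] bracket_smooth[OF f h_smooth]])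
    show ?thesis using tangent_scale[OF at hamiltonian_vf_tangent[OF x h_smooth] bracket_smooth[OF f h_smooth], of p "-1" q] s bracket_smooth[OF f h_smooth]
      by (simp add: hamiltonian_vf_apply)
  qed
  finally have 2: "pb (h p) (pb (h q) f) x = pb (pb f (h q)) (h p) x" by simp
  have 3: "pb f (pb (h p) (h q)) x = 0" by (rule bracket_locally_const_right[OF f bracket_smooth[OF h_smooth h_smooth] x bracket_h])
  show ?thesis using jacobi[OF f h_smooth h_smooth x, of p q] 1 2 3 by simp
qed

text \<open>With \<open>u s = f \<circ> \<phi> (s *\<^sub>R p)\<close> the time derivative has two
  parts: \<open>{{u s, h p}, h q}\<close> from the change of \<open>u s\<close>, and
  \<open>- {{u s, h q}, h p}\<close> from moving the point backwards along the flow. They cancel by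
  \<open>brackets_with_h_commute\<close>.\<close>

lemma flow_invariance_deriv:
  assumes f: "f \<in> \<C>" and y: "y \<in> points M"
  shows "((\<lambda>s. pb (\<lambda>x. f (\<phi> (s *\<^sub>R p) x)) (h q) (\<phi> ((- s) *\<^sub>R p) y)) has_real_derivative 0) (at s0)"
proof -
  define z0 where "z0 = \<phi> ((- s0) *\<^sub>R p) y"
  have z0: "z0 \<in> points M" unfolding z0_def by (rule flow_in[OF y])
  define u where "u s x = f (\<phi> (s *\<^sub>R p) x)" for s x
  have u: "u s \<in> \<C>" for s unfolding u_def by (rule flow_pullback_smooth[OF f])
  obtain A W T ka th where A: "open A" "s0 \<in> A" "openin (mtop M) W" "z0 \<in> W" "smooth_everywhere M (th :: 'a \<Rightarrow> 'e)"
    "C_inf_on T (ka :: real \<times> 'e \<Rightarrow> real)" "\<And>s z. s \<in> A \<Longrightarrow> z \<in> W \<Longrightarrow> (s, th z) \<in> T"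
    "\<And>s z. s \<in> A \<Longrightarrow> z \<in> W \<Longrightarrow> f (\<phi> (s *\<^sub>R p) z) = ka (s, th z)"
    "\<And>s z. s \<in> A \<Longrightarrow> z \<in> W \<Longrightarrow> fderiv ka (s, th z) (1, 0) = pb f (h p) (\<phi> (s *\<^sub>R p) z)"
    "\<And>\<eta> :: 'a \<Rightarrow> 'e. smooth_everywhere M \<eta> \<Longrightarrow> \<exists>W' T' g. openin (mtop M) W' \<and> z0 \<in> W' \<and> C_inf_on T' g \<and>
        (\<forall>y\<in>W'. th y \<in> T' \<and> \<eta> y = g (th y))" by (rule flow_local_representation[OF f z0, of s0 p], rule that)
  obtain W3 T3 xh where W3: "openin (mtop M) W3" "z0 \<in> W3" "C_inf_on T3 xh" "\<forall>y\<in>W3. th y \<in> T3 \<and> bracket_vec th (h q) y = xh (th y)"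
    using A(10)[OF bracket_vec_smooth[OF A(5) h_smooth[of q]]] by (elim exE conjE) (rule that)
  define Wn where "Wn = W \<inter> W3"
  have Wn: "openin (mtop M) Wn" "z0 \<in> Wn" using A W3 by (auto simp: Wn_def)
  have WnM: "z \<in> points M" if "z \<in> Wn" for z using that openin_subset[OF Wn(1)] by auto
  have xh: "th z \<in> T3" "bracket_vec th (h q) z = xh (th z)" if "z \<in> Wn" for z using W3(4) that by (auto simp: Wn_def)
  have ka: "(s, th z) \<in> T" "u s z = ka (s, th z)" if "s \<in> A" "z \<in> Wn" for s z using A(7,8) that by (auto simp: Wn_def u_def)
  define T' where "T' = T \<inter> UNIV \<times> T3"
  have oT': "open T'" unfolding T'_def using C_inf_on_open[OF A(6)] C_inf_on_open[OF W3(3)] by (intro open_Int open_Times open_UNIV)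
  define k1 where "k1 x = fderiv ka x (0, xh (snd x))" for x
  have xhs: "C_inf_on T' (\<lambda>x. xh (snd x))" by (rule C_inf_on_compose[OF C_inf_on_bounded_linear[OF oT' bounded_linear_snd] W3(3)]) (auto simp: T'_def)
  have k1: "C_inf_on T' k1" unfolding k1_def by (rule C_inf_on_frechet_family[OF C_inf_on_subset[OF A(6) oT'] C_inf_on_Pair[OF C_inf_on_const[OF oT'] xhs]]) (simp add: T'_def)
  define ka1 where "ka1 x = fderiv ka x (1, 0)" for x
  have ka1: "C_inf_on T ka1" unfolding ka1_def by (rule C_inf_on_frechet[OF A(6)])
  have bq: "pb (u s) (h q) z = k1 (s, th z)" if "s \<in> A" "z \<in> Wn" for s z
    using bracket_param_chain[OF WnM[OF that(2)] A(5) h_smooth u A(6) ka(1)[OF that] Wn(1) that(2) ka(2)[OF that(1)], of q] xh(2)[OF that(2)] by (simp add: k1_def)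
  have bp: "pb (u s) (h p) z = ka1 (s, th z)" if "s \<in> A" "z \<in> Wn" for s z
    using A(9)[of s z] that flow_deriv_shift[OF WnM[OF that(2)] f, of s p] by (simp add: ka1_def Wn_def u_def[abs_def])
  have inT': "(s, th z) \<in> T'" if "s \<in> A" "z \<in> Wn" for s z using ka(1)[OF that] xh(1)[OF that(2)] by (simp add: T'_def)
  define x0 where "x0 = (s0, th z0)"
  have x0: "x0 \<in> T'" "x0 \<in> T" using inT'[OF A(2) Wn(2)] by (auto simp: x0_def T'_def)
  define a where "a = xh (th z0)"
  define D where "D = fderiv k1 x0"
  have Dk1: "(k1 has_derivative D) (at x0)" unfolding D_def by (rule C_inf_on_has_derivative[OF k1 x0(1)])
  have i: "D (0, bracket_vec th (h p) z0) = pb (pb (u s0) (h q)) (h p) z0" unfolding D_def x0_def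
    by (rule bracket_param_chain[OF z0 A(5) h_smooth bracket_smooth[OF u h_smooth] k1 inT'[OF A(2) Wn(2)] Wn bq[OF A(2)], symmetric])
  \<comment> \<open>The time derivative passes through the bracket with \<open>h q\<close> by the
    symmetry of the second derivatives of \<open>ka\<close>.\<close>
  have ii: "D (1, 0) = pb (pb (u s0) (h p)) (h q) z0"
  proof -
    have "(0, th z0) + s0 *\<^sub>R (1, 0) = x0" by (simp add: x0_def)
    then have 1: "((\<lambda>t. k1 ((0, th z0) + t *\<^sub>R (1, 0))) has_vector_derivative D (1, 0)) (at s0)"
      using has_vector_derivative_line[of k1 D "(0, th z0)" s0 "(1, 0)" UNIV] Dk1 by simp
    define kaa where "kaa x = fderiv ka x (0, a)" for x
    have kaa: "C_inf_on T kaa" unfolding kaa_def by (rule C_inf_on_frechet[OF A(6)])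
    have 2: "((\<lambda>t. kaa ((0, th z0) + t *\<^sub>R (1, 0))) has_vector_derivative fderiv kaa x0 (1, 0)) (at s0)"
      by (rule has_vector_derivative_line) (use C_inf_on_has_derivative[OF kaa x0(2)] in \<open>simp add: x0_def\<close>)
    have "k1 ((0, th z0) + t *\<^sub>R (1, 0)) = kaa ((0, th z0) + t *\<^sub>R (1, 0))" for t by (simp add: k1_def kaa_def a_def)
    then have "D (1, 0) = fderiv kaa x0 (1, 0)" using vector_derivative_unique_at[OF 1] 2 by simp
    also have "\<dots> = fderiv ka1 x0 (0, a)" unfolding kaa_def ka1_def by (rule symmetric_second_derivative[OF A(6) x0(2)])
    also have "\<dots> = pb (pb (u s0) (h p)) (h q) z0"
      using bracket_param_chain[OF z0 A(5) h_smooth bracket_smooth[OF u h_smooth] ka1 ka(1)[OF A(2) Wn(2)] Wn bp[OF A(2)], of q] xh(2)[OF Wn(2)] by (simp add: x0_def a_def)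
    finally show ?thesis .
  qed
  define c where "c s = \<phi> (s *\<^sub>R (- p)) y" for s
  have cz: "c s0 = z0" "c s = \<phi> ((- s) *\<^sub>R p) y" for s by (simp_all add: c_def z0_def)
  have cc: "integral_curve M (ham (h (- p))) UNIV c" unfolding c_def by (rule flow_curve(1)[OF y])
  have "bracket_vec th (h (- p)) z0 = - bracket_vec th (h p) z0" by (simp add: bracket_vec_linear_family[OF z0 k] sum_negf)
  then have dc: "((\<lambda>s. th (c s)) has_vector_derivative - bracket_vec th (h p) z0) (at s0)"
    using integral_curve_vec[OF cc UNIV_I A(5), of s0] by (simp add: bracket_vec_def cz(1))
  have "((\<lambda>s. (s, th (c s))) has_vector_derivative (1, - bracket_vec th (h p) z0)) (at s0)" using dc by (auto intro!: has_vector_derivative_Pair derivative_eq_intros)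
  then have "((\<lambda>s. k1 (s, th (c s))) has_vector_derivative D (1, - bracket_vec th (h p) z0)) (at s0)"
    by (rule has_vector_derivative_compose_has_derivative) (use Dk1 in \<open>simp add: cz(1) x0_def\<close>)
  moreover have "D (1, - bracket_vec th (h p) z0) = 0"
  proof -
    have lin: "linear D" using Dk1 by (rule has_derivative_linear)
    have "D (1, - bracket_vec th (h p) z0) = D ((1, 0) - (0, bracket_vec th (h p) z0))" by simp
    also have "\<dots> = D (1, 0) - D (0, bracket_vec th (h p) z0)" by (rule linear_diff[OF lin])
    also have "\<dots> = 0" unfolding i ii using brackets_with_h_commute[OF u z0] by simp
    finally show ?thesis .
  qed
  ultimately have der: "((\<lambda>s. k1 (s, th (c s))) has_real_derivative 0) (at s0)" by (simp add: has_real_derivative_iff_has_vector_derivative)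
  have czW: "c s0 \<in> Wn" using Wn(2) cz(1) by simp
  obtain B where B: "openin (top_of_set UNIV) B" "s0 \<in> B" "\<forall>s\<in>B. c s \<in> Wn" using integral_curve_nbhd[OF cc UNIV_I Wn(1) czW] by blast
  have "open (B \<inter> A)" using B(1) A(1) by auto
  from has_field_derivative_transform_within_open[OF der this]
  show ?thesis using B A(2) bq cz(2) by (simp add: u_def[abs_def])
qed

text \<open>Integrates the previous lemma from \<open>s = 0\<close> to \<open>s = 1\<close>: the
  flow of \<open>h p\<close> preserves the vector field of \<open>h q\<close>.\<close>

lemma flow_invariance:
  assumes f: "f \<in> \<C>" and x: "x \<in> points M"
  shows "pb (\<lambda>x. f (\<phi> p x)) (h q) x = pb f (h q) (\<phi> p x)"
proof -
  define y where "y = \<phi> p x"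
  have y: "y \<in> points M" unfolding y_def by (rule flow_in[OF x])
  define Q where "Q s = pb (\<lambda>x. f (\<phi> (s *\<^sub>R p) x)) (h q) (\<phi> ((- s) *\<^sub>R p) y)" for s
  have "Q 1 = Q 0" by (rule DERIV_isconst_all[of Q 1 0]) (use flow_invariance_deriv[OF f y, of p q] in \<open>simp add: Q_def[abs_def]\<close>)
  moreover have "\<phi> ((- 1) *\<^sub>R p) y = x" using flow_add_collinear[OF x, of "-1" 1 p] flow_0[OF x] by (simp add: y_def)
  moreover have "Q 0 = pb f (h q) y"
  proof -
    have "pb (\<lambda>x. f (\<phi> 0 x)) (h q) y = pb f (h q) y" by (rule bracket_cong[OF y h_smooth flow_pullback_smooth[OF f] f openin_topspace y]) (simp add: flow_0)
    then show ?thesis by (simp add: Q_def flow_0[OF y])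
  qed
  ultimately show ?thesis by (simp add: Q_def y_def)
qed

text \<open>The composite curve moves with the velocity of \<open>h p\<close> plus the transported
  velocity of \<open>h q\<close>. By invariance the latter is the velocity of \<open>h q\<close> at
  the new point, so the curve belongs to \<open>h (p + q)\<close>, and integral curves are
  unique.\<close>

lemma flow_add:
  assumes x: "x \<in> points M" shows "\<phi> (p + q) x = \<phi> p (\<phi> q x)"
proof -
  define c where "c t = \<phi> (t *\<^sub>R p) (\<phi> (t *\<^sub>R q) x)" for t
  have cM: "c t \<in> points M" for t unfolding c_def by (intro flow_in x)
  have "integral_curve M (ham (h (p + q))) UNIV c"
  proof (rule integral_curveI)
    show "c t \<in> points M" for t by (rule cM)
    fix s0 f assume f: "f \<in> \<C>"
    define z where "z t = \<phi> (t *\<^sub>R q) x" for t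
    have zc: "integral_curve M (ham (h q)) UNIV z" unfolding z_def by (rule flow_curve(1)[OF x])
    define z0 where "z0 = z s0"
    have z0: "z0 \<in> points M" unfolding z0_def z_def by (rule flow_in[OF x])
    obtain A W T ka th where A: "open A" "s0 \<in> A" "openin (mtop M) W" "z0 \<in> W" "smooth_everywhere M (th :: 'a \<Rightarrow> 'e)"
      "C_inf_on T (ka :: real \<times> 'e \<Rightarrow> real)" "\<And>s z. s \<in> A \<Longrightarrow> z \<in> W \<Longrightarrow> (s, th z) \<in> T"
      "\<And>s z. s \<in> A \<Longrightarrow> z \<in> W \<Longrightarrow> f (\<phi> (s *\<^sub>R p) z) = ka (s, th z)"
      "\<And>s z. s \<in> A \<Longrightarrow> z \<in> W \<Longrightarrow> fderiv ka (s, th z) (1, 0) = pb f (h p) (\<phi> (s *\<^sub>R p) z)"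
      "\<And>\<eta> :: 'a \<Rightarrow> 'e. smooth_everywhere M \<eta> \<Longrightarrow> \<exists>W' T' g. openin (mtop M) W' \<and> z0 \<in> W' \<and> C_inf_on T' g \<and>
        (\<forall>y\<in>W'. th y \<in> T' \<and> \<eta> y = g (th y))" by (rule flow_local_representation[OF f z0, of s0 p], rule that)
    define D where "D = fderiv ka (s0, th z0)"
    have T0: "(s0, th z0) \<in> T" by (rule A(7)[OF A(2,4)])
    have D: "(ka has_derivative D) (at (s0, th z0))" unfolding D_def by (rule C_inf_on_has_derivative[OF A(6) T0])
    have dz: "((\<lambda>s. th (z s)) has_vector_derivative bracket_vec th (h q) z0) (at s0)"
      using integral_curve_vec[OF zc UNIV_I A(5), of s0] by (simp add: bracket_vec_def z0_def)
    have "((\<lambda>s. (s, th (z s))) has_vector_derivative (1, bracket_vec th (h q) z0)) (at s0)" using dz by (auto intro!: has_vector_derivative_Pair derivative_eq_intros)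
    then have 1: "((\<lambda>s. ka (s, th (z s))) has_vector_derivative D (1, bracket_vec th (h q) z0)) (at s0)"
      by (rule has_vector_derivative_compose_has_derivative) (use D in \<open>simp add: z0_def\<close>)
    have zW: "z s0 \<in> W" using A(4) by (simp add: z0_def)
    obtain B where B: "openin (top_of_set UNIV) B" "s0 \<in> B" "\<forall>s\<in>B. z s \<in> W" using integral_curve_nbhd[OF zc UNIV_I A(3) zW] by blast
    have "open (B \<inter> A)" using B(1) A(1) by auto
    from has_vector_derivative_transform_within_open[OF 1 this, of "\<lambda>s. f (c s)"]
    have 2: "((\<lambda>s. f (c s)) has_vector_derivative D (1, bracket_vec th (h q) z0)) (at s0)" using B A(2,8) by (simp add: c_def z_def)
    have "D (1, bracket_vec th (h q) z0) = D ((1, 0) + (0, bracket_vec th (h q) z0))" by simp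
    also have "\<dots> = D (1, 0) + D (0, bracket_vec th (h q) z0)" by (rule linear_add[OF has_derivative_linear[OF D]])
    also have "D (1, 0) = pb f (h p) (c s0)" using A(9)[OF A(2,4)] by (simp add: D_def c_def z0_def z_def)
    also have "D (0, bracket_vec th (h q) z0) = pb (\<lambda>x. f (\<phi> (s0 *\<^sub>R p) x)) (h q) z0" unfolding D_def
      by (rule bracket_param_chain[OF z0 A(5) h_smooth flow_pullback_smooth[OF f] A(6) T0 A(3,4) A(8)[OF A(2)], symmetric])
    also have "\<dots> = pb f (h q) (c s0)" using flow_invariance[OF f z0, of "s0 *\<^sub>R p" q] by (simp add: c_def z0_def z_def)
    also have "pb f (h p) (c s0) + pb f (h q) (c s0) = ham (h (p + q)) (c s0) f"
    proof -
      have e: "h (p + q) = (\<lambda>y. 1 * h p y + 1 * h q y)" by (simp add: linear_family_add fun_eq_iff)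
      show ?thesis unfolding e hamiltonian_vf_combine[OF cM h_smooth h_smooth] by (simp add: hamiltonian_vf_apply[OF f])
    qed
    finally show "((\<lambda>s. f (c s)) has_real_derivative ham (h (p + q)) (c s0) f) (at s0)" using 2 by (simp add: has_real_derivative_iff_has_vector_derivative)
  qed
  from integral_curve_unique[OF h_smooth convex_UNIV this flow_curve(1)[OF x], where ?t0.0 = 0 and t = 1]
  show ?thesis by (simp add: c_def flow_0 x)
qed

end

section \<open>Coordinates on a subspace and representation of functionals by a symplectic
  form\<close>

section \<open>Symplectic forms\<close>

lemma symplectic_skew: "symplectic_form_on E \<omega> \<Longrightarrow> u \<in> E \<Longrightarrow> v \<in> E \<Longrightarrow> \<omega> u v = - \<omega> v u"
  unfolding symplectic_form_on_def by (elim conjE) (drule (1) bspec, drule (1) bspec)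

lemma symplectic_linear:
  "symplectic_form_on E \<omega> \<Longrightarrow> u \<in> E \<Longrightarrow> v \<in> E \<Longrightarrow> w \<in> E \<Longrightarrow> \<omega> (a *\<^sub>R u + b *\<^sub>R v) w = a * \<omega> u w + b * \<omega> v w"
  unfolding symplectic_form_on_def by metis

lemma symplectic_comp_linear:
  assumes \<omega>: "symplectic_form_on E \<omega>" and P: "linear P" "\<And>p. P p \<in> E" and w: "w \<in> E"
  shows "linear (\<lambda>p. \<omega> (P p) w)" using symplectic_linear[OF \<omega> P(2) P(2) w, of 1 _ 1] symplectic_linear[OF \<omega> P(2) P(2) w, of _ _ 0]
  by (intro linearI) (auto simp: linear_add[OF P(1)] linear_scale[OF P(1)])

lemma symplectic_nondegenerate:
  assumes "symplectic_form_on E \<omega>" "u \<in> E" "\<And>v. v \<in> E \<Longrightarrow> \<omega> u v = 0" shows "u = 0"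
  using assms unfolding symplectic_form_on_def by (elim conjE) (drule (1) bspec, auto)

lemma subspace_coordinates:
  fixes E :: "'b::euclidean_space set"
  assumes E: "subspace E"
  obtains B where "finite B" "B \<subseteq> E" "card B = dim E" "\<And>b b'. b \<in> B \<Longrightarrow> b' \<in> B \<Longrightarrow> b \<bullet> b' = (if b = b' then 1 else 0)"
    "\<And>w. w \<in> E \<Longrightarrow> (\<Sum>b\<in>B. (w \<bullet> b) *\<^sub>R b) = w"
    "\<And>(L :: 'b \<Rightarrow> real) w. w \<in> E \<Longrightarrow> \<forall>u\<in>E. \<forall>v\<in>E. \<forall>a b. L (a *\<^sub>R u + b *\<^sub>R v) = a * L u + b * L v \<Longrightarrow>
      L w = (\<Sum>b\<in>B. (w \<bullet> b) * L b)"
proof -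
  obtain P where P: "linear P" "\<And>x. P x \<in> E" "\<And>x. x \<in> E \<Longrightarrow> P x = x" by (rule linear_projection_exists[OF E], rule that)
  obtain B where B: "B \<subseteq> E" "pairwise orthogonal B" "\<And>x. x \<in> B \<Longrightarrow> norm x = 1" "independent B" "card B = dim E" "span B = E"
    by (rule orthonormal_basis_subspace[OF E], rule that)
  have fB: "finite B" by (rule finiteI_independent[OF B(4)])
  have expand: "(\<Sum>b\<in>B. (w \<bullet> b) *\<^sub>R b) = w" if "w \<in> E" for w by (rule orthonormal_basis_expand[OF B(2,3)]) (use that B(6) fB in auto)
  have "L w = (\<Sum>b\<in>B. (w \<bullet> b) * L b)" if w: "w \<in> E"
    and L: "\<And>u v a b. u \<in> E \<Longrightarrow> v \<in> E \<Longrightarrow> L (a *\<^sub>R u + b *\<^sub>R v) = a * L u + b * L v" for L :: "'b \<Rightarrow> real" and w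
  proof -
    have lin: "linear (\<lambda>x. L (P x))" using L[OF P(2) P(2), of 1 _ 1] L[OF P(2) P(2), of _ _ 0] by (intro linearI) (auto simp: linear_add[OF P(1)] linear_scale[OF P(1)])
    have "L w = L (P (\<Sum>b\<in>B. (w \<bullet> b) *\<^sub>R b))" using expand w P(3) by simp
    also have "\<dots> = (\<Sum>b\<in>B. (w \<bullet> b) * L (P b))" by (simp only: linear_sum[OF lin] linear_scale[OF lin] real_scaleR_def)
    also have "\<dots> = (\<Sum>b\<in>B. (w \<bullet> b) * L b)" using B(1) P(3) by (intro sum.cong) auto
    finally show ?thesis .
  qed
  moreover have "b \<bullet> b' = (if b = b' then 1 else 0)" if "b \<in> B" "b' \<in> B" for b b'
    using B(3)[OF that(1)] pairwiseD[OF B(2) that] by (auto simp: norm_eq_1 orthogonal_def)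
  ultimately show ?thesis using that[of B] fB B(1,5) expand by simp
qed

text \<open>The map taking \<open>v\<close> to the vector with coordinates
  \<open>\<omega> v b\<close> is injective on \<open>E\<close> by nondegeneracy, hence onto by
  dimension.\<close>

lemma symplectic_riesz:
  fixes E :: "'b::euclidean_space set"
  assumes E: "subspace E" and \<omega>: "symplectic_form_on E \<omega>"
    and l: "\<And>u v a b. u \<in> E \<Longrightarrow> v \<in> E \<Longrightarrow> l (a *\<^sub>R u + b *\<^sub>R v) = a * l u + b * l v"
  shows "\<exists>!v. v \<in> E \<and> (\<forall>w\<in>E. \<omega> v w = l w)"
proof -
  obtain P where P: "linear P" "\<And>x. P x \<in> E" "\<And>x. x \<in> E \<Longrightarrow> P x = x" by (rule linear_projection_exists[OF E], rule that)
  obtain B where B: "finite B" "B \<subseteq> E" "\<And>b b'. b \<in> B \<Longrightarrow> b' \<in> B \<Longrightarrow> b \<bullet> b' = (if b = b' then 1 else 0)"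
    "\<And>(L :: 'b \<Rightarrow> real) w. w \<in> E \<Longrightarrow> \<forall>u\<in>E. \<forall>v\<in>E. \<forall>a b. L (a *\<^sub>R u + b *\<^sub>R v) = a * L u + b * L v \<Longrightarrow>
      L w = (\<Sum>b\<in>B. (w \<bullet> b) * L b)" by (rule subspace_coordinates[OF E], rule that)
  have right: "\<omega> w (a *\<^sub>R u + b *\<^sub>R v) = a * \<omega> w u + b * \<omega> w v" if "u \<in> E" "v \<in> E" "w \<in> E" for u v w a b
    using symplectic_linear[OF \<omega> that, of a b] symplectic_skew[OF \<omega>] that by (smt (verit) E mult_minus_right subspace_add subspace_scale)
  define T where "T v = (\<Sum>b\<in>B. \<omega> (P v) b *\<^sub>R b)" for v
  have "linear T"
  proof (rule linearI)
    have "\<omega> (P (u + v)) b = \<omega> (P u) b + \<omega> (P v) b" if "b \<in> B" for u v b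
      using symplectic_linear[OF \<omega> P(2) P(2), of b 1 u 1 v] that B(2) by (auto simp: linear_add[OF P(1)])
    then show "T (u + v) = T u + T v" for u v by (simp add: T_def sum.distrib scaleR_left_distrib)
    have "\<omega> (P (c *\<^sub>R u)) b = c * \<omega> (P u) b" if "b \<in> B" for c u b
      using symplectic_linear[OF \<omega> P(2) P(2), of b c u 0 u] that B(2) by (auto simp: linear_scale[OF P(1)])
    then show "T (c *\<^sub>R u) = c *\<^sub>R T u" for c u by (simp add: T_def scaleR_sum_right)
  qed
  have inner: "(\<Sum>b'\<in>B. c b' *\<^sub>R b') \<bullet> b = c b" if "b \<in> B" for c b
  proof -
    have "(\<Sum>b'\<in>B. c b' *\<^sub>R b') \<bullet> b = (\<Sum>b'\<in>B. if b' = b then c b else 0)" unfolding inner_sum_left by (rule sum.cong) (use B(3) that in auto)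
    then show ?thesis using B(1) that by simp
  qed
  have T_inner: "T v \<bullet> b = \<omega> (P v) b" if "b \<in> B" for v b unfolding T_def by (rule inner[OF that])
  have TE: "T v \<in> E" for v unfolding T_def by (rule subspace_sum[OF E]) (use B(2) subspace_scale[OF E] in blast)
  have eqI: "v = 0" if v: "v \<in> E" and 0: "\<And>b. b \<in> B \<Longrightarrow> \<omega> v b = 0" for v
    by (rule symplectic_nondegenerate[OF \<omega> v], subst B(4)[of _ "\<omega> v"]) (simp_all add: right v 0)
  have "inj_on T E"
  proof (subst linear_injective_on_subspace_0[OF \<open>linear T\<close> E], intro ballI impI)
    fix v assume v: "v \<in> E" and "T v = 0"
    then have "\<omega> v b = 0" if "b \<in> B" for b using T_inner[OF that, of v] P(3)[OF v] by simp
    then show "v = 0" by (rule eqI[OF v])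
  qed
  moreover have "span E = E" using E by (rule span_eq_iff[THEN iffD2])
  ultimately have "dim (T ` E) = dim E" by (metis dim_image_eq[OF \<open>linear T\<close>])
  then have TE': "T ` E = E" by (intro subspace_dim_equal linear_subspace_image \<open>linear T\<close> E) (use TE in auto)
  have "(\<Sum>b\<in>B. l b *\<^sub>R b) \<in> E" by (rule subspace_sum[OF E]) (use B(2) subspace_scale[OF E] in blast)
  then obtain v where v: "v \<in> E" "T v = (\<Sum>b\<in>B. l b *\<^sub>R b)" using TE' by (metis imageE)
  have vb: "\<omega> v b = l b" if "b \<in> B" for b using T_inner[OF that, of v] v inner[OF that, of l] P(3) by simp
  show ?thesis
  proof (rule ex1I[of _ v])
    have "\<omega> v w = l w" if "w \<in> E" for w using B(4)[OF that, of l] B(4)[OF that, of "\<omega> v"] l right v(1) vb by simp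
    then show "v \<in> E \<and> (\<forall>w\<in>E. \<omega> v w = l w)" using v(1) by simp
    fix v' assume v': "v' \<in> E \<and> (\<forall>w\<in>E. \<omega> v' w = l w)"
    have "v' - v = 0"
    proof (rule eqI)
      show "v' - v \<in> E" using v' v(1) E by (simp add: subspace_diff)
      show "\<omega> (v' - v) b = 0" if "b \<in> B" for b using symplectic_linear[OF \<omega>, of v' v b 1 "-1"] v' v(1) vb[OF that] B(2) that by auto
    qed
    then show "v' = v" by simp
  qed
qed


section \<open>Criteria for manifolds and smooth maps; transport of vectors and covectors\<close>

section \<open>Manifolds and maps between them\<close>

lemma smooth_manifoldI:
  assumes M: "smooth_atlas M" and "Hausdorff_space (mtop M)" "second_countable (mtop M)" "subspace (model M)"
  shows "smooth_manifold M"
proof -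
  have "homeomorphic_map (subtopology (mtop M) U) (top_of_set (\<phi> ` U)) \<phi>" if c: "(U, \<phi>) \<in> atlas M" for U \<phi>
  proof (rule bijective_open_imp_homeomorphic_map)
    have U: "U \<subseteq> points M" by (rule openin_subset[OF chart_open[OF M c]])
    then have ts: "topspace (subtopology (mtop M) U) = U" by auto
    have "openin (subtopology (mtop M) U) {x \<in> U. \<phi> x \<in> T}" if "open T" for T using chart_preimage_open[OF M c that] by (auto simp: openin_subtopology)
    then have "continuous_map (subtopology (mtop M) U) euclidean \<phi>" by (auto simp: continuous_map_def ts simp del: topspace_subtopology)
    then show "continuous_map (subtopology (mtop M) U) (top_of_set (\<phi> ` U)) \<phi>" by (simp add: continuous_map_in_subtopology ts del: topspace_subtopology)
    show "open_map (subtopology (mtop M) U) (top_of_set (\<phi> ` U)) \<phi>" unfolding open_map_def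
    proof (intro allI impI)
      fix W assume "openin (subtopology (mtop M) U) W"
      then have W: "openin (mtop M) W" "W \<subseteq> U" using chart_open[OF M c] by (simp_all add: openin_open_subtopology)
      have "openin (top_of_set (model M)) (\<phi> ` W)" by (rule chart_image_open[OF M c W(2,1)])
      moreover have "\<phi> ` W \<subseteq> \<phi> ` U" "\<phi> ` U \<subseteq> model M" using W(2) chart_model[OF M c] by auto
      ultimately show "openin (top_of_set (\<phi> ` U)) (\<phi> ` W)" by (rule openin_subset_trans)
    qed
    show "\<phi> ` topspace (subtopology (mtop M) U) = topspace (top_of_set (\<phi> ` U))" unfolding ts by simp
    show "inj_on \<phi> (topspace (subtopology (mtop M) U))" unfolding ts by (rule chart_inj[OF M c])
  qed
  moreover have "openin (top_of_set (model M)) (\<phi> ` U)" if c: "(U, \<phi>) \<in> atlas M" for U \<phi> by (rule chart_image_open[OF M c subset_refl chart_open[OF M c]])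
  ultimately show ?thesis using assms(2-) M unfolding smooth_manifold_def smooth_atlas_def by auto
qed

lemma smooth_mapI:
  assumes M: "smooth_atlas M" and c: "continuous_map (mtop M) (mtop N) F"
    and s: "\<And>V \<psi> x. (V, \<psi>) \<in> atlas N \<Longrightarrow> x \<in> points M \<Longrightarrow> F x \<in> V \<Longrightarrow> smooth_at M (points M) x (\<lambda>y. \<psi> (F y))"
  shows "smooth_map M N F"
proof -
  have "smooth_on (\<phi> ` (U \<inter> F -` V)) (\<psi> \<circ> F \<circ> inv_into U \<phi>)" if U: "(U, \<phi>) \<in> atlas M" and V: "(V, \<psi>) \<in> atlas N" for U \<phi> V \<psi>
    unfolding smooth_on_iff_C_inf_on
  proof (intro ballI)
    fix z assume "z \<in> \<phi> ` (U \<inter> F -` V)"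
    then obtain x where x: "x \<in> U" "F x \<in> V" "z = \<phi> x" by auto
    have UM: "U \<subseteq> points M" by (rule openin_subset[OF chart_open[OF M U]])
    obtain W T g where W: "openin (mtop M) W" "x \<in> W" "W \<subseteq> U" "C_inf_on T g" "\<phi> ` W \<subseteq> T"
      "\<And>y. y \<in> W \<Longrightarrow> y \<in> points M \<Longrightarrow> \<psi> (F y) = g (\<phi> y)"
      by (rule smooth_at_chartE[OF M s[OF V _ x(2)] U x(1)]) (use x(1) UM in blast)+
    have "openin (top_of_set (model M)) (\<phi> ` W)" by (rule chart_image_open[OF M U W(3,1)])
    then obtain T' where T': "open T'" "\<phi> ` W = model M \<inter> T'" by (auto simp: openin_open)
    have "(\<psi> \<circ> F \<circ> inv_into U \<phi>) y = g y" if "y \<in> \<phi> ` (U \<inter> F -` V) \<inter> (T \<inter> T')" for y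
    proof -
      have "y \<in> model M" using that chart_model[OF M U] by auto
      then have "y \<in> \<phi> ` W" using that T' by auto
      then obtain w where w: "w \<in> W" "y = \<phi> w" by auto
      then have "inv_into U \<phi> y = w" using chart_inj[OF M U] W(3) by (auto intro: inv_into_f_f)
      then show ?thesis using W(3,6) w UM by auto
    qed
    moreover have "C_inf_on (T \<inter> T') g" by (rule C_inf_on_subset[OF W(4)]) (use T'(1) C_inf_on_open[OF W(4)] in auto)
    moreover have "z \<in> T \<inter> T'" using W(2,5) T'(2) x(3) by blast
    ultimately show "\<exists>T g. z \<in> T \<and> C_inf_on T g \<and> (\<forall>y\<in>\<phi> ` (U \<inter> F -` V) \<inter> T. g y = (\<psi> \<circ> F \<circ> inv_into U \<phi>) y)"
      by (intro exI[of _ "T \<inter> T'"] exI[of _ g]) simp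
  qed
  then show ?thesis using c unfolding smooth_map_def by auto
qed

text \<open>Bump functions detect open sets, so smooth pullbacks force continuity.\<close>

lemma continuous_map_pullback:
  assumes M: "smooth_atlas M" and N: "smooth_manifold N" and F: "\<And>x. x \<in> points M \<Longrightarrow> F x \<in> points N"
    and s: "\<And>f. f \<in> smooth_functions N \<Longrightarrow> (\<lambda>x. f (F x)) \<in> smooth_functions M"
  shows "continuous_map (mtop M) (mtop N) F" unfolding continuous_map_def
proof (intro conjI allI impI)
  show "F \<in> points M \<rightarrow> points N" using F by blast
  fix W assume W: "openin (mtop N) W"
  show "openin (mtop M) {x \<in> points M. F x \<in> W}"
  proof (subst openin_subopen, intro ballI)
    fix x assume x: "x \<in> {x \<in> points M. F x \<in> W}"
    then have sx: "smooth_at M (points M) x (\<lambda>y. f (F y))" if "f \<in> smooth_functions N" for f using s[OF that] smooth_functions_iff[OF M] by blast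
    have "F x \<in> W" using x by simp
    obtain W' where W': "openin (mtop M) W'" "x \<in> W'" "\<And>y. y \<in> W' \<Longrightarrow> F y \<in> W"
      by (rule pullback_nbhd[where \<Phi> = F, OF M N sx W \<open>F x \<in> W\<close>]) (assumption | (rule that, assumption+))+
    then show "\<exists>T. openin (mtop M) T \<and> x \<in> T \<and> T \<subseteq> {x \<in> points M. F x \<in> W}" using openin_subset[OF W'(1)] by (intro exI[of _ W']) auto
  qed
qed

lemma smooth_map_pullbackI:
  assumes M: "smooth_atlas M" and N: "smooth_manifold N" and F: "\<And>x. x \<in> points M \<Longrightarrow> F x \<in> points N"
    and s: "\<And>f. f \<in> smooth_functions N \<Longrightarrow> (\<lambda>x. f (F x)) \<in> smooth_functions M"
  shows "smooth_map M N F"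
proof (rule smooth_mapI[OF M continuous_map_pullback[where F = F, OF M N F s]])
  note at = smooth_manifold_imp_atlas[OF N]
  fix V \<psi> x assume V: "(V, \<psi>) \<in> atlas N" and x: "x \<in> points M" "F x \<in> V"
  have sx: "smooth_at M (points M) y (\<lambda>y. f (F y))" if "y \<in> points M" "f \<in> smooth_functions N" for f y
    using s[OF that(2)] smooth_functions_iff[OF M] that(1) by blast
  have "smooth_at N (points N) (F x) \<psi>" by (rule smooth_atI[OF V chart_open[OF at V] x(2) subset_refl C_inf_on_id[OF open_UNIV]]) auto
  then show "smooth_at M (points M) x (\<lambda>y. \<psi> (F y))" by (intro smooth_at_pullback[where \<Phi> = F, OF M N x(1) sx[OF x(1)] F])
qed auto

lemma push_vector_tangent:
  assumes A: "smooth_atlas A" and B: "smooth_atlas B" and s: "\<And>f. f \<in> smooth_functions B \<Longrightarrow> f \<circ> F \<in> smooth_functions A" and v: "v \<in> tangent_space A x"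
  shows "push_vector B F v \<in> tangent_space B (F x)"
proof -
  have "v ((\<lambda>y. a * f y + b * g y) \<circ> F) = a * v (f \<circ> F) + b * v (g \<circ> F)"
    "v ((\<lambda>y. f y * g y) \<circ> F) = f (F x) * v (g \<circ> F) + g (F x) * v (f \<circ> F)" if "f \<in> smooth_functions B" "g \<in> smooth_functions B" for f g a b
    using tangent_linear[OF v s[OF that(1)] s[OF that(2)], of a b] tangent_leibniz[OF v s[OF that(1)] s[OF that(2)]] by (simp_all add: comp_def)
  then show ?thesis using smooth_functions_combine[OF B] smooth_functions_mult[OF B] unfolding tangent_space_def push_vector_def by simp
qed

lemma pull_covector_differential:
  assumes A: "smooth_atlas A" and B: "smooth_atlas B" and s: "\<And>f. f \<in> smooth_functions B \<Longrightarrow> f \<circ> F \<in> smooth_functions A"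
    and f: "f \<in> smooth_functions B"
  shows "pull_covector A B F x (differential B f (F x)) = differential A (f \<circ> F) x"
proof
  fix v
  show "pull_covector A B F x (differential B f (F x)) v = differential A (f \<circ> F) x v"
    using push_vector_tangent[OF A B s, of v x] f unfolding pull_covector_def differential_def by (simp add: push_vector_def)
qed

lemma vec_apply_real: "vec_apply v (f :: 'a \<Rightarrow> real) = v f" by (simp add: vec_apply_def)

section \<open>Translation of j by the flows, and the retraction r onto its zero level\<close>

section \<open>The momentum map and the projection along the flows\<close>

text \<open>
  \<open>j\<close> is the momentum map, written as a map into \<open>E\<close> by means of \<open>\<omega>\<close>; the Hamiltonian belonging
  to \<open>w \<in> E\<close> is \<open>\<omega> w (j _)\<close>. The projection \<open>P\<close> onto \<open>E\<close> makes the flows depend on a parameter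
  ranging over a whole Euclidean space.
\<close>

locale symplectic_splitting = poisson M \<pi> for M :: "('a, 'e::euclidean_space) manifold" and \<pi> :: "'a bivector" +
  fixes E :: "'b::euclidean_space set" and \<omega> :: "'b \<Rightarrow> 'b \<Rightarrow> real" and j :: "'a \<Rightarrow> 'b" and P :: "'b \<Rightarrow> 'b"
  assumes E: "subspace E" and \<omega>: "symplectic_form_on E \<omega>" and j: "smooth_everywhere M j" and jE: "j x \<in> E"
    and j_bracket: "v \<in> E \<Longrightarrow> w \<in> E \<Longrightarrow> x \<in> points M \<Longrightarrow> bracket M \<pi> (\<lambda>y. \<omega> v (j y)) (\<lambda>y. \<omega> w (j y)) x = \<omega> v w"
    and j_complete: "w \<in> E \<Longrightarrow> complete_vf M (hamiltonian_vf M \<pi> (\<lambda>y. \<omega> w (j y)))"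
    and P: "linear P" "P p \<in> E" "p \<in> E \<Longrightarrow> P p = p"
begin

abbreviation "J w \<equiv> (\<lambda>y. \<omega> w (j y))"

lemma \<omega>_left: "w \<in> E \<Longrightarrow> linear (\<lambda>p. \<omega> (P p) w)" by (rule symplectic_comp_linear[OF \<omega> P(1,2)])

lemma \<omega>_right: assumes w: "w \<in> E" shows "linear (\<lambda>p. \<omega> w (P p))"
proof -
  have "(\<lambda>p. \<omega> w (P p)) = (\<lambda>p. - \<omega> (P p) w)" by (rule ext) (rule symplectic_skew[OF \<omega> w P(2)])
  then show ?thesis using linear_compose_neg[OF \<omega>_left[OF w]] by simp
qed

text \<open>Identifies the abstract linear family with the components of \<open>j\<close>, so that
  \<open>\<phi> p\<close> is the flow of \<open>J (P p)\<close>.\<close>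

lemma linear_family_eq: "linear_family (\<lambda>i y. \<omega> (P i) (j y)) p = (\<lambda>y. \<omega> (P p) (j y))"
proof
  fix y
  have "\<omega> (P p) (j y) = \<omega> (P (\<Sum>i\<in>Basis. (p \<bullet> i) *\<^sub>R i)) (j y)" by (simp only: euclidean_representation)
  also have "\<dots> = (\<Sum>i\<in>Basis. (p \<bullet> i) * \<omega> (P i) (j y))"
    by (simp only: linear_sum[OF \<omega>_left[OF jE]] linear_scale[OF \<omega>_left[OF jE]] real_scaleR_def)
  finally show "linear_family (\<lambda>i y. \<omega> (P i) (j y)) p y = \<omega> (P p) (j y)" by (simp add: linear_family_def)
qed

lemma hamiltonian_smooth: assumes "w \<in> E" shows "J w \<in> \<C>"
proof -
  have "smooth_everywhere M (\<lambda>y. \<omega> w (P (j y)))" by (rule smooth_everywhere_map[OF at j, where h = "\<lambda>p. \<omega> w (P p)"])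
      (rule C_inf_on_linear[OF open_UNIV \<omega>_right[OF assms]])
  then show ?thesis by (simp add: smooth_functions_eq[OF at] P(3)[OF jE])
qed

sublocale commuting_flow M \<pi> "\<lambda>i y. \<omega> (P i) (j y)" "\<lambda>p q. \<omega> (P p) (P q)"
proof
  show "(\<lambda>y. \<omega> (P i) (j y)) \<in> \<C>" for i by (rule hamiltonian_smooth[OF P(2)])
qed (simp_all add: linear_family_eq j_bracket j_complete P(2))

lemma tangent_hamiltonian:
  assumes x: "x \<in> points M" and v: "v \<in> tangent_space M x" and w: "w \<in> E"
  shows "v (J w) = \<omega> w (vec_apply v j)"
proof -
  have "vec_apply v (\<lambda>y. \<omega> w (P (j y))) = \<omega> w (P (vec_apply v j))" by (rule vec_apply_linear[OF M v x j \<omega>_right[OF w]])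
  then show ?thesis using vec_apply_in_subspace[OF M v x j E jE] by (simp add: vec_apply_real P(3) jE)
qed

lemma \<omega>_eqI:
  assumes "u \<in> E" "v \<in> E" "\<And>w. w \<in> E \<Longrightarrow> \<omega> w u = \<omega> w v" shows "u = v"
proof -
  have "u - v = 0"
  proof (rule symplectic_nondegenerate[OF \<omega>])
    show uv: "u - v \<in> E" using assms E by (simp add: subspace_diff)
    show "\<omega> (u - v) w = 0" if w: "w \<in> E" for w using linear_diff[OF \<omega>_right[OF w], of u v] assms uv symplectic_skew[OF \<omega> uv w] w by (simp add: P(3))
  qed
  then show ?thesis by simp
qed

text \<open>Pairing with every \<open>u\<close> in \<open>E\<close> reproduces the prescribed
  bracket \<open>\<omega> u w\<close>, and \<omega> is nondegenerate. So \<open>j\<close> moves with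
  velocity \<open>w\<close> along the flow of \<open>J w\<close>.\<close>

lemma bracket_vec_j: assumes x: "x \<in> points M" and w: "w \<in> E" shows "bracket_vec j (J w) x = w"
proof (rule \<omega>_eqI)
  have v: "ham (J w) x \<in> tangent_space M x" by (rule hamiltonian_vf_tangent[OF x hamiltonian_smooth[OF w]])
  then show "bracket_vec j (J w) x \<in> E" unfolding bracket_vec_def by (rule vec_apply_in_subspace[OF M _ x j E jE])
  show "\<omega> u (bracket_vec j (J w) x) = \<omega> u w" if u: "u \<in> E" for u
    using tangent_hamiltonian[OF x v u] by (simp add: bracket_vec_def hamiltonian_vf_apply[OF hamiltonian_smooth[OF u]] j_bracket[OF u w x])
qed (rule w)

lemma flow_j: assumes x: "x \<in> points M" shows "j (\<phi> p x) = j x + P p"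
proof -
  have "((\<lambda>t. j (\<phi> (t *\<^sub>R p) x)) has_vector_derivative P p) (at t)" for t
    using integral_curve_vec[OF flow_curve(1)[OF x] UNIV_I j, of p t] bracket_vec_j[OF flow_in[OF x, of "t *\<^sub>R p"] P(2)[of p]]
    by (simp add: bracket_vec_def linear_family_eq)
  then have "((\<lambda>t. j (\<phi> (t *\<^sub>R p) x) - t *\<^sub>R P p) has_vector_derivative P p - P p) (at t)" for t
    by (intro has_vector_derivative_diff) (auto intro!: derivative_eq_intros)
  then have "((\<lambda>t. j (\<phi> (t *\<^sub>R p) x) - t *\<^sub>R P p) has_derivative (\<lambda>h. 0)) (at t within UNIV)" for t by (simp add: has_vector_derivative_def)
  from has_derivative_zero_unique[OF convex_UNIV this, of 1 0]
  show ?thesis by (simp add: flow_0[OF x] algebra_simps)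
qed

text \<open>Moves \<open>x\<close> along its orbit to the zero level; since the flows translate
  \<open>j\<close>, the parameter to use is \<open>- j x\<close>.\<close>

definition r :: "'a \<Rightarrow> 'a" where "r x = \<phi> (- j x) x"

lemma r_in: "x \<in> points M \<Longrightarrow> r x \<in> points M" by (simp add: r_def flow_in)

lemma j_r: "x \<in> points M \<Longrightarrow> j (r x) = 0" using P(3)[OF subspace_neg[OF E jE]] by (simp add: r_def flow_j)

lemma r_zero: "x \<in> points M \<Longrightarrow> j x = 0 \<Longrightarrow> r x = x" by (simp add: r_def flow_0)

lemma flow_j_r: "x \<in> points M \<Longrightarrow> \<phi> (j x) (r x) = x" unfolding r_def by (simp add: flow_add[symmetric] flow_0)

lemma r_flow: assumes x: "x \<in> points M" and w: "w \<in> E" shows "r (\<phi> w x) = r x"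
  unfolding r_def using flow_j[OF x, of w] w by (simp add: P(3) flow_add[OF x, symmetric])

lemma r_smooth: assumes f: "f \<in> \<C>" shows "(\<lambda>x. f (r x)) \<in> \<C>" unfolding smooth_functions_iff[OF at]
proof
  fix x assume x: "x \<in> points M"
  have "smooth_everywhere M (\<lambda>y. - j y)" by (rule smooth_everywhere_map[OF at j, where h = uminus]) (intro C_inf_on_uminus C_inf_on_id open_UNIV)
  then have q: "smooth_at M (points M) x (\<lambda>y. - j y)" using x by (rule smooth_everywhereD)
  have sm: "smooth_at M (points M) x f" if "f \<in> \<C>" for f using that x smooth_functions_iff[OF at] by blast
  from smooth_at_param_pullback[where \<Phi> = "\<lambda>y. y" and K = "\<lambda>z. f (\<phi> (fst z) (snd z))", OF at M subspace_UNIV x q UNIV_I sm _ flow_smooth[OF f x]]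
  show "smooth_at M (points M) x (\<lambda>x. f (r x))" by (simp add: r_def)
qed

lemma bracket_zero_invariant:
  assumes f: "f \<in> \<C>" and x: "x \<in> points M"
    and 0: "\<And>y w. y \<in> points M \<Longrightarrow> w \<in> E \<Longrightarrow> pb f (J w) y = 0"
  shows "f (\<phi> p x) = f x"
proof -
  have "((\<lambda>t. f (\<phi> (t *\<^sub>R p) x)) has_real_derivative 0) (at t)" for t using flow_deriv[OF x f, of p t] 0[OF flow_in[OF x] P(2)] by (simp add: linear_family_eq)
  from DERIV_isconst_all[OF allI[OF this], of 1 0] show ?thesis by (simp add: flow_0[OF x])
qed

lemma bracket_r_hamiltonian:
  assumes f: "(\<lambda>x. f (r x)) \<in> \<C>" and x: "x \<in> points M" and w: "w \<in> E"
  shows "pb (\<lambda>x. f (r x)) (J w) x = 0"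
proof -
  have "((\<lambda>t. f (r (\<phi> (t *\<^sub>R w) x))) has_real_derivative pb (\<lambda>x. f (r x)) (J w) x) (at 0)"
    using flow_deriv[OF x f, of w 0] by (simp add: linear_family_eq flow_0[OF x] P(3)[OF w])
  moreover have "(\<lambda>t. f (r (\<phi> (t *\<^sub>R w) x))) = (\<lambda>t. f (r x))" using r_flow[OF x subspace_scale[OF E w]] by simp
  ultimately show ?thesis using DERIV_unique[OF _ DERIV_const] by metis
qed

text \<open>The previous lemma read with the slots exchanged: the Hamiltonian vector field of a
  function of \<open>r\<close> is tangent to the levels of \<open>j\<close>.\<close>

lemma bracket_vec_j_r:
  assumes f: "(\<lambda>x. f (r x)) \<in> \<C>" and x: "x \<in> points M"
  shows "bracket_vec j (\<lambda>y. f (r y)) x = 0"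
proof (rule \<omega>_eqI)
  have v: "ham (\<lambda>y. f (r y)) x \<in> tangent_space M x" by (rule hamiltonian_vf_tangent[OF x f])
  then show "bracket_vec j (\<lambda>y. f (r y)) x \<in> E" unfolding bracket_vec_def by (rule vec_apply_in_subspace[OF M _ x j E jE])
  show "\<omega> w (bracket_vec j (\<lambda>y. f (r y)) x) = \<omega> w 0" if w: "w \<in> E" for w
    using tangent_hamiltonian[OF x v w] bracket_r_hamiltonian[OF f x w] bracket_skew[OF x f hamiltonian_smooth[OF w]]
      linear_0[OF \<omega>_right[OF w]] linear_0[OF P(1)] by (simp add: bracket_vec_def hamiltonian_vf_apply[OF hamiltonian_smooth[OF w]])
qed (rule subspace_0[OF E])

text \<open>By Jacobi's identity the bracket of two functions that commute with every
  \<open>J w\<close> again commutes with every \<open>J w\<close>. Hence it is constant along the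
  flows, in particular from \<open>x\<close> to \<open>r x\<close>.\<close>

lemma bracket_r_invariant:
  assumes f: "(\<lambda>x. f (r x)) \<in> \<C>" and g: "(\<lambda>x. g (r x)) \<in> \<C>" and x: "x \<in> points M"
  shows "pb (\<lambda>y. f (r y)) (\<lambda>y. g (r y)) (r x) = pb (\<lambda>y. f (r y)) (\<lambda>y. g (r y)) x" unfolding r_def
proof (rule bracket_zero_invariant[OF bracket_smooth[OF f g] x, unfolded r_def])
  fix y w assume y: "y \<in> points M" and w: "w \<in> E"
  define F G H where "F = (\<lambda>y. f (r y))" and "G = (\<lambda>y. g (r y))" and "H = (J w)"
  have s: "F \<in> \<C>" "G \<in> \<C>" "H \<in> \<C>" unfolding F_def G_def H_def by (intro f g hamiltonian_smooth w)+
  have 0: "pb F H z = 0" "pb G H z = 0" "pb H F z = 0" if "z \<in> points M" for z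
    using bracket_r_hamiltonian[OF f that w] bracket_r_hamiltonian[OF g that w] bracket_skew[OF that s(1,3)] by (simp_all add: F_def G_def H_def)
  have "pb F (pb G H) y = 0" "pb G (pb H F) y = 0" by (rule bracket_locally_const_right[OF s(1) bracket_smooth[OF s(2,3)] y 0(2)], assumption)
      (rule bracket_locally_const_right[OF s(2) bracket_smooth[OF s(3,1)] y 0(3)], assumption)
  then have "pb H (pb F G) y = 0" using jacobi[OF s y] by simp
  then show "pb (pb (\<lambda>y. f (\<phi> (- j y) y)) (\<lambda>y. g (\<phi> (- j y) y))) (J w) y = 0"
    using bracket_skew[OF y s(3) bracket_smooth[OF s(1,2)]] by (simp add: F_def G_def H_def r_def)
qed

end

section \<open>The zero level as a manifold, and functions on it compared with functions on
  M\<close>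

section \<open>The zero set of the momentum map\<close>

context symplectic_splitting
begin

abbreviation Z :: "'a set" where "Z \<equiv> {x \<in> points M. j x = 0}"

text \<open>
  Since \<open>{j, \<omega> w (j _)} = w\<close>, the differential of \<open>j\<close> maps onto \<open>E\<close>. Correcting a chart by a
  right inverse of this differential turns \<open>j = 0\<close> into a linear equation; the kernel \<open>K\<close> is the
  local model of \<open>Z\<close>.
\<close>

lemma flattening:
  assumes n: "n \<in> Z"
  obtains K U \<psi> W \<Lambda> V G where "subspace K" "dim K + dim E = dim (model M)" "(U, \<psi>) \<in> atlas M" "openin (mtop M) W" "n \<in> W" "W \<subseteq> U"
    "linear (\<Lambda> :: 'e \<Rightarrow> 'e)" "C_inf_on V (G :: 'e \<Rightarrow> 'e)"
    "\<And>x. x \<in> W \<inter> Z \<Longrightarrow> \<Lambda> (\<psi> x) \<in> K \<inter> V \<and> G (\<Lambda> (\<psi> x)) = \<psi> x"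
    "\<And>z. z \<in> K \<inter> V \<Longrightarrow> \<exists>x\<in>W \<inter> Z. \<psi> x = G z \<and> \<Lambda> (G z) = z"
proof -
  have nM: "n \<in> points M" and jn: "j n = 0" using n by auto
  define X where "X = model M"
  have X: "subspace X" unfolding X_def by (rule smooth_manifold_subspace[OF M])
  obtain U \<psi> W1 th where c: "(U, \<psi>) \<in> atlas M" "openin (mtop M) W1" "n \<in> W1" "W1 \<subseteq> U" "\<And>y. y \<in> W1 \<Longrightarrow> th y = \<psi> y"
    "\<And>y. th y \<in> model M" "smooth_everywhere M th" by (rule smooth_coordinates[OF M nM], rule that)
  obtain W2 T g where g: "openin (mtop M) W2" "n \<in> W2" "W2 \<subseteq> U" "C_inf_on T g" "\<psi> ` W2 \<subseteq> T" "\<And>y. y \<in> W2 \<Longrightarrow> y \<in> points M \<Longrightarrow> j y = g (\<psi> y)"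
    by (rule smooth_at_chartE[OF at smooth_everywhereD[OF j nM] c(1)]) (use c(3,4) in blast)+
  define W where "W = W1 \<inter> W2"
  have W: "openin (mtop M) W" "n \<in> W" "W \<subseteq> U" unfolding W_def using c g by auto
  have jg: "j y = g (\<psi> y)" "\<psi> y \<in> T" "\<psi> y \<in> X" if "y \<in> W" for y
    using g(5,6) that openin_subset[OF W(1)] chart_model[OF at c(1)] W(3) by (auto simp: W_def X_def)
  obtain T0 where T0: "open T0" "\<psi> ` W = X \<inter> T0" using chart_image_open[OF at c(1) W(3,1)] by (auto simp: openin_open X_def)
  obtain q where q: "linear q" "\<And>x. q x \<in> X" "\<And>x. x \<in> X \<Longrightarrow> q x = x" by (rule linear_projection_exists[OF X], rule that)
  define D where "D = fderiv g (\<psi> n)"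
  have D: "(g has_derivative D) (at (\<psi> n))" unfolding D_def by (rule C_inf_on_has_derivative[OF g(4) jg(2)[OF W(2)]])
  \<comment> \<open>The differential of \<open>j\<close> at \<open>n\<close>, in the chart and
    projected to \<open>E\<close>. It maps the model onto \<open>E\<close> because the Hamiltonian
    vector of \<open>J w\<close> is sent to \<open>w\<close>.\<close>
  define S where "S = (\<lambda>v. P (D v))"
  have S: "linear S" unfolding S_def using linear_compose[OF has_derivative_linear[OF D] P(1)] by (simp add: comp_def)
  have SX: "S ` X = E"
  proof
    show "S ` X \<subseteq> E" by (auto simp: S_def P(2))
    show "E \<subseteq> S ` X"
    proof
      fix w assume w: "w \<in> E"
      have v: "ham (J w) n \<in> tangent_space M n" by (rule hamiltonian_vf_tangent[OF nM hamiltonian_smooth[OF w]])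
      have "bracket_vec j (J w) n = fderiv g (th n) (bracket_vec th (J w) n)" unfolding bracket_vec_def
        by (rule vec_apply_chain[OF M v nM c(7) j g(4) _ W(1,2)]) (use jg W(2) c(5) in \<open>auto simp: W_def\<close>)
      then have "w = D (bracket_vec th (J w) n)" using bracket_vec_j[OF nM w] c(3,5) by (simp add: D_def)
      then have "S (bracket_vec th (J w) n) = w" using P(3)[OF w] by (simp add: S_def)
      moreover have "bracket_vec th (J w) n \<in> X" unfolding bracket_vec_def by (rule vec_apply_in_subspace[OF M v nM c(7) X]) (simp add: X_def c(6))
      ultimately show "w \<in> S ` X" by (metis imageI)
    qed
  qed
  obtain A where A: "range A \<subseteq> X" "linear A" "\<forall>w\<in>S ` X. S (A w) = w" using linear_exists_right_inverse_on[OF S X] by auto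
  have AX: "A w \<in> X" for w using A(1) by blast
  have SA: "S (A w) = w" if "w \<in> E" for w using A(3) SX that by simp
  have SE: "S v \<in> E" for v by (simp add: S_def P(2))
  define \<Lambda> where "\<Lambda> v = v - A (S v)" for v
  have \<Lambda>: "linear \<Lambda>" unfolding \<Lambda>_def using linear_compose_sub[OF linear_ident linear_compose[OF S A(2)]] by (simp add: comp_def)
  define K where "K = {v \<in> X. S v = 0}"
  have K: "subspace K" unfolding K_def using X linear_subspace_kernel[OF S] by (simp add: Collect_conj_eq subspace_inter)
  have \<Lambda>K: "\<Lambda> v \<in> K" if "v \<in> X" for v using that AX SA[OF SE] X by (simp add: K_def \<Lambda>_def subspace_diff linear_diff[OF S])
  have "dim K + dim E = dim X"
  proof -
    have inj: "inj_on A E" using SA by (metis inj_onI)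
    have "span E = E" using E span_eq_iff by blast
    then have dA: "dim (A ` E) = dim E" using dim_image_eq[OF A(2), of E] inj by metis
    have "{k + a |k a. k \<in> K \<and> a \<in> A ` E} = X"
    proof
      show "{k + a |k a. k \<in> K \<and> a \<in> A ` E} \<subseteq> X" using AX X by (auto simp: K_def subspace_add)
      have "v = \<Lambda> v + A (S v)" for v by (simp add: \<Lambda>_def)
      then show "X \<subseteq> {k + a |k a. k \<in> K \<and> a \<in> A ` E}" using \<Lambda>K SE by blast
    qed
    moreover have "K \<inter> A ` E = {0}" using SA linear_0[OF A(2)] subspace_0[OF K] subspace_0[OF E] by (auto simp: K_def)
    ultimately show ?thesis using dim_sums_Int[OF K linear_subspace_image[OF A(2) E]] dA by simp
  qed
  \<comment> \<open>The map \<Lambda> with the linear part of \<open>j\<close> exchanged for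
    \<open>j\<close> itself. Its derivative at \<open>\<psi> n\<close> is the identity, and at
    \<open>y = \<psi> x\<close> it equals \<open>\<Lambda> y + A (j x)\<close>; applying
    \<open>S\<close> recovers \<open>j x\<close>.\<close>
  define Q where "Q y = y - A (S (q y)) + A (P (g (q y)))" for y
  define Om where "Om = {y \<in> T0. q y \<in> T}"
  have op: "open Om" unfolding Om_def by (rule C_inf_on_preimage[OF C_inf_on_linear[OF T0(1) q(1)] C_inf_on_open[OF g(4)]])
  have bl: "bounded_linear A" "bounded_linear P" "bounded_linear (\<lambda>y. A (S (q y)))"
    using A(2) P(1) linear_compose[OF linear_compose[OF q(1) S] A(2)] by (simp_all add: linear_conv_bounded_linear comp_def)
  have "C_inf_on Om (\<lambda>y. g (q y))" by (rule C_inf_on_compose[OF C_inf_on_linear[OF op q(1)] g(4)]) (auto simp: Om_def)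
  then have "C_inf_on Om (\<lambda>y. A (P (g (q y))))" by (rule C_inf_on_linear_comp[OF bl(1) C_inf_on_linear_comp[OF bl(2)]])
  from C_inf_on_add[OF C_inf_on_diff[OF C_inf_on_id[OF op] C_inf_on_bounded_linear[OF op bl(3)]] this]
  have Q: "C_inf_on Om Q" unfolding Q_def .
  have y0: "\<psi> n \<in> X" "\<psi> n \<in> Om" using jg[OF W(2)] T0(2) W(2) q(3) by (auto simp: Om_def)
  have "((\<lambda>y. g (q y)) has_derivative (\<lambda>v. D (q v))) (at (\<psi> n))"
    by (rule has_derivative_compose[OF bounded_linear_imp_has_derivative]) (use q D y0(1) in \<open>simp_all add: linear_conv_bounded_linear\<close>)
  from bounded_linear.has_derivative[OF bl(1) bounded_linear.has_derivative[OF bl(2) this]] bounded_linear_imp_has_derivative[OF bl(3), of "at (\<psi> n)"]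
  have "(Q has_derivative (\<lambda>v. v - A (S (q v)) + A (P (D (q v))))) (at (\<psi> n))" unfolding Q_def by (intro has_derivative_add has_derivative_diff has_derivative_ident)
  from frechet_derivative_at[OF this] have "fderiv Q (\<psi> n) = (\<lambda>v. v)" by (simp add: S_def)
  then have inj: "inj (fderiv Q (\<psi> n))" by (simp add: inj_def)
  obtain U' V G where IF: "open U'" "U' \<subseteq> Om" "\<psi> n \<in> U'" "homeomorphism U' V Q G" "C_inf_on V G" by (rule smooth_inverse_function[OF Q y0(2) inj], rule that)
  define W' where "W' = {x \<in> U. \<psi> x \<in> U'} \<inter> W"
  have W': "openin (mtop M) W'" "n \<in> W'" "W' \<subseteq> U" unfolding W'_def using W IF(3) chart_preimage_open[OF at c(1) IF(1)] by auto
  show ?thesis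
  proof (rule that[OF K _ c(1) W' \<Lambda> IF(5)])
    show "dim K + dim E = dim (model M)" using \<open>dim K + dim E = dim X\<close> by (simp add: X_def)
    show "\<Lambda> (\<psi> x) \<in> K \<inter> V \<and> G (\<Lambda> (\<psi> x)) = \<psi> x" if x: "x \<in> W' \<inter> Z" for x
    proof -
      have xW: "x \<in> W" "\<psi> x \<in> U'" "j x = 0" using x by (auto simp: W'_def)
      have "Q (\<psi> x) = \<Lambda> (\<psi> x)" using jg[OF xW(1)] q(3) xW(3) linear_0[OF P(1)] linear_0[OF A(2)] by (simp add: Q_def \<Lambda>_def)
      then show ?thesis using \<Lambda>K jg(3)[OF xW(1)] homeomorphism_apply1[OF IF(4) xW(2)] homeomorphism_image1[OF IF(4)] xW(2) by (metis IntI imageI)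
    qed
    show "\<exists>x\<in>W' \<inter> Z. \<psi> x = G z \<and> \<Lambda> (G z) = z" if z: "z \<in> K \<inter> V" for z
    proof -
      define y where "y = G z"
      have y: "y \<in> U'" "Q y = z" using homeomorphism_image2[OF IF(4)] homeomorphism_apply2[OF IF(4)] z by (auto simp: y_def)
      have "z + (A (S (q y)) - A (P (g (q y)))) \<in> X" using z AX X by (simp add: K_def subspace_add subspace_diff)
      moreover have "z + (A (S (q y)) - A (P (g (q y)))) = y" using y(2) by (auto simp: Q_def)
      ultimately have yX: "y \<in> X" by simp
      then have "y \<in> \<psi> ` W" using T0(2) y(1) IF(2) by (auto simp: Om_def)
      then obtain x where x: "x \<in> W" "\<psi> x = y" by (metis imageE)
      have Qy: "Q y = \<Lambda> y + A (j x)" using q(3)[OF yX] jg(1)[OF x(1)] x(2) P(3)[OF jE[of x]] by (simp add: Q_def \<Lambda>_def)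
      have "S (Q y) = j x" unfolding Qy using \<Lambda>K[OF yX] SA[OF jE] by (simp add: linear_add[OF S] K_def)
      then have jx: "j x = 0" using z y(2) by (simp add: K_def)
      then have "x \<in> W' \<inter> Z" using x y(1) W(3) openin_subset[OF W(1)] by (auto simp: W'_def)
      moreover have "\<Lambda> y = z" using Qy jx y(2) linear_0[OF A(2)] by simp
      ultimately show ?thesis using x(2) by (auto simp: y_def)
    qed
  qed
qed

text \<open>All charts of a manifold share one model, whereas the kernels \<open>K\<close> of
  \<open>flattening\<close> vary with the point and only their dimension is fixed. For empty
  \<open>Z\<close> any subspace serves.\<close>

definition zero_model :: "'e set" where
  "zero_model = (SOME X. subspace X \<and> (Z \<noteq> {} \<longrightarrow> dim X + dim E = dim (model M)))"

lemma zero_model: "subspace zero_model" "n \<in> Z \<Longrightarrow> dim zero_model + dim E = dim (model M)"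
proof -
  have "\<exists>X :: 'e set. subspace X \<and> (Z \<noteq> {} \<longrightarrow> dim X + dim E = dim (model M))"
  proof (cases "Z = {}")
    case True
    then show ?thesis by (intro exI[of _ "{0}"]) simp
  next
    case False
    then obtain n where n: "n \<in> Z" by blast
    obtain K :: "'e set" where "subspace K" "dim K + dim E = dim (model M)" by (rule flattening[OF n], rule that)
    then show ?thesis by blast
  qed
  then have "subspace zero_model \<and> (Z \<noteq> {} \<longrightarrow> dim zero_model + dim E = dim (model M))" unfolding zero_model_def by (rule someI_ex)
  then show "subspace zero_model" "n \<in> Z \<Longrightarrow> dim zero_model + dim E = dim (model M)" by auto
qed

text \<open>The atlas collects all charts compatible with \<open>M\<close> in both directions: the
  chart is smooth on \<open>Z\<close> as a subset of \<open>M\<close>, and the inclusion into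
  \<open>M\<close> is smooth in the chart.\<close>

definition zero_manifold :: "('a, 'e) manifold" where
  "zero_manifold = \<lparr>mtop = subtopology (mtop M) Z, model = zero_model,
     atlas = {(U, \<kappa>). openin (subtopology (mtop M) Z) U \<and> inj_on \<kappa> U \<and>
       (\<forall>W. openin (mtop M) W \<longrightarrow> openin (top_of_set zero_model) (\<kappa> ` (U \<inter> W))) \<and>
       (\<forall>x\<in>U. smooth_at M Z x \<kappa> \<and> (\<exists>U' \<psi> T G. (U', \<psi>) \<in> atlas M \<and> C_inf_on T G \<and> \<kappa> x \<in> T \<and>
          (\<forall>y\<in>U. \<kappa> y \<in> T \<longrightarrow> y \<in> U' \<and> \<psi> y = G (\<kappa> y))))}\<rparr>"

abbreviation "N \<equiv> zero_manifold"

lemma mtop_N: "mtop N = subtopology (mtop M) Z" and model_N: "model N = zero_model" by (simp_all add: zero_manifold_def)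

lemma points_N [simp]: "points N = Z" by (auto simp: mtop_N)

lemma atlas_N: assumes "(U, ka) \<in> atlas N"
  shows "openin (mtop N) U" "U \<subseteq> Z" "inj_on ka U" "openin (mtop M) W \<Longrightarrow> openin (top_of_set zero_model) (ka ` (U \<inter> W))"
    "x \<in> U \<Longrightarrow> smooth_at M Z x ka"
    "x \<in> U \<Longrightarrow> \<exists>U' \<psi> T G. (U', \<psi>) \<in> atlas M \<and> C_inf_on T G \<and> ka x \<in> T \<and> (\<forall>y\<in>U. ka y \<in> T \<longrightarrow> y \<in> U' \<and> \<psi> y = G (ka y))"
  using assms openin_subset[of "mtop N" U] by (simp_all add: zero_manifold_def)

text \<open>The flattening of \<open>Z\<close>, followed by a linear isomorphism \<open>L\<close>
  from the kernel \<open>K\<close> onto the common model.\<close>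

lemma chart_exists_N:
  assumes n: "n \<in> Z" shows "\<exists>U ka. (U, ka) \<in> atlas N \<and> n \<in> U"
proof -
  obtain K U \<psi> W La V G where F: "subspace K" "dim K + dim E = dim (model M)" "(U, \<psi>) \<in> atlas M" "openin (mtop M) W" "n \<in> W" "W \<subseteq> U"
    "linear (La :: 'e \<Rightarrow> 'e)" "C_inf_on V (G :: 'e \<Rightarrow> 'e)"
    "\<And>x. x \<in> W \<inter> Z \<Longrightarrow> La (\<psi> x) \<in> K \<inter> V \<and> G (La (\<psi> x)) = \<psi> x"
    "\<And>z. z \<in> K \<inter> V \<Longrightarrow> \<exists>x\<in>W \<inter> Z. \<psi> x = G z \<and> La (G z) = z" by (rule flattening[OF n], rule that)
  have "dim K = dim zero_model" using F(2) zero_model(2)[OF n] by simp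
  then obtain L where L: "linear L" "L ` K = zero_model" "inj_on L K" using subspace_isomorphism[OF F(1) zero_model(1)] by blast
  obtain I where I: "range I \<subseteq> K" "linear I" "\<forall>v\<in>K. I (L v) = v" using linear_exists_left_inverse_on[OF L(1) F(1) L(3)] by blast
  have LI: "L (I z) = z" if "z \<in> zero_model" for z using that I(3) L(2) by (metis imageE)
  define ka where "ka x = L (La (\<psi> x))" for x
  define T where "T = {z. I z \<in> V}"
  have T: "open T" using C_inf_on_preimage[OF C_inf_on_linear[OF open_UNIV I(2)] C_inf_on_open[OF F(8)]] by (simp add: T_def)
  have IC: "C_inf_on T I" by (rule C_inf_on_linear[OF T I(2)])
  have ka: "ka x \<in> zero_model" "ka x \<in> T" "G (I (ka x)) = \<psi> x" if "x \<in> W \<inter> Z" for x using F(9)[OF that] I(3) L(2) by (auto simp: ka_def T_def)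
  have GC: "C_inf_on T (\<lambda>z. G (I z))" by (rule C_inf_on_compose[OF IC F(8)]) (auto simp: T_def)
  have inj: "inj_on ka (W \<inter> Z)"
  proof (rule inj_onI)
    fix x y assume x: "x \<in> W \<inter> Z" and y: "y \<in> W \<inter> Z" and "ka x = ka y"
    then have "\<psi> x = \<psi> y" using ka(3) by metis
    then show "x = y" using chart_inj[OF at F(3)] x y F(6) by (auto dest: inj_onD)
  qed
  have opn: "openin (top_of_set zero_model) (ka ` (Z \<inter> W \<inter> W'))" if W': "openin (mtop M) W'" for W'
  proof -
    have "openin (top_of_set (model M)) (\<psi> ` (W \<inter> W'))" by (rule chart_image_open[OF at F(3)]) (use F(4,6) W' in auto)
    then obtain T' where T': "open T'" "\<psi> ` (W \<inter> W') = model M \<inter> T'" by (auto simp: openin_open)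
    have "ka ` (Z \<inter> W \<inter> W') = zero_model \<inter> {z \<in> T. G (I z) \<in> T'}"
    proof
      show "ka ` (Z \<inter> W \<inter> W') \<subseteq> zero_model \<inter> {z \<in> T. G (I z) \<in> T'}" using ka T'(2) by fastforce
      show "zero_model \<inter> {z \<in> T. G (I z) \<in> T'} \<subseteq> ka ` (Z \<inter> W \<inter> W')"
      proof
        fix z assume z: "z \<in> zero_model \<inter> {z \<in> T. G (I z) \<in> T'}"
        then have "I z \<in> K \<inter> V" using I(1) by (auto simp: T_def)
        from F(10)[OF this] obtain x where x: "x \<in> W \<inter> Z" "\<psi> x = G (I z)" "La (G (I z)) = I z" by blast
        have "\<psi> x \<in> model M" using chart_model[OF at F(3)] x(1) F(6) by auto
        then have "\<psi> x \<in> \<psi> ` (W \<inter> W')" using T'(2) z x(2) by auto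
        then have "x \<in> W'" using chart_inj[OF at F(3)] x(1) F(6) by (auto dest!: inj_onD)
        moreover have "ka x = z" using x(2,3) LI z by (simp add: ka_def)
        ultimately show "z \<in> ka ` (Z \<inter> W \<inter> W')" using x(1) by auto
      qed
    qed
    moreover have "open {z \<in> T. G (I z) \<in> T'}" by (rule C_inf_on_preimage[OF GC T'(1)])
    ultimately show ?thesis by auto
  qed
  have "smooth_at M Z x ka" if "x \<in> Z \<inter> W" for x
  proof (rule smooth_atI[OF F(3,4) _ F(6)])
    show "C_inf_on UNIV (\<lambda>v. L (La v))" by (rule C_inf_on_linear[OF open_UNIV]) (use linear_compose[OF F(7) L(1)] in \<open>simp add: comp_def\<close>)
  qed (use that in \<open>auto simp: ka_def\<close>)
  moreover have "\<exists>U' \<psi> T G. (U', \<psi>) \<in> atlas M \<and> C_inf_on T G \<and> ka x \<in> T \<and> (\<forall>y\<in>Z \<inter> W. ka y \<in> T \<longrightarrow> y \<in> U' \<and> \<psi> y = G (ka y))"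
    if "x \<in> Z \<inter> W" for x using F(3,6) GC ka that by (intro exI[of _ U] exI[of _ \<psi>] exI[of _ T] exI[of _ "\<lambda>z. G (I z)"]) auto
  moreover have "openin (subtopology (mtop M) Z) (Z \<inter> W)" using F(4) by (auto simp: openin_subtopology)
  ultimately have "(Z \<inter> W, ka) \<in> atlas N" using inj opn by (simp add: zero_manifold_def Int_commute)
  then show ?thesis using n F(5) by blast
qed

lemma zero_extension:
  assumes f: "smooth_at M Z n f" and n: "n \<in> Z"
  obtains F W where "smooth_everywhere M F" "openin (mtop M) W" "n \<in> W" "\<And>y. y \<in> W \<Longrightarrow> y \<in> Z \<Longrightarrow> F y = f y"
proof -
  obtain U \<psi> W T g where g: "(U, \<psi>) \<in> atlas M" "openin (mtop M) W" "n \<in> W" "W \<subseteq> U" "C_inf_on T g" "\<psi> ` W \<subseteq> T"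
    "\<And>y. y \<in> W \<Longrightarrow> y \<in> Z \<Longrightarrow> f y = g (\<psi> y)" by (rule smooth_atE[OF f], rule that)
  have s: "smooth_at M (points M) n (\<lambda>y. g (\<psi> y))" by (rule smooth_atI[OF g(1-6)]) simp
  obtain F W' where "smooth_everywhere M F" "openin (mtop M) W'" "n \<in> W'" "\<And>y. y \<in> W' \<Longrightarrow> F y = g (\<psi> y)"
    by (rule smooth_extension[OF M s], rule that)
  then show ?thesis using g by (intro that[of F "W \<inter> W'"]) auto
qed

text \<open>The inverse of a chart of the zero set is smooth into \<open>M\<close>, so a function
  with smooth local extensions to \<open>M\<close> is smooth in the chart.\<close>

lemma chart_smooth_on_N:
  assumes c: "(U, ka) \<in> atlas N" and f: "\<And>x. x \<in> U \<inter> S \<Longrightarrow> smooth_at M Z x f"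
  shows "smooth_on (ka ` (U \<inter> S)) (f \<circ> inv_into U ka)" unfolding smooth_on_iff_C_inf_on
proof
  fix z assume "z \<in> ka ` (U \<inter> S)"
  then obtain x where x: "x \<in> U" "x \<in> S" "z = ka x" by auto
  obtain U' \<psi> T G where G: "(U', \<psi>) \<in> atlas M" "C_inf_on T G" "ka x \<in> T" "\<forall>y\<in>U. ka y \<in> T \<longrightarrow> y \<in> U' \<and> \<psi> y = G (ka y)"
    using atlas_N(6)[OF c x(1)] by (elim exE conjE) (rule that)
  have xU: "x \<in> U'" using G(3,4) x(1) by blast
  have fx: "smooth_at M Z x f" using f x by blast
  obtain W T1 g where g: "openin (mtop M) W" "x \<in> W" "W \<subseteq> U'" "C_inf_on T1 g" "\<psi> ` W \<subseteq> T1" "\<And>y. y \<in> W \<Longrightarrow> y \<in> Z \<Longrightarrow> f y = g (\<psi> y)"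
    by (rule smooth_at_chartE[OF at fx G(1) xU], rule that)
  obtain T2 where T2: "open T2" "ka ` (U \<inter> W) = zero_model \<inter> T2" using atlas_N(4)[OF c g(1)] by (auto simp: openin_open)
  have UM: "ka ` U \<subseteq> zero_model" using openin_imp_subset[OF atlas_N(4)[OF c openin_topspace]] atlas_N(2)[OF c] by blast
  define T3 where "T3 = {z \<in> T \<inter> T2. G z \<in> T1}"
  have GT: "C_inf_on (T \<inter> T2) G" by (rule C_inf_on_subset[OF G(2)]) (use T2(1) C_inf_on_open[OF G(2)] in auto)
  have "open T3" unfolding T3_def by (rule C_inf_on_preimage[OF GT C_inf_on_open[OF g(4)]])
  then have "C_inf_on T3 G" by (rule C_inf_on_subset[OF GT]) (auto simp: T3_def)
  then have "C_inf_on T3 (\<lambda>z. g (G z))" by (rule C_inf_on_compose[OF _ g(4)]) (auto simp: T3_def)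
  moreover have "z \<in> T3" using G(3,4) g(2,5) T2(2) x by (auto simp: T3_def)
  moreover have "g (G y) = (f \<circ> inv_into U ka) y" if y: "y \<in> ka ` (U \<inter> S) \<inter> T3" for y
  proof -
    obtain u where u: "u \<in> U" "y = ka u" using y by auto
    have "ka u \<in> ka ` (U \<inter> W)" using u y UM T2(2) by (auto simp: T3_def)
    then have "u \<in> W" using inj_onD[OF atlas_N(3)[OF c]] u(1) by blast
    then show ?thesis using g(6)[of u] G(4) u y atlas_N(2,3)[OF c] by (auto simp: T3_def)
  qed
  ultimately show "\<exists>T g. z \<in> T \<and> C_inf_on T g \<and> (\<forall>y\<in>ka ` (U \<inter> S) \<inter> T. g y = (f \<circ> inv_into U ka) y)" by blast
qed

lemma smooth_atlas_N: "smooth_atlas N"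
proof -
  have pre: "openin (mtop N) {x \<in> U. ka x \<in> T}" if c: "(U, ka) \<in> atlas N" and T: "open T" for U ka T
  proof (subst openin_subopen, intro ballI)
    fix x assume x: "x \<in> {x \<in> U. ka x \<in> T}"
    then have xZ: "x \<in> Z" using atlas_N(2)[OF c] by auto
    obtain F W where F: "smooth_everywhere M F" "openin (mtop M) W" "x \<in> W" "\<And>y. y \<in> W \<Longrightarrow> y \<in> Z \<Longrightarrow> F y = ka y"
      by (rule zero_extension[OF atlas_N(5)[OF c] xZ]) (use x in auto)
    have "openin (mtop M) (W \<inter> {y \<in> points M. F y \<in> T})" using F(2) smooth_everywhere_preimage_open[OF at F(1) T] by auto
    then have "openin (mtop N) (U \<inter> (Z \<inter> (W \<inter> {y \<in> points M. F y \<in> T})))"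
      by (intro openin_Int[OF atlas_N(1)[OF c]]) (simp only: mtop_N openin_subtopology_Int2)
    then show "\<exists>T'. openin (mtop N) T' \<and> x \<in> T' \<and> T' \<subseteq> {x \<in> U. ka x \<in> T}"
      using x xZ F(3,4) by (intro exI[of _ "U \<inter> (Z \<inter> (W \<inter> {y \<in> points M. F y \<in> T}))"]) auto
  qed
  have img: "openin (top_of_set zero_model) (ka ` W)" if c: "(U, ka) \<in> atlas N" and W: "W \<subseteq> U" "openin (mtop N) W" for U ka W
  proof -
    obtain W' where W': "openin (mtop M) W'" "W = W' \<inter> Z" using W(2) by (auto simp: mtop_N openin_subtopology)
    then have "U \<inter> W' = W" using W(1) atlas_N(2)[OF c] by auto
    then show ?thesis using atlas_N(4)[OF c W'(1)] by simp
  qed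
  have cov: "\<Union> (fst ` atlas N) = points N"
  proof
    have "fst c \<subseteq> points N" if "c \<in> atlas N" for c using atlas_N(2)[of "fst c" "snd c"] that by simp
    then show "\<Union> (fst ` atlas N) \<subseteq> points N" by blast
    show "points N \<subseteq> \<Union> (fst ` atlas N)"
    proof
      fix n assume "n \<in> points N"
      then obtain U ka where "(U, ka) \<in> atlas N" "n \<in> U" using chart_exists_N[of n] by auto
      then show "n \<in> \<Union> (fst ` atlas N)" by force
    qed
  qed
  have trans: "smooth_on (\<phi> ` (U \<inter> V)) (\<psi> \<circ> inv_into U \<phi>)" if "(U, \<phi>) \<in> atlas N" "(V, \<psi>) \<in> atlas N" for U \<phi> V \<psi>
    by (rule chart_smooth_on_N[OF that(1)]) (use atlas_N(5)[OF that(2)] in auto)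
  show ?thesis unfolding smooth_atlas_def model_N
  proof (intro conjI cov)
    show "\<forall>(U, \<phi>)\<in>atlas N. openin (mtop N) U \<and> inj_on \<phi> U \<and> (\<forall>T. open T \<longrightarrow> openin (mtop N) {x \<in> U. \<phi> x \<in> T}) \<and>
        (\<forall>W\<subseteq>U. openin (mtop N) W \<longrightarrow> openin (top_of_set zero_model) (\<phi> ` W))"
    proof (clarify, intro conjI allI impI)
      fix U \<phi> assume c: "(U, \<phi>) \<in> atlas N"
      show "openin (mtop N) U" "inj_on \<phi> U" by (rule atlas_N(1,3)[OF c])+
      show "openin (mtop N) {x \<in> U. \<phi> x \<in> T}" if "open T" for T by (rule pre[OF c that])
      show "openin (top_of_set zero_model) (\<phi> ` W)" if "W \<subseteq> U" "openin (mtop N) W" for W by (rule img[OF c that])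
    qed
    show "\<forall>(U, \<phi>)\<in>atlas N. \<forall>(V, \<psi>)\<in>atlas N. smooth_on (\<phi> ` (U \<inter> V)) (\<psi> \<circ> inv_into U \<phi>)" by (clarify, rule trans)
  qed
qed

lemma N: "smooth_manifold N" by (rule smooth_manifoldI[OF smooth_atlas_N])
    (use M zero_model(1) in \<open>simp_all add: mtop_N model_N smooth_manifold_def Hausdorff_space_subtopology second_countable_subtopology\<close>)

lemma smooth_functions_N: "f \<in> \<C> \<Longrightarrow> f \<in> smooth_functions N" unfolding smooth_functions_def smooth_fun_on_def
  using chart_smooth_on_N[of _ _ Z f] smooth_at_mono[of M "points M" _ f Z] smooth_functions_iff[OF at, of f] by (auto simp: smooth_functions_def smooth_fun_on_def)

text \<open>The charts of \<open>N\<close> themselves extend smoothly to \<open>M\<close>, hence so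
  do the functions that are smooth in them.\<close>

lemma smooth_at_N: assumes u: "smooth_at N Z n u" and n: "n \<in> Z" shows "smooth_at M Z n u"
proof -
  obtain U ka W T g where g: "(U, ka) \<in> atlas N" "openin (mtop N) W" "n \<in> W" "W \<subseteq> U" "C_inf_on T g" "ka ` W \<subseteq> T"
    "\<And>y. y \<in> W \<Longrightarrow> y \<in> Z \<Longrightarrow> u y = g (ka y)" by (rule smooth_atE[OF u], rule that)
  obtain W' where W': "openin (mtop M) W'" "W = W' \<inter> Z" using g(2) by (auto simp: mtop_N openin_subtopology)
  show ?thesis by (rule smooth_at_compose[OF at atlas_N(5)[OF g(1)] n g(5) _ W'(1)]) (use g W' in auto)
qed

text \<open>Near \<open>r x\<close> a function on \<open>N\<close> extends to a smooth function
  \<open>F\<close> on \<open>M\<close>, and \<open>F \<circ> r\<close> is smooth by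
  \<open>r_smooth\<close>.\<close>

lemma pullback_r: assumes u: "u \<in> smooth_functions N" shows "(\<lambda>x. u (r x)) \<in> \<C>" unfolding smooth_functions_iff[OF at]
proof
  fix x assume x: "x \<in> points M"
  have rZ: "r x \<in> Z" if "x \<in> points M" for x using that by (simp add: r_in j_r)
  have un: "smooth_at N Z (r x) u" using u rZ[OF x] smooth_functions_iff[OF smooth_atlas_N, of u] by simp
  obtain F W where F: "smooth_everywhere M F" "openin (mtop M) W" "r x \<in> W" "\<And>y. y \<in> W \<Longrightarrow> y \<in> Z \<Longrightarrow> F y = u y"
    by (rule zero_extension[OF smooth_at_N[OF un rZ[OF x]] rZ[OF x]], rule that)
  have s: "smooth_at M (points M) x (\<lambda>y. f (r y))" if "f \<in> \<C>" for f using r_smooth[OF that] x smooth_functions_iff[OF at] by blast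
  obtain W' where W': "openin (mtop M) W'" "x \<in> W'" "\<And>y. y \<in> W' \<Longrightarrow> r y \<in> W"
    by (rule pullback_nbhd[where \<Phi> = r, OF at M s F(2,3)]) (assumption | (rule that, assumption+))+
  have "smooth_at M (points M) x (\<lambda>y. F (r y))" using F(1) s by (simp add: smooth_functions_eq[OF at])
  then show "smooth_at M (points M) x (\<lambda>y. u (r y))" by (rule smooth_at_cong[OF at _ W'(1,2)]) (use F(4) W'(3) rZ in auto)
qed

end

section \<open>Directional derivatives on the symplectic vector space\<close>

lemma differential_combine:
  assumes M: "smooth_atlas M" and f: "f \<in> smooth_functions M" and g: "g \<in> smooth_functions M"
  shows "differential M (\<lambda>y. a * f y + b * g y) x = (\<lambda>v. a * differential M f x v + b * differential M g x v)"
  by (rule ext) (simp add: differential_def tangent_linear[OF _ f g])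

lemma direction_vector_eq:
  assumes E: "subspace E" and p: "p \<in> E" and w: "w \<in> E"
  shows "direction_vector E p w = chart_direction (vec_manifold E) E id p w"
proof -
  have "p + t *\<^sub>R w \<in> E" for t using assms by (simp add: subspace_add subspace_scale)
  then have i: "inv_into E id (p + t *\<^sub>R w) = p + t *\<^sub>R w" for t by (metis f_inv_into_f id_apply image_id)
  show ?thesis unfolding direction_vector_def chart_direction_def by (simp only: id_apply i)
qed

lemma atlas_vec_manifold: "(E, id) \<in> atlas (vec_manifold E)" by (simp add: vec_manifold_def)

lemma direction_vector_tangent:
  assumes E: "subspace E" and p: "p \<in> E" and w: "w \<in> E"
  shows "direction_vector E p w \<in> tangent_space (vec_manifold E) p" unfolding direction_vector_eq[OF assms]
  by (rule chart_direction_tangent[OF smooth_manifold_vec_manifold[OF E] atlas_vec_manifold _ p]) (simp add: w vec_manifold_def)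

lemma direction_vector_derivative:
  assumes E: "subspace E" and p: "p \<in> E" and f: "f \<in> smooth_functions (vec_manifold E)"
  obtains T g W where "C_inf_on T g" "openin (top_of_set E) W" "p \<in> W" "W \<subseteq> T" "\<And>y. y \<in> W \<Longrightarrow> f y = g y"
    "\<And>w. w \<in> E \<Longrightarrow> direction_vector E p w f = fderiv g p w"
proof -
  note V = smooth_manifold_vec_manifold[OF E]
  have fp: "smooth_at (vec_manifold E) E p f" using f p smooth_functions_iff[OF smooth_manifold_imp_atlas[OF V], of f] by simp
  obtain W T g where g: "openin (mtop (vec_manifold E)) W" "p \<in> W" "W \<subseteq> E" "C_inf_on T g" "id ` W \<subseteq> T" "\<And>y. y \<in> W \<Longrightarrow> y \<in> E \<Longrightarrow> f y = g (id y)"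
    by (rule smooth_at_chartE[OF smooth_manifold_imp_atlas[OF V] fp atlas_vec_manifold p], rule that)
  have fg: "f y = g (id y)" if "y \<in> W" for y using g(3,6) that by blast
  show ?thesis
  proof (rule that[OF g(4) _ g(2)])
    show "openin (top_of_set E) W" using g(1) by (simp add: vec_manifold_def)
    show "direction_vector E p w f = fderiv g p w" if w: "w \<in> E" for w unfolding direction_vector_eq[OF E p w]
      by (subst chart_direction_eq[OF V atlas_vec_manifold _ g(1,2,3,4,5) fg f]) (simp_all add: w vec_manifold_def)
  qed (use g(5) fg in auto)
qed

text \<open>Justifies the definite description in \<open>symplectic_sharp\<close>: a differential is
  linear in the direction, so \<open>symplectic_riesz\<close> supplies exactly one representing
  vector.\<close>

lemma symplectic_sharp_differential:
  assumes E: "subspace E" and \<omega>: "symplectic_form_on E \<omega>" and p: "p \<in> E" and f: "f \<in> smooth_functions (vec_manifold E)"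
  shows "symplectic_sharp E \<omega> p (differential (vec_manifold E) f p) \<in> E"
    and "w \<in> E \<Longrightarrow> \<omega> (symplectic_sharp E \<omega> p (differential (vec_manifold E) f p)) w = direction_vector E p w f"
proof -
  obtain T g W where g: "C_inf_on T g" "openin (top_of_set E) W" "p \<in> W" "W \<subseteq> T" "\<And>y. y \<in> W \<Longrightarrow> f y = g y"
    "\<And>w. w \<in> E \<Longrightarrow> direction_vector E p w f = fderiv g p w" by (rule direction_vector_derivative[OF E p f], rule that)
  have pT: "p \<in> T" using g(3,4) by blast
  have lin: "linear (fderiv g p)" by (rule has_derivative_linear[OF C_inf_on_has_derivative[OF g(1) pT]])
  have d: "differential (vec_manifold E) f p (direction_vector E p w) = direction_vector E p w f" if "w \<in> E" for w
    using direction_vector_tangent[OF E p that] by (simp add: differential_def)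
  have "\<exists>!v. v \<in> E \<and> (\<forall>w\<in>E. \<omega> v w = differential (vec_manifold E) f p (direction_vector E p w))"
  proof (rule symplectic_riesz[OF E \<omega>])
    fix u v a b assume uv: "u \<in> E" "v \<in> E"
    then have "a *\<^sub>R u + b *\<^sub>R v \<in> E" using E by (simp add: subspace_add subspace_scale)
    then show "differential (vec_manifold E) f p (direction_vector E p (a *\<^sub>R u + b *\<^sub>R v)) =
      a * differential (vec_manifold E) f p (direction_vector E p u) + b * differential (vec_manifold E) f p (direction_vector E p v)"
      using uv by (simp add: d g(6) linear_add[OF lin] linear_scale[OF lin])
  qed
  from theI'[OF this, folded symplectic_sharp_def] d
  show "symplectic_sharp E \<omega> p (differential (vec_manifold E) f p) \<in> E"
    and "w \<in> E \<Longrightarrow> \<omega> (symplectic_sharp E \<omega> p (differential (vec_manifold E) f p)) w = direction_vector E p w f" by auto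
qed

section \<open>Functions and tangent vectors in the coordinates (j, r)\<close>

section \<open>Splitting of tangent vectors\<close>

context symplectic_splitting
begin

lemma r_Z: "x \<in> points M \<Longrightarrow> r x \<in> Z" by (simp add: r_in j_r)

lemma r_idem: "n \<in> Z \<Longrightarrow> r n = n" by (simp add: r_zero)

abbreviation "EN \<equiv> prod_manifold (vec_manifold E) N"

lemma EN: "smooth_atlas EN" by (rule smooth_atlas_vec_prod[OF smooth_atlas_N E])

lemma pullback_EN:
  fixes A :: "('q, 's::euclidean_space) manifold"
  assumes A: "smooth_atlas A" and F: "F \<in> smooth_functions EN" and q: "smooth_everywhere A q" "\<And>y. y \<in> points A \<Longrightarrow> q y \<in> E"
    and \<rho>: "\<And>y. y \<in> points A \<Longrightarrow> \<rho> y \<in> Z" "\<And>f. f \<in> smooth_functions N \<Longrightarrow> (\<lambda>y. f (\<rho> y)) \<in> smooth_functions A"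
  shows "(\<lambda>y. F (q y, \<rho> y)) \<in> smooth_functions A" unfolding smooth_functions_iff[OF A]
proof
  fix x assume x: "x \<in> points A"
  have s: "smooth_at A (points A) x (\<lambda>y. f (\<rho> y))" if "f \<in> smooth_functions N" for f using \<rho>(2)[OF that] x smooth_functions_iff[OF A] by blast
  have "smooth_at EN (E \<times> points N) (q x, \<rho> x) F" using F q(2)[OF x] \<rho>(1)[OF x] smooth_functions_iff[OF EN, of F] by simp
  then show "smooth_at A (points A) x (\<lambda>y. F (q y, \<rho> y))"
    by (intro smooth_at_param_pullback[OF A N E x smooth_everywhereD[OF q(1) x] q(2) s]) (use \<rho>(1) in auto)
qed

lemma slice_N: "F \<in> smooth_functions EN \<Longrightarrow> w \<in> E \<Longrightarrow> (\<lambda>n. F (w, n)) \<in> smooth_functions N"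
  by (rule pullback_EN[OF smooth_atlas_N]) (simp_all add: smooth_everywhere_const[OF smooth_atlas_N])

lemma slice_E: assumes F: "F \<in> smooth_functions EN" and n: "n \<in> Z" shows "(\<lambda>w. F (w, n)) \<in> smooth_functions (vec_manifold E)"
proof -
  note V = smooth_manifold_imp_atlas[OF smooth_manifold_vec_manifold[OF E]]
  have "smooth_everywhere (vec_manifold E) (\<lambda>w. w)" unfolding smooth_everywhere_def
    by (intro ballI, rule smooth_atI[OF atlas_vec_manifold[of E] _ _ subset_refl C_inf_on_id[OF open_UNIV]])
      (simp_all add: vec_manifold_def)
  then show ?thesis by (rule pullback_EN[OF V F]) (use n smooth_functions_const[OF V] in auto)
qed

lemma pullback_jr: "F \<in> smooth_functions EN \<Longrightarrow> (\<lambda>x. F (j x, r x)) \<in> \<C>" by (rule pullback_EN[OF at _ j jE]) (auto intro: r_in j_r pullback_r)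

lemma flow_pullback_EN:
  assumes f: "f \<in> \<C>" shows "(\<lambda>z. f (\<phi> (fst z) (snd z))) \<in> smooth_functions EN" unfolding smooth_functions_iff[OF EN]
proof
  fix z assume z: "z \<in> points EN"
  then obtain w n where wn: "z = (w, n)" "w \<in> E" "n \<in> Z" by auto
  have q: "smooth_at EN (points EN) z fst" unfolding wn(1)
    by (rule smooth_at_vec_prod_fst[OF smooth_atlas_N E wn(2), where L = "\<lambda>x. x", simplified]) (use wn(3) C_inf_on_id[OF open_UNIV] in auto)
  have s: "smooth_at EN (points EN) z (\<lambda>y. f (snd y))" if f: "f \<in> \<C>" for f unfolding wn(1)
    by (rule smooth_at_vec_prod_snd[where S' = Z, OF smooth_atlas_N E wn(2)]) (use smooth_functions_N[OF f] wn(3) smooth_functions_iff[OF smooth_atlas_N, of f] in auto)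
  have "snd z \<in> points M" using wn by simp
  from smooth_at_param_pullback[where \<Phi> = snd and K = "\<lambda>z. f (\<phi> (fst z) (snd z))", OF EN M subspace_UNIV z q UNIV_I s _ flow_smooth[OF f this]]
  show "smooth_at EN (points EN) z (\<lambda>z. f (\<phi> (fst z) (snd z)))" by auto
qed

text \<open>Near \<open>(j x, r x)\<close> the function \<open>F\<close> is smooth in the first
  argument and in coordinates of the second. By the chain rule \<open>v\<close> acts through a
  linear map on pairs, and a pair is the sum of its two components.\<close>

lemma tangent_split:
  assumes x: "x \<in> points M" and v: "v \<in> tangent_space M x" and F: "F \<in> smooth_functions EN"
  shows "v (\<lambda>y. F (j y, r y)) = v (\<lambda>y. F (j y, r x)) + v (\<lambda>y. F (j x, r y))"
proof -
  have rx: "r x \<in> points N" using r_Z[OF x] by simp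
  have Fx: "smooth_at EN (E \<times> points N) (j x, r x) F" using F jE[of x] rx smooth_functions_iff[OF EN, of F] by simp
  obtain U \<psi> where c: "(U, \<psi>) \<in> atlas N" "r x \<in> U" by (rule chart_exists[OF smooth_atlas_N rx], rule that)
  obtain A W T g where g: "openin (top_of_set E) A" "j x \<in> A" "openin (mtop N) W" "r x \<in> W" "W \<subseteq> U" "C_inf_on T g"
    "\<And>q y. q \<in> A \<Longrightarrow> y \<in> W \<Longrightarrow> (q, \<psi> y) \<in> T"
    "\<And>q y. q \<in> A \<Longrightarrow> y \<in> W \<Longrightarrow> (q, y) \<in> E \<times> points N \<Longrightarrow> F (q, y) = g (q, \<psi> y)"
    by (rule smooth_at_vec_prodE[OF smooth_atlas_N E Fx c], rule that)
  have s: "smooth_at N (points N) (r x) \<psi>" by (rule smooth_atI[OF c(1) chart_open[OF smooth_atlas_N c(1)] c(2) subset_refl C_inf_on_id[OF open_UNIV]]) auto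
  obtain \<psi>' W' where e: "smooth_everywhere N \<psi>'" "openin (mtop N) W'" "r x \<in> W'" "\<And>y. y \<in> W' \<Longrightarrow> \<psi>' y = \<psi> y"
    by (rule smooth_extension[OF N s], rule that)
  have pr: "smooth_at M (points M) z (\<lambda>y. f (r y))" if "z \<in> points M" "f \<in> smooth_functions N" for f z
    using pullback_r[OF that(2)] that(1) smooth_functions_iff[OF at] by blast
  define th where "th y = \<psi>' (r y)" for y
  have th: "smooth_everywhere M th" unfolding smooth_everywhere_def th_def by (intro ballI smooth_at_pullback_vec[where \<Phi> = r, OF at N _ pr e(1)])
  have op: "openin (mtop N) (W \<inter> W')" "r x \<in> W \<inter> W'" using g e by auto
  obtain W1 where W1: "openin (mtop M) W1" "x \<in> W1" "\<And>y. y \<in> W1 \<Longrightarrow> r y \<in> W \<inter> W'"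
    by (rule pullback_nbhd[where \<Phi> = r, OF at N pr[OF x] op]) (assumption | (rule that, assumption+))+
  obtain A' where A': "open A'" "A = E \<inter> A'" using g(1) by (auto simp: openin_open)
  define W2 where "W2 = W1 \<inter> {y \<in> points M. j y \<in> A'}"
  have W2: "openin (mtop M) W2" "x \<in> W2" unfolding W2_def using W1 smooth_everywhere_preimage_open[OF at j A'(1)] g(2) A'(2) x by auto
  have yA: "j y \<in> A" "r y \<in> W" "\<psi> (r y) = th y" "r y \<in> points N" if "y \<in> W2" for y using that W1(3) A'(2) jE e(4) r_Z by (auto simp: W2_def th_def)
  note yx = yA[OF W2(2)]
  have T: "(j x, th x) \<in> T" using g(7)[OF yx(1,2)] yx(3) by simp
  define D where "D = fderiv g (j x, th x)"
  have D: "linear D" unfolding D_def by (rule has_derivative_linear[OF C_inf_on_has_derivative[OF g(6) T]])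
  have c0: "vec_apply v (\<lambda>y. c) = 0" for c by (simp add: vec_apply_def tangent_const[OF at v])
  have pair: "smooth_everywhere M (\<lambda>y. (a y, b y))" if "smooth_everywhere M a" "smooth_everywhere M b" for a :: "'a \<Rightarrow> 'b" and b :: "'a \<Rightarrow> 'e"
    using that by (simp add: smooth_everywhere_def smooth_at_Pair[OF at])
  note ec = smooth_everywhere_const[OF at]
  have "v (\<lambda>y. F (j y, r y)) = D (vec_apply v (\<lambda>y. (j y, th y)))" unfolding D_def
    by (rule tangent_chain[OF M v x pair[OF j th] pullback_jr[OF F] g(6) T W2]) (use yA g(8) jE in auto)
  moreover have "v (\<lambda>y. F (j y, r x)) = D (vec_apply v (\<lambda>y. (j y, th x)))" unfolding D_def
    by (rule tangent_chain[where \<eta> = "\<lambda>y. (j y, th x)", OF M v x pair[OF j ec] _ g(6) T W2])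
      (use pullback_EN[OF at F j jE, of "\<lambda>y. r x"] smooth_functions_const[OF at] yA yx g(8) jE r_Z[OF x] in auto)
  moreover have "v (\<lambda>y. F (j x, r y)) = D (vec_apply v (\<lambda>y. (j x, th y)))" unfolding D_def
    by (rule tangent_chain[where \<eta> = "\<lambda>y. (j x, th y)", OF M v x pair[OF ec th] _ g(6) T W2])
      (use pullback_EN[OF at F ec, of "j x" r] pullback_r r_Z yA yx g(8) jE in auto)
  ultimately show ?thesis by (simp add: vec_apply_Pair c0 linear_add[OF D, symmetric])
qed

lemma tangent_comp_j:
  assumes x: "x \<in> points M" and v: "v \<in> tangent_space M x" and f: "f \<in> smooth_functions (vec_manifold E)"
  shows "v (\<lambda>y. f (j y)) = direction_vector E (j x) (vec_apply v j) f"
proof -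
  obtain T g W where g: "C_inf_on T g" "openin (top_of_set E) W" "j x \<in> W" "W \<subseteq> T" "\<And>y. y \<in> W \<Longrightarrow> f y = g y"
    "\<And>w. w \<in> E \<Longrightarrow> direction_vector E (j x) w f = fderiv g (j x) w" by (rule direction_vector_derivative[OF E jE f], rule that)
  obtain A where A: "open A" "W = E \<inter> A" using g(2) by (auto simp: openin_open)
  have s: "(\<lambda>y. f (j y)) \<in> \<C>" unfolding smooth_functions_iff[OF at]
  proof
    fix z assume z: "z \<in> points M"
    obtain T g W where g: "C_inf_on T g" "openin (top_of_set E) W" "j z \<in> W" "W \<subseteq> T" "\<And>y. y \<in> W \<Longrightarrow> f y = g y"
      by (rule direction_vector_derivative[OF E jE f], rule that)
    obtain A where A: "open A" "W = E \<inter> A" using g(2) by (auto simp: openin_open)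
    show "smooth_at M (points M) z (\<lambda>y. f (j y))" by (rule smooth_at_compose[OF at smooth_everywhereD[OF j z] z g(1) _ smooth_everywhere_preimage_open[OF at j A(1)]])
        (use g A z jE in auto)
  qed
  have "v (\<lambda>y. f (j y)) = fderiv g (j x) (vec_apply v j)"
    by (rule tangent_chain[OF M v x j s g(1) _ smooth_everywhere_preimage_open[OF at j A(1)]]) (use g A x jE in auto)
  then show ?thesis using g(6)[OF vec_apply_in_subspace[OF M v x j E jE]] by simp
qed

text \<open>Any \<open>f\<close> is the function \<open>F (w, n) = f (\<phi> w n)\<close> of the
  coordinates \<open>(j, r)\<close>, and a vector along which \<open>j\<close> is stationary only
  sees the second coordinate.\<close>

lemma tangent_r:
  assumes n: "n \<in> Z" and v: "v \<in> tangent_space M n" and v0: "vec_apply v j = 0" and f: "f \<in> \<C>"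
  shows "v f = v (\<lambda>y. f (r y))"
proof -
  have nM: "n \<in> points M" using n by simp
  define F where "F z = f (\<phi> (fst z) (snd z))" for z
  have F: "F \<in> smooth_functions EN" unfolding F_def by (rule flow_pullback_EN[OF f])
  have "v f = v (\<lambda>y. F (j y, r y))" by (rule tangent_local[OF M v f pullback_jr[OF F] openin_topspace nM]) (simp add: F_def flow_j_r)
  also have "\<dots> = v (\<lambda>y. F (j y, r n)) + v (\<lambda>y. F (j n, r y))" by (rule tangent_split[OF nM v F])
  also have "v (\<lambda>y. F (j y, r n)) = 0"
  proof -
    have s: "(\<lambda>w. F (w, r n)) \<in> smooth_functions (vec_manifold E)" by (rule slice_E[OF F r_Z[OF nM]])
    have "v (\<lambda>y. F (j y, r n)) = direction_vector E (j n) 0 (\<lambda>w. F (w, r n))" using tangent_comp_j[OF nM v s] v0 by simp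
    then show ?thesis by (simp add: direction_vector_def)
  qed
  also have "v (\<lambda>y. F (j n, r y)) = v (\<lambda>y. f (r y))" by (rule tangent_local[OF M v _ r_smooth[OF f] openin_topspace nM])
      (use pullback_r[OF slice_N[OF F jE[of n]]] n in \<open>simp_all add: F_def flow_0 r_in\<close>)
  finally show ?thesis by simp
qed

end

section \<open>The Poisson-Dirac condition and the induced bracket\<close>

section \<open>The induced Poisson structure\<close>

context symplectic_splitting
begin

lemma bracket_combine:
  assumes x: "x \<in> points M" and f: "f \<in> \<C>" and g: "g \<in> \<C>" and l: "l \<in> \<C>"
  shows "pb (\<lambda>y. a * f y + b * g y) l x = a * pb f l x + b * pb g l x" unfolding bracket_def differential_combine[OF at f g]
  by (rule bivector_linear[OF x]) (intro differential_in_cotangent_space f g l)+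

lemma bracket_cong_right:
  assumes "x \<in> points M" "f \<in> \<C>" "g \<in> \<C>" "l \<in> \<C>" "\<And>y. y \<in> points M \<Longrightarrow> g y = l y"
  shows "pb f g x = pb f l x" using hamiltonian_vf_cong[OF assms(1,3,4) openin_topspace assms(1,5)] hamiltonian_vf_apply[OF assms(2)] by metis

text \<open>The Hamiltonian vector of the pullback \<open>u \<circ> r\<close>, projected to
  \<open>N\<close> along the orbits.\<close>

definition XN :: "('a \<Rightarrow> real) \<Rightarrow> 'a \<Rightarrow> (('a \<Rightarrow> real) \<Rightarrow> real)" where
  "XN u n = push_vector N r (ham (\<lambda>y. u (r y)) n)"

lemma XN_tangent: assumes u: "u \<in> smooth_functions N" and n: "n \<in> Z" shows "XN u n \<in> tangent_space N n"
  using push_vector_tangent[OF at smooth_atlas_N, of r "ham (\<lambda>y. u (r y)) n" n] pullback_r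
    hamiltonian_vf_tangent[OF _ pullback_r[OF u]] n by (simp add: comp_def r_idem XN_def)

lemma XN_apply: "l \<in> smooth_functions N \<Longrightarrow> XN u n l = pb (\<lambda>y. l (r y)) (\<lambda>y. u (r y)) n"
  by (simp add: XN_def push_vector_def comp_def hamiltonian_vf_apply pullback_r)

text \<open>By \<open>bracket_vec_j_r\<close> this vector leaves \<open>j\<close> stationary, so by
  \<open>tangent_r\<close> the projection does not change it: the Hamiltonian vector of
  \<open>u \<circ> r\<close> at a point of \<open>N\<close> is tangent to \<open>N\<close>.\<close>

lemma bracket_pullback_r:
  assumes u: "u \<in> smooth_functions N" and n: "n \<in> Z" and g: "g \<in> \<C>"
  shows "pb g (\<lambda>y. u (r y)) n = XN u n g"
proof -
  have nM: "n \<in> points M" using n by simp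
  have "ham (\<lambda>y. u (r y)) n g = ham (\<lambda>y. u (r y)) n (\<lambda>y. g (r y))" by (rule tangent_r[OF n hamiltonian_vf_tangent[OF nM pullback_r[OF u]] _ g])
      (use bracket_vec_j_r[OF pullback_r[OF u] nM] in \<open>simp add: bracket_vec_def\<close>)
  then show ?thesis using g r_smooth[OF g] smooth_functions_N[OF g] by (simp add: hamiltonian_vf_apply XN_apply)
qed

lemma tangent_N_r:
  assumes v: "v \<in> tangent_space N n" and n: "n \<in> Z" and u: "u \<in> smooth_functions N"
  shows "v (\<lambda>y. u (r y)) = v u" by (rule tangent_local[OF N v smooth_functions_N[OF pullback_r[OF u]] u openin_topspace]) (use n in \<open>auto simp: r_idem\<close>)

lemma push_id: "push_vector M id v = (\<lambda>g. if g \<in> \<C> then v g else 0)" unfolding push_vector_def comp_id ..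

lemma push_id_tangent: "v \<in> tangent_space N n \<Longrightarrow> push_vector M id v \<in> tangent_space M n"
  using push_vector_tangent[OF smooth_atlas_N at, of id v n] smooth_functions_N by simp

text \<open>A derivation on \<open>N\<close> is recovered from its image in \<open>M\<close> by
  evaluating the image on pullbacks along \<open>r\<close>.\<close>

lemma push_id_inj:
  assumes n: "n \<in> Z" shows "inj_on (push_vector M id) (tangent_space N n)"
proof (rule inj_onI, rule ext)
  fix v w u assume v: "v \<in> tangent_space N n" and w: "w \<in> tangent_space N n" and eq: "push_vector M id v = push_vector M id w"
  show "v u = w u"
  proof (cases "u \<in> smooth_functions N")
    case True
    then show ?thesis using fun_cong[OF eq, of "\<lambda>y. u (r y)"] tangent_N_r[OF v n] tangent_N_r[OF w n] pullback_r[OF True] by (simp add: push_id)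
  next
    case False
    then show ?thesis using tangent_not_smooth[OF v] tangent_not_smooth[OF w] by simp
  qed
qed

lemma embedded_submanifold_N: "embedded_submanifold N M"
proof -
  have "smooth_map N M id" by (rule smooth_map_pullbackI[OF smooth_atlas_N M]) (use smooth_functions_N in auto)
  then show ?thesis unfolding embedded_submanifold_def points_N using N mtop_N push_id_inj by blast
qed

lemma conormal_differential:
  assumes n: "n \<in> Z" and f: "f \<in> \<C>" and c: "differential M f n \<in> conormal_space N M n" and v: "v \<in> tangent_space N n"
  shows "v f = 0" using c v f push_id_tangent[OF v] by (auto simp: conormal_space_def tangent_in_def differential_def push_id)

text \<open>Write \<alpha> as \<open>df\<close>. For tangent \<open>v\<close> one has
  \<open>v g = v (g \<circ> r) = {f, g \<circ> r}\<close>, which is a vector tangent to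
  \<open>N\<close> applied to \<open>f\<close>, and \<open>df\<close> vanishes on such vectors. This
  is the Poisson-Dirac condition, and it gives the uniqueness behind
  \<open>induced_bivector\<close>.\<close>

lemma sharp_in_tangent_eq_0:
  assumes n: "n \<in> Z" and v: "v \<in> tangent_space N n" and a: "\<alpha> \<in> conormal_space N M n" and eq: "push_vector M id v = sharp M \<pi> n \<alpha>"
  shows "v = (\<lambda>_. 0)"
proof (rule inj_onD[OF push_id_inj[OF n] _ v zero_in_tangent_space])
  have nM: "n \<in> points M" using n by simp
  obtain f where f: "f \<in> \<C>" "\<alpha> = differential M f n" using cotangent_is_differential[OF M nM, of \<alpha>] a unfolding conormal_space_def by blast
  have "v g = 0" if g: "g \<in> \<C>" for g
  proof -
    note gN = smooth_functions_N[OF g]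
    have "v g = v (\<lambda>y. g (r y))" using tangent_N_r[OF v n gN] by simp
    also have "\<dots> = pb f (\<lambda>y. g (r y)) n" using fun_cong[OF eq, of "\<lambda>y. g (r y)"] r_smooth[OF g] f(2) by (simp add: push_id sharp_def bracket_def)
    also have "\<dots> = XN g n f" by (rule bracket_pullback_r[OF gN n f(1)])
    also have "\<dots> = 0" using conormal_differential[OF n f(1) _ XN_tangent[OF gN n]] a f(2) by simp
    finally show ?thesis .
  qed
  then show "push_vector M id v = push_vector M id (\<lambda>_. 0)" by (auto simp: push_id)
qed

abbreviation "\<pi>N \<equiv> induced_bivector N M \<pi>"

text \<open>The extension \<open>d(u \<circ> r)\<close> of the covector \<open>du\<close> is sent by
  \<open>sharp\<close> to a vector tangent to \<open>N\<close>, so it may be used to evaluate the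
  induced bivector.\<close>

lemma induced_bracket:
  assumes n: "n \<in> Z" and u: "u \<in> smooth_functions N" and l: "l \<in> smooth_functions N"
  shows "bracket N \<pi>N u l n = pb (\<lambda>y. u (r y)) (\<lambda>y. l (r y)) n"
proof -
  have nM: "n \<in> points M" using n by simp
  note ur = pullback_r[OF u]
  \<comment> \<open>The sign arises because \<open>sharp\<close> puts the covector in the first
    slot, while \<open>XN\<close> has \<open>u\<close> in the second. The zero term gives the shape
    that \<open>tangent_space_combine\<close> expects.\<close>
  define v0 where "v0 = (\<lambda>g. (-1) * XN u n g + 0 * XN u n g)"
  have v0: "v0 \<in> tangent_space N n" unfolding v0_def by (intro tangent_space_combine XN_tangent u n)
  define \<alpha>0 where "\<alpha>0 = differential M (\<lambda>y. u (r y)) n"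
  have \<alpha>0: "\<alpha>0 \<in> cotangent_space M n" unfolding \<alpha>0_def by (rule differential_in_cotangent_space[OF ur])
  have pull0: "pull_covector N M id n \<alpha>0 = differential N u n"
  proof -
    have "pull_covector N M id n \<alpha>0 = differential N (\<lambda>y. u (r y)) n"
      using pull_covector_differential[OF smooth_atlas_N at _ ur, of id n] smooth_functions_N by (simp add: \<alpha>0_def)
    also have "\<dots> = differential N u n" using tangent_N_r[OF _ n u] by (auto simp: differential_def)
    finally show ?thesis .
  qed
  have push0: "push_vector M id v0 = sharp M \<pi> n \<alpha>0"
    using bracket_pullback_r[OF u n] bracket_skew[OF nM _ ur] by (auto simp: push_id sharp_def v0_def \<alpha>0_def bracket_def)
  have "(THE v. v \<in> tangent_space N n \<and> (\<exists>\<alpha>\<in>cotangent_space M n. pull_covector N M id n \<alpha> = differential N u n \<and>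
      push_vector M id v = sharp M \<pi> n \<alpha>)) = v0"
  proof (rule the_equality)
    show "v0 \<in> tangent_space N n \<and> (\<exists>\<alpha>\<in>cotangent_space M n. pull_covector N M id n \<alpha> = differential N u n \<and> push_vector M id v0 = sharp M \<pi> n \<alpha>)"
      using v0 \<alpha>0 pull0 push0 by blast
    fix v assume "v \<in> tangent_space N n \<and> (\<exists>\<alpha>\<in>cotangent_space M n. pull_covector N M id n \<alpha> = differential N u n \<and> push_vector M id v = sharp M \<pi> n \<alpha>)"
    then obtain \<alpha> where v: "v \<in> tangent_space N n" and \<alpha>: "\<alpha> \<in> cotangent_space M n"
      "pull_covector N M id n \<alpha> = differential N u n" "push_vector M id v = sharp M \<pi> n \<alpha>" by blast
    obtain f where f: "f \<in> \<C>" "\<alpha> = differential M f n" by (rule cotangent_is_differential[OF M nM \<alpha>(1)], rule that)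
    define f' where "f' = (\<lambda>y. 1 * f y + (-1) * u (r y))"
    have f': "f' \<in> \<C>" unfolding f'_def by (rule smooth_functions_combine[OF at f(1) ur])
    have df': "differential M f' n = (\<lambda>w. 1 * \<alpha> w + (-1) * \<alpha>0 w)" unfolding f'_def f(2) \<alpha>0_def by (rule differential_combine[OF at f(1) ur])
    have "\<alpha> (push_vector M id w) = \<alpha>0 (push_vector M id w)" if "w \<in> tangent_space N n" for w
      using fun_cong[OF trans[OF \<alpha>(2) pull0[symmetric]], of w] that by (simp add: pull_covector_def)
    then have "differential M f' n \<in> conormal_space N M n" using differential_in_cotangent_space[OF f', of n] by (auto simp: conormal_space_def tangent_in_def df')
    moreover have "push_vector M id (\<lambda>g. 1 * v g + (-1) * v0 g) = sharp M \<pi> n (differential M f' n)"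
    proof
      fix g
      show "push_vector M id (\<lambda>g. 1 * v g + (-1) * v0 g) g = sharp M \<pi> n (differential M f' n) g" using fun_cong[OF \<alpha>(3), of g] fun_cong[OF push0, of g]
          bivector_linear[OF nM \<alpha>(1) \<alpha>0 differential_in_cotangent_space, of g 1 "-1"] by (auto simp: push_id sharp_def df')
    qed
    ultimately have "(\<lambda>g. 1 * v g + (-1) * v0 g) = (\<lambda>_. 0)" by (intro sharp_in_tangent_eq_0[OF n tangent_space_combine[OF v v0]])
    from fun_cong[OF this] have "v g = v0 g" for g by simp
    then show "v = v0" by (rule ext)
  qed
  then have "bracket N \<pi>N u l n = v0 l" using v0 by (simp add: bracket_def induced_bivector_def differential_def[of N l])
  also have "\<dots> = pb (\<lambda>y. u (r y)) (\<lambda>y. l (r y)) n" using XN_apply[OF l] bracket_skew[OF nM ur pullback_r[OF l]] by (simp add: v0_def)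
  finally show ?thesis .
qed

lemma bracket_r_N:
  assumes u: "u \<in> smooth_functions N" and l: "l \<in> smooth_functions N" and x: "x \<in> points M"
  shows "bracket N \<pi>N u l (r x) = pb (\<lambda>y. u (r y)) (\<lambda>y. l (r y)) x"
  using induced_bracket[OF r_Z[OF x] u l] bracket_r_invariant[OF pullback_r[OF u] pullback_r[OF l] x] by simp

lemma bracket_N_smooth:
  assumes u: "u \<in> smooth_functions N" and l: "l \<in> smooth_functions N"
  shows "bracket N \<pi>N u l \<in> smooth_functions N"
  by (rule smooth_functions_cong_points[OF smooth_atlas_N smooth_functions_N[OF bracket_smooth[OF pullback_r[OF u] pullback_r[OF l]]]]) (use induced_bracket[OF _ u l] in simp)

text \<open>Covectors on \<open>N\<close> are differentials, so skew-symmetry and linearity come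
  from the bracket of \<open>M\<close> on pullbacks along \<open>r\<close>.\<close>

lemma smooth_bivector_field_N: "smooth_bivector_field N \<pi>N"
proof -
  have "bivector_field N \<pi>N" unfolding bivector_field_def
  proof (intro ballI conjI allI)
    fix n \<alpha> \<beta> assume "n \<in> points N" and \<alpha>: "\<alpha> \<in> cotangent_space N n" and \<beta>: "\<beta> \<in> cotangent_space N n"
    then have n: "n \<in> points N" "n \<in> Z" "n \<in> points M" by simp_all
    obtain f where f: "f \<in> smooth_functions N" "\<alpha> = differential N f n" by (rule cotangent_is_differential[OF N n(1) \<alpha>], rule that)
    obtain g where g: "g \<in> smooth_functions N" "\<beta> = differential N g n" by (rule cotangent_is_differential[OF N n(1) \<beta>], rule that)
    show "\<pi>N n \<alpha> \<beta> = - \<pi>N n \<beta> \<alpha>" using induced_bracket[OF n(2) f(1) g(1)] induced_bracket[OF n(2) g(1) f(1)]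
        bracket_skew[OF n(3) pullback_r[OF f(1)] pullback_r[OF g(1)]] by (simp add: bracket_def f(2) g(2))
    fix c a b assume c: "c \<in> cotangent_space N n"
    obtain l where l: "l \<in> smooth_functions N" "c = differential N l n" by (rule cotangent_is_differential[OF N n(1) c], rule that)
    have "(\<lambda>v. a * \<alpha> v + b * \<beta> v) = differential N (\<lambda>y. a * f y + b * g y) n"
      by (simp add: differential_combine[OF smooth_atlas_N f(1) g(1)] f(2) g(2))
    then have "\<pi>N n (\<lambda>v. a * \<alpha> v + b * \<beta> v) c = bracket N \<pi>N (\<lambda>y. a * f y + b * g y) l n" by (simp add: bracket_def l(2))
    also have "\<dots> = a * bracket N \<pi>N f l n + b * bracket N \<pi>N g l n"
      using induced_bracket[OF n(2) smooth_functions_combine[OF smooth_atlas_N f(1) g(1)] l(1), of a b] induced_bracket[OF n(2) f(1) l(1)]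
        induced_bracket[OF n(2) g(1) l(1)] bracket_combine[OF n(3) pullback_r[OF f(1)] pullback_r[OF g(1)] pullback_r[OF l(1)], of a b] by simp
    finally show "\<pi>N n (\<lambda>v. a * \<alpha> v + b * \<beta> v) c = a * \<pi>N n \<alpha> c + b * \<pi>N n \<beta> c" by (simp add: bracket_def f(2) g(2) l(2))
  qed
  then show ?thesis using bracket_N_smooth unfolding smooth_bivector_field_def by blast
qed

text \<open>The bracket on \<open>N\<close> pulls back along \<open>r\<close> to the bracket of the
  pullbacks. So iterated brackets on \<open>N\<close> are iterated brackets on \<open>M\<close>, and
  Jacobi's identity is inherited.\<close>

lemma poisson_structure_N: "poisson_structure N \<pi>N"
proof -
  have "bracket N \<pi>N f (bracket N \<pi>N g l) n = pb (\<lambda>y. f (r y)) (pb (\<lambda>y. g (r y)) (\<lambda>y. l (r y))) n"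
    if f: "f \<in> smooth_functions N" and g: "g \<in> smooth_functions N" and l: "l \<in> smooth_functions N" and n: "n \<in> Z" for f g l n
  proof -
    have nM: "n \<in> points M" using n by simp
    note gl = bracket_N_smooth[OF g l]
    show ?thesis unfolding induced_bracket[OF n f gl]
      by (rule bracket_cong_right[OF nM pullback_r[OF f] pullback_r[OF gl] bracket_smooth[OF pullback_r[OF g] pullback_r[OF l]] bracket_r_N[OF g l]])
  qed
  then show ?thesis using smooth_bivector_field_N jacobi[OF pullback_r pullback_r pullback_r] by (simp add: poisson_structure_def)
qed

lemma poisson_dirac_N: "poisson_dirac_submanifold N M \<pi>"
proof -
  have "tangent_in N M n \<inter> sharp M \<pi> n ` conormal_space N M n = {\<lambda>_. 0}" if n: "n \<in> Z" for n
  proof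
    have nM: "n \<in> points M" using n by simp
    show "tangent_in N M n \<inter> sharp M \<pi> n ` conormal_space N M n \<subseteq> {\<lambda>_. 0}"
    proof
      fix w assume "w \<in> tangent_in N M n \<inter> sharp M \<pi> n ` conormal_space N M n"
      then obtain v \<alpha> where v: "v \<in> tangent_space N n" "w = push_vector M id v" and \<alpha>: "\<alpha> \<in> conormal_space N M n" "w = sharp M \<pi> n \<alpha>"
        by (auto simp: tangent_in_def)
      have "v = (\<lambda>_. 0)" by (rule sharp_in_tangent_eq_0[OF n v(1) \<alpha>(1)]) (use v \<alpha> in simp)
      then show "w \<in> {\<lambda>_. 0}" using v(2) by (simp add: push_id)
    qed
    have "(\<lambda>_. 0) \<in> tangent_in N M n" unfolding tangent_in_def using zero_in_tangent_space[of N n] by (intro image_eqI[of _ _ "\<lambda>_. 0"]) (auto simp: push_id)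
    moreover have c: "(\<lambda>_. 0) \<in> cotangent_space M n" by (simp add: cotangent_space_def)
    then have "(\<lambda>_. 0) \<in> conormal_space N M n" by (simp add: conormal_space_def)
    moreover have "sharp M \<pi> n (\<lambda>_. 0) = (\<lambda>_. 0)" using bivector_linear[OF nM c c differential_in_cotangent_space, of _ 0 0] by (auto simp: sharp_def)
    ultimately show "{\<lambda>_. 0} \<subseteq> tangent_in N M n \<inter> sharp M \<pi> n ` conormal_space N M n" by force
  qed
  then show ?thesis using embedded_submanifold_N smooth_bivector_field_N by (simp add: poisson_dirac_submanifold_def)
qed

section \<open>The map (j, r) is a diffeomorphism and respects the brackets\<close>

section \<open>The splitting diffeomorphism\<close>

text \<open>Applying \<open>\<phi> w\<close> to a point of \<open>N\<close> changes \<open>j\<close>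
  from 0 to \<open>w\<close> and keeps \<open>r\<close>, so \<open>\<phi>\<close> is the inverse
  map. Its smoothness is that of the flow in parameter and point together.\<close>

lemma diffeomorphism_jr: "diffeomorphism M EN (\<lambda>x. (j x, r x))"
proof -
  have N_r: "(\<lambda>x. f (r x)) \<in> \<C>" if "f \<in> smooth_functions N" for f by (rule pullback_r[OF that])
  have rN: "r x \<in> points N" if "x \<in> points M" for x using r_Z[OF that] by simp
  have "continuous_map (mtop M) euclidean j" using smooth_everywhere_preimage_open[OF at j] by (simp add: continuous_map_def)
  then have "continuous_map (mtop M) (top_of_set E) j" by (simp add: continuous_map_in_subtopology jE image_subset_iff)
  moreover have "continuous_map (mtop M) (mtop N) r" by (rule continuous_map_pullback[where F = r, OF at N rN N_r])
  ultimately have cont: "continuous_map (mtop M) (mtop EN) (\<lambda>x. (j x, r x))" by (simp add: continuous_map_paired prod_manifold_def vec_manifold_def)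
  have "smooth_map M EN (\<lambda>x. (j x, r x))"
  proof (rule smooth_mapI[OF at cont])
    fix V \<psi> x assume V: "(V, \<psi>) \<in> atlas EN" and x: "x \<in> points M" and xV: "(j x, r x) \<in> V"
    obtain U ka where c: "V = E \<times> U" "\<psi> = map_prod id ka" "(U, ka) \<in> atlas N" using V by (auto simp: prod_manifold_def vec_manifold_def)
    have rU: "r x \<in> U" using xV c(1) by simp
    have s: "smooth_at N (points N) (r x) ka" by (rule smooth_atI[OF c(3) chart_open[OF smooth_atlas_N c(3)] rU subset_refl C_inf_on_id[OF open_UNIV]]) auto
    have pr: "smooth_at M (points M) x (\<lambda>y. f (r y))" if "f \<in> smooth_functions N" for f using N_r[OF that] x smooth_functions_iff[OF at] by blast
    have "smooth_at M (points M) x (\<lambda>y. ka (r y))" by (rule smooth_at_pullback[where \<Phi> = r, OF at N x pr rN s])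
    from smooth_at_Pair[OF at smooth_everywhereD[OF j x] this]
    show "smooth_at M (points M) x (\<lambda>y. \<psi> (j y, r y))" by (simp add: c(2))
  qed
  moreover have inv: "\<phi> w n \<in> points M" "j (\<phi> w n) = w" "r (\<phi> w n) = n" if "w \<in> E" "n \<in> Z" for w n
    using that by (simp_all add: flow_in flow_j P(3) r_flow r_idem)
  have bij: "bij_betw (\<lambda>x. (j x, r x)) (points M) (points EN)"
    by (rule bij_betw_byWitness[where f' = "\<lambda>z. \<phi> (fst z) (snd z)"]) (use inv in \<open>auto simp: flow_j_r jE r_in j_r\<close>)
  moreover have "smooth_map EN M (inv_into (points M) (\<lambda>x. (j x, r x)))"
  proof (rule smooth_map_pullbackI[OF EN M])
    have eq: "inv_into (points M) (\<lambda>x. (j x, r x)) z = \<phi> (fst z) (snd z)" if "z \<in> points EN" for z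
      using that inv bij_betw_imp_inj_on[OF bij] by (intro inv_into_f_eq) auto
    show "inv_into (points M) (\<lambda>x. (j x, r x)) z \<in> points M" if "z \<in> points EN" for z using eq[OF that] inv(1) that by auto
    show "(\<lambda>z. f (inv_into (points M) (\<lambda>x. (j x, r x)) z)) \<in> smooth_functions EN" if "f \<in> \<C>" for f
      by (rule smooth_functions_cong_points[OF EN flow_pullback_EN[OF that]]) (simp add: eq del: points_prod_manifold)
  qed
  ultimately show ?thesis unfolding diffeomorphism_def by blast
qed

lemma sum_bivector_differential:
  assumes F: "F \<in> smooth_functions EN" and G: "G \<in> smooth_functions EN" and w: "w \<in> E" and n: "n \<in> Z"
  shows "bracket EN (sum_bivector (vec_manifold E) \<sigma> N \<tau>) F G (w, n) =
    bracket (vec_manifold E) \<sigma> (\<lambda>w. F (w, n)) (\<lambda>w. G (w, n)) w + bracket N \<tau> (\<lambda>n. F (w, n)) (\<lambda>n. G (w, n)) n"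
proof -
  note V = smooth_manifold_imp_atlas[OF smooth_manifold_vec_manifold[OF E]]
  have 1: "pull_covector (vec_manifold E) EN (\<lambda>w. (w, n)) w (differential EN F (w, n)) = differential (vec_manifold E) (\<lambda>w. F (w, n)) w"
    if "F \<in> smooth_functions EN" for F using pull_covector_differential[OF V EN _ that, of "\<lambda>w. (w, n)" w] slice_E[OF _ n] by (simp add: comp_def)
  have 2: "pull_covector N EN (\<lambda>n. (w, n)) n (differential EN F (w, n)) = differential N (\<lambda>n. F (w, n)) n" if "F \<in> smooth_functions EN" for F
    using pull_covector_differential[OF smooth_atlas_N EN _ that, of "\<lambda>n. (w, n)" n] slice_N[OF _ w] by (simp add: comp_def)
  show ?thesis by (simp add: bracket_def sum_bivector_def 1[OF F] 1[OF G] 2[OF F] 2[OF G])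
qed

text \<open>The vector field of \<open>g \<circ> j\<close> moves \<open>j\<close> with the velocity
  that represents \<open>dg\<close> under \<omega>, as pairing with the components
  \<open>J w\<close> shows. Hence \<open>j\<close> is a Poisson map to the symplectic vector
  space.\<close>

lemma bracket_comp_j:
  assumes x: "x \<in> points M" and f: "f \<in> smooth_functions (vec_manifold E)" and g: "g \<in> smooth_functions (vec_manifold E)"
    and fj: "(\<lambda>y. f (j y)) \<in> \<C>" and gj: "(\<lambda>y. g (j y)) \<in> \<C>"
  shows "pb (\<lambda>y. f (j y)) (\<lambda>y. g (j y)) x = bracket (vec_manifold E) (inverse_bivector E \<omega>) f g (j x)"
proof -
  define a where "a f = symplectic_sharp E \<omega> (j x) (differential (vec_manifold E) f (j x))" for f
  note a = symplectic_sharp_differential[OF E \<omega> jE[of x], folded a_def]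
  define v where "v = ham (\<lambda>y. g (j y)) x"
  have v: "v \<in> tangent_space M x" unfolding v_def by (rule hamiltonian_vf_tangent[OF x gj])
  have vE: "vec_apply v j \<in> E" by (rule vec_apply_in_subspace[OF M v x j E jE])
  have "vec_apply v j = a g"
  proof (rule \<omega>_eqI[OF vE a(1)[OF g]])
    fix w assume w: "w \<in> E"
    note hs = hamiltonian_smooth[OF w]
    have "\<omega> w (vec_apply v j) = pb (J w) (\<lambda>y. g (j y)) x" using tangent_hamiltonian[OF x v w] by (simp add: v_def hamiltonian_vf_apply[OF hs])
    also have "\<dots> = - pb (\<lambda>y. g (j y)) (J w) x" by (rule bracket_skew[OF x hs gj])
    also have "\<dots> = - direction_vector E (j x) w g"
      using tangent_comp_j[OF x hamiltonian_vf_tangent[OF x hs] g] bracket_vec_j[OF x w] by (simp add: bracket_vec_def hamiltonian_vf_apply[OF gj])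
    also have "\<dots> = \<omega> w (a g)" using a(2)[OF g w] symplectic_skew[OF \<omega> a(1)[OF g] w] by simp
    finally show "\<omega> w (vec_apply v j) = \<omega> w (a g)" .
  qed
  then have "pb (\<lambda>y. f (j y)) (\<lambda>y. g (j y)) x = \<omega> (a f) (a g)"
    using tangent_comp_j[OF x v f] a(2)[OF f a(1)[OF g]] by (simp add: v_def hamiltonian_vf_apply[OF fj])
  then show ?thesis by (simp add: bracket_def inverse_bivector_def a_def)
qed

text \<open>Each argument splits into a function of \<open>j\<close> and a function of
  \<open>r\<close>, with the other coordinate frozen. Cross brackets vanish since functions of
  \<open>r\<close> do not move \<open>j\<close>, and the remaining two are the brackets of the
  factors.\<close>

lemma poisson_diffeomorphism_jr:
  "poisson_diffeomorphism M \<pi> EN (sum_bivector (vec_manifold E) (inverse_bivector E \<omega>) N \<pi>N) (\<lambda>x. (j x, r x))"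
proof -
  have "pb (\<lambda>y. F (j y, r y)) (\<lambda>y. G (j y, r y)) x =
      bracket EN (sum_bivector (vec_manifold E) (inverse_bivector E \<omega>) N \<pi>N) F G (j x, r x)"
    if F: "F \<in> smooth_functions EN" and G: "G \<in> smooth_functions EN" and x: "x \<in> points M" for F G x
  proof -
    note E1 = slice_E[OF _ r_Z[OF x]] and N2 = slice_N[OF _ jE[of x]]
    have s1: "(\<lambda>y. F (j y, r x)) \<in> \<C>" if "F \<in> smooth_functions EN" for F
      using pullback_EN[OF at that j jE, of "\<lambda>y. r x"] smooth_functions_const[OF at] r_Z[OF x] by simp
    have s2: "(\<lambda>y. F (j x, r y)) \<in> \<C>" if "F \<in> smooth_functions EN" for F using pullback_r[OF N2[OF that]] by simp
    have split: "pb (\<lambda>y. F (j y, r y)) g x = pb (\<lambda>y. F (j y, r x)) g x + pb (\<lambda>y. F (j x, r y)) g x"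
      if "F \<in> smooth_functions EN" "g \<in> \<C>" for F g using tangent_split[OF x hamiltonian_vf_tangent[OF x that(2)] that(1)]
      by (simp add: hamiltonian_vf_apply pullback_jr s1 s2 that(1))
    have cross: "pb (\<lambda>y. F (j y, r x)) (\<lambda>y. G (j x, r y)) x = 0" if F: "F \<in> smooth_functions EN" and G: "G \<in> smooth_functions EN" for F G
      using tangent_comp_j[OF x hamiltonian_vf_tangent[OF x s2[OF G]] E1[OF F]] bracket_vec_j_r[OF s2[OF G] x]
      by (simp add: bracket_vec_def hamiltonian_vf_apply[OF s1[OF F]] direction_vector_def)
    note sk = bracket_skew[OF x]
    have "pb (\<lambda>y. F (j y, r y)) (\<lambda>y. G (j y, r y)) x =
      pb (\<lambda>y. F (j y, r x)) (\<lambda>y. G (j y, r x)) x + pb (\<lambda>y. F (j x, r y)) (\<lambda>y. G (j x, r y)) x"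
      using split[OF F pullback_jr[OF G]] split[OF G s1[OF F]] split[OF G s2[OF F]] cross[OF F G] cross[OF G F]
        sk[OF s1[OF F] pullback_jr[OF G]] sk[OF s2[OF F] pullback_jr[OF G]] sk[OF s1[OF F] s1[OF G]] sk[OF s1[OF F] s2[OF G]]
        sk[OF s2[OF F] s2[OF G]] by linarith
    also have "pb (\<lambda>y. F (j y, r x)) (\<lambda>y. G (j y, r x)) x = bracket (vec_manifold E) (inverse_bivector E \<omega>) (\<lambda>w. F (w, r x)) (\<lambda>w. G (w, r x)) (j x)"
      by (rule bracket_comp_j[OF x E1[OF F] E1[OF G] s1[OF F] s1[OF G]])
    also have "pb (\<lambda>y. F (j x, r y)) (\<lambda>y. G (j x, r y)) x = bracket N \<pi>N (\<lambda>n. F (j x, n)) (\<lambda>n. G (j x, n)) (r x)"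
      by (rule bracket_r_N[OF N2[OF F] N2[OF G] x, symmetric])
    also note sum_bivector_differential[OF F G jE r_Z[OF x], symmetric]
    finally show ?thesis .
  qed
  then show ?thesis using diffeomorphism_jr unfolding poisson_diffeomorphism_def comp_def by blast
qed

end

section \<open>Smooth dependence of the inverse framing on the base point\<close>

section \<open>Inverting the framing\<close>

text \<open>In a chart this becomes a smooth family of invertible linear maps on an open set, to
  which \<open>inverse_family_C_inf\<close> applies.\<close>

lemma smooth_at_inverse_family:
  fixes A :: "'a \<Rightarrow> 'b::euclidean_space \<Rightarrow> 'b" and M :: "('a, 'e::euclidean_space) manifold"
  assumes M: "smooth_manifold M" and W: "openin (mtop M) W" "x \<in> W"
    and lin: "\<And>y. y \<in> W \<Longrightarrow> linear (A y)" and bij: "\<And>y. y \<in> W \<Longrightarrow> bij (A y)"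
    and s: "\<And>i. i \<in> Basis \<Longrightarrow> smooth_at M (points M) x (\<lambda>y. A y i)"
  shows "smooth_at M (points M) x (\<lambda>y. inv (A y) v)"
proof -
  note at = smooth_manifold_imp_atlas[OF M]
  have xM: "x \<in> points M" using openin_subset[OF W(1)] W(2) by blast
  obtain U \<psi> where c: "(U, \<psi>) \<in> atlas M" "x \<in> U" by (rule chart_exists[OF at xM], rule that)
  define Q where "Q i R \<longleftrightarrow> openin (mtop M) (fst R) \<and> x \<in> fst R \<and> C_inf_on (fst (snd R)) (snd (snd R)) \<and>
      \<psi> ` fst R \<subseteq> fst (snd R) \<and> (\<forall>y\<in>fst R. y \<in> points M \<longrightarrow> A y i = snd (snd R) (\<psi> y))"
    for i and R :: "'a set \<times> 'e set \<times> ('e \<Rightarrow> 'b)"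
  have "\<exists>R. Q i R" if i: "i \<in> Basis" for i
  proof -
    obtain O' T g where "openin (mtop M) O'" "x \<in> O'" "O' \<subseteq> U" "C_inf_on T g" "\<psi> ` O' \<subseteq> T" "\<And>y. y \<in> O' \<Longrightarrow> y \<in> points M \<Longrightarrow> A y i = g (\<psi> y)"
      by (rule smooth_at_chartE[OF at s[OF i] c], rule that)
    then show ?thesis by (intro exI[of _ "(O', T, g)"]) (simp add: Q_def)
  qed
  then obtain R where QR: "\<forall>i\<in>Basis. Q i (R i)" using bchoice[of Basis Q] by auto
  define O' T g where "O' i = fst (R i)" and "T i = fst (snd (R i))" and "g i = snd (snd (R i))" for i
  have R: "openin (mtop M) (O' i)" "x \<in> O' i" "C_inf_on (T i) (g i)" "\<psi> ` O' i \<subseteq> T i"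
    "\<And>y. y \<in> O' i \<Longrightarrow> y \<in> points M \<Longrightarrow> A y i = g i (\<psi> y)" if "i \<in> Basis" for i
    using bspec[OF QR that] by (simp_all add: O'_def T_def g_def Q_def)
  define W' where "W' = W \<inter> U \<inter> (\<Inter>i\<in>Basis. O' i)"
  have W': "openin (mtop M) W'" "x \<in> W'" "W' \<subseteq> U" unfolding W'_def using W c R(1,2) chart_open[OF at c(1)] by (auto intro!: openin_Int openin_Inter)
  obtain T0 where T0: "open T0" "\<psi> ` W' = model M \<inter> T0" using chart_image_open[OF at c(1) W'(3,1)] by (auto simp: openin_open)
  obtain q where q: "linear q" "\<And>x. q x \<in> model M" "\<And>x. x \<in> model M \<Longrightarrow> q x = x"
    by (rule linear_projection_exists[OF smooth_manifold_subspace[OF M]], rule that)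
  \<comment> \<open>An open set of the ambient space, obtained by projecting to the model. The
    family is extended to it along \<open>q\<close>, and its members are still some
    \<open>A y\<close>, hence invertible.\<close>
  define S where "S = q -` T0"
  have S: "open S" using C_inf_on_preimage[OF C_inf_on_linear[OF open_UNIV q(1)] T0(1)] by (simp add: S_def vimage_def)
  have qS: "\<exists>y\<in>W'. q z = \<psi> y" if "z \<in> S" for z
  proof -
    have "q z \<in> \<psi> ` W'" unfolding T0(2) using that q(2) by (simp add: S_def)
    then show ?thesis by blast
  qed
  define B where "B z v = (\<Sum>i\<in>Basis. (v \<bullet> i) *\<^sub>R g i (q z))" for z v
  have B: "B z = A y" if "y \<in> W'" "q z = \<psi> y" for z y
  proof
    fix v
    have y: "y \<in> W" "\<And>i. i \<in> Basis \<Longrightarrow> y \<in> O' i" "y \<in> points M" using that(1) openin_subset[OF W(1)] by (auto simp: W'_def)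
    have "A y (\<Sum>i\<in>Basis. (v \<bullet> i) *\<^sub>R i) = (\<Sum>i\<in>Basis. (v \<bullet> i) *\<^sub>R A y i)"
      by (simp only: linear_sum[OF lin[OF y(1)]] linear_scale[OF lin[OF y(1)]])
    then show "B z v = A y v" using R(5) y(2,3) that(2) by (simp add: B_def euclidean_representation)
  qed
  have "C_inf_on S (\<lambda>z. inv (B z) v)"
  proof (rule inverse_family_C_inf[OF S])
    show "linear (B z)" "bij (B z)" if z: "z \<in> S" for z using qS[OF z] B lin bij by (auto simp: W'_def)
    have "C_inf_on S (\<lambda>z. g i (q z))" if "i \<in> Basis" for i by (rule C_inf_on_compose[OF C_inf_on_linear[OF S q(1)] R(3)[OF that]])
        (use qS R(4)[OF that] that in \<open>fastforce simp: W'_def\<close>)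
    then show "C_inf_on S (\<lambda>z. B z v)" for v unfolding B_def by (intro C_inf_on_sum S C_inf_on_linear_comp[OF bounded_linear_scaleR_right])
  qed
  moreover have q\<psi>: "q (\<psi> y) = \<psi> y" "\<psi> y \<in> S" if "y \<in> W'" for y
  proof -
    have "\<psi> y \<in> model M \<inter> T0" using that T0(2) by blast
    then show "q (\<psi> y) = \<psi> y" "\<psi> y \<in> S" using q(3) by (auto simp: S_def)
  qed
  ultimately show ?thesis by (intro smooth_atI[OF c(1) W']) (use B[OF _ q\<psi>(1)] in auto)
qed

text \<open>In a local frame \<open>s i\<close> of \<open>F\<close> the framing has the smooth
  columns \<open>t i\<close>, the images of the frame. They are completed to an invertible map
  \<open>A y\<close> of the whole space; its inverse is smooth and yields the coefficients of the
  inverse framing in the frame.\<close>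

lemma inverse_framing_smooth:
  fixes M :: "('a, 'e::euclidean_space) manifold" and E :: "'b::euclidean_space set" and G :: "'g::euclidean_space set"
  assumes M: "smooth_manifold M" and F: "smooth_subbundle M G k F" and G: "subspace G" and E: "subspace E" "dim E = k"
    and sb: "smooth_fun_on (prod_manifold (vec_manifold G) M) {(u, x). x \<in> points M \<and> u \<in> F x} (\<lambda>(u, x). b x u)"
    and bij: "\<And>x. x \<in> points M \<Longrightarrow> bij_betw (b x) (F x) E"
    and lin: "\<And>x u v r s. x \<in> points M \<Longrightarrow> u \<in> F x \<Longrightarrow> v \<in> F x \<Longrightarrow> b x (r *\<^sub>R u + s *\<^sub>R v) = r *\<^sub>R b x u + s *\<^sub>R b x v"
    and w: "w \<in> E"
  shows "smooth_everywhere M (\<lambda>x. inv_into (F x) (b x) w)" unfolding smooth_everywhere_def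
proof
  fix x assume x: "x \<in> points M"
  note at = smooth_manifold_imp_atlas[OF M]
  have FG: "subspace (F y)" "F y \<subseteq> G" if "y \<in> points M" for y using F that unfolding smooth_subbundle_def by blast+
  obtain U s where U: "openin (mtop M) U" "x \<in> U" "\<forall>i<k. smooth_fun_on M U (s i :: 'a \<Rightarrow> 'g)"
    "\<forall>y\<in>U. F y = span ((\<lambda>i. s i y) ` {..<k})" using F x unfolding smooth_subbundle_def by blast
  have UM: "U \<subseteq> points M" by (rule openin_subset[OF U(1)])
  have ss: "smooth_at M (points M) x (s i)" if "i < k" for i
  proof -
    have "smooth_at M U x (s i)" using U(2,3) that smooth_fun_on_iff[OF at UM] by blast
    then show ?thesis by (rule smooth_at_cong[OF at _ U(1,2)]) simp
  qed
  have sF: "s i y \<in> F y" if "i < k" "y \<in> U" for i y using U(4) that by (auto intro: span_base)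
  define t where "t i y = b y (s i y)" for i y
  have t: "smooth_at M (points M) x (t i)" if i: "i < k" for i
  proof -
    let ?S = "{(u, x). x \<in> points M \<and> u \<in> F x}"
    have "(s i x, x) \<in> ?S" using sF[OF i U(2)] x by simp
    moreover have "?S \<subseteq> points (prod_manifold (vec_manifold G) M)" using FG(2) by auto
    ultimately have bs: "smooth_at (prod_manifold (vec_manifold G) M) ?S (s i x, x) (\<lambda>(u, x). b x u)"
      using sb smooth_fun_on_iff[OF smooth_atlas_vec_prod[OF at G]] by blast
    obtain V \<psi> where c: "(V, \<psi>) \<in> atlas M" "x \<in> V" by (rule chart_exists[OF at x], rule that)
    obtain A W T g where g: "openin (top_of_set G) A" "s i x \<in> A" "openin (mtop M) W" "x \<in> W" "W \<subseteq> V" "C_inf_on T g"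
      "\<And>q y. q \<in> A \<Longrightarrow> y \<in> W \<Longrightarrow> (q, \<psi> y) \<in> T"
      "\<And>q y. q \<in> A \<Longrightarrow> y \<in> W \<Longrightarrow> (q, y) \<in> ?S \<Longrightarrow> (\<lambda>(u, x). b x u) (q, y) = g (q, \<psi> y)"
      by (rule smooth_at_vec_prodE[OF at G bs c], rule that)
    obtain A' where A': "open A'" "A = G \<inter> A'" using g(1) by (auto simp: openin_open)
    obtain W1 where W1: "openin (mtop M) W1" "x \<in> W1" "\<And>y. y \<in> W1 \<Longrightarrow> s i y \<in> A'"
      by (rule smooth_at_nbhd[OF at ss[OF i] A'(1)]) (use g(2) A'(2) in \<open>auto intro: that\<close>)
    have "smooth_at M (points M) x \<psi>" by (rule smooth_atI[OF c(1) chart_open[OF at c(1)] c(2) subset_refl C_inf_on_id[OF open_UNIV]]) auto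
    from smooth_at_Pair[OF at ss[OF i] this]
    show ?thesis
    proof (rule smooth_at_compose[OF at _ x g(6)])
      show "openin (mtop M) (U \<inter> (W1 \<inter> W))" using U(1) W1(1) g(3) by (intro openin_Int)
      fix y assume y: "y \<in> U \<inter> (W1 \<inter> W)" "y \<in> points M"
      have "s i y \<in> A" using W1(3) A'(2) sF[OF i] FG(2) y by blast
      then show "t i y = g (s i y, \<psi> y)" using g(8)[of "s i y" y] y sF[OF i] by (simp add: t_def)
    qed (use U(2) W1(2) g(2,4,7) in auto)
  qed
  have comb: "(\<Sum>i<m. c i *\<^sub>R s i y) \<in> F y \<and> b y (\<Sum>i<m. c i *\<^sub>R s i y) = (\<Sum>i<m. c i *\<^sub>R t i y)" if y: "y \<in> U" and "m \<le> k" for y c m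
    using that(2)
  proof (induction m)
    case 0
    have yM: "y \<in> points M" using y UM by blast
    show ?case using lin[OF yM subspace_0[OF FG(1)[OF yM]] subspace_0[OF FG(1)[OF yM]], of 0 0] subspace_0[OF FG(1)[OF yM]] by simp
  next
    case (Suc m)
    have yM: "y \<in> points M" using y UM by blast
    have "m < k" using Suc.prems by simp
    then show ?case using Suc lin[OF yM _ sF[OF _ y], of "\<Sum>i<m. c i *\<^sub>R s i y" m 1 "c m"] sF[OF _ y, of m] FG(1)[OF yM]
      by (simp add: t_def subspace_add subspace_scale)
  qed
  obtain B where B: "finite B" "B \<subseteq> E" "card B = dim E" "\<And>b b'. b \<in> B \<Longrightarrow> b' \<in> B \<Longrightarrow> b \<bullet> b' = (if b = b' then 1 else 0)"
    "\<And>w. w \<in> E \<Longrightarrow> (\<Sum>b\<in>B. (w \<bullet> b) *\<^sub>R b) = w" by (rule subspace_coordinates[OF E(1)], rule that)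
  obtain e where e: "bij_betw e {..<k} B" using ex_bij_betw_nat_finite[OF B(1)] B(3) E(2) by (auto simp: atLeast0LessThan)
  have eB: "e i \<in> B" if "i < k" for i using e that by (auto simp: bij_betw_def)
  have orth: "e i \<bullet> e l = (if i = l then 1 else 0)" if "i < k" "l < k" for i l
    using B(4)[OF eB[OF that(1)] eB[OF that(2)]] bij_betw_imp_inj_on[OF e] that by (auto dest: inj_onD)
  have expand: "(\<Sum>i<k. (v \<bullet> e i) *\<^sub>R e i) = v" if "v \<in> E" for v
    using B(5)[OF that] sum.reindex_bij_betw[OF e, of "\<lambda>b. (v \<bullet> b) *\<^sub>R b"] by simp
  have eE: "e i \<in> E" if "i < k" for i using eB[OF that] B(2) by blast
  \<comment> \<open>Sends the orthonormal basis \<open>e i\<close> of \<open>E\<close> to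
    \<open>t i\<close> and is the identity on the orthogonal complement, so that it is invertible on
    the whole type.\<close>
  define A where "A y z = (\<Sum>i<k. (z \<bullet> e i) *\<^sub>R t i y) + (z - (\<Sum>i<k. (z \<bullet> e i) *\<^sub>R e i))" for y z
  have A: "linear (A y)" for y
    unfolding A_def by (intro linearI) (simp_all add: inner_add_left scaleR_left_distrib sum.distrib scaleR_sum_right scaleR_diff_right scaleR_add_right)
  have inner_e: "(\<Sum>i<k. c i *\<^sub>R e i) \<bullet> e l = c l" if "l < k" for c l
  proof -
    have "(\<Sum>i<k. c i *\<^sub>R e i) \<bullet> e l = (\<Sum>i<k. if i = l then c l else 0)" unfolding inner_sum_left by (rule sum.cong) (use orth that in auto)
    then show ?thesis using that by simp
  qed
  have Ae: "A y (\<Sum>i<k. c i *\<^sub>R e i) = (\<Sum>i<k. c i *\<^sub>R t i y)" for c y by (simp add: A_def inner_e)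
  have tsurj: "\<exists>c. v = (\<Sum>i<k. c i *\<^sub>R t i y)" if y: "y \<in> U" and v: "v \<in> E" for y v
  proof -
    obtain u where u: "u \<in> F y" "b y u = v" using bij[of y] y UM v unfolding bij_betw_def by blast
    let ?R = "range (\<lambda>c. \<Sum>i<k. c i *\<^sub>R s i y)"
    have "subspace ?R"
    proof (rule subspaceI)
      show "0 \<in> ?R" by (rule image_eqI[of _ _ "\<lambda>i. 0"]) simp_all
      show "a + a' \<in> ?R" if a: "a \<in> ?R" "a' \<in> ?R" for a a'
      proof -
        obtain c c' where "a = (\<Sum>i<k. c i *\<^sub>R s i y)" "a' = (\<Sum>i<k. c' i *\<^sub>R s i y)" using a by blast
        then show ?thesis by (intro image_eqI[of _ _ "\<lambda>i. c i + c' i"]) (simp_all add: scaleR_left_distrib sum.distrib)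
      qed
      show "r *\<^sub>R a \<in> ?R" if a: "a \<in> ?R" for r a
      proof -
        obtain c where "a = (\<Sum>i<k. c i *\<^sub>R s i y)" using a by blast
        then show ?thesis by (intro image_eqI[of _ _ "\<lambda>i. r * c i"]) (simp_all add: scaleR_sum_right)
      qed
    qed
    moreover have "(\<lambda>i. s i y) ` {..<k} \<subseteq> ?R"
    proof (clarify)
      fix l assume "l < k"
      then have 1: "s l y = (\<Sum>i<k. (if i = l then 1 else 0) *\<^sub>R s i y)" by (simp add: if_distrib[of "\<lambda>c. c *\<^sub>R _"] cong: if_cong)
      show "s l y \<in> ?R" using 1 by (intro image_eqI[of _ _ "\<lambda>i. if i = l then 1 else 0"]) simp_all
    qed
    ultimately have "u \<in> ?R" using u(1) U(4) y span_minimal by blast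
    then obtain c where "u = (\<Sum>i<k. c i *\<^sub>R s i y)" by blast
    then show ?thesis using comb[OF y order_refl, of c] u(2) by auto
  qed
  have bijA: "bij (A y)" if y: "y \<in> U" for y
  proof -
    have "\<exists>z. v = A y z" for v
    proof -
      define v' where "v' = v - (\<Sum>i<k. (v \<bullet> e i) *\<^sub>R e i)"
      have "(\<Sum>i<k. (v \<bullet> e i) *\<^sub>R e i) \<in> E" by (intro subspace_sum E(1) subspace_scale eE) simp
      then obtain c where c: "(\<Sum>i<k. (v \<bullet> e i) *\<^sub>R e i) = (\<Sum>i<k. c i *\<^sub>R t i y)" using tsurj[OF y] by blast
      have "v' \<bullet> e l = 0" if "l < k" for l using inner_e[OF that] by (simp add: v'_def inner_diff_left)
      then have "A y v' = v'" by (simp add: A_def)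
      then have "A y ((\<Sum>i<k. c i *\<^sub>R e i) + v') = v" by (simp add: linear_add[OF A] Ae c[symmetric] v'_def)
      then show ?thesis by metis
    qed
    then have "surj (A y)" by (auto simp: surj_def)
    then show ?thesis using linear_surjective_imp_injective[OF A] by (auto simp: bij_def)
  qed
  have "smooth_at M (points M) x (\<lambda>y. inv (A y) w)"
  proof (rule smooth_at_inverse_family[OF M U(1,2) A bijA])
    fix i :: 'b
    show "smooth_at M (points M) x (\<lambda>y. A y i)" unfolding A_def
      by (intro smooth_at_add smooth_at_sum smooth_at_linear[OF at _ x bounded_linear_scaleR_right] smooth_at_const at x t) auto
  qed
  then have "smooth_at M (points M) x (\<lambda>y. \<Sum>i<k. (inv (A y) w \<bullet> e i) *\<^sub>R s i y)"
    by (intro smooth_at_sum at x smooth_at_bilinear[OF at bounded_bilinear_scaleR] ss smooth_at_linear[OF at _ x bounded_linear_inner_left]) auto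
  then show "smooth_at M (points M) x (\<lambda>y. inv_into (F y) (b y) w)"
  proof (rule smooth_at_cong[OF at _ U(1,2)], intro conjI)
    fix y assume y: "y \<in> U" "y \<in> points M"
    obtain c where c: "w = (\<Sum>i<k. c i *\<^sub>R t i y)" using tsurj[OF y(1) w] by blast
    define z where "z = (\<Sum>i<k. c i *\<^sub>R e i)"
    have "A y z = w" by (simp add: z_def Ae c)
    then have z: "inv (A y) w = z" using bijA[OF y(1)] by (metis bij_inv_eq_iff)
    have zE: "z \<in> E" unfolding z_def by (intro subspace_sum E(1) subspace_scale eE) simp
    have "b y (\<Sum>i<k. (z \<bullet> e i) *\<^sub>R s i y) = A y (\<Sum>i<k. (z \<bullet> e i) *\<^sub>R e i)" using comb[OF y(1) order_refl] by (simp add: Ae)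
    also have "\<dots> = w" using expand[OF zE] \<open>A y z = w\<close> by simp
    finally show "inv_into (F y) (b y) w = (\<Sum>i<k. (inv (A y) w \<bullet> e i) *\<^sub>R s i y)"
      unfolding z using bij[OF y(2)] comb[OF y(1) order_refl] by (auto simp: bij_betw_def intro: inv_into_f_eq)
  qed auto
qed

section \<open>Leafwise constant functions as Casimirs, and the passage from the framing to
  j\<close>

section \<open>Functions that are constant on the leaves\<close>

context poisson
begin

lemma same_leaf_integral_curve:
  assumes g: "integral_curve M (ham f) J cv" and f: "f \<in> \<C>" and J: "\<And>s. s \<in> {0..1} \<Longrightarrow> t * s \<in> J"
  shows "same_leaf M \<pi> (cv 0) (cv t)"
proof -
  have c: "integral_curve M (ham (\<lambda>y. t * f y)) {0..1} (\<lambda>s. cv (t * s + 0))" by (rule integral_curve_affine[OF g f]) (simp add: J)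
  have "(\<lambda>y. t * f y) \<in> \<C>" using smooth_functions_combine[OF at f f, of t 0] by simp
  then have "hamiltonian_step M \<pi> (cv 0) (cv t)" unfolding hamiltonian_step_def using c by (intro bexI exI[of _ "\<lambda>s. cv (t * s)"]) simp_all
  moreover have "cv 0 \<in> points M" "cv t \<in> points M" using J[of 0] J[of 1] integral_curve_in_points[OF g] by auto
  ultimately show ?thesis by (simp add: same_leaf_def)
qed

text \<open>A short integral curve of a nonzero multiple of \<open>f\<close> stays in one leaf,
  where \<open>c\<close> is constant, and the derivative of \<open>c\<close> along it is a multiple
  of the bracket. So such functions are Casimirs.\<close>

lemma bracket_leaf_invariant:
  assumes c: "c \<in> \<C>" and inv: "\<And>x y. same_leaf M \<pi> x y \<Longrightarrow> c x = c y" and f: "f \<in> \<C>" and x: "x \<in> points M"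
  shows "pb c f x = 0"
proof -
  obtain d W' Fl where F: "0 < d" "openin (mtop M) W'" "x \<in> W'"
    "\<And>p x. norm (p :: real) < d \<Longrightarrow> x \<in> W' \<Longrightarrow> \<exists>cv. integral_curve M (ham (linear_family (\<lambda>i. f) p)) {0..1} cv \<and> cv 0 = x \<and> cv 1 = Fl (p, x)"
    by (rule local_hamiltonian_flow[OF f x], rule that)
  define p where "p = d / 2"
  have p: "norm p < d" "p \<noteq> 0" using F(1) by (simp_all add: p_def)
  obtain cv where g: "integral_curve M (ham (linear_family (\<lambda>i. f) p)) {0..1} cv" "cv 0 = x" using F(4)[OF p(1) F(3)] by blast
  have lf: "linear_family (\<lambda>i. f) p = (\<lambda>y. p * f y)" by (simp add: linear_family_def)
  have pf: "(\<lambda>y. p * f y) \<in> \<C>" using smooth_functions_combine[OF at f f, of p 0] by simp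
  have "c (cv t) = c x" if "t \<in> {0..1}" for t using inv[OF same_leaf_integral_curve[OF g(1)[unfolded lf] pf, of t]] that g(2) by (simp add: mult_le_one)
  then have "((\<lambda>s. c (cv s)) has_vector_derivative 0) (at 0 within {0..1})" by (intro has_vector_derivative_transform[OF _ _ has_vector_derivative_const[of "c x"]]) auto
  moreover have "((\<lambda>s. c (cv s)) has_vector_derivative pb c (\<lambda>y. p * f y) x) (at 0 within {0..1})"
    using integral_curve_deriv[OF g(1) _ c, of 0] g(2) by (simp add: lf hamiltonian_vf_apply[OF c] has_real_derivative_iff_has_vector_derivative)
  ultimately have "pb c (\<lambda>y. p * f y) x = 0" using vector_derivative_unique_within_closed_interval[of 0 1 0] by fastforce
  then show ?thesis using fun_cong[OF hamiltonian_vf_scale[OF x f, of p], of c] p(2) by (simp add: hamiltonian_vf_apply[OF c])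
qed

end

text \<open>Nondegeneracy turns the linear family \<open>J\<close> into one vector-valued map:
  \<open>f e\<close> represents the functional \<open>- (w \<bullet> e)\<close> under \<omega>, and
  summing \<open>J e x *\<^sub>R f e\<close> over an orthonormal basis gives
  \<open>\<omega> w (j x) = J w x\<close>.\<close>

lemma (in poisson) symplectic_splitting_exists:
  fixes E :: "'b::euclidean_space set"
  assumes E: "subspace E" and \<omega>: "symplectic_form_on E \<omega>"
    and J: "\<And>w. w \<in> E \<Longrightarrow> J w \<in> smooth_functions M"
    and J_linear: "\<And>u v a b x. u \<in> E \<Longrightarrow> v \<in> E \<Longrightarrow> x \<in> points M \<Longrightarrow> J (a *\<^sub>R u + b *\<^sub>R v) x = a * J u x + b * J v x"
    and J_bracket: "\<And>u v x. u \<in> E \<Longrightarrow> v \<in> E \<Longrightarrow> x \<in> points M \<Longrightarrow> bracket M \<pi> (J u) (J v) x = \<omega> u v"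
    and J_complete: "\<And>w. w \<in> E \<Longrightarrow> complete_vf M (hamiltonian_vf M \<pi> (J w))"
  obtains j P where "symplectic_splitting M \<pi> E \<omega> j P"
proof -
  obtain P where P: "linear P" "\<And>x. P x \<in> E" "\<And>x. x \<in> E \<Longrightarrow> P x = x" by (rule linear_projection_exists[OF E], rule that)
  have "\<exists>v. v \<in> E \<and> (\<forall>w\<in>E. \<omega> v w = - (w \<bullet> e))" for e
    using symplectic_riesz[OF E \<omega>, of "\<lambda>w. - (w \<bullet> e)"] by (auto simp: inner_add_left algebra_simps)
  then obtain f where f: "\<And>e. f e \<in> E" "\<And>e w. w \<in> E \<Longrightarrow> \<omega> (f e) w = - (w \<bullet> e)" by metis
  obtain B where B: "B \<subseteq> E" "\<And>(L :: 'b \<Rightarrow> real) w. w \<in> E \<Longrightarrow>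
      \<forall>u\<in>E. \<forall>v\<in>E. \<forall>a b. L (a *\<^sub>R u + b *\<^sub>R v) = a * L u + b * L v \<Longrightarrow> L w = (\<Sum>b\<in>B. (w \<bullet> b) * L b)"
    by (rule subspace_coordinates[OF E], rule that)
  define j where "j x = (\<Sum>e\<in>B. J e x *\<^sub>R f e)" for x
  have jE: "j x \<in> E" for x unfolding j_def by (intro subspace_sum E subspace_scale f)
  have j: "smooth_everywhere M j" unfolding j_def by (intro smooth_everywhere_sum at smooth_everywhere_bilinear[OF at bounded_bilinear_scaleR] smooth_everywhere_const)
      (use J B(1) smooth_functions_eq[OF at] in blast)
  have \<omega>j: "\<omega> w (j x) = J w x" if w: "w \<in> E" and x: "x \<in> points M" for w x
  proof -
    note lin\<omega> = symplectic_comp_linear[OF \<omega> P(1,2) w]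
    have "\<omega> w (j x) = - \<omega> (P (j x)) w" using symplectic_skew[OF \<omega> w jE] P(3)[OF jE] by simp
    also have "\<dots> = (\<Sum>e\<in>B. J e x * (w \<bullet> e))" unfolding j_def linear_sum[OF lin\<omega>] linear_scale[OF lin\<omega>] using f w P(3) by (simp add: sum_negf)
    also have "\<dots> = J w x" using B(2)[OF w, of "\<lambda>w. J w x"] J_linear[OF _ _ x] by (simp add: mult.commute)
    finally show ?thesis .
  qed
  have s: "(\<lambda>y. \<omega> w (j y)) \<in> smooth_functions M" if "w \<in> E" for w by (rule smooth_functions_cong_points[OF at J[OF that] \<omega>j[OF that]])
  have vf: "hamiltonian_vf M \<pi> (\<lambda>y. \<omega> w (j y)) x = hamiltonian_vf M \<pi> (J w) x" if "w \<in> E" "x \<in> points M" for w x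
    by (rule hamiltonian_vf_cong[OF that(2) s[OF that(1)] J[OF that(1)] openin_topspace that(2) \<omega>j[OF that(1)]])
  have "symplectic_splitting M \<pi> E \<omega> j P"
  proof (intro symplectic_splitting.intro symplectic_splitting_axioms.intro poisson_axioms)
    fix v w x assume vw: "v \<in> E" "w \<in> E" and x: "x \<in> points M"
    have "bracket M \<pi> (\<lambda>y. \<omega> v (j y)) (\<lambda>y. \<omega> w (j y)) x = bracket M \<pi> (\<lambda>y. \<omega> v (j y)) (J w) x"
      using fun_cong[OF vf[OF vw(2) x], of "\<lambda>y. \<omega> v (j y)"] by (simp add: hamiltonian_vf_apply[OF s[OF vw(1)]])
    also have "\<dots> = bracket M \<pi> (J v) (J w) x" by (rule bracket_cong[OF x J[OF vw(2)] s[OF vw(1)] J[OF vw(1)] openin_topspace x \<omega>j[OF vw(1)]])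
    finally show "bracket M \<pi> (\<lambda>y. \<omega> v (j y)) (\<lambda>y. \<omega> w (j y)) x = \<omega> v w" using J_bracket[OF vw x] by simp
  next
    fix w assume w: "w \<in> E"
    show "complete_vf M (hamiltonian_vf M \<pi> (\<lambda>y. \<omega> w (j y)))" unfolding complete_vf_def
    proof
      fix x assume x: "x \<in> points M"
      obtain c where g: "c 0 = x" "integral_curve M (hamiltonian_vf M \<pi> (J w)) UNIV c" using J_complete[OF w] x unfolding complete_vf_def by blast
      show "\<exists>c. c 0 = x \<and> integral_curve M (hamiltonian_vf M \<pi> (\<lambda>y. \<omega> w (j y))) UNIV c"
        by (intro exI[of _ c] conjI g(1) integral_curve_cong[OF g(2)] vf[OF w, symmetric] integral_curve_in_points[OF g(2)] UNIV_I)
    qed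
  qed (rule E \<omega> j jE P, assumption?)+
  then show ?thesis by (rule that)
qed

theorem theorem2:
  fixes M :: "('a, 'e::euclidean_space) manifold"
    and \<pi> :: "'a bivector"
    and G :: "'g::euclidean_space set"
    and lie :: "'g \<Rightarrow> 'g \<Rightarrow> 'g"
    and H :: "'g \<Rightarrow> 'a \<Rightarrow> real"
    and F :: "'a \<Rightarrow> 'g set"
    and d :: nat
    and E :: "'b::euclidean_space set"
    and b :: "'a \<Rightarrow> 'g \<Rightarrow> 'b"
    and \<omega> :: "'b \<Rightarrow> 'b \<Rightarrow> real"
  assumes "poisson_manifold M \<pi>"
    and "connected_space (mtop M)"
    and "abelian_lie_algebra G lie"
    and "weakly_hamiltonian_action M \<pi> G lie H"
    and "complete_action M \<pi> G H"
    and "subbundle_over_leaf_space M \<pi> G (2 * d) F"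
    and "symplectic_relative_to M (cocycle M \<pi> lie H) F"
    and "subspace E" and "dim E = 2 * d"
    and "framing_over_leaf_space M \<pi> G F E b"
    and "compatible_framing M (cocycle M \<pi> lie H) F E b \<omega>"
  shows "\<exists>(N :: ('a, 'e) manifold) (\<Phi> :: 'a \<Rightarrow> 'b \<times> 'a).
    poisson_dirac_submanifold N M \<pi> \<and>
    poisson_structure N (induced_bivector N M \<pi>) \<and>
    poisson_diffeomorphism M \<pi>
      (prod_manifold (vec_manifold E) N)
      (sum_bivector (vec_manifold E) (inverse_bivector E \<omega>) N (induced_bivector N M \<pi>)) \<Phi>"
proof -
  interpret poisson M \<pi> by unfold_locales (rule assms(1))
  have G: "subspace G" using assms(3) unfolding abelian_lie_algebra_def lie_algebra_def by (elim conjE)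
  have lie0: "\<And>u v. u \<in> G \<Longrightarrow> v \<in> G \<Longrightarrow> lie u v = 0" using assms(3) by (simp add: abelian_lie_algebra_def)
  have H: "\<And>u. u \<in> G \<Longrightarrow> H u \<in> smooth_functions M"
    and H_linear: "\<And>u v a b x. u \<in> G \<Longrightarrow> v \<in> G \<Longrightarrow> x \<in> points M \<Longrightarrow> H (a *\<^sub>R u + b *\<^sub>R v) x = a * H u x + b * H v x"
    using assms(4) unfolding weakly_hamiltonian_action_def by (elim conjE, simp)+
  have H0: "H 0 x = 0" if "x \<in> points M" for x using H_linear[OF subspace_0[OF G] subspace_0[OF G] that, of 0 0] by simp
  have F: "smooth_subbundle M G (2 * d) F" and F_leaf: "\<And>x y. same_leaf M \<pi> x y \<Longrightarrow> F x = F y" using assms(6) by (auto simp: subbundle_over_leaf_space_def)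
  have FG: "subspace (F x)" "F x \<subseteq> G" if "x \<in> points M" for x using F that unfolding smooth_subbundle_def by blast+
  note fr = assms(10)[unfolded framing_over_leaf_space_def]
  have b: "bij_betw (b x) (F x) E" if "x \<in> points M" for x using fr that by blast
  have b_linear: "b x (r *\<^sub>R u + s *\<^sub>R v) = r *\<^sub>R b x u + s *\<^sub>R b x v" if "x \<in> points M" "u \<in> F x" "v \<in> F x" for x u v r s
    using fr that by blast
  have b_leaf: "b x u = b y u" if "same_leaf M \<pi> x y" "u \<in> F x" for x y u using fr that by blast
  have \<omega>: "symplectic_form_on E \<omega>" using assms(11) by (simp add: compatible_framing_def)
  \<comment> \<open>The inverse framing. Like \<open>F\<close> and \<open>b\<close> it is constant
    on leaves, so its components will be Casimirs.\<close>
  define \<beta> where "\<beta> x w = inv_into (F x) (b x) w" for x w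
  have \<beta>: "\<beta> x w \<in> F x" "b x (\<beta> x w) = w" "\<beta> x w \<in> G" if "x \<in> points M" "w \<in> E" for x w
  proof -
    have "w \<in> b x ` F x" using b[OF that(1)] that(2) by (simp add: bij_betw_def)
    then show "\<beta> x w \<in> F x" "b x (\<beta> x w) = w" unfolding \<beta>_def by (rule inv_into_into, rule f_inv_into_f)
    then show "\<beta> x w \<in> G" using FG(2)[OF that(1)] by blast
  qed
  have \<beta>_linear: "\<beta> x (r *\<^sub>R u + s *\<^sub>R v) = r *\<^sub>R \<beta> x u + s *\<^sub>R \<beta> x v" if x: "x \<in> points M" and uv: "u \<in> E" "v \<in> E" for x u v r s
    unfolding \<beta>_def[of x "r *\<^sub>R u + s *\<^sub>R v"]
  proof (rule inv_into_f_eq)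
    show "inj_on (b x) (F x)" by (rule bij_betw_imp_inj_on[OF b[OF x]])
    show "r *\<^sub>R \<beta> x u + s *\<^sub>R \<beta> x v \<in> F x" using \<beta>[OF x] uv FG(1)[OF x] by (simp add: subspace_add subspace_scale)
    show "b x (r *\<^sub>R \<beta> x u + s *\<^sub>R \<beta> x v) = r *\<^sub>R u + s *\<^sub>R v" using b_linear[OF x] \<beta>[OF x] uv by simp
  qed
  have \<beta>_leaf: "\<beta> x w = \<beta> y w" if "same_leaf M \<pi> x y" for x y w
    using F_leaf[OF that] b_leaf[OF that] unfolding \<beta>_def inv_into_def by (intro arg_cong[of _ _ Eps]) auto
  have \<beta>_smooth: "smooth_everywhere M (\<lambda>x. \<beta> x w)" if "w \<in> E" for w
    unfolding \<beta>_def by (rule inverse_framing_smooth[OF M F G assms(8,9) conjunct1[OF fr] b b_linear that])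
  obtain B where B: "B \<subseteq> G" "\<And>(L :: 'g \<Rightarrow> real) w. w \<in> G \<Longrightarrow>
      \<forall>u\<in>G. \<forall>v\<in>G. \<forall>a b. L (a *\<^sub>R u + b *\<^sub>R v) = a * L u + b * L v \<Longrightarrow> L w = (\<Sum>b\<in>B. (w \<bullet> b) * L b)"
    by (rule subspace_coordinates[OF G], rule that)
  have BG: "\<And>g. g \<in> B \<Longrightarrow> g \<in> G" using B(1) by blast
  have H_expand: "H u x = (\<Sum>g\<in>B. (u \<bullet> g) * H g x)" if u: "u \<in> G" and x: "x \<in> points M" for u x
    using B(2)[OF u, of "\<lambda>u. H u x"] H_linear[OF _ _ x] by simp
  \<comment> \<open>This is \<open>H (\<beta> x w) x\<close> at points of \<open>M\<close>; the
    expansion in a basis of \<open>G\<close> displays it as a sum of products of smooth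
    functions.\<close>
  define J where "J w x = (\<Sum>g\<in>B. (\<beta> x w \<bullet> g) * H g x)" for w x
  have JH: "J w x = H (\<beta> x w) x" if "w \<in> E" "x \<in> points M" for w x using H_expand[OF \<beta>(3)[OF that(2,1)] that(2)] by (simp add: J_def)
  have \<beta>g: "(\<lambda>x. \<beta> x w \<bullet> g) \<in> smooth_functions M" if "w \<in> E" for w g
    unfolding smooth_functions_eq[OF at] by (rule smooth_everywhere_inner[OF at \<beta>_smooth[OF that]])
  have terms: "(\<lambda>x. (\<beta> x w \<bullet> g) * H g x) \<in> smooth_functions M" if "w \<in> E" "g \<in> B" for w g
    by (rule smooth_functions_mult[OF at \<beta>g[OF that(1)] H[OF BG[OF that(2)]]])
  have J: "J w \<in> smooth_functions M" if "w \<in> E" for w unfolding J_def[abs_def] by (rule smooth_functions_sum[OF at terms[OF that]])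
  \<comment> \<open>The coefficients are Casimirs, so Leibniz's rule differentiates only the
    functions \<open>H g\<close>. At \<open>x\<close> the result is the bracket with the fixed
    Hamiltonian \<open>H (\<beta> x w)\<close>.\<close>
  have bracket_J: "bracket M \<pi> (J w) f x = bracket M \<pi> (H (\<beta> x w)) f x" if w: "w \<in> E" and x: "x \<in> points M" and f: "f \<in> smooth_functions M" for w x f
  proof -
    note v = hamiltonian_vf_tangent[OF x f]
    have "bracket M \<pi> (\<lambda>x. \<beta> x w \<bullet> g) f x = 0" for g by (rule bracket_leaf_invariant[OF \<beta>g[OF w] _ f x]) (simp add: \<beta>_leaf[of _ _ w])
    then have "bracket M \<pi> (J w) f x = (\<Sum>g\<in>B. (\<beta> x w \<bullet> g) * bracket M \<pi> (H g) f x)"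
      using tangent_sum[OF at v terms[OF w], of B "\<lambda>g. g"] tangent_leibniz[OF v \<beta>g[OF w] H[OF BG]]
      by (simp add: J_def[abs_def] hamiltonian_vf_apply[symmetric, of _ f] J[OF w, unfolded J_def[abs_def]] H BG \<beta>g[OF w])
    also have "\<dots> = hamiltonian_vf M \<pi> f x (\<lambda>y. \<Sum>g\<in>B. (\<beta> x w \<bullet> g) * H g y)"
      using tangent_sum[OF at v, of B "\<lambda>g y. (\<beta> x w \<bullet> g) * H g y"] tangent_scale[OF at v H[OF BG]]
        smooth_functions_mult[OF at smooth_functions_const[OF at] H[OF BG]] by (simp add: hamiltonian_vf_apply H BG)
    also have "\<dots> = hamiltonian_vf M \<pi> f x (H (\<beta> x w))" by (rule tangent_local[OF M v _ H[OF \<beta>(3)[OF x w]] openin_topspace x])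
        (use H_expand[OF \<beta>(3)[OF x w]] smooth_functions_sum[OF at smooth_functions_mult[OF at smooth_functions_const[OF at] H[OF BG]]] in auto)
    finally show ?thesis by (simp add: hamiltonian_vf_apply H[OF \<beta>(3)[OF x w]])
  qed
  have vf_J: "hamiltonian_vf M \<pi> (J w) x = hamiltonian_vf M \<pi> (H (\<beta> x w)) x" if "w \<in> E" "x \<in> points M" for w x
  proof
    fix f
    show "hamiltonian_vf M \<pi> (J w) x f = hamiltonian_vf M \<pi> (H (\<beta> x w)) x f"
      using bracket_J[OF that, of f] bracket_skew[OF that(2) _ J[OF that(1)], of f] bracket_skew[OF that(2) _ H[OF \<beta>(3)[OF that(2,1)]], of f]
      by (simp add: hamiltonian_vf_def)
  qed
  have J_linear: "J (r *\<^sub>R u + s *\<^sub>R v) x = r * J u x + s * J v x" if "u \<in> E" "v \<in> E" "x \<in> points M" for u v r s x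
    using that subspace_add[OF assms(8) subspace_scale[OF assms(8) that(1), of r] subspace_scale[OF assms(8) that(2), of s]] by (simp add: JH \<beta>_linear H_linear \<beta>(3))
  have J_bracket: "bracket M \<pi> (J u) (J v) x = \<omega> u v" if uv: "u \<in> E" "v \<in> E" and x: "x \<in> points M" for u v x
  proof -
    have "bracket M \<pi> (J u) (J v) x = bracket M \<pi> (J u) (H (\<beta> x v)) x"
      using fun_cong[OF vf_J[OF uv(2) x], of "J u"] by (simp add: hamiltonian_vf_apply[OF J[OF uv(1)]])
    also have "\<dots> = bracket M \<pi> (H (\<beta> x u)) (H (\<beta> x v)) x" by (rule bracket_J[OF uv(1) x H[OF \<beta>(3)[OF x uv(2)]]])
    \<comment> \<open>The Lie bracket term of the cocycle is \<open>H 0\<close>, which vanishes by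
      linearity.\<close>
    also have "\<dots> = cocycle M \<pi> lie H (\<beta> x u) (\<beta> x v) x" by (simp add: cocycle_def lie0 \<beta>(3) x uv H0)
    also have "\<dots> = \<omega> (b x (\<beta> x u)) (b x (\<beta> x v))" using assms(11) x \<beta>(1)[OF x] uv by (simp add: compatible_framing_def)
    finally show ?thesis by (simp add: \<beta>(2) x uv)
  qed
  \<comment> \<open>An integral curve of the fixed Hamiltonian \<open>H (\<beta> x w)\<close> stays
    in the leaf of \<open>x\<close>, where \<beta> does not change, so it is an integral curve of
    \<open>J w\<close> as well.\<close>
  have J_complete: "complete_vf M (hamiltonian_vf M \<pi> (J w))" if w: "w \<in> E" for w unfolding complete_vf_def
  proof
    fix x assume x: "x \<in> points M"
    note u = \<beta>(3)[OF x w]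
    obtain \<gamma> where g: "\<gamma> 0 = x" "integral_curve M (hamiltonian_vf M \<pi> (H (\<beta> x w))) UNIV \<gamma>"
      using assms(5) u x unfolding complete_action_def complete_vf_def by blast
    have "same_leaf M \<pi> x (\<gamma> t)" for t using same_leaf_integral_curve[OF g(2) H[OF u], of t] g(1) by simp
    then have "\<beta> (\<gamma> t) w = \<beta> x w" for t using \<beta>_leaf by metis
    then have "hamiltonian_vf M \<pi> (H (\<beta> x w)) (\<gamma> t) = hamiltonian_vf M \<pi> (J w) (\<gamma> t)" for t
      using vf_J[OF w integral_curve_in_points[OF g(2) UNIV_I]] by simp
    then show "\<exists>\<gamma>. \<gamma> 0 = x \<and> integral_curve M (hamiltonian_vf M \<pi> (J w)) UNIV \<gamma>" using g(1) integral_curve_cong[OF g(2)] by blast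
  qed
  obtain j Q where "symplectic_splitting M \<pi> E \<omega> j Q"
    by (rule symplectic_splitting_exists[of E \<omega> J, OF assms(8) \<omega>]) (rule J J_linear J_bracket J_complete that, assumption+)+
  then interpret S: symplectic_splitting M \<pi> E \<omega> j Q .
  show ?thesis by (intro exI conjI) (rule S.poisson_dirac_N S.poisson_structure_N S.poisson_diffeomorphism_jr)+
qed

end
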